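(* Let $\ell>0$ be an integer and let $0<a_1<a_2<\cdots<a_\ell$ be integers with $\gcd(a_1,a_2,\ldots,a_\ell)=1$. Let $k$ be a field, let $R=k[\![t^{a_1},t^{a_2},\ldots,t^{a_\ell}]\!]$ be the numerical semigroup ring over $k$, and let $H=\langle a_1,a_2,\ldots,a_\ell\rangle$ be the corresponding semigroup. Let $I$ be a canonical ideal of $R$ containing a parameter ideal $aR$ as a reduction, let $K=\left\{\frac{x}{a}\mid x\in I\right\}\subseteq Q(R)$, $S=R[K]\subseteq Q(R)$, and $\mathfrak c=R:_{Q(R)}S$. Assume $R$ is a generalized Gorenstein ring. Then the following conditions are equivalent. (i) $R$ is an Arf ring. (ii) $R$ has minimal multiplicity, $2+\ell_R(R/\mathfrak c)\cdot a_1\in H$, and $2+a_i\in H$ for each $i=2,\ldots,\ell$.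
   Context: All rings are commutative Noetherian. $Q(R)$ is the total quotient ring of $R$. $\mathrm{e}(\cdot)$ denotes the Hilbert–Samuel multiplicity of a local ring with respect to its maximal ideal $\mathfrak m$, $\ell_R(\cdot)$ denotes length of an $R$-module (not to be confused with the integer $\ell$), and $\mathrm{e}^0_{\mathfrak a}(M)$ is the multiplicity of $M$ with respect to $\mathfrak a$. $\mathrm K_R$ is the canonical module of $R$. A canonical ideal is a proper ideal isomorphic to $\mathrm K_R$ as an $R$-module. $aR\subseteq I$ is a reduction of $I$ if $I^{n+1}=aI^n$ for some $n\ge 0$. $H=\langle a_1,\ldots,a_\ell\rangle$ is the set of all sums $\sum_i c_ia_i$ with integers $c_i\ge 0$. Minimal multiplicity: a one-dimensional Cohen–Macaulay local ring $R$ has minimal multiplicity if $\mathrm e(R)=\operatorname{embdim}(R)$, where $\operatorname{embdim}(R)$ is the embedding dimension. Ulrich modules: a finitely generated $R$-module $M$ is an Ulrich $R$-module with respect to an $\mathfrak m$-primary ideal $\mathfrak a$ if $M$ is Cohen–Macaulay, $\mathrm e^0_{\mathfrak a}(M)=\ell_R(M/\mathfrak aM)$, and $M/\mathfrak aM$ is a free $R/\mathfrak a$-module. Generalized Gorenstein: $R$ is a generalized Gorenstein ring if either $R$ is Gorenstein, or $R$ is not Gorenstein and there exist an $\mathfrak m$-primary ideal $\mathfrak a$ and an exact sequence $0\to R\xrightarrow{\varphi}\mathrm K_R\to C\to 0$ of $R$-modules such that $C$ is an Ulrich $R$-module with respect to $\mathfrak a$ and $R/\mathfrak a\otimes_R\varphi: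 R/\mathfrak a\to \mathrm K_R/\mathfrak a\mathrm K_R$ is injective. Arf: Let $A$ be a Noetherian semi-local ring such that $A_{\mathcal M}$ is a one-dimensional Cohen–Macaulay ring for each maximal ideal $\mathcal M$. For an ideal $J$ of $A$ containing a non-zerodivisor, the blowup of $A$ at $J$ is $A^J=\bigcup_{n\ge1}[J^n:_{Q(A)}J^n]$; $J$ is stable if $A^J=J:_{Q(A)}J$ (equivalently $J^2=xJ$ for some $x\in J$). $A$ is an Arf ring if every integrally closed ideal of $A$ containing a non-zerodivisor is stable.
   Formalization: The integers a_1,…,a_ℓ are assumed to be a minimal generating system of H (no a_i lies in the semigroup generated by the others); otherwise the claim fails, e.g. for 3, 6, 10, 11, where R is Arf and generalized Gorenstein but 2+6 is not in H. *)

theory Defs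
  imports
    "HOL-Algebra.QuotRing"
    "HOL-Algebra.Module"
    "HOL-Algebra.Ideal_Product"
    "HOL-Algebra.Generated_Rings"
    "HOL-Algebra.Algebraic_Closure_Type"
    "HOL-Library.Extended_Nat"
    "HOL-Computational_Algebra.Formal_Laurent_Series"
begin

section \<open>Modules\<close>

text \<open>
  Module records extend ring records; the fields \<open>mult\<close> and \<open>one\<close> play no role in the
  locale \<^locale>\<open>module\<close> and are left undefined in the modules constructed here.
\<close>

definition self_module :: "('a, 'm) ring_scheme \<Rightarrow> ('a, 'a) module" where
  "self_module R = \<lparr>carrier = carrier R, monoid.mult = monoid.mult R, one = one R, ring.zero = ring.zero R,
                    add = add R, module.smult = monoid.mult R\<rparr>"

definition ideal_module :: "('a, 'm) ring_scheme \<Rightarrow> 'a set \<Rightarrow> ('a, 'a) module" where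
  "ideal_module R J = (self_module R)\<lparr>carrier := J\<rparr>"

definition quotient_module :: "('a, 'b, 'n) module_scheme \<Rightarrow> 'b set \<Rightarrow> ('a, 'b set) module" where
  "quotient_module M N = \<lparr>carrier = a_rcosets\<^bsub>M\<^esub> N, monoid.mult = undefined, one = undefined,
     ring.zero = N, add = set_add M,
     module.smult = (\<lambda>r Y. \<Union>x\<in>Y. N +>\<^bsub>M\<^esub> (r \<odot>\<^bsub>M\<^esub> x))\<rparr>"

definition power_module :: "('a, 'b, 'n) module_scheme \<Rightarrow> nat \<Rightarrow> ('a, nat \<Rightarrow> 'b) module" where
  "power_module M n = \<lparr>carrier = {..<n} \<rightarrow>\<^sub>E carrier M, monoid.mult = undefined, one = undefined,
     ring.zero = (\<lambda>i\<in>{..<n}. \<zero>\<^bsub>M\<^esub>), add = (\<lambda>f g. \<lambda>i\<in>{..<n}. f i \<oplus>\<^bsub>M\<^esub> g i),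
     module.smult = (\<lambda>r f. \<lambda>i\<in>{..<n}. r \<odot>\<^bsub>M\<^esub> f i)\<rparr>"

definition module_hom ::
  "('a, 'm) ring_scheme \<Rightarrow> ('a, 'b, 'n) module_scheme \<Rightarrow> ('a, 'c, 'p) module_scheme \<Rightarrow> ('b \<Rightarrow> 'c) set"
where
  "module_hom R M N = {f. f \<in> carrier M \<rightarrow> carrier N \<and>
     (\<forall>x\<in>carrier M. \<forall>y\<in>carrier M. f (x \<oplus>\<^bsub>M\<^esub> y) = f x \<oplus>\<^bsub>N\<^esub> f y) \<and>
     (\<forall>r\<in>carrier R. \<forall>x\<in>carrier M. f (r \<odot>\<^bsub>M\<^esub> x) = r \<odot>\<^bsub>N\<^esub> f x)}"

definition module_isomorphic ::
  "('a, 'm) ring_scheme \<Rightarrow> ('a, 'b, 'n) module_scheme \<Rightarrow> ('a, 'c, 'p) module_scheme \<Rightarrow> bool" where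
  "module_isomorphic R M N \<longleftrightarrow> (\<exists>f\<in>module_hom R M N. bij_betw f (carrier M) (carrier N))"

definition submodule_generated ::
  "('a, 'm) ring_scheme \<Rightarrow> ('a, 'b, 'n) module_scheme \<Rightarrow> 'b set \<Rightarrow> 'b set" where
  "submodule_generated R M Y = \<Inter>{N. submodule N R M \<and> Y \<subseteq> N}"

definition finitely_generated_module ::
  "('a, 'm) ring_scheme \<Rightarrow> ('a, 'b, 'n) module_scheme \<Rightarrow> bool" where
  "finitely_generated_module R M \<longleftrightarrow> module R M \<and>
     (\<exists>Y\<subseteq>carrier M. finite Y \<and> submodule_generated R M Y = carrier M)"

definition ideal_smult ::
  "('a, 'm) ring_scheme \<Rightarrow> 'a set \<Rightarrow> ('a, 'b, 'n) module_scheme \<Rightarrow> 'b set" where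
  "ideal_smult R J M = submodule_generated R M {r \<odot>\<^bsub>M\<^esub> x | r x. r \<in> J \<and> x \<in> carrier M}"

definition free_module :: "('a, 'm) ring_scheme \<Rightarrow> ('a, 'b, 'n) module_scheme \<Rightarrow> bool" where
  "free_module R M \<longleftrightarrow> module R M \<and>
     (\<exists>B\<subseteq>carrier M. \<forall>x\<in>carrier M. \<exists>!c. c \<in> B \<rightarrow>\<^sub>E carrier R \<and>
        finite {b\<in>B. c b \<noteq> \<zero>\<^bsub>R\<^esub>} \<and>
        x = (\<Oplus>\<^bsub>M\<^esub>b\<in>{b\<in>B. c b \<noteq> \<zero>\<^bsub>R\<^esub>}. c b \<odot>\<^bsub>M\<^esub> b))"

definition module_length ::
  "('a, 'm) ring_scheme \<Rightarrow> ('a, 'b, 'n) module_scheme \<Rightarrow> enat" where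
  "module_length R M = Sup {enat n | n. \<exists>N :: nat \<Rightarrow> 'b set.
     (\<forall>i\<le>n. submodule (N i) R M) \<and> (\<forall>i<n. N i \<subset> N (Suc i))}"


section \<open>Local rings: dimension, depth, multiplicity\<close>

text \<open>Meant for local rings only, where the maximal ideal is unique.\<close>

definition max_ideal :: "('a, 'm) ring_scheme \<Rightarrow> 'a set" where
  "max_ideal R = (THE \<mm>. maximalideal \<mm> R)"

definition residue_field_module :: "('a, 'm) ring_scheme \<Rightarrow> ('a, 'a set) module" where
  "residue_field_module R = quotient_module (self_module R) (max_ideal R)"

primrec ideal_power :: "('a, 'm) ring_scheme \<Rightarrow> 'a set \<Rightarrow> nat \<Rightarrow> 'a set" where
  "ideal_power R J 0 = carrier R"
| "ideal_power R J (Suc n) = ideal_prod R (ideal_power R J n) J"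

text \<open>\<open>\<mm>\<close>-primary means: a proper ideal with radical \<open>\<mm>\<close>.\<close>

definition max_primary :: "('a, 'm) ring_scheme \<Rightarrow> 'a set \<Rightarrow> bool" where
  "max_primary R q \<longleftrightarrow> ideal q R \<and> q \<subseteq> max_ideal R \<and>
     (\<forall>x\<in>max_ideal R. \<exists>n::nat. x [^]\<^bsub>R\<^esub> n \<in> q)"

text \<open>The dimension of \<open>R/J\<close>, as the supremum of lengths of chains of primes containing \<open>J\<close>.\<close>

definition dim_above :: "('a, 'm) ring_scheme \<Rightarrow> 'a set \<Rightarrow> enat" where
  "dim_above R J = Sup {enat n | n. \<exists>p :: nat \<Rightarrow> 'a set.
     (\<forall>i\<le>n. primeideal (p i) R \<and> J \<subseteq> p i) \<and> (\<forall>i<n. p i \<subset> p (Suc i))}"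

definition krull_dim :: "('a, 'm) ring_scheme \<Rightarrow> enat" where
  "krull_dim R = dim_above R {\<zero>\<^bsub>R\<^esub>}"

definition annihilator :: "('a, 'm) ring_scheme \<Rightarrow> ('a, 'b, 'n) module_scheme \<Rightarrow> 'a set" where
  "annihilator R M = {r\<in>carrier R. \<forall>x\<in>carrier M. r \<odot>\<^bsub>M\<^esub> x = \<zero>\<^bsub>M\<^esub>}"

definition module_dim :: "('a, 'm) ring_scheme \<Rightarrow> ('a, 'b, 'n) module_scheme \<Rightarrow> enat" where
  "module_dim R M = dim_above R (annihilator R M)"

definition regular_sequence ::
  "('a, 'm) ring_scheme \<Rightarrow> ('a, 'b, 'n) module_scheme \<Rightarrow> 'a list \<Rightarrow> bool" where
  "regular_sequence R M xs \<longleftrightarrow> set xs \<subseteq> carrier R \<and>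
     (\<forall>i<length xs. \<forall>y\<in>carrier M.
        xs ! i \<odot>\<^bsub>M\<^esub> y \<in> ideal_smult R (set (take i xs)) M \<longrightarrow> y \<in> ideal_smult R (set (take i xs)) M) \<and>
     ideal_smult R (set xs) M \<noteq> carrier M"

definition module_depth :: "('a, 'm) ring_scheme \<Rightarrow> ('a, 'b, 'n) module_scheme \<Rightarrow> enat" where
  "module_depth R M = Sup {enat (length xs) | xs. set xs \<subseteq> max_ideal R \<and> regular_sequence R M xs}"

definition cohen_macaulay_module ::
  "('a, 'm) ring_scheme \<Rightarrow> ('a, 'b, 'n) module_scheme \<Rightarrow> bool" where
  "cohen_macaulay_module R M \<longleftrightarrow> finitely_generated_module R M \<and>
     (carrier M = {\<zero>\<^bsub>M\<^esub>} \<or> module_depth R M = module_dim R M)"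

text \<open>
  The multiplicity \<open>e\<^sup>0\<^bsub>q\<^esub>(M) = lim s! \<ell>(M/q\<^sup>nM) / n\<^sup>s\<close>, where \<open>s\<close> is the dimension
  of \<open>M\<close> itself (not of \<open>R\<close>), for \<open>q\<close> an \<open>\<mm>\<close>-primary ideal and \<open>M\<close> finitely generated.
\<close>

definition multiplicity_wrt ::
  "('a, 'm) ring_scheme \<Rightarrow> 'a set \<Rightarrow> ('a, 'b, 'n) module_scheme \<Rightarrow> real" where
  "multiplicity_wrt R q M = (let s = the_enat (module_dim R M) in
     lim (\<lambda>n. fact s *
       real (the_enat (module_length R (quotient_module M (ideal_smult R (ideal_power R q n) M))))
         / real n ^ s))"

definition ring_multiplicity :: "('a, 'm) ring_scheme \<Rightarrow> real" where
  "ring_multiplicity R = multiplicity_wrt R (max_ideal R) (self_module R)"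

definition embedding_dim :: "('a, 'm) ring_scheme \<Rightarrow> nat" where
  "embedding_dim R = (LEAST n. \<exists>Y\<subseteq>carrier R. finite Y \<and> card Y = n \<and> genideal R Y = max_ideal R)"

text \<open>Meant for one-dimensional Cohen--Macaulay local rings.\<close>

definition minimal_multiplicity :: "('a, 'm) ring_scheme \<Rightarrow> bool" where
  "minimal_multiplicity R \<longleftrightarrow> ring_multiplicity R = real (embedding_dim R)"


section \<open>Ext, canonical modules and Gorenstein rings\<close>

text \<open>
  A resolution of \<open>N\<close> by finite free modules \<open>F\<^sub>i = R\<^bsup>r i\<^esup>\<close>: the differential
  \<open>F\<^bsub>i+1\<^esub> \<rightarrow> F\<^sub>i\<close> sends the \<open>j\<close>-th basis vector to the row \<open>D i j\<close>, and the augmentation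
  \<open>F\<^sub>0 \<rightarrow> N\<close> sends the \<open>l\<close>-th basis vector to \<open>g l\<close>. Under the identification
  \<open>Hom(R\<^sup>n, M) = M\<^sup>n\<close>, the transposed map is \<open>dual_map\<close>.
\<close>

definition row_map ::
  "('a, 'm) ring_scheme \<Rightarrow> nat \<Rightarrow> nat \<Rightarrow> (nat \<Rightarrow> nat \<Rightarrow> 'a) \<Rightarrow> (nat \<Rightarrow> 'a) \<Rightarrow> (nat \<Rightarrow> 'a)" where
  "row_map R p q A v = (\<lambda>l\<in>{..<q}. \<Oplus>\<^bsub>R\<^esub>j\<in>{..<p}. v j \<otimes>\<^bsub>R\<^esub> A j l)"

definition dual_map ::
  "('a, 'b, 'n) module_scheme \<Rightarrow> nat \<Rightarrow> nat \<Rightarrow> (nat \<Rightarrow> nat \<Rightarrow> 'a) \<Rightarrow> (nat \<Rightarrow> 'b) \<Rightarrow> (nat \<Rightarrow> 'b)" where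
  "dual_map M p q A f = (\<lambda>j\<in>{..<p}. \<Oplus>\<^bsub>M\<^esub>l\<in>{..<q}. A j l \<odot>\<^bsub>M\<^esub> f l)"

definition augmentation :: "('a, 'b, 'n) module_scheme \<Rightarrow> nat \<Rightarrow> (nat \<Rightarrow> 'b) \<Rightarrow> (nat \<Rightarrow> 'a) \<Rightarrow> 'b" where
  "augmentation N q g v = (\<Oplus>\<^bsub>N\<^esub>l\<in>{..<q}. v l \<odot>\<^bsub>N\<^esub> g l)"

definition free_resolution ::
  "('a, 'm) ring_scheme \<Rightarrow> ('a, 'b, 'n) module_scheme \<Rightarrow>
   (nat \<Rightarrow> nat) \<Rightarrow> (nat \<Rightarrow> nat \<Rightarrow> nat \<Rightarrow> 'a) \<Rightarrow> (nat \<Rightarrow> 'b) \<Rightarrow> bool" where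
  "free_resolution R N r D g \<longleftrightarrow>
     (\<forall>i. \<forall>j<r (Suc i). \<forall>l<r i. D i j l \<in> carrier R) \<and>
     (\<forall>l<r 0. g l \<in> carrier N) \<and>
     augmentation N (r 0) g ` ({..<r 0} \<rightarrow>\<^sub>E carrier R) = carrier N \<and>
     {v \<in> {..<r 0} \<rightarrow>\<^sub>E carrier R. augmentation N (r 0) g v = \<zero>\<^bsub>N\<^esub>}
       = row_map R (r 1) (r 0) (D 0) ` ({..<r 1} \<rightarrow>\<^sub>E carrier R) \<and>
     (\<forall>i. {v \<in> {..<r (Suc i)} \<rightarrow>\<^sub>E carrier R.
             row_map R (r (Suc i)) (r i) (D i) v = (\<lambda>l\<in>{..<r i}. \<zero>\<^bsub>R\<^esub>)}
       = row_map R (r (Suc (Suc i))) (r (Suc i)) (D (Suc i)) ` ({..<r (Suc (Suc i))} \<rightarrow>\<^sub>E carrier R))"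

definition ext_cocycles ::
  "('a, 'b, 'n) module_scheme \<Rightarrow> (nat \<Rightarrow> nat) \<Rightarrow> (nat \<Rightarrow> nat \<Rightarrow> nat \<Rightarrow> 'a) \<Rightarrow> nat \<Rightarrow> (nat \<Rightarrow> 'b) set" where
  "ext_cocycles M r D i = {f \<in> carrier (power_module M (r i)).
     dual_map M (r (Suc i)) (r i) (D i) f = \<zero>\<^bsub>power_module M (r (Suc i))\<^esub>}"

fun ext_coboundaries ::
  "('a, 'b, 'n) module_scheme \<Rightarrow> (nat \<Rightarrow> nat) \<Rightarrow> (nat \<Rightarrow> nat \<Rightarrow> nat \<Rightarrow> 'a) \<Rightarrow> nat \<Rightarrow> (nat \<Rightarrow> 'b) set" where
  "ext_coboundaries M r D 0 = {\<zero>\<^bsub>power_module M (r 0)\<^esub>}"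
| "ext_coboundaries M r D (Suc i) =
     dual_map M (r (Suc i)) (r i) (D i) ` carrier (power_module M (r i))"

text \<open>\<open>Ext\<^sup>i(N, M)\<close>, computed from the resolution \<open>(r, D)\<close> of \<open>N\<close>.\<close>

definition ext_module ::
  "('a, 'b, 'n) module_scheme \<Rightarrow> (nat \<Rightarrow> nat) \<Rightarrow> (nat \<Rightarrow> nat \<Rightarrow> nat \<Rightarrow> 'a) \<Rightarrow> nat \<Rightarrow>
   ('a, (nat \<Rightarrow> 'b) set) module" where
  "ext_module M r D i = quotient_module
     ((power_module M (r i))\<lparr>carrier := ext_cocycles M r D i\<rparr>) (ext_coboundaries M r D i)"

text \<open>
  \<open>C\<close> is a canonical module of the Cohen--Macaulay local ring \<open>R\<close> of dimension \<open>d\<close> with residue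
  field \<open>k\<close>: it is finitely generated, \<open>Ext\<^sup>d(k, C) \<cong> k\<close> and \<open>Ext\<^sup>i(k, C) = 0\<close> for \<open>i \<noteq> d\<close>
  (that is, \<open>C\<close> is maximal Cohen--Macaulay of type one and finite injective dimension). The choice
  of resolution is immaterial. Canonical modules are unique up to isomorphism.
\<close>

definition canonical_module ::
  "('a, 'm) ring_scheme \<Rightarrow> ('a, 'b, 'n) module_scheme \<Rightarrow> bool" where
  "canonical_module R C \<longleftrightarrow> finitely_generated_module R C \<and>
     (\<exists>r D g. free_resolution R (residue_field_module R) r D g \<and>
        (\<forall>i. if enat i = krull_dim R
              then module_isomorphic R (ext_module C r D i) (residue_field_module R)
              else carrier (ext_module C r D i) = {\<zero>\<^bsub>ext_module C r D i\<^esub>}))"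

text \<open>
  One of the standard definitions (Matsumura, Commutative Ring Theory, Section 18) for a
  \<open>d\<close>-dimensional Noetherian local ring: \<open>Ext\<^sup>i(k, R)\<close> is \<open>k\<close> for \<open>i = d\<close> and vanishes
  otherwise. Equivalently, \<open>R\<close> is its own canonical module.
\<close>

definition gorenstein_ring :: "('a, 'm) ring_scheme \<Rightarrow> bool" where
  "gorenstein_ring R \<longleftrightarrow> canonical_module R (self_module R)"


section \<open>Ulrich modules and generalized Gorenstein rings\<close>

text \<open>\<open>M/qM\<close> as a module over the quotient ring \<open>R/q\<close>.\<close>

definition reduction_module ::
  "('a, 'm) ring_scheme \<Rightarrow> 'a set \<Rightarrow> ('a, 'b, 'n) module_scheme \<Rightarrow> ('a set, 'b set) module" where
  "reduction_module R q M = \<lparr>carrier = a_rcosets\<^bsub>M\<^esub> (ideal_smult R q M),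
     monoid.mult = undefined, one = undefined, ring.zero = ideal_smult R q M, add = set_add M,
     module.smult = (\<lambda>A Y. \<Union>r\<in>A. \<Union>x\<in>Y. ideal_smult R q M +>\<^bsub>M\<^esub> (r \<odot>\<^bsub>M\<^esub> x))\<rparr>"

definition ulrich_module ::
  "('a, 'm) ring_scheme \<Rightarrow> 'a set \<Rightarrow> ('a, 'b, 'n) module_scheme \<Rightarrow> bool" where
  "ulrich_module R q M \<longleftrightarrow> finitely_generated_module R M \<and>
     cohen_macaulay_module R M \<and>
     multiplicity_wrt R q M
       = real (the_enat (module_length R (quotient_module M (ideal_smult R q M)))) \<and>
     free_module (R Quot q) (reduction_module R q M)"

definition short_exact ::
  "('a, 'm) ring_scheme \<Rightarrow> ('a, 'b, 'n) module_scheme \<Rightarrow> ('b \<Rightarrow> 'c) \<Rightarrow> ('a, 'c, 'p) module_scheme \<Rightarrow>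
   ('c \<Rightarrow> 'd) \<Rightarrow> ('a, 'd, 'q) module_scheme \<Rightarrow> bool" where
  "short_exact R L \<phi> M \<psi> N \<longleftrightarrow> \<phi> \<in> module_hom R L M \<and> \<psi> \<in> module_hom R M N \<and>
     inj_on \<phi> (carrier L) \<and> \<phi> ` carrier L = {x \<in> carrier M. \<psi> x = \<zero>\<^bsub>N\<^esub>} \<and>
     \<psi> ` carrier M = carrier N"

text \<open>The map \<open>R/q \<rightarrow> K/qK\<close> induced by \<open>\<phi> : R \<rightarrow> K\<close>.\<close>

definition reduced_map ::
  "('a, 'm) ring_scheme \<Rightarrow> 'a set \<Rightarrow> ('a, 'b, 'n) module_scheme \<Rightarrow> ('a \<Rightarrow> 'b) \<Rightarrow> 'a set \<Rightarrow> 'b set" where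
  "reduced_map R q K \<phi> Y = (\<Union>x\<in>Y. ideal_smult R q K +>\<^bsub>K\<^esub> \<phi> x)"

text \<open>
  The modules \<open>K\<close> and \<open>C\<close> are finitely generated. Every such module is isomorphic to a
  quotient of some \<open>R\<^sup>n\<close>, whose elements are sets of functions \<open>nat \<Rightarrow> 'a\<close>, so quantifying
  over modules on the type \<open>(nat \<Rightarrow> 'a) set\<close> is no restriction.
\<close>

definition generalized_gorenstein :: "('a, 'm) ring_scheme \<Rightarrow> bool" where
  "generalized_gorenstein R \<longleftrightarrow> gorenstein_ring R \<or>
     (\<not> gorenstein_ring R \<and>
      (\<exists>q (K :: ('a, (nat \<Rightarrow> 'a) set) module) (C :: ('a, (nat \<Rightarrow> 'a) set) module) \<phi> \<psi>.
         max_primary R q \<and> canonical_module R K \<and> module R C \<and>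
         short_exact R (self_module R) \<phi> K \<psi> C \<and>
         ulrich_module R q C \<and>
         inj_on (reduced_map R q K \<phi>) (carrier (R Quot q))))"


section \<open>Subrings of a field: fractions, blowups and Arf rings\<close>

text \<open>
  The rings \<open>A\<close> below are subrings of an ambient field, hence domains, and their
  non-zerodivisors are the nonzero elements.
\<close>

definition ring_on :: "'a::field set \<Rightarrow> 'a ring" where
  "ring_on A = ring_of_type_algebra\<lparr>carrier := A\<rparr>"

definition total_quotient :: "'a::field set \<Rightarrow> 'a set" where
  "total_quotient A = {x / y | x y. x \<in> A \<and> y \<in> A \<and> y \<noteq> 0}"

definition colon :: "'a::field set \<Rightarrow> 'a set \<Rightarrow> 'a set \<Rightarrow> 'a set" where
  "colon A V W = {z \<in> total_quotient A. \<forall>w\<in>W. z * w \<in> V}"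

definition integrally_closed_ideal :: "'a::field set \<Rightarrow> 'a set \<Rightarrow> bool" where
  "integrally_closed_ideal A J \<longleftrightarrow> ideal J (ring_on A) \<and>
     (\<forall>x\<in>A. \<forall>n>0. \<forall>c. (\<forall>i\<in>{1..n}. c i \<in> ideal_power (ring_on A) J i) \<and>
        x ^ n + (\<Sum>i=1..n. c i * x ^ (n - i)) = 0 \<longrightarrow> x \<in> J)"

definition blowup :: "'a::field set \<Rightarrow> 'a set \<Rightarrow> 'a set" where
  "blowup A J = (\<Union>n\<in>{1..}. colon A (ideal_power (ring_on A) J n) (ideal_power (ring_on A) J n))"

definition stable_ideal :: "'a::field set \<Rightarrow> 'a set \<Rightarrow> bool" where
  "stable_ideal A J \<longleftrightarrow> blowup A J = colon A J J"

text \<open>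
  Meant for Noetherian semi-local \<open>A\<close> all of whose localizations at maximal ideals are
  one-dimensional and Cohen--Macaulay.
\<close>

definition arf_ring :: "'a::field set \<Rightarrow> bool" where
  "arf_ring A \<longleftrightarrow> (\<forall>J. integrally_closed_ideal A J \<and> (\<exists>x\<in>J. x \<noteq> 0) \<longrightarrow> stable_ideal A J)"

definition canonical_ideal :: "'a::field set \<Rightarrow> 'a set \<Rightarrow> bool" where
  "canonical_ideal A I \<longleftrightarrow> ideal I (ring_on A) \<and> I \<noteq> A \<and>
     canonical_module (ring_on A) (ideal_module (ring_on A) I)"

definition principal_reduction :: "'a::field set \<Rightarrow> 'a set \<Rightarrow> 'a \<Rightarrow> bool" where
  "principal_reduction A I b \<longleftrightarrow> b \<in> I \<and>
     (\<exists>n. ideal_power (ring_on A) I (Suc n) = (*) b ` ideal_power (ring_on A) I n)"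


section \<open>Numerical semigroup rings\<close>

definition semigroup_generated :: "(nat \<Rightarrow> nat) \<Rightarrow> nat set \<Rightarrow> nat set" where
  "semigroup_generated a J = {\<Sum>i\<in>J. c i * a i | c :: nat \<Rightarrow> nat. True}"

text \<open>
  \<open>k[[t\<^bsup>a 1\<^esup>, \<dots>, t\<^bsup>a l\<^esup>]]\<close>: the series \<open>\<Sum>\<^sub>e C\<^sub>e (t\<^bsup>a 1\<^esup>)\<^bsup>e 1\<^esup> \<cdots> (t\<^bsup>a l\<^esup>)\<^bsup>e l\<^esup>\<close> over all multi-indices
  \<open>e\<close>, as a subring of the field of Laurent series. For positive \<open>a i\<close> each coefficient is
  a finite sum.
\<close>

definition semigroup_ring :: "(nat \<Rightarrow> nat) \<Rightarrow> nat \<Rightarrow> 'k::field fls set" where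
  "semigroup_ring a l = fps_to_fls ` {f. \<exists>C :: (nat \<Rightarrow> nat) \<Rightarrow> 'k. \<forall>n. fps_nth f n =
     (\<Sum>e\<in>{e \<in> {1..l} \<rightarrow>\<^sub>E UNIV. (\<Sum>i=1..l. e i * a i) = n}. C e)}"

end

theory Submission imports Defs "HOL-Library.Function_Algebras" begin

text \<open>Everything is translated into the value semigroup \<open>H\<close>, written as a set of integers with
  Frobenius number \<open>F\<close> and multiplicity \<open>e\<close>. The canonical modules of \<open>A\<close> are isomorphic to the
  fractional ideal \<open>\<omega>\<close> of the series with exponents in \<open>K = {j. F - j \<notin> H}\<close>; a canonical ideal divided by
  the generator of its reduction is \<open>\<omega>/g\<close> for some unit \<open>g\<close> of order 0, and therefore \<open>S\<close> is the ring of
  series on the semigroup \<open>T\<close> generated by \<open>K\<close>, and its conductor is that of \<open>T\<close> in \<open>H\<close>. The ring is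
  Arf if and only if \<open>x + y - z \<in> H\<close> for all \<open>x, y \<ge> z\<close> in \<open>H\<close>.

  If \<open>A\<close> is generalized Gorenstein but not Gorenstein, the exact sequence is \<open>0 \<rightarrow> A \<rightarrow> \<omega> \<rightarrow> Q \<rightarrow> 0\<close> with
  \<open>1 \<mapsto> g\<close>. Equality of multiplicity and length forces \<open>q Q = 0\<close>, the injectivity assumption forces \<open>g\<close> to
  have order 0 and \<open>q\<close> to be an ideal of \<open>S\<close>, and freeness of \<open>Q\<close> over \<open>A/q\<close> bounds the length of \<open>\<omega>/A\<close>
  from below by \<open>n = \<ell>(A/\<cc>)\<close> times the number of generators of \<open>Q\<close>. For minimal multiplicity this forces \<open>H\<close>
  to consist of the multiples of \<open>e\<close> below \<open>n e\<close> and of \<open>n e + T\<close>, with \<open>T\<close> symmetric. Such an \<open>H\<close> is Arf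
  if and only if \<open>T\<close> is, and a symmetric semigroup is Arf if and only if it contains 2.\<close>

text \<open>A canonical module is an abstract module, known only through Ext of the residue field
  along some free resolution, whereas the rest of the argument lives in sets of Laurent series. The
  bridge is Matlis duality done by hand. Vanishing of Ext^0 makes the module torsion-free, hence a
  lattice L in a space V of families of Laurent series; Ext^1 = k says that the vectors moved into L
  by \<mm> form a line modulo L. A linear functional that vanishes on L but not on that line turns a
  vector w into the series whose j-th coefficient is its value at t^(F-j) w, and L is exactly what
  lands in \<omega>.

  Lengths, independence and numbers of generators are read off from orders of series: each order
  contributes one dimension over k.

  The combinatorial core squeezes K - H between two bounds. The numbers F + e - w, for w in the
  Apery set, generate K over the multiples of e, which gives an upper bound n times the size of
  \<open>Apery'\<close>. Freeness gives the same number as a lower bound, once minimal multiplicity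
  shows that these generators are irredundant.\<close>

unbundle fps_syntax

section \<open>Series with support in a set of exponents\<close>

definition fls_mono :: "int \<Rightarrow> 'k::field fls" where "fls_mono i = fls_shift (- i) 1"

lemma fls_mono_nth [simp]: "fls_mono i $$ n = (if n = i then 1 else 0)"
  by (auto simp: fls_mono_def)

lemma fls_mono_mult_nth [simp]: "(fls_mono i * f) $$ n = f $$ (n - i)"
  by (simp add: fls_mono_def fls_X_intpow_times_conv_shift)

lemma mult_fls_mono_nth [simp]: "(f * fls_mono i) $$ n = f $$ (n - i)"
  by (metis fls_mono_mult_nth mult.commute)

lemma fls_mono_mult: "fls_mono i * fls_mono j = fls_mono (i + j)"
  by (rule fls_eqI) auto

lemma fls_mono_0 [simp]: "fls_mono 0 = 1"
  by (rule fls_eqI) auto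

lemma fls_mono_nonzero [simp]: "fls_mono i \<noteq> 0"
  using fls_mono_nth[of i i] by (metis fls_zero_nth zero_neq_one)

lemma fls_mono_subdegree [simp]: "fls_subdegree (fls_mono i) = i"
  by (rule fls_subdegree_eqI) auto

lemma fls_mono_power: "fls_mono i ^ n = fls_mono (int n * i)"
  by (induction n) (auto simp: fls_mono_mult algebra_simps)

lemma fls_const_mult_nth [simp]: "(fls_const c * f) $$ n = c * f $$ n"
  for f :: "'k::field fls"
  by simp

lemma fls_mult_nth_nonzero:
  fixes f g :: "'k::field fls"
  assumes "(f * g) $$ n \<noteq> 0"
  obtains i j where "i + j = n" "f $$ i \<noteq> 0" "g $$ j \<noteq> 0"
proof -
  have "\<exists>i. f $$ i * g $$ (n - i) \<noteq> 0"
  proof (rule ccontr)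
    assume "\<not> ?thesis"
    then have "(f * g) $$ n = 0" unfolding fls_times_nth(2) by (intro sum.neutral) auto
    then show False using assms by simp
  qed
  then obtain i where "f $$ i * g $$ (n - i) \<noteq> 0" by blast
  then show ?thesis by (intro that[of i "n - i"]) auto
qed

definition series_on :: "int set \<Rightarrow> 'k::field fls set" where
  "series_on T = {f. \<forall>n. f $$ n \<noteq> 0 \<longrightarrow> n \<in> T}"

lemma series_onI: "(\<And>n. f $$ n \<noteq> 0 \<Longrightarrow> n \<in> T) \<Longrightarrow> f \<in> series_on T"
  by (auto simp: series_on_def)

lemma series_onD: "f \<in> series_on T \<Longrightarrow> f $$ n \<noteq> 0 \<Longrightarrow> n \<in> T"
  by (auto simp: series_on_def)

lemma series_on_zero: "f \<in> series_on T \<Longrightarrow> n \<notin> T \<Longrightarrow> f $$ n = 0"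
  by (auto simp: series_on_def)

lemma series_on_mono: "S \<subseteq> T \<Longrightarrow> series_on S \<subseteq> series_on T"
  by (auto simp: series_on_def)

lemma zero_in_series_on [simp]: "0 \<in> series_on T"
  by (auto simp: series_on_def)

lemma fls_mono_in_series_on [simp]: "fls_mono i \<in> series_on T \<longleftrightarrow> i \<in> T"
  by (auto simp: series_on_def)

lemma series_on_add: "f \<in> series_on T \<Longrightarrow> g \<in> series_on T \<Longrightarrow> f + g \<in> series_on T"
  unfolding series_on_def by (auto, metis add.right_neutral)

lemma series_on_uminus: "f \<in> series_on T \<Longrightarrow> - f \<in> series_on T"
  unfolding series_on_def by auto

lemma series_on_diff: "f \<in> series_on T \<Longrightarrow> g \<in> series_on T \<Longrightarrow> f - g \<in> series_on T"
  using series_on_add[of f T "- g"] series_on_uminus[of g T] by simp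

lemma series_on_sum: "(\<And>i. i \<in> Z \<Longrightarrow> f i \<in> series_on T) \<Longrightarrow> (\<Sum>i\<in>Z. f i) \<in> series_on T"
  by (induction Z rule: infinite_finite_induct) (auto intro: series_on_add)

lemma series_on_const_mult: "f \<in> series_on T \<Longrightarrow> fls_const c * f \<in> series_on T"
  unfolding series_on_def by auto

lemma series_on_mult:
  assumes "f \<in> series_on S" "g \<in> series_on T" "\<And>i j. i \<in> S \<Longrightarrow> j \<in> T \<Longrightarrow> i + j \<in> U"
  shows "f * g \<in> series_on U"
proof (rule series_onI)
  fix n assume "(f * g) $$ n \<noteq> 0"
  then obtain i j where "i + j = n" "f $$ i \<noteq> 0" "g $$ j \<noteq> 0" by (rule fls_mult_nth_nonzero)
  then show "n \<in> U" using assms series_onD by metis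
qed

lemma const_in_series_on: "0 \<in> T \<Longrightarrow> fls_const c \<in> series_on T"
  unfolding series_on_def by auto

lemma subdegree_in_series_on: "f \<in> series_on T \<Longrightarrow> f \<noteq> 0 \<Longrightarrow> fls_subdegree f \<in> T"
  using series_onD nth_fls_subdegree_nonzero by metis

lemma series_on_atLeast_iff: "f \<in> series_on {n..} \<longleftrightarrow> f = 0 \<or> n \<le> fls_subdegree f"
  unfolding series_on_def
  by (auto, metis atLeast_iff fls_subdegree_geI linorder_not_le,
      meson dual_order.trans fls_subdegree_leI)

lemma series_on_subdegree: "f \<in> series_on {fls_subdegree f..}"
  by (simp add: series_on_atLeast_iff)

text \<open>Stated on plain sets so that ideals, fractional ideals, subrings and colon sets can all
  be fed to the same linear algebra over the coefficient field.\<close>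

definition ksubspace :: "'k::field fls set \<Rightarrow> bool" where
  "ksubspace W \<longleftrightarrow> 0 \<in> W \<and> (\<forall>x\<in>W. \<forall>y\<in>W. x + y \<in> W) \<and> (\<forall>c. \<forall>x\<in>W. fls_const c * x \<in> W)"

lemma ksubspaceD:
  assumes "ksubspace W"
  shows "0 \<in> W" "x \<in> W \<Longrightarrow> y \<in> W \<Longrightarrow> x + y \<in> W" "x \<in> W \<Longrightarrow> fls_const c * x \<in> W"
    "x \<in> W \<Longrightarrow> - x \<in> W" "x \<in> W \<Longrightarrow> y \<in> W \<Longrightarrow> x - y \<in> W"
proof -
  show "0 \<in> W" using assms by (auto simp: ksubspace_def)
  show add: "x \<in> W \<Longrightarrow> y \<in> W \<Longrightarrow> x + y \<in> W" for x y
    using assms by (auto simp: ksubspace_def)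
  show sc: "x \<in> W \<Longrightarrow> fls_const c * x \<in> W" for c x
    using assms by (auto simp: ksubspace_def)
  show neg: "x \<in> W \<Longrightarrow> - x \<in> W" for x
    using sc[of x "-1"] by simp
  show "x \<in> W \<Longrightarrow> y \<in> W \<Longrightarrow> x - y \<in> W"
    using add[of x "- y"] neg[of y] by simp
qed

lemma ksubspace_sum: "ksubspace W \<Longrightarrow> (\<And>i. i \<in> Z \<Longrightarrow> f i \<in> W) \<Longrightarrow> (\<Sum>i\<in>Z. f i) \<in> W"
  by (induction Z rule: infinite_finite_induct) (auto intro: ksubspaceD)

lemma ksubspace_series_on: "ksubspace (series_on T)"
  by (auto simp: ksubspace_def series_on_add series_on_const_mult)

lemma fls_split:
  fixes f :: "'k::field fls"
  assumes "f \<in> series_on {m..}"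
  shows "f - (\<Sum>i\<in>{m..<n}. fls_const (f $$ i) * fls_mono i) \<in> series_on {max m n..}"
proof (rule series_onI)
  fix j assume j: "(f - (\<Sum>i\<in>{m..<n}. fls_const (f $$ i) * fls_mono i)) $$ j \<noteq> 0"
  have "(\<Sum>i\<in>{m..<n}. fls_const (f $$ i) * fls_mono i) $$ j = (\<Sum>i\<in>{m..<n}. if j = i then f $$ i else 0)"
    by (auto simp: fls_nth_sum intro!: sum.cong)
  also have "\<dots> = (if m \<le> j \<and> j < n then f $$ j else 0)" by (simp add: sum.delta)
  finally show "j \<in> {max m n..}" using j series_on_zero[OF assms, of j] by (auto split: if_splits)
qed

text \<open>Takes the place of closure under infinite sums: once a tail lies in \<open>U\<close>,
  the series \<open>f\<close> differs from a finite combination of its own low monomials by an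
  element of the tail.\<close>

lemma ksubspace_memI:
  assumes U: "ksubspace U" and tail: "series_on {n..} \<subseteq> U"
    and low: "\<And>i. i < n \<Longrightarrow> f $$ i \<noteq> 0 \<Longrightarrow> fls_mono i \<in> U"
  shows "f \<in> U"
proof -
  define m where "m = fls_subdegree f"
  define s where "s = (\<Sum>i\<in>{m..<n}. fls_const (f $$ i) * fls_mono i)"
  have "f - s \<in> series_on {max m n..}"
    unfolding s_def m_def by (rule fls_split[OF series_on_subdegree])
  also have "\<dots> \<subseteq> series_on {n..}" by (rule series_on_mono) auto
  finally have "f - s \<in> U" using tail by blast
  moreover have "s \<in> U" unfolding s_def
  proof (rule ksubspace_sum[OF U])
    fix i assume "i \<in> {m..<n}"
    then show "fls_const (f $$ i) * fls_mono i \<in> U"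
      using low[of i] ksubspaceD[OF U] by (cases "f $$ i = 0") auto
  qed
  ultimately have "(f - s) + s \<in> U" using ksubspaceD[OF U] by blast
  then show ?thesis by simp
qed

text \<open>Modulo the high-order series, the inverse of a unit is a polynomial in it (geometric series).\<close>

lemma inverse_mem_ring:
  fixes B :: "'k::field fls set"
  assumes B: "ksubspace B" "\<And>x y. x \<in> B \<Longrightarrow> y \<in> B \<Longrightarrow> x * y \<in> B" and tail: "series_on {c..} \<subseteq> B"
    and one: "1 \<in> B" and u: "u \<in> B" "u \<in> series_on {0..}" "u $$ 0 \<noteq> 0"
  shows "inverse u \<in> B"
proof -
  define y where "y = 1 - fls_const (inverse (u $$ 0)) * u"
  have yB: "y \<in> B" unfolding y_def using ksubspaceD[OF B(1)] one u(1) by blast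
  have y1: "y \<in> series_on {1..}"
  proof (rule series_onI)
    fix n assume n: "y $$ n \<noteq> 0"
    have "n \<noteq> 0" using n u(3) unfolding y_def by auto
    then have "u $$ n \<noteq> 0" using n unfolding y_def by auto
    then have "0 \<le> n" using series_onD[OF u(2)] by auto
    then show "n \<in> {1..}" using \<open>n \<noteq> 0\<close> by simp
  qed
  have pow: "y ^ n \<in> series_on {int n..}" for n
  proof (induction n)
    case 0
    show ?case using fls_mono_in_series_on[of 0 "{0::int..}", where 'a = 'k] by simp
  next
    case (Suc n)
    show ?case unfolding power_Suc by (rule series_on_mult[OF y1 Suc]) auto
  qed
  have powB: "y ^ n \<in> B" for n
  proof (induction n)
    case (Suc n)
    show ?case unfolding power_Suc by (rule B(2)[OF yB Suc])
  qed (use one in simp)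
  have u0: "u \<noteq> 0" using u(3) by auto
  have sub0: "fls_subdegree u = 0"
  proof (rule antisym)
    show "fls_subdegree u \<le> 0" by (rule fls_subdegree_leI[OF u(3)])
    show "0 \<le> fls_subdegree u" using u(2) u0 unfolding series_on_atLeast_iff by simp
  qed
  \<comment> \<open>\<open>y ^ N\<close> has order at least c, so the remainder of the geometric
    series falls into the tail. For negative c the exponent is 0, the sum is empty, and
    \<open>inverse u\<close> itself lies in the tail.\<close>
  define N where "N = nat c"
  have uy: "fls_const (inverse (u $$ 0)) * u = 1 - y" unfolding y_def by simp
  have "(1 - y) * (\<Sum>i<N. y ^ i) = 1 - y ^ N"
    by (rule one_diff_power_eq[symmetric])
  then have "fls_const (inverse (u $$ 0)) * u * (\<Sum>i<N. y ^ i) + y ^ N = 1" unfolding uy by simp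
  then have "inverse u * (fls_const (inverse (u $$ 0)) * u * (\<Sum>i<N. y ^ i) + y ^ N) = inverse u" by simp
  moreover have "inverse u * (fls_const (inverse (u $$ 0)) * u * (\<Sum>i<N. y ^ i) + y ^ N)
      = fls_const (inverse (u $$ 0)) * (\<Sum>i<N. y ^ i) + inverse u * y ^ N"
    using u0 by (simp add: field_simps)
  ultimately have eq: "inverse u = fls_const (inverse (u $$ 0)) * (\<Sum>i<N. y ^ i) + inverse u * y ^ N" by simp
  have "inverse u \<in> series_on {0..}" using sub0 unfolding series_on_atLeast_iff by simp
  then have "inverse u * y ^ N \<in> series_on {c..}"
    by (rule series_on_mult[OF _ pow]) (auto simp: N_def split: if_splits)
  then have 1: "inverse u * y ^ N \<in> B" using tail by blast
  have "fls_const (inverse (u $$ 0)) * (\<Sum>i<N. y ^ i) \<in> B"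
    by (intro ksubspaceD(3)[OF B(1)] ksubspace_sum[OF B(1)] powB)
  then show ?thesis by (subst eq) (rule ksubspaceD(2)[OF B(1) _ 1])
qed

section \<open>Subsets of a field as rings, and their ideals\<close>

lemma ring_on_simps [simp]:
  "carrier (ring_on A) = A" "x \<otimes>\<^bsub>ring_on A\<^esub> y = x * y" "x \<oplus>\<^bsub>ring_on A\<^esub> y = x + y"
  "\<zero>\<^bsub>ring_on A\<^esub> = 0" "\<one>\<^bsub>ring_on A\<^esub> = 1"
  by (auto simp: ring_on_def ring_of_type_algebra_def)

lemma ring_on_pow [simp]: "x [^]\<^bsub>ring_on A\<^esub> (n::nat) = x ^ n"
  by (induction n) (auto simp: nat_pow_def mult.commute)

lemma cring_ring_on:
  assumes "1 \<in> A" "\<And>x y. x \<in> A \<Longrightarrow> y \<in> A \<Longrightarrow> x + y \<in> A" "\<And>x y. x \<in> A \<Longrightarrow> y \<in> A \<Longrightarrow> x * y \<in> A"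
    "\<And>x. x \<in> A \<Longrightarrow> - x \<in> A"
  shows "cring (ring_on A)"
proof -
  have 0: "0 \<in> A" using assms(1,2,4) by (metis ab_left_minus)
  show ?thesis
  proof (rule cringI)
    show "abelian_group (ring_on A)"
    proof (rule abelian_groupI)
      fix x assume "x \<in> carrier (ring_on A)"
      then show "\<exists>y\<in>carrier (ring_on A). y \<oplus>\<^bsub>ring_on A\<^esub> x = \<zero>\<^bsub>ring_on A\<^esub>"
        using assms(4) by (auto intro!: bexI[of _ "- x"])
    qed (use 0 assms in \<open>auto simp: algebra_simps\<close>)
    show "Group.comm_monoid (ring_on A)"
      by (rule comm_monoidI) (use 0 assms in \<open>auto simp: algebra_simps\<close>)
  qed (auto simp: algebra_simps)
qed

lemma finsum_ring_on:
  assumes "cring (ring_on A)" "f \<in> Z \<rightarrow> A"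
  shows "finsum (ring_on A) f Z = sum f Z"
proof -
  interpret cring "ring_on A" by fact
  show ?thesis using assms(2)
  proof (induction Z rule: infinite_finite_induct)
    case (infinite Z)
    then show ?case by (simp add: finsum_infinite)
  next
    case (insert x Z)
    then have "f \<in> Z \<rightarrow> carrier (ring_on A)" "f x \<in> carrier (ring_on A)" by auto
    then show ?case using insert by (simp add: finsum_insert)
  qed auto
qed

lemma ideal_ring_onI:
  assumes "cring (ring_on A)" "J \<subseteq> A" "0 \<in> J" "\<And>x y. x \<in> J \<Longrightarrow> y \<in> J \<Longrightarrow> x + y \<in> J"
    "\<And>r x. r \<in> A \<Longrightarrow> x \<in> J \<Longrightarrow> r * x \<in> J"
  shows "ideal J (ring_on A)"
proof -
  interpret cring "ring_on A" by fact
  have uminus: "\<ominus>\<^bsub>ring_on A\<^esub> x = - x" if "x \<in> A" for x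
    using that minus_equality[of "- x" x]
    by (metis add.inv_closed eq_neg_iff_add_eq_0 l_neg ring_on_simps(1,3,4))
  have "- x \<in> J" if "x \<in> J" for x
  proof -
    have "x \<in> A" using that assms(2) by auto
    have "- 1 \<in> A" using uminus[of 1] one_closed a_inv_closed by (metis ring_on_simps(1,5))
    then show ?thesis using assms(5)[of "-1" x] that by simp
  qed
  then have "subgroup J (add_monoid (ring_on A))"
    using assms(2-4) uminus
    by (intro add.subgroupI) (auto simp flip: a_inv_def)
  then show ?thesis
    using assms(5) by (intro idealI ring_axioms) (simp, simp, metis mult.commute ring_on_simps(1,2))
qed

lemma ideal_ring_onD:
  assumes "ideal J (ring_on A)"
  shows "J \<subseteq> A" "0 \<in> J" "x \<in> J \<Longrightarrow> y \<in> J \<Longrightarrow> x + y \<in> J" "r \<in> A \<Longrightarrow> x \<in> J \<Longrightarrow> r * x \<in> J"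
    "r \<in> A \<Longrightarrow> x \<in> J \<Longrightarrow> x * r \<in> J"
proof -
  interpret ideal J "ring_on A" by fact
  show "J \<subseteq> A" using a_subset by auto
  show "0 \<in> J" using additive_subgroup.zero_closed[OF ideal.axioms(1)[OF assms]] by simp
  show "x \<in> J \<Longrightarrow> y \<in> J \<Longrightarrow> x + y \<in> J"
    using additive_subgroup.a_closed[OF ideal.axioms(1)[OF assms]] by simp
  show "r \<in> A \<Longrightarrow> x \<in> J \<Longrightarrow> r * x \<in> J" using I_l_closed by auto
  show "r \<in> A \<Longrightarrow> x \<in> J \<Longrightarrow> x * r \<in> J" using I_r_closed by auto
qed

text \<open>A numerical semigroup \<open>H\<close> with Frobenius number \<open>F\<close> (which is \<open>-1\<close> for \<open>H = \<nat>\<close>).\<close>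

locale numerical_semigroup =
  fixes H :: "int set" and F :: int
  assumes zero_in: "0 \<in> H" and nonneg: "h \<in> H \<Longrightarrow> 0 \<le> h"
    and add_in: "h \<in> H \<Longrightarrow> h' \<in> H \<Longrightarrow> h + h' \<in> H"
    and F_notin: "F \<notin> H" and above_F: "F < n \<Longrightarrow> n \<in> H"
begin

abbreviation A :: "'k::field fls set" where "A \<equiv> series_on H"
abbreviation R :: "'k::field fls ring" where "R \<equiv> ring_on A"
abbreviation \<mm> :: "'k::field fls set" where "\<mm> \<equiv> series_on (H - {0})"

lemma F_ge: "-1 \<le> F"
  using above_F[of "-1"] nonneg[of "-1"] by force

lemma mult_in: "n * h \<in> H" if "h \<in> H" "0 \<le> n" for n :: int
  using that(2) by (induction n rule: int_ge_induct) (auto simp: zero_in that add_in algebra_simps)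

lemma tail_A: "series_on {F + 1..} \<subseteq> A"
  by (rule series_on_mono) (auto intro: above_F)

lemma one_A [simp]: "1 \<in> A" 
  using fls_mono_in_series_on[of 0 H] zero_in by simp

lemma const_A [simp]: "fls_const c \<in> A"
  by (rule const_in_series_on) (rule zero_in)

lemma mult_A: "x \<in> A \<Longrightarrow> y \<in> A \<Longrightarrow> x * y \<in> A"
  by (erule series_on_mult) (auto intro: add_in)

lemma cring_R: "cring R"
  by (rule cring_ring_on) (auto intro: series_on_add mult_A series_on_uminus)

lemma A_subdegree: "x \<in> A \<Longrightarrow> 0 \<le> fls_subdegree x"
  by (cases "x = 0") (auto dest!: subdegree_in_series_on nonneg)

lemma A_series_nat: "A \<subseteq> series_on {0..}"
  by (rule series_on_mono) (auto intro: nonneg)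

text \<open>A nonzero constant term makes a series a unit of \<open>A\<close>; this is why
  \<open>A\<close> is local with maximal ideal \<mm>.\<close>

lemma inverse_A: "f \<in> A \<Longrightarrow> f $$ 0 \<noteq> 0 \<Longrightarrow> inverse f \<in> A"
  by (rule inverse_mem_ring[OF ksubspace_series_on mult_A tail_A one_A]) (use A_series_nat in auto)

lemma mm_iff: "x \<in> \<mm> \<longleftrightarrow> x \<in> A \<and> x $$ 0 = 0"
  by (auto simp: series_on_def)

lemma mm_subset_A: "\<mm> \<subseteq> A"
  by (auto simp: mm_iff)

lemma A_mm: "r \<in> A \<Longrightarrow> x \<in> \<mm> \<Longrightarrow> r * x \<in> \<mm>"
proof (erule series_on_mult)
  fix i j assume "i \<in> H" "j \<in> H - {0}"
  then show "i + j \<in> H - {0}" using add_in nonneg[of i] nonneg[of j] by auto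
qed

lemma ideal_mm: "ideal \<mm> R"
  by (rule ideal_ring_onI[OF cring_R]) (auto intro: series_on_add A_mm subsetD[OF mm_subset_A])

lemma proper_ideal_subset_mm:
  assumes J: "ideal J R" and "J \<noteq> A"
  shows "J \<subseteq> \<mm>"
proof
  fix x assume x: "x \<in> J"
  note JD = ideal_ring_onD[OF J]
  have xA: "x \<in> A" using JD(1) x by auto
  have "x $$ 0 = 0"
  proof (rule ccontr)
    assume n: "x $$ 0 \<noteq> 0"
    then have "inverse x * x \<in> J" using JD(4)[OF inverse_A[OF xA n] x] by simp
    moreover have "x \<noteq> 0" using n by auto
    ultimately have "1 \<in> J" by simp
    then have "A \<subseteq> J" using JD(4)[of _ 1] by auto
    then show False using JD(1) assms(2) by auto
  qed
  then show "x \<in> \<mm>" using xA by (simp add: mm_iff)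
qed

lemma one_notin_mm: "1 \<notin> \<mm>"
  by (simp add: mm_iff)

lemma maximalideal_mm: "maximalideal \<mm> (R :: 'k::field fls ring)"
proof (rule maximalidealI[OF ideal_mm])
  show "carrier R \<noteq> \<mm>" using one_notin_mm one_A by auto
next
  fix J :: "'k fls set" assume J: "ideal J R" "\<mm> \<subseteq> J" "J \<subseteq> carrier R"
  show "J = \<mm> \<or> J = carrier R"
  proof (cases "J = A")
    case False
    then show ?thesis using proper_ideal_subset_mm[OF J(1)] J(2) by blast
  qed simp
qed

lemma max_ideal_R: "max_ideal R = (\<mm> :: 'k::field fls set)"
  unfolding max_ideal_def
proof (rule the_equality, rule maximalideal_mm)
  fix m :: "'k fls set" assume m: "maximalideal m R"
  interpret m: maximalideal m R by fact
  have "m \<noteq> A" using m.I_notcarr by simp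
  then have "m \<subseteq> \<mm>" using proper_ideal_subset_mm m.is_ideal by blast
  moreover have "\<mm> \<subseteq> carrier (R :: 'k fls ring)" by (simp add: mm_subset_A)
  ultimately have "\<mm> = m \<or> \<mm> = carrier (R :: 'k fls ring)" by (rule m.I_maximal[OF ideal_mm])
  moreover have "\<mm> \<noteq> carrier (R :: 'k fls ring)"
    using one_notin_mm one_A by (metis ring_on_simps(1))
  ultimately show "m = \<mm>" by simp
qed

section \<open>Prime ideals and Krull dimension\<close>

lemma power_in_ideal:
  assumes x: "x \<in> \<mm>" and J: "ideal J R" and y: "y \<in> J" "y \<noteq> 0"
  shows "\<exists>n. x ^ n \<in> J"
proof (cases "x = 0")
  case True
  then show ?thesis using ideal_ring_onD(2)[OF J] by (intro exI[of _ 1]) simp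
next
  case False
  have "fls_subdegree x \<in> H - {0}" using subdegree_in_series_on[OF x False] .
  then have d: "fls_subdegree x \<ge> 1" using nonneg by force
  \<comment> \<open>Since x has order at least 1, this exponent keeps the order of
    \<open>x ^ n / y\<close> above F, so that the quotient is in \<open>A\<close> and
    \<open>x ^ n\<close> is a multiple of y.\<close>
  define n where "n = nat (F + 1 + fls_subdegree y)"
  have yA: "y \<in> A" using y ideal_ring_onD(1)[OF J] by auto
  have "fls_subdegree (x ^ n / y) = int n * fls_subdegree x - fls_subdegree y"
    using False y by (simp add: fls_divide_subdegree fls_subdegree_pow)
  also have "\<dots> \<ge> F + 1"
  proof -
    have "int n * fls_subdegree x \<ge> int n * 1" using d by (intro mult_left_mono) auto
    then show ?thesis unfolding n_def using A_subdegree[OF yA] F_ge by auto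
  qed
  finally have "x ^ n / y \<in> series_on {F + 1..}" by (simp add: series_on_atLeast_iff)
  then have "x ^ n / y \<in> A" using tail_A by blast
  then have "x ^ n / y * y \<in> J" using ideal_ring_onD(4)[OF J] y by blast
  then show ?thesis using y by auto
qed

text \<open>By \<open>power_in_ideal\<close> a nonzero prime contains a power of every element of
  \<mm>. The spectrum is therefore {0} and \<mm>, and all dimensions follow.\<close>

lemma primeideal_R:
  assumes "primeideal p R" "y \<in> p" "y \<noteq> 0"
  shows "p = \<mm>"
proof -
  interpret p: primeideal p R by fact
  have "p \<subseteq> \<mm>" using proper_ideal_subset_mm[OF p.is_ideal] p.I_notcarr by auto
  moreover have "x \<in> p" if x: "x \<in> \<mm>" for x
  proof -
    obtain n where n: "x ^ n \<in> p" using power_in_ideal[OF x p.is_ideal assms(2,3)] by blast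
    then show ?thesis
    proof (induction n)
      case 0
      then show ?case using \<open>p \<subseteq> \<mm>\<close> one_notin_mm by auto
    next
      case (Suc n)
      have "x \<in> A" using x mm_subset_A by blast
      moreover from this have "x ^ n \<in> A" by (induction n) (auto intro: mult_A)
      ultimately have "x \<in> p \<or> x ^ n \<in> p" using p.I_prime[of x "x ^ n"] Suc by auto
      then show ?case using Suc by auto
    qed
  qed
  ultimately show ?thesis by auto
qed

lemma primeideal_zero: "primeideal {0} (R :: 'k::field fls ring)"
proof (rule primeidealI)
  show "ideal {0} R" by (rule ideal_ring_onI[OF cring_R]) auto
  show "cring R" by (rule cring_R)
  have "(1 :: 'k fls) \<noteq> 0" by simp
  then show "carrier R \<noteq> {0 :: 'k fls}" using one_A by (metis ring_on_simps(1) singletonD)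
qed auto

lemma primeideal_mm: "primeideal \<mm> R"
  using cring.maximalideal_prime[OF cring_R maximalideal_mm] .

text \<open>The exponent F + 2 works uniformly: if H is all of the nonnegative integers, then F = -1
  and the monomial of exponent F + 1 is the unit 1.\<close>

lemma mm_nonzero: "fls_mono (F + 2) \<in> \<mm>"
  using F_ge above_F[of "F + 2"] by simp

lemma dim_above_le:
  assumes "\<And>p n. \<forall>i\<le>n. primeideal (p i) R' \<and> J \<subseteq> p i \<Longrightarrow> \<forall>i<n. p i \<subset> p (Suc i) \<Longrightarrow> n \<le> d"
  shows "dim_above R' J \<le> enat d"
  unfolding dim_above_def
proof (rule Sup_least)
  fix x assume "x \<in> {enat n | n. \<exists>p :: nat \<Rightarrow> 'a set.
     (\<forall>i\<le>n. primeideal (p i) R' \<and> J \<subseteq> p i) \<and> (\<forall>i<n. p i \<subset> p (Suc i))}"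
  then obtain n p where "x = enat n"
    and "\<forall>i\<le>n. primeideal (p i) R' \<and> J \<subseteq> p i" "\<forall>i<n. p i \<subset> p (Suc i)" by blast
  then show "x \<le> enat d" using assms[of n p] by simp
qed

lemma dim_above_ge:
  assumes "\<forall>i\<le>n. primeideal (p i) R' \<and> J \<subseteq> p i" "\<forall>i<n. p i \<subset> p (Suc i)"
  shows "enat n \<le> dim_above R' J"
  unfolding dim_above_def using assms by (intro Sup_upper) blast

text \<open>Applied to the annihilator of the cokernel of A \<rightarrow> \<omega>: that module has
  dimension 0, so its multiplicity is a plain limit of lengths.\<close>

lemma dim_above_nonzero:
  fixes J :: "'k::field fls set"
  assumes y: "y \<in> J" "y \<noteq> 0"
  shows "dim_above R J = 0"
proof -
  have "n \<le> 0" if p: "\<forall>i\<le>n. primeideal (p i) R \<and> J \<subseteq> p i" "\<forall>i<n. p i \<subset> p (Suc i)" for n and p :: "nat \<Rightarrow> 'k fls set"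
  proof (rule ccontr)
    assume n: "\<not> n \<le> 0"
    then have "primeideal (p 0) R" "y \<in> p 0" "primeideal (p 1) R" "y \<in> p 1"
      using p(1)[rule_format, of 0] p(1)[rule_format, of 1] y(1) by auto
    then have "p 0 = \<mm>" "p 1 = \<mm>" using primeideal_R y(2) by blast+
    moreover have "p 0 \<subset> p 1" using p(2)[rule_format, of 0] n by simp
    ultimately show False by simp
  qed
  then have "dim_above R J \<le> enat 0" by (rule dim_above_le)
  then show ?thesis by (simp add: enat_0)
qed

lemma krull_dim_R: "krull_dim (R :: 'k::field fls ring) = 1"
proof -
  have "n \<le> 1" if p: "\<forall>i\<le>n. primeideal (p i) R \<and> {0} \<subseteq> p i" "\<forall>i<n. p i \<subset> p (Suc i)" for n and p :: "nat \<Rightarrow> 'k fls set"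
  proof (rule ccontr)
    assume n: "\<not> n \<le> 1"
    then have ps: "p 0 \<subset> p 1" "p 1 \<subset> p 2"
      using p(2)[rule_format, of 0] p(2)[rule_format, of 1] by (simp_all add: numeral_2_eq_2)
    have pr: "primeideal (p 1) R" "primeideal (p 2) R" "0 \<in> p 0"
      using n p(1)[rule_format, of 0] p(1)[rule_format, of 1] p(1)[rule_format, of 2] by simp_all
    obtain x where x: "x \<in> p 1" "x \<notin> p 0" using ps(1) by blast
    have "x \<in> p 2" using x ps(2) by blast
    moreover have "x \<noteq> 0" using pr(3) x(2) by blast
    ultimately have "p 1 = \<mm>" "p 2 = \<mm>"
      using primeideal_R[OF pr(1) x(1)] primeideal_R[OF pr(2)] by blast+
    then show False using ps by simp
  qed
  then have "dim_above R {0 :: 'k fls} \<le> enat 1" by (rule dim_above_le)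
  moreover have "enat 1 \<le> dim_above R {0 :: 'k fls}"
  proof (rule dim_above_ge)
    let ?p = "\<lambda>i::nat. if i = 0 then {0} else \<mm> :: 'k fls set"
    show "\<forall>i\<le>1. primeideal (?p i) R \<and> {0} \<subseteq> ?p i"
      by (simp add: primeideal_zero primeideal_mm)
    have "{0} \<noteq> (\<mm> :: 'k fls set)" using mm_nonzero fls_mono_nonzero by (metis singletonD)
    then show "\<forall>i<1. ?p i \<subset> ?p (Suc i)" by (simp add: psubset_eq)
  qed
  ultimately show ?thesis unfolding krull_dim_def by (simp add: one_enat_def)
qed

end

section \<open>Quotient modules and length\<close>

lemma a_r_coset_mem: "y \<in> N +>\<^bsub>M\<^esub> x \<longleftrightarrow> (\<exists>n\<in>N. y = n \<oplus>\<^bsub>M\<^esub> x)"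
  by (auto simp: a_r_coset_def')

locale submodule_quotient = module R M for R :: "('r, 'm) ring_scheme" and M :: "('r, 'b, 'n) module_scheme" (structure) +
  fixes N assumes N: "submodule N R M"
begin

lemma NE: "N \<subseteq> carrier M" "\<zero>\<^bsub>M\<^esub> \<in> N" "x \<in> N \<Longrightarrow> y \<in> N \<Longrightarrow> x \<oplus>\<^bsub>M\<^esub> y \<in> N"
  "x \<in> N \<Longrightarrow> \<ominus>\<^bsub>M\<^esub> x \<in> N" "a \<in> carrier R \<Longrightarrow> x \<in> N \<Longrightarrow> a \<odot>\<^bsub>M\<^esub> x \<in> N"
  using submoduleE[OF N] subgroup.one_closed[OF submodule.axioms(1)[OF N]] by auto

lemma N_subgroup: "abelian_subgroup N M"
  by (rule abelian_subgroupI3)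
    (use submodule.axioms(1)[OF N] in \<open>auto simp: additive_subgroup_def M.abelian_group_axioms\<close>)

lemma coset_eq_iff:
  assumes "x \<in> carrier M" "y \<in> carrier M"
  shows "N +>\<^bsub>M\<^esub> x = N +>\<^bsub>M\<^esub> y \<longleftrightarrow> x \<ominus>\<^bsub>M\<^esub> y \<in> N"
proof
  assume eq: "N +>\<^bsub>M\<^esub> x = N +>\<^bsub>M\<^esub> y"
  have "x \<in> N +>\<^bsub>M\<^esub> x" using NE(2) assms by (auto simp: a_r_coset_mem intro!: bexI[of _ "\<zero>\<^bsub>M\<^esub>"])
  then obtain n where n: "n \<in> N" "x = n \<oplus>\<^bsub>M\<^esub> y" unfolding eq by (auto simp: a_r_coset_mem)
  then have "x \<ominus>\<^bsub>M\<^esub> y = n"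
    using NE(1) assms by (auto simp: a_minus_def a_assoc M.r_neg)
  then show "x \<ominus>\<^bsub>M\<^esub> y \<in> N" using n by simp
next
  have sub: "N +>\<^bsub>M\<^esub> x \<subseteq> N +>\<^bsub>M\<^esub> y" if xy: "x \<ominus>\<^bsub>M\<^esub> y \<in> N" "x \<in> carrier M" "y \<in> carrier M" for x y
  proof
    fix z assume "z \<in> N +>\<^bsub>M\<^esub> x"
    then obtain n where n: "n \<in> N" "z = n \<oplus>\<^bsub>M\<^esub> x" by (auto simp: a_r_coset_mem)
    have "n \<oplus>\<^bsub>M\<^esub> (x \<ominus>\<^bsub>M\<^esub> y) \<in> N" using n xy NE by blast
    moreover have "z = n \<oplus>\<^bsub>M\<^esub> (x \<ominus>\<^bsub>M\<^esub> y) \<oplus>\<^bsub>M\<^esub> y"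
      using n xy NE(1) by (auto simp: a_minus_def a_assoc M.l_neg subset_iff)
    ultimately show "z \<in> N +>\<^bsub>M\<^esub> y" by (auto simp: a_r_coset_mem)
  qed
  assume xy: "x \<ominus>\<^bsub>M\<^esub> y \<in> N"
  have "\<ominus>\<^bsub>M\<^esub> (x \<ominus>\<^bsub>M\<^esub> y) = y \<ominus>\<^bsub>M\<^esub> x"
    using assms by (simp add: a_minus_def M.minus_add M.a_comm)
  then have "y \<ominus>\<^bsub>M\<^esub> x \<in> N" using NE(4)[OF xy] by simp
  then show "N +>\<^bsub>M\<^esub> x = N +>\<^bsub>M\<^esub> y" using sub[OF xy] sub[of y x] assms by auto
qed

lemma coset_self: "x \<in> carrier M \<Longrightarrow> x \<in> N +>\<^bsub>M\<^esub> x"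
  using NE(2) by (auto simp: a_r_coset_mem intro!: bexI[of _ "\<zero>\<^bsub>M\<^esub>"])

lemma coset_zero: "N +>\<^bsub>M\<^esub> \<zero>\<^bsub>M\<^esub> = N"
  using NE(1) by (force simp: a_r_coset_mem)

lemma coset_eq_N_iff: "x \<in> carrier M \<Longrightarrow> N +>\<^bsub>M\<^esub> x = N \<longleftrightarrow> x \<in> N"
  using coset_eq_iff[of x "\<zero>\<^bsub>M\<^esub>"] coset_zero
  by (simp add: a_minus_def M.minus_equality[OF M.l_zero[OF M.zero_closed]])

lemma coset_eq_of_mem: "x \<in> carrier M \<Longrightarrow> y \<in> N +>\<^bsub>M\<^esub> x \<Longrightarrow> N +>\<^bsub>M\<^esub> y = N +>\<^bsub>M\<^esub> x"
proof -
  assume x: "x \<in> carrier M" and "y \<in> N +>\<^bsub>M\<^esub> x"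
  then obtain n where n: "n \<in> N" "y = n \<oplus>\<^bsub>M\<^esub> x" by (auto simp: a_r_coset_mem)
  then have "y \<ominus>\<^bsub>M\<^esub> x = n" "y \<in> carrier M" using NE(1) x by (auto simp: a_minus_def a_assoc M.r_neg)
  then show ?thesis using coset_eq_iff[of y x] n x by simp
qed

lemma quotient_simps [simp]:
  "carrier (quotient_module M N) = (\<lambda>x. N +>\<^bsub>M\<^esub> x) ` carrier M"
  "\<zero>\<^bsub>quotient_module M N\<^esub> = N"
  by (auto simp: quotient_module_def A_RCOSETS_def')

lemma quotient_add [simp]:
  "x \<in> carrier M \<Longrightarrow> y \<in> carrier M \<Longrightarrow>
    (N +>\<^bsub>M\<^esub> x) \<oplus>\<^bsub>quotient_module M N\<^esub> (N +>\<^bsub>M\<^esub> y) = N +>\<^bsub>M\<^esub> (x \<oplus>\<^bsub>M\<^esub> y)"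
  by (simp add: quotient_module_def abelian_subgroup.a_rcos_sum[OF N_subgroup])

text \<open>The union in \<open>quotient_module\<close> runs over all representatives of the coset;
  they all yield the same coset and there is at least one, so the union collapses.\<close>

lemma quotient_smult [simp]:
  assumes "a \<in> carrier R" "x \<in> carrier M"
  shows "a \<odot>\<^bsub>quotient_module M N\<^esub> (N +>\<^bsub>M\<^esub> x) = N +>\<^bsub>M\<^esub> (a \<odot>\<^bsub>M\<^esub> x)"
proof -
  have "N +>\<^bsub>M\<^esub> (a \<odot>\<^bsub>M\<^esub> y) = N +>\<^bsub>M\<^esub> (a \<odot>\<^bsub>M\<^esub> x)" if y: "y \<in> N +>\<^bsub>M\<^esub> x" for y
  proof -
    obtain n where n: "n \<in> N" "y = n \<oplus>\<^bsub>M\<^esub> x" using y by (auto simp: a_r_coset_mem)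
    then have "a \<odot>\<^bsub>M\<^esub> y = a \<odot>\<^bsub>M\<^esub> n \<oplus>\<^bsub>M\<^esub> a \<odot>\<^bsub>M\<^esub> x" using assms NE(1) smult_r_distr by auto
    then show ?thesis using coset_eq_of_mem[of "a \<odot>\<^bsub>M\<^esub> x" "a \<odot>\<^bsub>M\<^esub> y"] assms NE(5)[OF assms(1) n(1)]
      by (auto simp: a_r_coset_mem)
  qed
  moreover have "N +>\<^bsub>M\<^esub> x \<noteq> {}" using coset_self[OF assms(2)] by blast
  ultimately have "(\<Union>y\<in>N +>\<^bsub>M\<^esub> x. N +>\<^bsub>M\<^esub> (a \<odot>\<^bsub>M\<^esub> y)) = N +>\<^bsub>M\<^esub> (a \<odot>\<^bsub>M\<^esub> x)"
    by (intro SUP_eq_const)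
  then show ?thesis by (simp add: quotient_module_def)
qed

lemma quotient_is_module: "module R (quotient_module M N)"
proof (rule moduleI)
  show "cring R" by (rule is_cring)
  show "abelian_group (quotient_module M N)"
  proof (rule abelian_groupI)
    fix x assume "x \<in> carrier (quotient_module M N)"
    then obtain y where y: "y \<in> carrier M" "x = N +>\<^bsub>M\<^esub> y" by auto
    show "\<exists>y\<in>carrier (quotient_module M N). y \<oplus>\<^bsub>quotient_module M N\<^esub> x = \<zero>\<^bsub>quotient_module M N\<^esub>"
      by (rule bexI[of _ "N +>\<^bsub>M\<^esub> (\<ominus>\<^bsub>M\<^esub> y)"]) (use y in \<open>auto simp: M.l_neg coset_zero\<close>)
    show "\<zero>\<^bsub>quotient_module M N\<^esub> \<oplus>\<^bsub>quotient_module M N\<^esub> x = x"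
      using y quotient_add[of "\<zero>\<^bsub>M\<^esub>" y] by (simp add: coset_zero)
  next
    show "\<zero>\<^bsub>quotient_module M N\<^esub> \<in> carrier (quotient_module M N)"
      using coset_zero by (auto intro!: image_eqI[of _ _ "\<zero>\<^bsub>M\<^esub>"])
  qed (auto simp: M.a_ac intro!: imageI)
qed (auto simp: smult_l_distr smult_r_distr smult_assoc1)

lemma quotient_finsum:
  "f \<in> Z \<rightarrow> carrier M \<Longrightarrow>
    (\<Oplus>\<^bsub>quotient_module M N\<^esub>i\<in>Z. N +>\<^bsub>M\<^esub> f i) = N +>\<^bsub>M\<^esub> (\<Oplus>\<^bsub>M\<^esub>i\<in>Z. f i)"
proof -
  interpret Q: module R "quotient_module M N" by (rule quotient_is_module)
  show "f \<in> Z \<rightarrow> carrier M \<Longrightarrow> ?thesis"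
  proof (induction Z rule: infinite_finite_induct)
    case (infinite Z)
    then show ?case by (simp add: Q.finsum_infinite M.finsum_infinite coset_zero)
  next
    case empty
    then show ?case by (simp add: coset_zero)
  next
    case (insert z Z)
    then have "f \<in> Z \<rightarrow> carrier M" "f z \<in> carrier M" by auto
    moreover from this have "(\<lambda>i. N +>\<^bsub>M\<^esub> f i) \<in> Z \<rightarrow> carrier (quotient_module M N)" by auto
    ultimately show ?case using insert by (simp add: Q.finsum_insert M.finsum_insert)
  qed
qed

end

text \<open>The length of M/N measured inside M. It allows lengths to be computed among sets of
  Laurent series, where orders can be compared, without passing to cosets.\<close>

definition length_above :: "('r, 'm) ring_scheme \<Rightarrow> ('r, 'b, 'n) module_scheme \<Rightarrow> 'b set \<Rightarrow> enat" where
  "length_above R M N = Sup {enat n | n. \<exists>L :: nat \<Rightarrow> 'b set.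
     (\<forall>i\<le>n. submodule (L i) R M \<and> N \<subseteq> L i) \<and> (\<forall>i<n. L i \<subset> L (Suc i))}"

lemma length_above_le:
  fixes M :: "('r, 'b, 'n) module_scheme"
  assumes "\<And>L n. \<forall>i\<le>n. submodule (L i) R M \<and> N \<subseteq> L i \<Longrightarrow> \<forall>i<n. L i \<subset> L (Suc i) \<Longrightarrow> n \<le> d"
  shows "length_above R M N \<le> enat d"
  unfolding length_above_def
proof (rule Sup_least)
  fix x assume "x \<in> {enat n | n. \<exists>L :: nat \<Rightarrow> 'b set.
     (\<forall>i\<le>n. submodule (L i) R M \<and> N \<subseteq> L i) \<and> (\<forall>i<n. L i \<subset> L (Suc i))}"
  then obtain n L where "x = enat n"
    and "\<forall>i\<le>n. submodule (L i) R M \<and> N \<subseteq> L i" "\<forall>i<n. L i \<subset> L (Suc i)" by blast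
  then show "x \<le> enat d" using assms[of n L] by simp
qed

lemma length_above_ge:
  assumes "\<forall>i\<le>n. submodule (L i) R M \<and> N \<subseteq> L i" "\<forall>i<n. L i \<subset> L (Suc i)"
  shows "enat n \<le> length_above R M N"
  unfolding length_above_def using assms by (intro Sup_upper) blast

lemma module_length_ge:
  assumes "\<forall>i\<le>n. submodule (L i) R M" "\<forall>i<n. L i \<subset> L (Suc i)"
  shows "enat n \<le> module_length R M"
  unfolding module_length_def using assms by (intro Sup_upper) blast

lemma module_hom_zero:
  assumes "module R M" "module R Q" "\<pi> \<in> module_hom R M Q"
  shows "\<pi> \<zero>\<^bsub>M\<^esub> = \<zero>\<^bsub>Q\<^esub>"
proof -
  interpret M: module R M by fact
  interpret Q: module R Q by fact
  have "\<pi> (\<zero>\<^bsub>R\<^esub> \<odot>\<^bsub>M\<^esub> \<zero>\<^bsub>M\<^esub>) = \<zero>\<^bsub>R\<^esub> \<odot>\<^bsub>Q\<^esub> \<pi> \<zero>\<^bsub>M\<^esub>"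
    using assms(3) M.R.zero_closed M.M.zero_closed unfolding module_hom_def by blast
  moreover have "\<pi> \<zero>\<^bsub>M\<^esub> \<in> carrier Q" using assms(3) by (auto simp: module_hom_def)
  ultimately show ?thesis by simp
qed

lemma module_hom_minus:
  assumes "module R M" "module R Q" "\<pi> \<in> module_hom R M Q" "x \<in> carrier M"
  shows "\<pi> (\<ominus>\<^bsub>M\<^esub> x) = \<ominus>\<^bsub>Q\<^esub> \<pi> x"
proof -
  interpret M: module R M by fact
  interpret Q: module R Q by fact
  have "\<pi> (\<ominus>\<^bsub>M\<^esub> x \<oplus>\<^bsub>M\<^esub> x) = \<pi> (\<ominus>\<^bsub>M\<^esub> x) \<oplus>\<^bsub>Q\<^esub> \<pi> x"
    using assms(3,4) M.M.a_inv_closed[OF assms(4)] unfolding module_hom_def by blast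
  moreover have "\<pi> (\<ominus>\<^bsub>M\<^esub> x) \<in> carrier Q" "\<pi> x \<in> carrier Q"
    using assms(3,4) M.M.a_inv_closed[OF assms(4)] by (auto simp: module_hom_def)
  ultimately show ?thesis using module_hom_zero[OF assms(1-3)] assms(4)
    by (metis M.M.l_neg Q.M.minus_equality)
qed

lemma (in module) submoduleI':
  assumes "N \<subseteq> carrier M" "\<zero>\<^bsub>M\<^esub> \<in> N" "\<And>x y. x \<in> N \<Longrightarrow> y \<in> N \<Longrightarrow> x \<oplus>\<^bsub>M\<^esub> y \<in> N"
    "\<And>r x. r \<in> carrier R \<Longrightarrow> x \<in> N \<Longrightarrow> r \<odot>\<^bsub>M\<^esub> x \<in> N"
  shows "submodule N R M"
proof (rule submoduleI)
  fix x assume x: "x \<in> N"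
  then have "\<ominus>\<^bsub>M\<^esub> x = (\<ominus> \<one>) \<odot>\<^bsub>M\<^esub> x"
    using smult_l_minus[of \<one> x] assms(1) by auto
  then show "\<ominus>\<^bsub>M\<^esub> x \<in> N" using assms(4)[OF _ x, of "\<ominus> \<one>"] by simp
qed (use assms in auto)

lemma module_homD:
  assumes "\<pi> \<in> module_hom R M Q"
  shows "x \<in> carrier M \<Longrightarrow> \<pi> x \<in> carrier Q"
    "x \<in> carrier M \<Longrightarrow> y \<in> carrier M \<Longrightarrow> \<pi> (x \<oplus>\<^bsub>M\<^esub> y) = \<pi> x \<oplus>\<^bsub>Q\<^esub> \<pi> y"
    "r \<in> carrier R \<Longrightarrow> x \<in> carrier M \<Longrightarrow> \<pi> (r \<odot>\<^bsub>M\<^esub> x) = r \<odot>\<^bsub>Q\<^esub> \<pi> x"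
  using assms unfolding module_hom_def by auto

lemma submodule_zero: "module R M \<Longrightarrow> submodule N R M \<Longrightarrow> \<zero>\<^bsub>M\<^esub> \<in> N"
  using subgroup.one_closed[OF submodule.axioms(1)] by fastforce

lemma submodule_preimage:
  assumes M: "module R M" and Q: "module R Q" and \<pi>: "\<pi> \<in> module_hom R M Q" and P: "submodule P R Q"
  shows "submodule {x \<in> carrier M. \<pi> x \<in> P} R M"
proof -
  interpret M: module R M by fact
  interpret Q: module R Q by fact
  note hom = module_homD[OF \<pi>]
  note PE = Q.submoduleE[OF P]
  show ?thesis
  proof (rule M.submoduleI')
    show "\<zero>\<^bsub>M\<^esub> \<in> {x \<in> carrier M. \<pi> x \<in> P}"
      using module_hom_zero[OF M Q \<pi>] submodule_zero[OF Q P] by simp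
    fix a assume a: "a \<in> {x \<in> carrier M. \<pi> x \<in> P}"
    show "a \<oplus>\<^bsub>M\<^esub> b \<in> {x \<in> carrier M. \<pi> x \<in> P}" if "b \<in> {x \<in> carrier M. \<pi> x \<in> P}" for b
      using a that hom(2)[of a b] PE(5) by simp
    show "r \<odot>\<^bsub>M\<^esub> a \<in> {x \<in> carrier M. \<pi> x \<in> P}" if "r \<in> carrier R" for r
      using a that hom(3)[of r a] PE(4) by simp
  qed auto
qed

lemma submodule_image:
  assumes M: "module R M" and Q: "module R Q" and \<pi>: "\<pi> \<in> module_hom R M Q" and L: "submodule L R M"
  shows "submodule (\<pi> ` L) R Q"
proof -
  interpret M: module R M by fact
  interpret Q: module R Q by fact
  note hom = module_homD[OF \<pi>]
  note LE = M.submoduleE[OF L]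
  note sub = subsetD[OF LE(1)]
  show ?thesis
  proof (rule Q.submoduleI')
    show "\<pi> ` L \<subseteq> carrier Q" using sub hom(1) by auto
    show "\<zero>\<^bsub>Q\<^esub> \<in> \<pi> ` L"
      using module_hom_zero[OF M Q \<pi>] submodule_zero[OF M L] by (metis imageI)
    fix a assume "a \<in> \<pi> ` L"
    then obtain x where x: "x \<in> L" "a = \<pi> x" by blast
    show "a \<oplus>\<^bsub>Q\<^esub> b \<in> \<pi> ` L" if b: "b \<in> \<pi> ` L" for b
    proof -
      obtain y where y: "y \<in> L" "b = \<pi> y" using b by blast
      have "a \<oplus>\<^bsub>Q\<^esub> b = \<pi> (x \<oplus>\<^bsub>M\<^esub> y)" using hom(2)[OF sub sub] x y by simp
      then show ?thesis using LE(5)[OF x(1) y(1)] by blast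
    qed
    show "r \<odot>\<^bsub>Q\<^esub> a \<in> \<pi> ` L" if r: "r \<in> carrier R" for r
    proof -
      have "r \<odot>\<^bsub>Q\<^esub> a = \<pi> (r \<odot>\<^bsub>M\<^esub> x)" using hom(3)[OF r sub] x by simp
      then show ?thesis using LE(4)[OF r x(1)] by blast
    qed
  qed
qed

text \<open>The correspondence theorem. Preimages of a strict chain stay strict by surjectivity.
  Images of a strict chain above the kernel stay strict, because two elements with the same image
  differ by an element of the kernel, which every member of the chain contains.\<close>

lemma module_length_surjection:
  fixes R :: "('r, 'm) ring_scheme" and M :: "('r, 'c, 'n) module_scheme"
    and Q :: "('r, 'd, 'p) module_scheme"
  assumes M: "module R M" and Q: "module R Q" and \<pi>: "\<pi> \<in> module_hom R M Q"
    and surj: "\<pi> ` carrier M = carrier Q"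
  shows "module_length R Q = length_above R M {x \<in> carrier M. \<pi> x = \<zero>\<^bsub>Q\<^esub>}"
proof -
  interpret M: module R M by fact
  interpret Q: module R Q by fact
  have hom: "\<pi> (x \<oplus>\<^bsub>M\<^esub> y) = \<pi> x \<oplus>\<^bsub>Q\<^esub> \<pi> y" "\<pi> (r \<odot>\<^bsub>M\<^esub> x) = r \<odot>\<^bsub>Q\<^esub> \<pi> x" "\<pi> x \<in> carrier Q"
    if "x \<in> carrier M" "y \<in> carrier M" "r \<in> carrier R" for x y r
    using \<pi> that unfolding module_hom_def by blast+
  let ?N = "{x \<in> carrier M. \<pi> x = \<zero>\<^bsub>Q\<^esub>}"
  have minus: "\<pi> (\<ominus>\<^bsub>M\<^esub> x) = \<ominus>\<^bsub>Q\<^esub> \<pi> x" if "x \<in> carrier M" for x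
    using module_hom_minus[OF M Q \<pi> that] .
  note pre = submodule_preimage[OF M Q \<pi>]
  note img = submodule_image[OF M Q \<pi>]
  show ?thesis
  proof (rule antisym)
    show "module_length R Q \<le> length_above R M ?N"
      unfolding module_length_def
    proof (rule Sup_least)
      fix z assume "z \<in> {enat n | n. \<exists>N :: nat \<Rightarrow> 'd set.
        (\<forall>i\<le>n. submodule (N i) R Q) \<and> (\<forall>i<n. N i \<subset> N (Suc i))}"
      then obtain n P where z: "z = enat n" and P: "\<forall>i\<le>n. submodule (P i) R Q" "\<forall>i<n. P i \<subset> P (Suc i)"
        by blast
      define L where "L i = {x \<in> carrier M. \<pi> x \<in> P i}" for i
      have "submodule (L i) R M \<and> ?N \<subseteq> L i" if "i \<le> n" for i
      proof -
        have sub: "submodule (P i) R Q" using P(1) that by blast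
        have "\<zero>\<^bsub>Q\<^esub> \<in> P i" using subgroup.one_closed[OF submodule.axioms(1)[OF sub]] by simp
        then have "?N \<subseteq> L i" unfolding L_def by auto
        then show ?thesis using pre[OF sub] unfolding L_def by blast
      qed
      moreover have "L i \<subset> L (Suc i)" if "i < n" for i
      proof -
        have "P i \<subset> P (Suc i)" using P(2) that by blast
        then obtain y where y: "y \<in> P (Suc i)" "y \<notin> P i" by blast
        have "submodule (P (Suc i)) R Q" using P(1) that by simp
        then have "y \<in> carrier Q" using y(1) Q.submoduleE(1) by blast
        then obtain x where "x \<in> carrier M" "y = \<pi> x" using surj by blast
        then show ?thesis using y \<open>P i \<subset> P (Suc i)\<close> unfolding L_def by blast
      qed
      ultimately show "z \<le> length_above R M ?N" unfolding z by (intro length_above_ge[of n L]) blast+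
    qed
  next
    show "length_above R M ?N \<le> module_length R Q"
      unfolding length_above_def
    proof (rule Sup_least)
      fix z assume "z \<in> {enat n | n. \<exists>L :: nat \<Rightarrow> 'c set.
        (\<forall>i\<le>n. submodule (L i) R M \<and> ?N \<subseteq> L i) \<and> (\<forall>i<n. L i \<subset> L (Suc i))}"
      then obtain n L where z: "z = enat n"
        and L: "\<forall>i\<le>n. submodule (L i) R M \<and> ?N \<subseteq> L i" "\<forall>i<n. L i \<subset> L (Suc i)"
        by blast
      have "\<pi> ` L i \<subset> \<pi> ` L (Suc i)" if i: "i < n" for i
      proof -
        have ss: "L i \<subset> L (Suc i)" and Li: "submodule (L i) R M" "?N \<subseteq> L i" and LS: "submodule (L (Suc i)) R M"
          using L i by auto
        obtain y where y: "y \<in> L (Suc i)" "y \<notin> L i" using ss by blast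
        have yM: "y \<in> carrier M" using y M.submoduleE(1)[OF LS] by blast
        have "\<pi> y \<notin> \<pi> ` L i"
        proof
          assume "\<pi> y \<in> \<pi> ` L i"
          then obtain x where x: "x \<in> L i" "\<pi> y = \<pi> x" by blast
          have xM: "x \<in> carrier M" using x M.submoduleE(1)[OF Li(1)] by blast
          have "\<pi> (y \<oplus>\<^bsub>M\<^esub> (\<ominus>\<^bsub>M\<^esub> x)) = \<pi> y \<oplus>\<^bsub>Q\<^esub> (\<ominus>\<^bsub>Q\<^esub> \<pi> x)"
            using hom(1)[OF yM M.M.a_inv_closed[OF xM] M.R.zero_closed] minus[OF xM] by simp
          also have "\<dots> = \<zero>\<^bsub>Q\<^esub>" using x(2) hom(3)[OF xM xM M.R.zero_closed] by (simp add: Q.M.r_neg)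
          finally have "y \<oplus>\<^bsub>M\<^esub> (\<ominus>\<^bsub>M\<^esub> x) \<in> L i" using Li(2) yM xM by auto
          then have "y \<oplus>\<^bsub>M\<^esub> (\<ominus>\<^bsub>M\<^esub> x) \<oplus>\<^bsub>M\<^esub> x \<in> L i" using M.submoduleE(5)[OF Li(1)] x by blast
          then show False using y(2) yM xM by (simp add: M.M.a_assoc M.M.l_neg)
        qed
        then show ?thesis using ss y by blast
      qed
      moreover have "submodule (\<pi> ` L i) R Q" if "i \<le> n" for i using img L(1) that by blast
      ultimately show "z \<le> module_length R Q" unfolding z
        using module_length_ge[of n "\<lambda>i. \<pi> ` L i"] by blast
    qed
  qed
qed

lemma (in submodule_quotient) module_length_quotient:
  "module_length R (quotient_module M N) = length_above R M N"
proof -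
  have "(\<lambda>x. N +>\<^bsub>M\<^esub> x) \<in> module_hom R M (quotient_module M N)"
    by (auto simp: module_hom_def)
  then have "module_length R (quotient_module M N) =
      length_above R M {x \<in> carrier M. N +>\<^bsub>M\<^esub> x = \<zero>\<^bsub>quotient_module M N\<^esub>}"
    by (intro module_length_surjection quotient_is_module module_axioms) auto
  also have "{x \<in> carrier M. N +>\<^bsub>M\<^esub> x = \<zero>\<^bsub>quotient_module M N\<^esub>} = N"
    using coset_eq_N_iff NE(1) by auto
  finally show ?thesis .
qed

lemma power_module_simps [simp]:
  "carrier (power_module M n) = {..<n} \<rightarrow>\<^sub>E carrier M"
  "\<zero>\<^bsub>power_module M n\<^esub> = (\<lambda>i\<in>{..<n}. \<zero>\<^bsub>M\<^esub>)"
  "f \<oplus>\<^bsub>power_module M n\<^esub> g = (\<lambda>i\<in>{..<n}. f i \<oplus>\<^bsub>M\<^esub> g i)"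
  "r \<odot>\<^bsub>power_module M n\<^esub> f = (\<lambda>i\<in>{..<n}. r \<odot>\<^bsub>M\<^esub> f i)"
  by (auto simp: power_module_def)

lemma power_module_is_module:
  assumes "module R M"
  shows "module R (power_module M n)"
proof -
  interpret module R M by fact
  show ?thesis
  proof (rule moduleI)
    show "cring R" by (rule is_cring)
    show "abelian_group (power_module M n)"
    proof (rule abelian_groupI)
      fix f assume f: "f \<in> carrier (power_module M n)"
      then show "\<exists>g\<in>carrier (power_module M n). g \<oplus>\<^bsub>power_module M n\<^esub> f = \<zero>\<^bsub>power_module M n\<^esub>"
        by (intro bexI[of _ "\<lambda>i\<in>{..<n}. \<ominus>\<^bsub>M\<^esub> f i"])
          (auto simp: PiE_iff M.l_neg intro!: restrict_ext)
      show "\<zero>\<^bsub>power_module M n\<^esub> \<oplus>\<^bsub>power_module M n\<^esub> f = f"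
        using f by (auto simp: PiE_iff extensional_def fun_eq_iff)
    qed (auto simp: PiE_iff M.a_ac intro!: restrict_ext)
  qed (auto simp: PiE_iff smult_l_distr smult_r_distr smult_assoc1 extensional_def fun_eq_iff
      intro!: restrict_ext)
qed

lemma self_module_simps [simp]:
  "carrier (self_module R) = carrier R" "\<zero>\<^bsub>self_module R\<^esub> = \<zero>\<^bsub>R\<^esub>"
  "x \<oplus>\<^bsub>self_module R\<^esub> y = x \<oplus>\<^bsub>R\<^esub> y" "x \<odot>\<^bsub>self_module R\<^esub> y = x \<otimes>\<^bsub>R\<^esub> y"
  by (auto simp: self_module_def)

lemma module_ring_onI:
  fixes M :: "('k::field fls, 'k fls, 'n) module_scheme"
  assumes R: "cring (ring_on A)" and z: "\<zero>\<^bsub>M\<^esub> = 0" and pl: "\<And>x y. x \<oplus>\<^bsub>M\<^esub> y = x + y"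
    and sm: "\<And>r x. r \<odot>\<^bsub>M\<^esub> x = r * x" and L: "carrier M = L" "0 \<in> L"
    and add: "\<And>x y. x \<in> L \<Longrightarrow> y \<in> L \<Longrightarrow> x + y \<in> L"
    and mult: "\<And>r x. r \<in> A \<Longrightarrow> x \<in> L \<Longrightarrow> r * x \<in> L" and m1: "- 1 \<in> A"
  shows "module (ring_on A) M"
proof (rule moduleI[OF R])
  show "abelian_group M"
  proof (rule abelian_groupI)
    fix x assume "x \<in> carrier M"
    then have "- x \<in> carrier M" using mult[OF m1, of x] L by simp
    then show "\<exists>y\<in>carrier M. y \<oplus>\<^bsub>M\<^esub> x = \<zero>\<^bsub>M\<^esub>" by (intro bexI[of _ "- x"]) (auto simp: pl z)
  qed (auto simp: z pl L add algebra_simps)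
qed (auto simp: z pl L sm mult algebra_simps)

section \<open>The residue field and its free resolutions\<close>

context numerical_semigroup begin

lemma minus_one_A: "- 1 \<in> A"
  by (rule series_on_uminus) simp

lemma self_module_R: "module R (self_module R)"
  by (rule module_ring_onI[OF cring_R]) (auto intro: series_on_add mult_A minus_one_A)

lemma submodule_iff_set:
  fixes M :: "('k::field fls, 'k fls, 'n) module_scheme"
  assumes M: "module R M" and z: "\<zero>\<^bsub>M\<^esub> = 0" and pl: "\<And>x y. x \<oplus>\<^bsub>M\<^esub> y = x + y"
    and sm: "\<And>r x. r \<odot>\<^bsub>M\<^esub> x = r * x"
  shows "submodule N R M \<longleftrightarrow> N \<subseteq> carrier M \<and> 0 \<in> N \<and> (\<forall>x\<in>N. \<forall>y\<in>N. x + y \<in> N) \<and> (\<forall>r\<in>A. \<forall>x\<in>N. r * x \<in> N)"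
proof
  interpret module R M by fact
  show "submodule N R M" if N: "N \<subseteq> carrier M \<and> 0 \<in> N \<and> (\<forall>x\<in>N. \<forall>y\<in>N. x + y \<in> N) \<and> (\<forall>r\<in>A. \<forall>x\<in>N. r * x \<in> N)"
  proof (rule submoduleI)
    fix a assume a: "a \<in> N"
    then have aM: "a \<in> carrier M" using N by blast
    have "- a \<in> N" using N a minus_one_A by (metis mult_minus1)
    moreover have "\<ominus>\<^bsub>M\<^esub> a = - a"
      using M.minus_equality[of "- a" a] aM calculation N by (auto simp: pl z)
    ultimately show "\<ominus>\<^bsub>M\<^esub> a \<in> N" by simp
  qed (use N in \<open>auto simp: z pl sm\<close>)
  assume N: "submodule N R M"
  have "\<zero>\<^bsub>M\<^esub> \<in> N" using subgroup.one_closed[OF submodule.axioms(1)[OF N]] by simp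
  then show "N \<subseteq> carrier M \<and> 0 \<in> N \<and> (\<forall>x\<in>N. \<forall>y\<in>N. x + y \<in> N) \<and> (\<forall>r\<in>A. \<forall>x\<in>N. r * x \<in> N)"
    using submoduleE[OF N] by (auto simp: z pl sm)
qed

lemmas submodule_self_iff = submodule_iff_set[OF self_module_R, simplified]

lemma submodule_mm: "submodule \<mm> R (self_module R)"
  unfolding submodule_self_iff using mm_subset_A by (auto intro: series_on_add A_mm)

lemma residue_quotient: "submodule_quotient R (self_module R) \<mm>"
  by (intro submodule_quotient.intro submodule_quotient_axioms.intro self_module_R submodule_mm)

lemma residue_field_R: "residue_field_module R = quotient_module (self_module R) \<mm>"
  by (simp add: residue_field_module_def max_ideal_R)

lemma residue_carrier: "carrier (residue_field_module R) = (\<lambda>x. \<mm> +>\<^bsub>self_module R\<^esub> x) ` A"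
  by (simp add: residue_field_R submodule_quotient.quotient_simps[OF residue_quotient])

lemma residue_zero: "\<zero>\<^bsub>residue_field_module R\<^esub> = \<mm>"
  by (simp add: residue_field_R submodule_quotient.quotient_simps[OF residue_quotient])

lemma residue_eq_zero_iff:
  "x \<in> A \<Longrightarrow> \<mm> +>\<^bsub>self_module R\<^esub> x = \<zero>\<^bsub>residue_field_module R\<^esub> \<longleftrightarrow> x \<in> \<mm>"
  using submodule_quotient.coset_eq_N_iff[OF residue_quotient, of x] by (simp add: residue_zero)

lemma residue_smult:
  "a \<in> A \<Longrightarrow> x \<in> A \<Longrightarrow>
    a \<odot>\<^bsub>residue_field_module R\<^esub> (\<mm> +>\<^bsub>self_module R\<^esub> x) = \<mm> +>\<^bsub>self_module R\<^esub> (a * x)"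
  using submodule_quotient.quotient_smult[OF residue_quotient, of a x] by (simp add: residue_field_R)

lemma residue_add:
  "x \<in> A \<Longrightarrow> y \<in> A \<Longrightarrow>
    (\<mm> +>\<^bsub>self_module R\<^esub> x) \<oplus>\<^bsub>residue_field_module R\<^esub> (\<mm> +>\<^bsub>self_module R\<^esub> y)
      = \<mm> +>\<^bsub>self_module R\<^esub> (x + y)"
  using submodule_quotient.quotient_add[OF residue_quotient, of x y] by (simp add: residue_field_R)

lemma finsum_self_module:
  assumes "f \<in> Z \<rightarrow> A"
  shows "finsum (self_module R) f Z = sum f Z"
proof -
  interpret S: module R "self_module R" by (rule self_module_R)
  show ?thesis using assms
  proof (induction Z rule: infinite_finite_induct)
    case (infinite Z)
    then show ?case by (simp add: S.finsum_infinite)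
  next
    case (insert z Z)
    then have "f \<in> Z \<rightarrow> carrier (self_module R)" "f z \<in> carrier (self_module R)" by auto
    then show ?case using insert S.finsum_insert[of Z z f] by auto
  qed auto
qed

text \<open>With representatives \<kappa> of the images of the basis vectors, a condition on cosets
  becomes membership of one linear combination in \<mm>.\<close>

lemma augmentation_residue:
  assumes v: "\<And>i. i < q \<Longrightarrow> v i \<in> A" and \<kappa>: "\<And>i. i < q \<Longrightarrow> \<kappa> i \<in> A"
    and g: "\<And>i. i < q \<Longrightarrow> g i = \<mm> +>\<^bsub>self_module R\<^esub> \<kappa> i"
  shows "augmentation (residue_field_module R) q g v = \<mm> +>\<^bsub>self_module R\<^esub> (\<Sum>i<q. v i * \<kappa> i)"
proof -
  interpret S: module R "residue_field_module R"
    unfolding residue_field_R by (rule submodule_quotient.quotient_is_module[OF residue_quotient])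
  have vk: "(\<lambda>i. v i * \<kappa> i) \<in> {..<q} \<rightarrow> A" using v \<kappa> mult_A by auto
  have "augmentation (residue_field_module R) q g v
      = (\<Oplus>\<^bsub>residue_field_module R\<^esub>i\<in>{..<q}. \<mm> +>\<^bsub>self_module R\<^esub> (v i * \<kappa> i))"
    unfolding augmentation_def
    by (rule S.M.finsum_cong') (use vk v \<kappa> g in \<open>auto simp: residue_smult residue_carrier\<close>)
  also have "\<dots> = \<mm> +>\<^bsub>self_module R\<^esub> (\<Oplus>\<^bsub>self_module R\<^esub>i\<in>{..<q}. v i * \<kappa> i)"
    unfolding residue_field_R
    by (rule submodule_quotient.quotient_finsum[OF residue_quotient]) (use vk in simp)
  also have "(\<Oplus>\<^bsub>self_module R\<^esub>i\<in>{..<q}. v i * \<kappa> i) = (\<Sum>i<q. v i * \<kappa> i)"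
    by (rule finsum_self_module[OF vk])
  finally show ?thesis .
qed

lemma row_map_ring_on:
  assumes "\<And>j. j < p \<Longrightarrow> v j \<in> A" "\<And>j l. j < p \<Longrightarrow> l < q \<Longrightarrow> D j l \<in> A"
  shows "row_map R p q D v = (\<lambda>l\<in>{..<q}. \<Sum>j<p. v j * D j l)"
proof -
  have "(\<lambda>j. v j * D j l) \<in> {..<p} \<rightarrow> A" if "l < q" for l
    by (intro Pi_I mult_A) (use assms that in auto)
  then show ?thesis
    unfolding row_map_def ring_on_simps
    by (intro restrict_ext) (simp add: finsum_ring_on[OF cring_R])
qed

text \<open>The part of a free resolution of the residue field that computes \<open>Ext\<^sup>0\<close> and
  \<open>Ext\<^sup>1\<close>, in terms of representatives \<open>\<kappa> l\<close> of the images of the basis vectors of \<open>F\<^sub>0\<close>.\<close>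

lemma residue_resolution:
  fixes D :: "nat \<Rightarrow> nat \<Rightarrow> nat \<Rightarrow> 'k::field fls"
  assumes "free_resolution R (residue_field_module R) r D g"
  obtains \<kappa> where
    "\<And>l. l < r 0 \<Longrightarrow> \<kappa> l \<in> A"
    "\<exists>l<r 0. \<kappa> l \<notin> \<mm>"
    "\<And>i j l. j < r (Suc i) \<Longrightarrow> l < r i \<Longrightarrow> D i j l \<in> A"
    "\<And>v. (\<And>l. l < r 0 \<Longrightarrow> v l \<in> A) \<Longrightarrow> (\<Sum>l<r 0. v l * \<kappa> l) \<in> \<mm> \<Longrightarrow>
      \<exists>u. (\<forall>j<r 1. u j \<in> A) \<and> (\<forall>l<r 0. v l = (\<Sum>j<r 1. u j * D 0 j l))"
    "\<And>u. (\<And>j. j < r 1 \<Longrightarrow> u j \<in> A) \<Longrightarrow> (\<Sum>l<r 0. (\<Sum>j<r 1. u j * D 0 j l) * \<kappa> l) \<in> \<mm>"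
    "\<And>u. (\<And>j. j < r 1 \<Longrightarrow> u j \<in> A) \<Longrightarrow> (\<forall>l<r 0. (\<Sum>j<r 1. u j * D 0 j l) = 0) \<Longrightarrow>
      \<exists>w. (\<forall>i<r 2. w i \<in> A) \<and> (\<forall>j<r 1. u j = (\<Sum>i<r 2. w i * D 1 i j))"
    "\<And>w l. (\<And>i. i < r 2 \<Longrightarrow> w i \<in> A) \<Longrightarrow> l < r 0 \<Longrightarrow> (\<Sum>j<r 1. (\<Sum>i<r 2. w i * D 1 i j) * D 0 j l) = 0"
proof -
  let ?N = "residue_field_module (R :: 'k fls ring)"
  note FR = assms[unfolded free_resolution_def]
  note F1 = FR[THEN conjunct1] and F2 = FR[THEN conjunct2, THEN conjunct1]
    and F3 = FR[THEN conjunct2, THEN conjunct2, THEN conjunct1]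
    and F4 = FR[THEN conjunct2, THEN conjunct2, THEN conjunct2, THEN conjunct1]
    and F5 = FR[THEN conjunct2, THEN conjunct2, THEN conjunct2, THEN conjunct2]
  have D: "D i j l \<in> A" if "j < r (Suc i)" "l < r i" for i j l using F1 that by simp
  have "\<exists>\<kappa>. \<forall>l<r 0. \<kappa> l \<in> A \<and> g l = \<mm> +>\<^bsub>self_module R\<^esub> \<kappa> l"
  proof -
    have "\<exists>k. k \<in> A \<and> g l = \<mm> +>\<^bsub>self_module R\<^esub> k" if "l < r 0" for l
    proof -
      have "g l \<in> carrier ?N" using F2 that by simp
      then show ?thesis unfolding residue_carrier by blast
    qed
    then show ?thesis by metis
  qed
  then obtain \<kappa> where \<kappa>: "\<And>l. l < r 0 \<Longrightarrow> \<kappa> l \<in> A" and g: "\<And>l. l < r 0 \<Longrightarrow> g l = \<mm> +>\<^bsub>self_module R\<^esub> \<kappa> l"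
    by blast
  have aug: "augmentation ?N (r 0) g v = \<mm> +>\<^bsub>self_module R\<^esub> (\<Sum>i<r 0. v i * \<kappa> i)"
    if "\<And>i. i < r 0 \<Longrightarrow> v i \<in> A" for v
    using augmentation_residue[OF that \<kappa> g] .
  have sumA: "(\<Sum>i<n. v i * w i) \<in> A" if "\<And>i. i < n \<Longrightarrow> v i \<in> A" "\<And>i. i < n \<Longrightarrow> w i \<in> A" for n :: nat and v w :: "nat \<Rightarrow> 'k fls"
    using that by (intro series_on_sum mult_A) auto
  have sub: "(\<Sum>i<r 0. v i * \<kappa> i) \<in> \<mm> \<longleftrightarrow> augmentation ?N (r 0) g v = \<zero>\<^bsub>?N\<^esub>"
    if v: "\<And>i. i < r 0 \<Longrightarrow> v i \<in> A" for v
    using residue_eq_zero_iff[OF sumA[OF v \<kappa>]] aug[OF v] by simp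
  have E0: "{v \<in> {..<r 0} \<rightarrow>\<^sub>E A. augmentation ?N (r 0) g v = \<zero>\<^bsub>?N\<^esub>}
       = row_map R (r 1) (r 0) (D 0) ` ({..<r 1} \<rightarrow>\<^sub>E A)" using F4 by simp
  have E1: "{v \<in> {..<r 1} \<rightarrow>\<^sub>E A. row_map R (r 1) (r 0) (D 0) v = (\<lambda>l\<in>{..<r 0}. 0)}
       = row_map R (r 2) (r 1) (D 1) ` ({..<r 2} \<rightarrow>\<^sub>E A)"
    using spec[OF F5, of 0] by (simp add: numeral_2_eq_2)
  have rm0: "row_map R (r 1) (r 0) (D 0) u = (\<lambda>l\<in>{..<r 0}. \<Sum>j<r 1. u j * D 0 j l)"
    if "\<And>j. j < r 1 \<Longrightarrow> u j \<in> A" for u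
    by (rule row_map_ring_on) (use that D in auto)
  have rm1: "row_map R (r 2) (r 1) (D 1) u = (\<lambda>l\<in>{..<r 1}. \<Sum>j<r 2. u j * D 1 j l)"
    if "\<And>j. j < r 2 \<Longrightarrow> u j \<in> A" for u
    by (rule row_map_ring_on) (use that D in \<open>auto simp: numeral_2_eq_2\<close>)
  show ?thesis
  proof (rule that[of \<kappa>])
    show "\<kappa> l \<in> A" if "l < r 0" for l using \<kappa> that .
    show "D i j l \<in> A" if "j < r (Suc i)" "l < r i" for i j l using D that .
    \<comment> \<open>If all \<kappa> were in \<mm>, the augmentation would be zero and miss the
      class of 1.\<close>
    show "\<exists>l<r 0. \<kappa> l \<notin> \<mm>"
    proof (rule ccontr)
      assume "\<not> ?thesis"
      then have k: "\<kappa> l \<in> \<mm>" if "l < r 0" for l using that by blast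
      have "\<mm> +>\<^bsub>self_module R\<^esub> 1 \<in> carrier ?N" unfolding residue_carrier using one_A by blast
      moreover have "augmentation ?N (r 0) g ` ({..<r 0} \<rightarrow>\<^sub>E A) = carrier ?N" using F3 by simp
      ultimately obtain v where v: "v \<in> {..<r 0} \<rightarrow>\<^sub>E A" "augmentation ?N (r 0) g v = \<mm> +>\<^bsub>self_module R\<^esub> 1"
        by (metis (no_types, lifting) imageE)
      have vA: "v i \<in> A" if "i < r 0" for i using v(1) that by auto
      have "(\<Sum>i<r 0. v i * \<kappa> i) \<in> \<mm>" using vA k by (intro series_on_sum A_mm) auto
      then have "\<mm> +>\<^bsub>self_module R\<^esub> 1 = \<zero>\<^bsub>?N\<^esub>" using sub[OF vA] v(2) by simp
      then show False using residue_eq_zero_iff[OF one_A] one_notin_mm by blast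
    qed
    show "\<exists>u. (\<forall>j<r 1. u j \<in> A) \<and> (\<forall>l<r 0. v l = (\<Sum>j<r 1. u j * D 0 j l))"
      if v: "\<And>l. l < r 0 \<Longrightarrow> v l \<in> A" "(\<Sum>l<r 0. v l * \<kappa> l) \<in> \<mm>" for v
    proof -
      \<comment> \<open>\<open>free_resolution\<close> speaks of extensional functions, so arbitrary
        families are cut down to the index range before exactness applies.\<close>
      let ?v = "\<lambda>l\<in>{..<r 0}. v l"
      have vA: "?v l \<in> A" if "l < r 0" for l using v(1) that by simp
      have "(\<Sum>l<r 0. ?v l * \<kappa> l) \<in> \<mm>" using v(2) by simp
      then have "augmentation ?N (r 0) g ?v = \<zero>\<^bsub>?N\<^esub>"
        by (rule iffD1[OF sub[of "?v"], rotated]) (rule vA)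
      then have "?v \<in> row_map R (r 1) (r 0) (D 0) ` ({..<r 1} \<rightarrow>\<^sub>E A)"
        unfolding E0[symmetric] using v(1) by simp
      then obtain u where u: "u \<in> {..<r 1} \<rightarrow>\<^sub>E A" "?v = row_map R (r 1) (r 0) (D 0) u" by blast
      have uA: "u j \<in> A" if "j < r 1" for j using u(1) that by auto
      have "v l = (\<Sum>j<r 1. u j * D 0 j l)" if "l < r 0" for l
        using fun_cong[OF u(2), of l] rm0[OF uA] that by simp
      then show ?thesis using uA by blast
    qed
    show "(\<Sum>l<r 0. (\<Sum>j<r 1. u j * D 0 j l) * \<kappa> l) \<in> \<mm>" if u: "\<And>j. j < r 1 \<Longrightarrow> u j \<in> A" for u
    proof -
      let ?u = "\<lambda>l\<in>{..<r 1}. u l"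
      let ?v = "row_map R (r 1) (r 0) (D 0) ?u"
      have "?v \<in> {v \<in> {..<r 0} \<rightarrow>\<^sub>E A. augmentation ?N (r 0) g v = \<zero>\<^bsub>?N\<^esub>}"
        unfolding E0 using u by auto
      then have v: "?v \<in> {..<r 0} \<rightarrow>\<^sub>E A" "augmentation ?N (r 0) g ?v = \<zero>\<^bsub>?N\<^esub>" by auto
      then have "(\<Sum>l<r 0. ?v l * \<kappa> l) \<in> \<mm>" by (subst sub) auto
      moreover have "?v = (\<lambda>l\<in>{..<r 0}. \<Sum>j<r 1. ?u j * D 0 j l)" by (rule rm0) (use u in simp)
      ultimately show ?thesis by simp
    qed
    show "\<exists>w. (\<forall>i<r 2. w i \<in> A) \<and> (\<forall>j<r 1. u j = (\<Sum>i<r 2. w i * D 1 i j))"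
      if u: "\<And>j. j < r 1 \<Longrightarrow> u j \<in> A" "\<forall>l<r 0. (\<Sum>j<r 1. u j * D 0 j l) = 0" for u
    proof -
      let ?u = "\<lambda>l\<in>{..<r 1}. u l"
      have "row_map R (r 1) (r 0) (D 0) ?u = (\<lambda>l\<in>{..<r 0}. \<Sum>j<r 1. ?u j * D 0 j l)"
        by (rule rm0) (use u in simp)
      also have "\<dots> = (\<lambda>l\<in>{..<r 0}. 0)" using u(2) by (intro restrict_ext) simp
      finally have "?u \<in> row_map R (r 2) (r 1) (D 1) ` ({..<r 2} \<rightarrow>\<^sub>E A)"
        unfolding E1[symmetric] using u by auto
      then obtain w where w: "w \<in> {..<r 2} \<rightarrow>\<^sub>E A" "?u = row_map R (r 2) (r 1) (D 1) w" by blast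
      have wA: "w j \<in> A" if "j < r 2" for j using w(1) that by auto
      have "u l = (\<Sum>j<r 2. w j * D 1 j l)" if "l < r 1" for l
        using fun_cong[OF w(2), of l] rm1[OF wA] that by simp
      then show ?thesis using wA by blast
    qed
    show "(\<Sum>j<r 1. (\<Sum>i<r 2. w i * D 1 i j) * D 0 j l) = 0"
      if w: "\<And>i. i < r 2 \<Longrightarrow> w i \<in> A" and l: "l < r 0" for w l
    proof -
      let ?w = "\<lambda>l\<in>{..<r 2}. w l"
      let ?v = "row_map R (r 2) (r 1) (D 1) ?w"
      have "?v \<in> {v \<in> {..<r 1} \<rightarrow>\<^sub>E A. row_map R (r 1) (r 0) (D 0) v = (\<lambda>l\<in>{..<r 0}. 0)}"
        unfolding E1 using w by auto
      then have v: "?v \<in> {..<r 1} \<rightarrow>\<^sub>E A" "row_map R (r 1) (r 0) (D 0) ?v = (\<lambda>l\<in>{..<r 0}. 0)" by auto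
      have vA: "?v j \<in> A" if "j < r 1" for j using PiE_mem[OF v(1)] that by simp
      have "(\<Sum>j<r 1. ?v j * D 0 j l) = 0"
        using fun_cong[OF trans[OF sym[OF rm0[OF vA]] v(2)], of l] l by simp
      moreover have "?v = (\<lambda>l\<in>{..<r 1}. \<Sum>j<r 2. ?w j * D 1 j l)" by (rule rm1) (use w in simp)
      ultimately show ?thesis by simp
    qed
  qed
qed

end

section \<open>Embedding a finitely generated torsion-free module into Laurent series\<close>

context numerical_semigroup begin

text \<open>Generators are added one at a time. If a nonzero multiple s y lies in the part already
  embedded, y must go to the image of s y divided by s; otherwise y is independent of it and
  receives a coordinate of its own. Coordinates are indexed by the generators themselves, so the
  coordinate of a new generator vanishes on everything embedded before. The uniform bound on orders
  survives because the set of generators is finite.\<close>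

lemma finitely_generated_embedding:
  fixes M :: "('k::field fls, 'b, 'n) module_scheme"
  assumes "module R M"
    and tf: "\<And>r z. r \<in> A \<Longrightarrow> z \<in> carrier M \<Longrightarrow> r \<odot>\<^bsub>M\<^esub> z = \<zero>\<^bsub>M\<^esub> \<Longrightarrow> r = 0 \<or> z = \<zero>\<^bsub>M\<^esub>"
    and Y: "finite Y" "Y \<subseteq> carrier M"
  shows "\<exists>N (\<iota> :: 'b \<Rightarrow> 'b \<Rightarrow> 'k fls) n. submodule N R M \<and> Y \<subseteq> N \<and>
    (\<forall>x\<in>N. \<forall>y\<in>N. \<forall>b. \<iota> (x \<oplus>\<^bsub>M\<^esub> y) b = \<iota> x b + \<iota> y b) \<and>
    (\<forall>r\<in>A. \<forall>x\<in>N. \<forall>b. \<iota> (r \<odot>\<^bsub>M\<^esub> x) b = r * \<iota> x b) \<and>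
    inj_on \<iota> N \<and> (\<forall>x\<in>N. \<forall>b. \<iota> x b \<in> series_on {n..} \<and> (b \<notin> Y \<longrightarrow> \<iota> x b = 0))"
  using Y
proof (induction Y)
  case empty
  interpret M: module R M by fact
  have "submodule {\<zero>\<^bsub>M\<^esub>} R M" by (rule M.submoduleI) auto
  then show ?case by (intro exI[of _ "{\<zero>\<^bsub>M\<^esub>}"] exI[of _ "\<lambda>_ _. 0"]) auto
next
  case (insert y Y)
  interpret M: module R M by fact
  have y: "y \<in> carrier M" using insert by simp
  have null [simp]: "0 \<odot>\<^bsub>M\<^esub> x = \<zero>\<^bsub>M\<^esub>" if "x \<in> carrier M" for x
    using M.smult_l_null[OF that] by simp
  have shift: "d = z' \<oplus>\<^bsub>M\<^esub> \<ominus>\<^bsub>M\<^esub> z" if "z \<oplus>\<^bsub>M\<^esub> d = z'" "z \<in> carrier M" "d \<in> carrier M" for z d z'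
  proof -
    have "z' \<oplus>\<^bsub>M\<^esub> \<ominus>\<^bsub>M\<^esub> z = d \<oplus>\<^bsub>M\<^esub> z \<oplus>\<^bsub>M\<^esub> \<ominus>\<^bsub>M\<^esub> z"
      using that M.M.a_comm[of d z] by simp
    also have "\<dots> = d" using that by (simp add: M.M.a_assoc M.M.r_neg)
    finally show ?thesis by simp
  qed
  have shift2: "z \<oplus>\<^bsub>M\<^esub> (z' \<oplus>\<^bsub>M\<^esub> \<ominus>\<^bsub>M\<^esub> z) = z'" if "z \<in> carrier M" "z' \<in> carrier M" for z z'
    using that M.M.a_lcomm[of z z' "\<ominus>\<^bsub>M\<^esub> z"] by (simp add: M.M.r_neg)
  have one [simp]: "1 \<odot>\<^bsub>M\<^esub> x = x" if "x \<in> carrier M" for x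
    using M.smult_one[OF that] by simp
  have "Y \<subseteq> carrier M" using insert.prems by simp
  from insert.IH[OF this] obtain N n and \<iota> :: "'b \<Rightarrow> 'b \<Rightarrow> 'k fls"
    where IH: "submodule N R M \<and> Y \<subseteq> N \<and>
      (\<forall>x\<in>N. \<forall>y\<in>N. \<forall>b. \<iota> (x \<oplus>\<^bsub>M\<^esub> y) b = \<iota> x b + \<iota> y b) \<and>
      (\<forall>r\<in>A. \<forall>x\<in>N. \<forall>b. \<iota> (r \<odot>\<^bsub>M\<^esub> x) b = r * \<iota> x b) \<and>
      inj_on \<iota> N \<and> (\<forall>x\<in>N. \<forall>b. \<iota> x b \<in> series_on {n..} \<and> (b \<notin> Y \<longrightarrow> \<iota> x b = 0))"
    by blast
  have N: "submodule N R M" and YN: "Y \<subseteq> N" and inj: "inj_on \<iota> N" using IH by blast+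
  have add: "\<iota> (x \<oplus>\<^bsub>M\<^esub> y) b = \<iota> x b + \<iota> y b" if "x \<in> N" "y \<in> N" for x y b
    using IH that by blast
  have sm: "\<iota> (r \<odot>\<^bsub>M\<^esub> x) b = r * \<iota> x b" if "r \<in> A" "x \<in> N" for r x b using IH that by blast
  have bound: "\<iota> x b \<in> series_on {n..}" if "x \<in> N" for x b using IH that by blast
  have supp: "\<iota> x b = 0" if "x \<in> N" "b \<notin> Y" for x b using IH that by blast
  note NE = M.submoduleE[OF N]
  note NM = subsetD[OF NE(1)]
  have N0: "\<zero>\<^bsub>M\<^esub> \<in> N" using subgroup.one_closed[OF submodule.axioms(1)[OF N]] by simp
  have \<iota>0: "\<iota> \<zero>\<^bsub>M\<^esub> b = 0" for b using add[OF N0 N0, of b] unfolding M.M.l_zero[OF M.M.zero_closed] by (metis add_cancel_right_right)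
  have minusA: "- r \<in> A" if "r \<in> A" for r :: "'k fls" using series_on_uminus[OF that] .
  \<comment> \<open>\<eta> is the intended image of y. \<open>W\<close> will make the extension well
    defined, \<open>I\<close> injective, while \<open>B\<close> and \<open>S\<close> preserve the
    bound on orders and the support.\<close>
  obtain \<eta> m where W: "\<And>a z b. a \<in> A \<Longrightarrow> z \<in> N \<Longrightarrow> a \<odot>\<^bsub>M\<^esub> y = z \<Longrightarrow> a * \<eta> b = \<iota> z b"
    and I: "\<And>a z. a \<in> A \<Longrightarrow> z \<in> N \<Longrightarrow> (\<And>b. a * \<eta> b = \<iota> z b) \<Longrightarrow> a \<odot>\<^bsub>M\<^esub> y = z"
    and B: "\<And>b. \<eta> b \<in> series_on {m..}" and S: "\<And>b. b \<notin> insert y Y \<Longrightarrow> \<eta> b = 0"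
  proof (cases "\<exists>s\<in>A. s \<noteq> 0 \<and> s \<odot>\<^bsub>M\<^esub> y \<in> N")
    case True
    then obtain s where s: "s \<in> A" "s \<noteq> 0" "s \<odot>\<^bsub>M\<^esub> y \<in> N" by auto
    show ?thesis
    proof (rule that[of "\<lambda>b. \<iota> (s \<odot>\<^bsub>M\<^esub> y) b / s" "n - fls_subdegree s"])
      fix a z b assume a: "a \<in> A" "z \<in> N" "a \<odot>\<^bsub>M\<^esub> y = z"
      have "s \<odot>\<^bsub>M\<^esub> z = a \<odot>\<^bsub>M\<^esub> (s \<odot>\<^bsub>M\<^esub> y)"
        using M.smult_assoc1[of s a y] M.smult_assoc1[of a s y] a s y by (simp add: mult.commute)
      then have "s * \<iota> z b = a * \<iota> (s \<odot>\<^bsub>M\<^esub> y) b" using sm a s by metis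
      then show "a * (\<iota> (s \<odot>\<^bsub>M\<^esub> y) b / s) = \<iota> z b" using s by (simp add: field_simps)
    next
      fix a z assume a: "a \<in> A" "z \<in> N" "\<And>b. a * (\<iota> (s \<odot>\<^bsub>M\<^esub> y) b / s) = \<iota> z b"
      have "a * \<iota> (s \<odot>\<^bsub>M\<^esub> y) b = s * \<iota> z b" for b using a(3)[of b] s(2) by (auto simp: field_simps)
      then have "\<iota> (a \<odot>\<^bsub>M\<^esub> (s \<odot>\<^bsub>M\<^esub> y)) = \<iota> (s \<odot>\<^bsub>M\<^esub> z)" using sm a s by (intro ext) simp
      then have "a \<odot>\<^bsub>M\<^esub> (s \<odot>\<^bsub>M\<^esub> y) = s \<odot>\<^bsub>M\<^esub> z"
        using inj a s NE(4) by (auto simp: inj_on_def)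
      then have "s \<odot>\<^bsub>M\<^esub> (a \<odot>\<^bsub>M\<^esub> y) = s \<odot>\<^bsub>M\<^esub> z"
        using M.smult_assoc1[of s a y] M.smult_assoc1[of a s y] a s y by (simp add: mult.commute)
      then have "s \<odot>\<^bsub>M\<^esub> (a \<odot>\<^bsub>M\<^esub> y \<oplus>\<^bsub>M\<^esub> \<ominus>\<^bsub>M\<^esub> z) = \<zero>\<^bsub>M\<^esub>"
        using a s y NM by (simp add: M.smult_r_distr M.smult_r_minus M.M.r_neg)
      then have "a \<odot>\<^bsub>M\<^esub> y \<oplus>\<^bsub>M\<^esub> \<ominus>\<^bsub>M\<^esub> z = \<zero>\<^bsub>M\<^esub>" using tf[of s] a s y NM by simp
      then show "a \<odot>\<^bsub>M\<^esub> y = z" using a y NM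
        by (metis M.M.a_inv_closed M.M.minus_equality M.M.minus_minus M.smult_closed ring_on_simps(1))
    next
      fix b show "\<iota> (s \<odot>\<^bsub>M\<^esub> y) b / s \<in> series_on {n - fls_subdegree s..}"
        using bound[OF s(3), of b] s(2)
        by (cases "\<iota> (s \<odot>\<^bsub>M\<^esub> y) b = 0") (auto simp: series_on_atLeast_iff fls_divide_subdegree)
    next
      fix b assume "b \<notin> insert y Y"
      then show "\<iota> (s \<odot>\<^bsub>M\<^esub> y) b / s = 0" using supp[OF s(3)] by simp
    qed
  next
    case False
    \<comment> \<open>No nonzero multiple of y lies in N: y gets the fresh coordinate y, on which
      all of N vanishes.\<close>
    show ?thesis
    proof (rule that[of "\<lambda>b. if b = y then 1 else 0" 0])
      fix a z b assume a: "a \<in> A" "z \<in> N" "a \<odot>\<^bsub>M\<^esub> y = z"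
      then have "a = 0" using False by blast
      moreover from this have "z = \<zero>\<^bsub>M\<^esub>" using a y by auto
      ultimately show "a * (if b = y then 1 else 0) = \<iota> z b" using \<iota>0 by simp
    next
      fix a z assume a: "a \<in> A" "z \<in> N" "\<And>b. a * (if b = y then 1 else 0) = \<iota> z b"
      have "a = 0" using a(3)[of y] supp[OF a(2) insert.hyps(2)] by simp
      then have "\<iota> z = \<iota> \<zero>\<^bsub>M\<^esub>" using a(3) \<iota>0 by (intro ext) (metis mult_zero_left)
      then have "z = \<zero>\<^bsub>M\<^esub>" using inj a N0 by (auto simp: inj_on_def)
      then show "a \<odot>\<^bsub>M\<^esub> y = z" using \<open>a = 0\<close> y by simp
    qed (auto simp: series_on_def)
  qed
  define N' where "N' = {z \<oplus>\<^bsub>M\<^esub> a \<odot>\<^bsub>M\<^esub> y | z a. z \<in> N \<and> a \<in> A}"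
  \<comment> \<open>An element may have several expressions z + a y. One is chosen, and
    \<open>W\<close>, applied to the difference of two expressions, shows that the value does not
    depend on the choice.\<close>
  define \<iota>' where "\<iota>' x = (let (z, a) = (SOME (z, a). z \<in> N \<and> a \<in> A \<and> x = z \<oplus>\<^bsub>M\<^esub> a \<odot>\<^bsub>M\<^esub> y)
      in (\<lambda>b. \<iota> z b + a * \<eta> b))" for x
  have \<iota>': "\<iota>' (z \<oplus>\<^bsub>M\<^esub> a \<odot>\<^bsub>M\<^esub> y) b = \<iota> z b + a * \<eta> b" if z: "z \<in> N" and a: "a \<in> A" for z a b
  proof -
    let ?P = "\<lambda>(z', a'). z' \<in> N \<and> a' \<in> A \<and> z \<oplus>\<^bsub>M\<^esub> a \<odot>\<^bsub>M\<^esub> y = z' \<oplus>\<^bsub>M\<^esub> a' \<odot>\<^bsub>M\<^esub> y"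
    obtain z' a' where za: "(SOME p. ?P p) = (z', a')" by fastforce
    have "?P (z, a)" using z a by simp
    then have "?P (SOME p. ?P p)" by (rule someI)
    then have z': "z' \<in> N" "a' \<in> A" and eq: "z \<oplus>\<^bsub>M\<^esub> a \<odot>\<^bsub>M\<^esub> y = z' \<oplus>\<^bsub>M\<^esub> a' \<odot>\<^bsub>M\<^esub> y"
      unfolding za by auto
    have aa: "a - a' \<in> A" using series_on_diff a z' by blast
    have carr: "z \<in> carrier M" "z' \<in> carrier M" "a \<odot>\<^bsub>M\<^esub> y \<in> carrier M" "a' \<odot>\<^bsub>M\<^esub> y \<in> carrier M"
      using z z' a y NM by auto
    have "(a - a') \<odot>\<^bsub>M\<^esub> y \<oplus>\<^bsub>M\<^esub> a' \<odot>\<^bsub>M\<^esub> y = a \<odot>\<^bsub>M\<^esub> y"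
      using M.smult_l_distr[of "a - a'" a' y] aa z' y by simp
    then have "z \<oplus>\<^bsub>M\<^esub> (a - a') \<odot>\<^bsub>M\<^esub> y \<oplus>\<^bsub>M\<^esub> a' \<odot>\<^bsub>M\<^esub> y = z' \<oplus>\<^bsub>M\<^esub> a' \<odot>\<^bsub>M\<^esub> y"
      using eq carr aa y by (simp add: M.M.a_assoc)
    then have "z \<oplus>\<^bsub>M\<^esub> (a - a') \<odot>\<^bsub>M\<^esub> y = z'" using carr aa y by simp
    then have "(a - a') \<odot>\<^bsub>M\<^esub> y = z' \<oplus>\<^bsub>M\<^esub> \<ominus>\<^bsub>M\<^esub> z"
      by (rule shift) (use carr aa y in auto)
    then have "(a - a') * \<eta> b = \<iota> (z' \<oplus>\<^bsub>M\<^esub> \<ominus>\<^bsub>M\<^esub> z) b"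
      by (rule W[OF aa NE(5)[OF z'(1) NE(3)[OF z]]])
    also have "\<dots> = \<iota> z' b + \<iota> (\<ominus>\<^bsub>M\<^esub> z) b" by (rule add[OF z'(1) NE(3)[OF z]])
    also have "\<iota> (\<ominus>\<^bsub>M\<^esub> z) b = - \<iota> z b"
      using add[OF z NE(3)[OF z], of b] carr \<iota>0[of b] by (simp add: M.M.r_neg eq_neg_iff_add_eq_0 add.commute)
    finally have "\<iota> z b + a * \<eta> b = \<iota> z' b + a' * \<eta> b" by (simp add: algebra_simps)
    moreover have "\<iota>' (z \<oplus>\<^bsub>M\<^esub> a \<odot>\<^bsub>M\<^esub> y) = (\<lambda>b. \<iota> z' b + a' * \<eta> b)"
      unfolding \<iota>'_def za by simp
    ultimately show ?thesis by simp
  qed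
  have N'I: "z \<oplus>\<^bsub>M\<^esub> a \<odot>\<^bsub>M\<^esub> y \<in> N'" if "z \<in> N" "a \<in> A" for z a using that unfolding N'_def by blast
  have sumN': "(z \<oplus>\<^bsub>M\<^esub> a \<odot>\<^bsub>M\<^esub> y) \<oplus>\<^bsub>M\<^esub> (z' \<oplus>\<^bsub>M\<^esub> a' \<odot>\<^bsub>M\<^esub> y) = (z \<oplus>\<^bsub>M\<^esub> z') \<oplus>\<^bsub>M\<^esub> (a + a') \<odot>\<^bsub>M\<^esub> y"
    if "z \<in> N" "a \<in> A" "z' \<in> N" "a' \<in> A" for z a z' a'
    using M.smult_l_distr[of a a' y] that NM y by (simp add: M.M.a_ac)
  have smN': "r \<odot>\<^bsub>M\<^esub> (z \<oplus>\<^bsub>M\<^esub> a \<odot>\<^bsub>M\<^esub> y) = r \<odot>\<^bsub>M\<^esub> z \<oplus>\<^bsub>M\<^esub> (r * a) \<odot>\<^bsub>M\<^esub> y"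
    if "z \<in> N" "a \<in> A" "r \<in> A" for z a r
    using M.smult_assoc1[of r a y] that NM y by (simp add: M.smult_r_distr)
  show ?case
  proof (intro exI[of _ N'] exI[of _ \<iota>'] exI[of _ "min n m"] conjI ballI allI)
    show "submodule N' R M"
    proof (rule M.submoduleI)
      show "N' \<subseteq> carrier M" unfolding N'_def using NM y by auto
      show "\<zero>\<^bsub>M\<^esub> \<in> N'" using N'I[OF N0, of 0] y by simp
      fix x assume "x \<in> N'"
      then obtain z a where x: "z \<in> N" "a \<in> A" "x = z \<oplus>\<^bsub>M\<^esub> a \<odot>\<^bsub>M\<^esub> y" unfolding N'_def by auto
      show "x \<oplus>\<^bsub>M\<^esub> x' \<in> N'" if x': "x' \<in> N'" for x'
      proof -
        obtain z' a' where x': "z' \<in> N" "a' \<in> A" "x' = z' \<oplus>\<^bsub>M\<^esub> a' \<odot>\<^bsub>M\<^esub> y"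
          using x' unfolding N'_def by auto
        show ?thesis using sumN'[OF x(1,2) x'(1,2)] x x' N'I[OF NE(5)[OF x(1) x'(1)] series_on_add[OF x(2) x'(2)]]
          by simp
      qed
      show r: "r \<odot>\<^bsub>M\<^esub> x \<in> N'" if "r \<in> carrier R" for r
        using smN'[OF x(1,2), of r] that x N'I[OF NE(4)[OF that x(1)] mult_A[of r a]] by simp
      have "\<ominus>\<^bsub>M\<^esub> x = (- 1) \<odot>\<^bsub>M\<^esub> x"
      proof -
        have xM: "x \<in> carrier M" using x NM y by auto
        have "(- 1) \<odot>\<^bsub>M\<^esub> x \<oplus>\<^bsub>M\<^esub> x = (- 1 + 1) \<odot>\<^bsub>M\<^esub> x"
          using M.smult_l_distr[of "-1" 1 x] M.smult_one[of x] minusA[OF one_A] one_A xM by simp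
        also have "\<dots> = \<zero>\<^bsub>M\<^esub>" using M.smult_l_null[OF xM] by simp
        finally show ?thesis using M.M.minus_equality xM minusA[OF one_A] M.smult_closed by simp
      qed
      then show "\<ominus>\<^bsub>M\<^esub> x \<in> N'" using r[of "-1"] minusA[OF one_A] by simp
    qed
    show "insert y Y \<subseteq> N'"
    proof -
      have "y \<in> N'" using N'I[OF N0 one_A] y M.smult_one[OF y] by simp
      moreover have "z \<in> N'" if "z \<in> N" for z using N'I[OF that, of 0] y NM[OF that] by simp
      ultimately show ?thesis using YN by auto
    qed
    fix x b assume "x \<in> N'"
    then obtain z a where x: "z \<in> N" "a \<in> A" "x = z \<oplus>\<^bsub>M\<^esub> a \<odot>\<^bsub>M\<^esub> y" unfolding N'_def by auto
    show "\<iota>' (x \<oplus>\<^bsub>M\<^esub> x') b = \<iota>' x b + \<iota>' x' b" if x': "x' \<in> N'" for x'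
    proof -
      obtain z' a' where x': "z' \<in> N" "a' \<in> A" "x' = z' \<oplus>\<^bsub>M\<^esub> a' \<odot>\<^bsub>M\<^esub> y"
        using x' unfolding N'_def by auto
      show ?thesis using sumN'[OF x(1,2) x'(1,2)] x x' \<iota>'[OF x(1,2)] \<iota>'[OF x'(1,2)] add[OF x(1) x'(1)]
        \<iota>'[OF NE(5)[OF x(1) x'(1)] series_on_add[OF x(2) x'(2)]]
        by (simp add: algebra_simps)
    qed
    show "\<iota>' (r \<odot>\<^bsub>M\<^esub> x) b = r * \<iota>' x b" if "r \<in> A" for r
      using smN'[OF x(1,2) that] that x \<iota>'[OF x(1,2)] \<iota>'[OF NE(4) mult_A] sm[OF that x(1)]
      by (simp add: algebra_simps)
    have "\<iota> z b \<in> series_on {min n m..}" by (rule subsetD[OF series_on_mono bound[OF x(1)]]) auto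
    moreover have "a * \<eta> b \<in> series_on {min n m..}"
      by (rule series_on_mult[OF x(2) B]) (use nonneg in force)
    ultimately show "\<iota>' x b \<in> series_on {min n m..}"
      unfolding x(3) \<iota>'[OF x(1,2)] by (rule series_on_add)
    show "b \<notin> insert y Y \<longrightarrow> \<iota>' x b = 0"
      unfolding x(3) \<iota>'[OF x(1,2)] using supp[OF x(1), of b] S[of b] by auto
  next
    show "inj_on \<iota>' N'"
    proof (rule inj_onI)
      fix x x' assume "x \<in> N'" "x' \<in> N'" and eq: "\<iota>' x = \<iota>' x'"
      then obtain z a z' a' where x: "z \<in> N" "a \<in> A" "x = z \<oplus>\<^bsub>M\<^esub> a \<odot>\<^bsub>M\<^esub> y"
        and x': "z' \<in> N" "a' \<in> A" "x' = z' \<oplus>\<^bsub>M\<^esub> a' \<odot>\<^bsub>M\<^esub> y" unfolding N'_def by auto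
      have aa: "a - a' \<in> A" using series_on_diff x x' by blast
      have carr: "z \<in> carrier M" "z' \<in> carrier M" "a \<odot>\<^bsub>M\<^esub> y \<in> carrier M" "a' \<odot>\<^bsub>M\<^esub> y \<in> carrier M"
        "(a - a') \<odot>\<^bsub>M\<^esub> y \<in> carrier M"
        using x x' y NM aa by auto
      have "(a - a') * \<eta> b = \<iota> (z' \<oplus>\<^bsub>M\<^esub> \<ominus>\<^bsub>M\<^esub> z) b" for b
      proof -
        have "\<iota> (\<ominus>\<^bsub>M\<^esub> z) b = - \<iota> z b"
          using add[OF x(1) NE(3)[OF x(1)], of b] carr \<iota>0[of b]
          by (simp add: M.M.r_neg eq_neg_iff_add_eq_0 add.commute)
        then have e: "\<iota> (z' \<oplus>\<^bsub>M\<^esub> \<ominus>\<^bsub>M\<^esub> z) b = \<iota> z' b - \<iota> z b"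
          using add[OF x'(1) NE(3)[OF x(1)], of b] by simp
        have "\<iota> z b + a * \<eta> b = \<iota> z' b + a' * \<eta> b"
          using eq \<iota>'[OF x(1,2)] \<iota>'[OF x'(1,2)] x x' by metis
        then have "a * \<eta> b = \<iota> z' b + a' * \<eta> b - \<iota> z b" by (metis add_diff_cancel_left')
        then show ?thesis unfolding left_diff_distrib e by simp
      qed
      then have "(a - a') \<odot>\<^bsub>M\<^esub> y = z' \<oplus>\<^bsub>M\<^esub> \<ominus>\<^bsub>M\<^esub> z"
        by (rule I[OF aa NE(5)[OF x'(1) NE(3)[OF x(1)]]])
      then have "z \<oplus>\<^bsub>M\<^esub> (a - a') \<odot>\<^bsub>M\<^esub> y = z'"
        using carr shift2 by simp
      moreover have "(a - a') \<odot>\<^bsub>M\<^esub> y \<oplus>\<^bsub>M\<^esub> a' \<odot>\<^bsub>M\<^esub> y = a \<odot>\<^bsub>M\<^esub> y"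
        using M.smult_l_distr[of "a - a'" a' y] aa x' y by simp
      ultimately show "x = x'" unfolding x(3) x'(3) using carr
        M.M.a_assoc[of z "(a - a') \<odot>\<^bsub>M\<^esub> y" "a' \<odot>\<^bsub>M\<^esub> y"] by simp
    qed
  qed
qed

end

section \<open>Finite free resolutions and Ext\<close>

lemma (in abelian_monoid) finsum_swap:
  assumes "finite Y" "finite Z" "\<And>i j. i \<in> Y \<Longrightarrow> j \<in> Z \<Longrightarrow> f i j \<in> carrier G"
  shows "(\<Oplus>i\<in>Y. \<Oplus>j\<in>Z. f i j) = (\<Oplus>j\<in>Z. \<Oplus>i\<in>Y. f i j)"
  using assms(1,3)
proof (induction Y)
  case empty
  then show ?case by simp
next
  case (insert y Y)
  have fy: "f y \<in> Z \<rightarrow> carrier G" using insert.prems by auto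
  have fYc: "(\<Oplus>i\<in>Y. f i j) \<in> carrier G" if "j \<in> Z" for j
    using insert.prems that by (intro finsum_closed) auto
  have fZc: "(\<lambda>i. \<Oplus>j\<in>Z. f i j) \<in> Y \<rightarrow> carrier G" "(\<Oplus>j\<in>Z. f y j) \<in> carrier G"
    using insert.prems by (auto intro!: finsum_closed)
  have "(\<Oplus>i\<in>insert y Y. \<Oplus>j\<in>Z. f i j) = (\<Oplus>j\<in>Z. f y j) \<oplus> (\<Oplus>j\<in>Z. \<Oplus>i\<in>Y. f i j)"
    using insert fZc by (simp add: finsum_insert)
  also have "\<dots> = (\<Oplus>j\<in>Z. f y j \<oplus> (\<Oplus>i\<in>Y. f i j))"
    using fy fYc by (intro finsum_addf[symmetric]) auto
  also have "\<dots> = (\<Oplus>j\<in>Z. \<Oplus>i\<in>insert y Y. f i j)"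
  proof (rule finsum_cong')
    fix j assume j: "j \<in> Z"
    then have "(\<lambda>i. f i j) \<in> Y \<rightarrow> carrier G" "f y j \<in> carrier G" using insert.prems by auto
    then show "f y j \<oplus> (\<Oplus>i\<in>Y. f i j) = (\<Oplus>i\<in>insert y Y. f i j)"
      using insert by (simp add: finsum_insert)
  qed (use insert.prems in \<open>auto intro!: finsum_closed\<close>)
  finally show ?case .
qed

text \<open>Membership of the partial sums in \<open>A\<close> is proved along with the identity,
  because distributivity of the action asks for it in the induction step.\<close>

lemma smult_sum_left:
  assumes "module (ring_on A) M" "x \<in> carrier M" "\<And>j. j \<in> Y \<Longrightarrow> f j \<in> A"
  shows "(\<Sum>j\<in>Y. f j) \<odot>\<^bsub>M\<^esub> x = (\<Oplus>\<^bsub>M\<^esub>j\<in>Y. f j \<odot>\<^bsub>M\<^esub> x) \<and> (\<Sum>j\<in>Y. f j) \<in> A"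
proof -
  interpret module "ring_on A" M by fact
  have z: "0 \<odot>\<^bsub>M\<^esub> x = \<zero>\<^bsub>M\<^esub>" "0 \<in> A" using smult_l_null[OF assms(2)] R.zero_closed by auto
  show ?thesis using assms(3)
  proof (induction Y rule: infinite_finite_induct)
    case (infinite Y)
    then show ?case using z by (simp add: M.finsum_infinite)
  next
    case empty
    then show ?case using z by simp
  next
    case (insert y Y)
    have yA: "f y \<in> A" and IH: "(\<Sum>j\<in>Y. f j) \<odot>\<^bsub>M\<^esub> x = (\<Oplus>\<^bsub>M\<^esub>j\<in>Y. f j \<odot>\<^bsub>M\<^esub> x)" "(\<Sum>j\<in>Y. f j) \<in> A"
      using insert by auto
    have "(f y + (\<Sum>j\<in>Y. f j)) \<odot>\<^bsub>M\<^esub> x = f y \<odot>\<^bsub>M\<^esub> x \<oplus>\<^bsub>M\<^esub> (\<Oplus>\<^bsub>M\<^esub>j\<in>Y. f j \<odot>\<^bsub>M\<^esub> x)"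
      using smult_l_distr[of "f y" "\<Sum>j\<in>Y. f j" x] yA IH assms(2) by simp
    moreover have "(\<lambda>j. f j \<odot>\<^bsub>M\<^esub> x) \<in> Y \<rightarrow> carrier M" "f y \<odot>\<^bsub>M\<^esub> x \<in> carrier M"
      using insert.prems assms(2) smult_closed by auto
    moreover have "f y + (\<Sum>j\<in>Y. f j) \<in> A" using R.a_closed[of "f y"] yA IH by simp
    ultimately show ?case using insert by (simp add: M.finsum_insert)
  qed
qed

lemma dual_map_closed:
  assumes "module (ring_on A) M" "\<And>j l. j < p \<Longrightarrow> l < q \<Longrightarrow> D j l \<in> A" "f \<in> {..<q} \<rightarrow>\<^sub>E carrier M"
  shows "dual_map M p q D f \<in> {..<p} \<rightarrow>\<^sub>E carrier M"
proof -
  interpret module "ring_on A" M by fact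
  have "(\<Oplus>\<^bsub>M\<^esub>l\<in>{..<q}. D j l \<odot>\<^bsub>M\<^esub> f l) \<in> carrier M" if "j < p" for j
    using assms(2,3) that smult_closed by (intro M.finsum_closed) (auto simp: PiE_iff)
  then show ?thesis unfolding dual_map_def by auto
qed

lemma dual_map_linear:
  assumes "module (ring_on A) M" "\<And>j l. j < p \<Longrightarrow> l < q \<Longrightarrow> D j l \<in> A"
    "f \<in> {..<q} \<rightarrow>\<^sub>E carrier M" "g \<in> {..<q} \<rightarrow>\<^sub>E carrier M" "r \<in> A"
  shows "dual_map M p q D (\<lambda>i\<in>{..<q}. f i \<oplus>\<^bsub>M\<^esub> g i)
      = (\<lambda>i\<in>{..<p}. dual_map M p q D f i \<oplus>\<^bsub>M\<^esub> dual_map M p q D g i)" (is ?T1)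
    and "dual_map M p q D (\<lambda>i\<in>{..<q}. r \<odot>\<^bsub>M\<^esub> f i) = (\<lambda>i\<in>{..<p}. r \<odot>\<^bsub>M\<^esub> dual_map M p q D f i)" (is ?T2)
    and "dual_map M p q D (\<lambda>i\<in>{..<q}. \<zero>\<^bsub>M\<^esub>) = (\<lambda>i\<in>{..<p}. \<zero>\<^bsub>M\<^esub>)" (is ?T3)
proof -
  interpret module "ring_on A" M by fact
  have f: "f i \<in> carrier M" and g: "g i \<in> carrier M" if "i < q" for i
    using assms(3,4) that by (auto simp: PiE_iff)
  have Df: "D j i \<odot>\<^bsub>M\<^esub> f i \<in> carrier M" and Dg: "D j i \<odot>\<^bsub>M\<^esub> g i \<in> carrier M"
    if "j < p" "i < q" for i j
    using smult_closed assms(2)[OF that] f[OF that(2)] g[OF that(2)] by auto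
  show ?T1
  proof (intro ext)
    fix j
    show "dual_map M p q D (\<lambda>i\<in>{..<q}. f i \<oplus>\<^bsub>M\<^esub> g i) j
      = (\<lambda>i\<in>{..<p}. dual_map M p q D f i \<oplus>\<^bsub>M\<^esub> dual_map M p q D g i) j"
    proof (cases "j < p")
      case True
      have "(\<Oplus>\<^bsub>M\<^esub>l\<in>{..<q}. D j l \<odot>\<^bsub>M\<^esub> (\<lambda>i\<in>{..<q}. f i \<oplus>\<^bsub>M\<^esub> g i) l)
          = (\<Oplus>\<^bsub>M\<^esub>l\<in>{..<q}. D j l \<odot>\<^bsub>M\<^esub> f l \<oplus>\<^bsub>M\<^esub> D j l \<odot>\<^bsub>M\<^esub> g l)"
        by (rule M.finsum_cong') (use True Df Dg f g assms(2) smult_r_distr in auto)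
      also have "\<dots> = (\<Oplus>\<^bsub>M\<^esub>l\<in>{..<q}. D j l \<odot>\<^bsub>M\<^esub> f l) \<oplus>\<^bsub>M\<^esub> (\<Oplus>\<^bsub>M\<^esub>l\<in>{..<q}. D j l \<odot>\<^bsub>M\<^esub> g l)"
        by (rule M.finsum_addf) (use True Df Dg in auto)
      finally show ?thesis using True by (simp add: dual_map_def)
    qed (simp add: dual_map_def)
  qed
  show ?T2
  proof (intro ext)
    fix j
    show "dual_map M p q D (\<lambda>i\<in>{..<q}. r \<odot>\<^bsub>M\<^esub> f i) j = (\<lambda>i\<in>{..<p}. r \<odot>\<^bsub>M\<^esub> dual_map M p q D f i) j"
    proof (cases "j < p")
      case True
      have "r \<odot>\<^bsub>M\<^esub> (\<Oplus>\<^bsub>M\<^esub>l\<in>{..<q}. D j l \<odot>\<^bsub>M\<^esub> f l) = (\<Oplus>\<^bsub>M\<^esub>l\<in>{..<q}. r \<odot>\<^bsub>M\<^esub> (D j l \<odot>\<^bsub>M\<^esub> f l))"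
        by (rule finsum_smult_ldistr) (use True Df assms(5) in auto)
      also have "\<dots> = (\<Oplus>\<^bsub>M\<^esub>l\<in>{..<q}. D j l \<odot>\<^bsub>M\<^esub> (\<lambda>i\<in>{..<q}. r \<odot>\<^bsub>M\<^esub> f i) l)"
      proof (rule M.finsum_cong')
        fix l assume l: "l \<in> {..<q}"
        then show "r \<odot>\<^bsub>M\<^esub> (D j l \<odot>\<^bsub>M\<^esub> f l) = D j l \<odot>\<^bsub>M\<^esub> (\<lambda>i\<in>{..<q}. r \<odot>\<^bsub>M\<^esub> f i) l"
          using smult_assoc1[of r "D j l" "f l"] smult_assoc1[of "D j l" r "f l"] f[of l] assms(2)[OF True, of l] assms(5)
          by (simp add: mult.commute)
      qed (use f assms(2)[OF True] assms(5) smult_closed in auto)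
      finally show ?thesis using True by (simp add: dual_map_def)
    qed (simp add: dual_map_def)
  qed
  show ?T3
  proof (intro ext)
    fix j
    show "dual_map M p q D (\<lambda>i\<in>{..<q}. \<zero>\<^bsub>M\<^esub>) j = (\<lambda>i\<in>{..<p}. \<zero>\<^bsub>M\<^esub>) j"
    proof (cases "j < p")
      case True
      have "(\<Oplus>\<^bsub>M\<^esub>l\<in>{..<q}. D j l \<odot>\<^bsub>M\<^esub> (\<lambda>i\<in>{..<q}. \<zero>\<^bsub>M\<^esub>) l) = (\<Oplus>\<^bsub>M\<^esub>l\<in>{..<q}. \<zero>\<^bsub>M\<^esub>)"
        by (rule M.finsum_cong') (use True assms(2) smult_r_null in auto)
      then show ?thesis using True by (simp add: dual_map_def M.finsum_zero)
    qed (simp add: dual_map_def)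
  qed
qed

text \<open>The transposes of two differentials that compose to zero compose to zero as well; this
  is what puts coboundaries among the cocycles.\<close>

lemma dual_map_comp:
  assumes M: "module (ring_on A) M" and D: "\<And>j l. j < p \<Longrightarrow> l < q \<Longrightarrow> D j l \<in> A"
    and E: "\<And>i j. i < s \<Longrightarrow> j < p \<Longrightarrow> E i j \<in> A" and x: "x \<in> {..<q} \<rightarrow>\<^sub>E carrier M"
    and comp: "\<And>i l. i < s \<Longrightarrow> l < q \<Longrightarrow> (\<Sum>j<p. E i j * D j l) = 0"
  shows "dual_map M s p E (dual_map M p q D x) = (\<lambda>i\<in>{..<s}. \<zero>\<^bsub>M\<^esub>)"
proof (intro ext)
  interpret module "ring_on A" M by fact
  fix i
  have xM: "x l \<in> carrier M" if "l < q" for l using x that by (auto simp: PiE_iff)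
  show "dual_map M s p E (dual_map M p q D x) i = (\<lambda>i\<in>{..<s}. \<zero>\<^bsub>M\<^esub>) i"
  proof (cases "i < s")
    case True
    note i = True
    have Dx: "D j l \<odot>\<^bsub>M\<^esub> x l \<in> carrier M" if "j < p" "l < q" for j l
      using smult_closed D[OF that] xM[OF that(2)] by simp
    have EDx: "E i j \<odot>\<^bsub>M\<^esub> (D j l \<odot>\<^bsub>M\<^esub> x l) \<in> carrier M" if "j < p" "l < q" for j l
      using smult_closed E[OF i that(1)] Dx[OF that] by simp
    have "(\<Oplus>\<^bsub>M\<^esub>j\<in>{..<p}. E i j \<odot>\<^bsub>M\<^esub> dual_map M p q D x j)
        = (\<Oplus>\<^bsub>M\<^esub>j\<in>{..<p}. \<Oplus>\<^bsub>M\<^esub>l\<in>{..<q}. E i j \<odot>\<^bsub>M\<^esub> (D j l \<odot>\<^bsub>M\<^esub> x l))"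
    proof (rule M.finsum_cong')
      fix j assume j: "j \<in> {..<p}"
      have "E i j \<odot>\<^bsub>M\<^esub> (\<Oplus>\<^bsub>M\<^esub>l\<in>{..<q}. D j l \<odot>\<^bsub>M\<^esub> x l) = (\<Oplus>\<^bsub>M\<^esub>l\<in>{..<q}. E i j \<odot>\<^bsub>M\<^esub> (D j l \<odot>\<^bsub>M\<^esub> x l))"
        by (rule finsum_smult_ldistr) (use j Dx E[OF i] in auto)
      then show "E i j \<odot>\<^bsub>M\<^esub> dual_map M p q D x j = (\<Oplus>\<^bsub>M\<^esub>l\<in>{..<q}. E i j \<odot>\<^bsub>M\<^esub> (D j l \<odot>\<^bsub>M\<^esub> x l))"
        using j by (simp add: dual_map_def)
    qed (use EDx in \<open>auto intro!: M.finsum_closed\<close>)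
    also have "\<dots> = (\<Oplus>\<^bsub>M\<^esub>l\<in>{..<q}. \<Oplus>\<^bsub>M\<^esub>j\<in>{..<p}. E i j \<odot>\<^bsub>M\<^esub> (D j l \<odot>\<^bsub>M\<^esub> x l))"
      by (rule M.finsum_swap) (use EDx in auto)
    also have "\<dots> = (\<Oplus>\<^bsub>M\<^esub>l\<in>{..<q}. \<zero>\<^bsub>M\<^esub>)"
    proof (rule M.finsum_cong')
      fix l assume l: "l \<in> {..<q}"
      have "(\<Oplus>\<^bsub>M\<^esub>j\<in>{..<p}. E i j \<odot>\<^bsub>M\<^esub> (D j l \<odot>\<^bsub>M\<^esub> x l)) = (\<Oplus>\<^bsub>M\<^esub>j\<in>{..<p}. (E i j * D j l) \<odot>\<^bsub>M\<^esub> x l)"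
      proof (rule M.finsum_cong')
        fix j assume j: "j \<in> {..<p}"
        show "E i j \<odot>\<^bsub>M\<^esub> (D j l \<odot>\<^bsub>M\<^esub> x l) = (E i j * D j l) \<odot>\<^bsub>M\<^esub> x l"
          using smult_assoc1[of "E i j" "D j l" "x l"] j l E[OF i, of j] D[of j l] xM[of l] by simp
      next
        show "(\<lambda>j. (E i j * D j l) \<odot>\<^bsub>M\<^esub> x l) \<in> {..<p} \<rightarrow> carrier M"
        proof
          fix j assume j: "j \<in> {..<p}"
          then have "E i j * D j l \<in> A" using R.m_closed[of "E i j" "D j l"] E[OF i, of j] D[of j l] l by simp
          then show "(E i j * D j l) \<odot>\<^bsub>M\<^esub> x l \<in> carrier M" using smult_closed xM[of l] l by simp
        qed
      qed simp
      also have "\<dots> = (\<Sum>j<p. E i j * D j l) \<odot>\<^bsub>M\<^esub> x l"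
      proof (rule conjunct1[OF smult_sum_left[OF M], symmetric])
        show "x l \<in> carrier M" using xM l by simp
        fix j assume "j \<in> {..<p}"
        then show "E i j * D j l \<in> A" using R.m_closed[of "E i j" "D j l"] E[OF i, of j] D[of j l] l by simp
      qed
      also have "\<dots> = \<zero>\<^bsub>M\<^esub>" using comp[OF i, of l] l smult_l_null[OF xM, of l] by simp
      finally show "(\<Oplus>\<^bsub>M\<^esub>j\<in>{..<p}. E i j \<odot>\<^bsub>M\<^esub> (D j l \<odot>\<^bsub>M\<^esub> x l)) = \<zero>\<^bsub>M\<^esub>" .
    qed auto
    finally show ?thesis using True by (simp add: dual_map_def M.finsum_zero)
  qed (simp add: dual_map_def)
qed

lemma ext_cocycles_submodule:
  assumes M: "module (ring_on A) M" and D: "\<And>j l. j < r (Suc i) \<Longrightarrow> l < r i \<Longrightarrow> D i j l \<in> A"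
  shows "submodule (ext_cocycles M r D i) (ring_on A) (power_module M (r i))"
proof -
  interpret P: module "ring_on A" "power_module M (r i)" by (rule power_module_is_module[OF M])
  interpret module "ring_on A" M by fact
  have zA: "0 \<in> A" using P.R.zero_closed by simp
  let ?d = "dual_map M (r (Suc i)) (r i) (D i)"
  have lin1: "?d (\<lambda>l\<in>{..<r i}. f l \<oplus>\<^bsub>M\<^esub> g l) = (\<lambda>j\<in>{..<r (Suc i)}. ?d f j \<oplus>\<^bsub>M\<^esub> ?d g j)"
    if "f \<in> {..<r i} \<rightarrow>\<^sub>E carrier M" "g \<in> {..<r i} \<rightarrow>\<^sub>E carrier M" for f g
    by (rule dual_map_linear(1)[OF M _ that zA]) (rule D)
  have lin2: "?d (\<lambda>l\<in>{..<r i}. a \<odot>\<^bsub>M\<^esub> f l) = (\<lambda>j\<in>{..<r (Suc i)}. a \<odot>\<^bsub>M\<^esub> ?d f j)"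
    if "f \<in> {..<r i} \<rightarrow>\<^sub>E carrier M" "a \<in> A" for f a
    by (rule dual_map_linear(2)[OF M _ that(1) that(1) that(2)]) (rule D)
  have lin3: "?d (\<lambda>l\<in>{..<r i}. \<zero>\<^bsub>M\<^esub>) = (\<lambda>j\<in>{..<r (Suc i)}. \<zero>\<^bsub>M\<^esub>)"
    if "(\<lambda>l\<in>{..<r i}. \<zero>\<^bsub>M\<^esub>) \<in> {..<r i} \<rightarrow>\<^sub>E carrier M"
    by (rule dual_map_linear(3)[OF M _ that that zA]) (rule D)
  show ?thesis
  proof (rule P.submoduleI')
    have z0: "(\<lambda>l\<in>{..<r i}. \<zero>\<^bsub>M\<^esub>) \<in> {..<r i} \<rightarrow>\<^sub>E carrier M" by auto
    show "\<zero>\<^bsub>power_module M (r i)\<^esub> \<in> ext_cocycles M r D i"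
      using lin3[OF z0] z0 unfolding ext_cocycles_def by simp
    fix f assume f: "f \<in> ext_cocycles M r D i"
    then have f': "f \<in> {..<r i} \<rightarrow>\<^sub>E carrier M" "dual_map M (r (Suc i)) (r i) (D i) f = (\<lambda>i\<in>{..<r (Suc i)}. \<zero>\<^bsub>M\<^esub>)"
      unfolding ext_cocycles_def by auto
    show "f \<oplus>\<^bsub>power_module M (r i)\<^esub> g \<in> ext_cocycles M r D i" if g: "g \<in> ext_cocycles M r D i" for g
    proof -
      have g': "g \<in> {..<r i} \<rightarrow>\<^sub>E carrier M" "dual_map M (r (Suc i)) (r i) (D i) g = (\<lambda>i\<in>{..<r (Suc i)}. \<zero>\<^bsub>M\<^esub>)"
        using g unfolding ext_cocycles_def by auto
      have "f \<oplus>\<^bsub>power_module M (r i)\<^esub> g \<in> carrier (power_module M (r i))"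
        by (rule P.M.a_closed) (use f' g' in simp_all)
      moreover have "dual_map M (r (Suc i)) (r i) (D i) (f \<oplus>\<^bsub>power_module M (r i)\<^esub> g) = (\<lambda>i\<in>{..<r (Suc i)}. \<zero>\<^bsub>M\<^esub>)"
        using lin1[OF f'(1) g'(1)] f'(2) g'(2)
        by (auto intro!: restrict_ext)
      ultimately show ?thesis unfolding ext_cocycles_def by simp
    qed
    show "a \<odot>\<^bsub>power_module M (r i)\<^esub> f \<in> ext_cocycles M r D i" if a: "a \<in> carrier (ring_on A)" for a
    proof -
      have "a \<odot>\<^bsub>power_module M (r i)\<^esub> f \<in> carrier (power_module M (r i))"
        by (rule P.smult_closed) (use a f' in simp_all)
      moreover have "dual_map M (r (Suc i)) (r i) (D i) (a \<odot>\<^bsub>power_module M (r i)\<^esub> f) = (\<lambda>i\<in>{..<r (Suc i)}. \<zero>\<^bsub>M\<^esub>)"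
        using lin2[OF f'(1), of a] a f'(2) smult_r_null[of a]
        by (auto intro!: restrict_ext)
      ultimately show ?thesis unfolding ext_cocycles_def by simp
    qed
  qed (auto simp: ext_cocycles_def)
qed

text \<open>A basis of \<open>L\<close> together with \<open>w0\<close> is independent, so values on
  it can be prescribed and extended. The functional is linear over k with no continuity claimed;
  vanishing on \<open>L\<close>, which will contain the high-order multiples of the vectors in
  question, does the work of continuity.\<close>

lemma separating_functional:
  fixes L :: "('b \<Rightarrow> 'k::field fls) set"
  assumes 0: "(\<lambda>_. 0) \<in> L" and add: "\<And>v w. v \<in> L \<Longrightarrow> w \<in> L \<Longrightarrow> (\<lambda>b. v b + w b) \<in> L"
    and sc: "\<And>c w. w \<in> L \<Longrightarrow> (\<lambda>b. fls_const c * w b) \<in> L" and w0: "w0 \<notin> L"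
  shows "\<exists>ev :: ('b \<Rightarrow> 'k fls) \<Rightarrow> 'k. (\<forall>v w. ev (\<lambda>b. v b + w b) = ev v + ev w) \<and>
    (\<forall>c w. ev (\<lambda>b. fls_const c * w b) = c * ev w) \<and> (\<forall>w\<in>L. ev w = 0) \<and> ev w0 = 1"
proof -
  let ?s = "\<lambda>(c::'k) (w :: 'b \<Rightarrow> 'k fls) b. fls_const c * w b"
  interpret V: vector_space ?s
    by unfold_locales (simp_all add: fun_eq_iff distrib_left distrib_right fls_plus_const[symmetric] flip: mult.assoc)
  interpret K: vector_space "(*) :: 'k \<Rightarrow> 'k \<Rightarrow> 'k" by unfold_locales (auto simp: algebra_simps)
  interpret VK: vector_space_pair ?s "(*)" ..
  have L: "V.subspace L"
    unfolding V.subspace_def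
  proof (intro conjI ballI allI)
    show "0 \<in> L" using 0 by (simp add: zero_fun_def)
    show "v + w \<in> L" if "v \<in> L" "w \<in> L" for v w unfolding plus_fun_def by (rule add[OF that])
    show "?s c w \<in> L" if "w \<in> L" for c w by (rule sc[OF that])
  qed
  obtain B where B: "B \<subseteq> L" "V.independent B" "L \<subseteq> V.span B" using V.basis_exists[of L] by metis
  have "V.span B \<subseteq> L" using B(1) L by (rule V.span_minimal)
  then have "w0 \<notin> V.span B" using w0 by blast
  then have "V.independent (insert w0 B)" using B(2) by (simp add: V.independent_insertI)
  then obtain ev where ev: "Vector_Spaces.linear ?s (*) ev"
    "\<forall>x\<in>insert w0 B. ev x = (if x = w0 then 1 else 0)"
    using VK.linear_independent_extend[of "insert w0 B" "\<lambda>x. if x = w0 then 1 else 0"] by blast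
  interpret l: Vector_Spaces.linear ?s "(*)" ev by (rule ev(1))
  have B0: "ev x = 0" if "x \<in> B" for x using ev(2) that B(1) w0 by auto
  have span: "ev x = 0" if "x \<in> V.span B" for x
    using VK.linear_eq_0_on_span[OF ev(1)] that B0 by blast
  show ?thesis
  proof (intro exI[of _ ev] conjI allI ballI)
    show "ev (\<lambda>b. v b + w b) = ev v + ev w" for v w using l.add[of v w] by (simp add: plus_fun_def)
    show "ev (\<lambda>b. fls_const c * w b) = c * ev w" for c w using l.scale[of c w] .
    show "ev w0 = 1" using ev(2) by simp
    show "ev w = 0" if "w \<in> L" for w using span that B(3) by blast
  qed
qed

section \<open>What Ext^0 = 0 and Ext^1 = k say about cocycles\<close>

context numerical_semigroup begin

text \<open>Ext^0 is Hom(k, M): an element z killed by \<mm> defines the 0-cocycle with entries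
  \<kappa> l z. If that cocycle is zero, an index with \<kappa> l a unit recovers z = 0.\<close>

lemma ext0_vanishes_imp:
  fixes M :: "('k::field fls, 'b, 'n) module_scheme" and D :: "nat \<Rightarrow> nat \<Rightarrow> nat \<Rightarrow> 'k fls"
  assumes M: "module R M"
    and \<kappa>: "\<And>l. l < r 0 \<Longrightarrow> \<kappa> l \<in> A" "\<exists>l<r 0. \<kappa> l \<notin> \<mm>"
    and D: "\<And>i j l. j < r (Suc i) \<Longrightarrow> l < r i \<Longrightarrow> D i j l \<in> A"
    and D\<kappa>: "\<And>j. j < r 1 \<Longrightarrow> (\<Sum>l<r 0. D 0 j l * \<kappa> l) \<in> \<mm>"
    and ext: "carrier (ext_module M r D 0) = {\<zero>\<^bsub>ext_module M r D 0\<^esub>}"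
    and z: "z \<in> carrier M" "\<And>s. s \<in> \<mm> \<Longrightarrow> s \<odot>\<^bsub>M\<^esub> z = \<zero>\<^bsub>M\<^esub>"
  shows "z = \<zero>\<^bsub>M\<^esub>"
proof -
  interpret module R M by fact
  define f where "f = (\<lambda>l\<in>{..<r 0}. \<kappa> l \<odot>\<^bsub>M\<^esub> z)"
  have \<kappa>z: "\<kappa> l \<odot>\<^bsub>M\<^esub> z \<in> carrier M" if "l < r 0" for l using \<kappa>(1)[OF that] z(1) smult_closed by simp
  have fP: "f \<in> {..<r 0} \<rightarrow>\<^sub>E carrier M" unfolding f_def using \<kappa>z by auto
  have "dual_map M (r (Suc 0)) (r 0) (D 0) f = (\<lambda>j\<in>{..<r (Suc 0)}. \<zero>\<^bsub>M\<^esub>)"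
    unfolding dual_map_def
  proof (rule restrict_ext)
    fix j assume j: "j \<in> {..<r (Suc 0)}"
    have DA: "D 0 j l * \<kappa> l \<in> A" if "l < r 0" for l
      by (rule mult_A) (use D[of j 0 l] \<kappa>(1) that j in auto)
    have "(\<Oplus>\<^bsub>M\<^esub>l\<in>{..<r 0}. D 0 j l \<odot>\<^bsub>M\<^esub> f l) = (\<Oplus>\<^bsub>M\<^esub>l\<in>{..<r 0}. (D 0 j l * \<kappa> l) \<odot>\<^bsub>M\<^esub> z)"
    proof (rule M.finsum_cong')
      fix l assume l: "l \<in> {..<r 0}"
      show "D 0 j l \<odot>\<^bsub>M\<^esub> f l = (D 0 j l * \<kappa> l) \<odot>\<^bsub>M\<^esub> z"
        using smult_assoc1[of "D 0 j l" "\<kappa> l" z] D[of j 0 l] \<kappa>(1)[of l] z(1) j l by (simp add: f_def)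
    next
      show "(\<lambda>l. (D 0 j l * \<kappa> l) \<odot>\<^bsub>M\<^esub> z) \<in> {..<r 0} \<rightarrow> carrier M"
        using DA z(1) smult_closed by simp
    qed simp
    also have "\<dots> = (\<Sum>l<r 0. D 0 j l * \<kappa> l) \<odot>\<^bsub>M\<^esub> z"
      by (rule conjunct1[OF smult_sum_left[OF M], symmetric]) (use z(1) DA in auto)
    also have "\<dots> = \<zero>\<^bsub>M\<^esub>" using z(2) D\<kappa>[of j] j by simp
    finally show "(\<Oplus>\<^bsub>M\<^esub>l\<in>{..<r 0}. D 0 j l \<odot>\<^bsub>M\<^esub> f l) = \<zero>\<^bsub>M\<^esub>" .
  qed
  then have fZ: "f \<in> ext_cocycles M r D 0" unfolding ext_cocycles_def using fP by simp
  let ?P = "power_module M (r 0)"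
  let ?Z = "?P\<lparr>carrier := ext_cocycles M r D 0\<rparr>"
  have "{\<zero>\<^bsub>?P\<^esub>} +>\<^bsub>?Z\<^esub> f \<in> carrier (ext_module M r D 0)"
    using fZ unfolding ext_module_def quotient_module_def A_RCOSETS_def' by auto
  then have "{\<zero>\<^bsub>?P\<^esub>} +>\<^bsub>?Z\<^esub> f = {\<zero>\<^bsub>?P\<^esub>}"
    unfolding ext by (simp add: ext_module_def quotient_module_def)
  moreover have "\<zero>\<^bsub>?P\<^esub> \<oplus>\<^bsub>?P\<^esub> f = f"
    using module.axioms(2)[OF power_module_is_module[OF M, of "r 0"]] fP
    by (metis abelian_group.axioms(1) abelian_monoid.l_zero power_module_simps(1))
  moreover have "\<zero>\<^bsub>?P\<^esub> \<oplus>\<^bsub>?P\<^esub> f \<in> {\<zero>\<^bsub>?P\<^esub>} +>\<^bsub>?Z\<^esub> f" by (simp add: a_r_coset_mem)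
  ultimately have f0: "f = \<zero>\<^bsub>?P\<^esub>" by (metis singletonD)
  obtain l where l: "l < r 0" "\<kappa> l \<notin> \<mm>" using \<kappa>(2) by blast
  have "\<kappa> l \<odot>\<^bsub>M\<^esub> z = \<zero>\<^bsub>M\<^esub>" using fun_cong[OF f0, of l] l(1) by (simp add: f_def)
  moreover have "\<kappa> l $$ 0 \<noteq> 0" using l \<kappa>(1) mm_iff by blast
  ultimately show "z = \<zero>\<^bsub>M\<^esub>"
    using smult_assoc1[of "inverse (\<kappa> l)" "\<kappa> l" z] inverse_A[OF \<kappa>(1)[OF l(1)]] \<kappa>(1)[OF l(1)] z(1)
      smult_one[OF z(1)] smult_r_null[of "inverse (\<kappa> l)"]
    by (cases "\<kappa> l = 0") auto
qed

declare One_nat_def [simp del]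

text \<open>Only the dimension of Ext^1 over k is extracted: it is at least 1, as there is a cocycle
  that is no coboundary, and at most 1, as any two classes are dependent. Constants suffice as
  coefficients because \<open>A\<close> acts on its residue field through constant terms.\<close>

lemma ext1_residue_field_imp:
  fixes M :: "('k::field fls, 'b, 'n) module_scheme" and D :: "nat \<Rightarrow> nat \<Rightarrow> nat \<Rightarrow> 'k fls"
  assumes M: "module R M"
    and D: "\<And>i j l. j < r (Suc i) \<Longrightarrow> l < r i \<Longrightarrow> D i j l \<in> A"
    and DD: "\<And>i l. i < r 2 \<Longrightarrow> l < r 0 \<Longrightarrow> (\<Sum>j<r 1. D 1 i j * D 0 j l) = 0"
    and iso: "module_isomorphic R (ext_module M r D 1) (residue_field_module R)"
  shows "\<exists>f\<in>ext_cocycles M r D 1. f \<notin> ext_coboundaries M r D 1"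
    and "\<And>f f'. f \<in> ext_cocycles M r D 1 \<Longrightarrow> f' \<in> ext_cocycles M r D 1 \<Longrightarrow>
      \<exists>c c'. (c \<noteq> 0 \<or> c' \<noteq> 0) \<and>
        (\<lambda>j\<in>{..<r 1}. fls_const c \<odot>\<^bsub>M\<^esub> f j \<oplus>\<^bsub>M\<^esub> fls_const c' \<odot>\<^bsub>M\<^esub> f' j) \<in> ext_coboundaries M r D 1"
proof -
  interpret module R M by fact
  let ?P = "power_module M (r 1)"
  define Z where "Z = ext_cocycles M r D 1"
  define B where "B = ext_coboundaries M r D 1"
  let ?Z = "?P\<lparr>carrier := Z\<rparr>"
  have B_def': "B = dual_map M (r 1) (r 0) (D 0) ` ({..<r 0} \<rightarrow>\<^sub>E carrier M)"
    unfolding B_def by (simp add: One_nat_def)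
  interpret P: module R ?P by (rule power_module_is_module[OF M])
  have Zsub: "submodule Z R ?P"
    unfolding Z_def by (rule ext_cocycles_submodule[OF M]) (rule D)
  interpret Z: module R ?Z by (rule submodule.submodule_is_module[OF Zsub P.module_axioms])
  have D0: "D 0 j l \<in> A" if "j < r 1" "l < r 0" for j l using D[of j 0 l] that by (simp add: One_nat_def)
  have D1: "D 1 j l \<in> A" if "j < r 2" "l < r 1" for j l using D[of j 1 l] that by (simp add: numeral_2_eq_2 One_nat_def)
  let ?d = "dual_map M (r 1) (r 0) (D 0)"
  have lin1: "?d (\<lambda>l\<in>{..<r 0}. f l \<oplus>\<^bsub>M\<^esub> g l) = (\<lambda>j\<in>{..<r 1}. ?d f j \<oplus>\<^bsub>M\<^esub> ?d g j)"
    if "f \<in> {..<r 0} \<rightarrow>\<^sub>E carrier M" "g \<in> {..<r 0} \<rightarrow>\<^sub>E carrier M" for f g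
    by (rule dual_map_linear(1)[OF M _ that zero_in_series_on]) (rule D0)
  have lin2: "?d (\<lambda>l\<in>{..<r 0}. a \<odot>\<^bsub>M\<^esub> f l) = (\<lambda>j\<in>{..<r 1}. a \<odot>\<^bsub>M\<^esub> ?d f j)"
    if "f \<in> {..<r 0} \<rightarrow>\<^sub>E carrier M" "a \<in> A" for f a
    by (rule dual_map_linear(2)[OF M _ that(1) that(1) that(2)]) (rule D0)
  have lin3: "?d (\<lambda>l\<in>{..<r 0}. \<zero>\<^bsub>M\<^esub>) = (\<lambda>j\<in>{..<r 1}. \<zero>\<^bsub>M\<^esub>)"
    if "(\<lambda>l\<in>{..<r 0}. \<zero>\<^bsub>M\<^esub>) \<in> {..<r 0} \<rightarrow>\<^sub>E carrier M"
    by (rule dual_map_linear(3)[OF M _ that that zero_in_series_on]) (rule D0)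
  have BZ: "B \<subseteq> Z"
  proof
    fix y assume "y \<in> B"
    then obtain x where x: "x \<in> {..<r 0} \<rightarrow>\<^sub>E carrier M" "y = dual_map M (r 1) (r 0) (D 0) x"
      unfolding B_def' by blast
    have "y \<in> {..<r 1} \<rightarrow>\<^sub>E carrier M" unfolding x(2) by (rule dual_map_closed[OF M _ x(1)]) (rule D0)
    moreover have "dual_map M (r 2) (r 1) (D 1) y = (\<lambda>i\<in>{..<r 2}. \<zero>\<^bsub>M\<^esub>)"
      unfolding x(2)
      by (rule dual_map_comp[OF M _ _ x(1)]) (use D0 D1 DD in auto)
    ultimately show "y \<in> Z" unfolding Z_def ext_cocycles_def by (simp add: numeral_2_eq_2 One_nat_def)
  qed
  have Bsub: "submodule B R ?Z"
  proof (rule Z.submoduleI')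
    show "B \<subseteq> carrier ?Z" using BZ by simp
    have z0: "(\<lambda>i\<in>{..<r 0}. \<zero>\<^bsub>M\<^esub>) \<in> {..<r 0} \<rightarrow>\<^sub>E carrier M" by auto
    have "dual_map M (r 1) (r 0) (D 0) (\<lambda>i\<in>{..<r 0}. \<zero>\<^bsub>M\<^esub>) = (\<lambda>i\<in>{..<r 1}. \<zero>\<^bsub>M\<^esub>)"
      by (rule lin3[OF z0])
    then have "\<zero>\<^bsub>?Z\<^esub> = dual_map M (r 1) (r 0) (D 0) (\<lambda>i\<in>{..<r 0}. \<zero>\<^bsub>M\<^esub>)" by simp
    then show "\<zero>\<^bsub>?Z\<^esub> \<in> B" unfolding B_def' using z0 by (rule image_eqI)
    fix y assume "y \<in> B"
    then obtain x where x: "x \<in> {..<r 0} \<rightarrow>\<^sub>E carrier M" "y = dual_map M (r 1) (r 0) (D 0) x"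
      unfolding B_def' by blast
    show "y \<oplus>\<^bsub>?Z\<^esub> y' \<in> B" if y': "y' \<in> B" for y'
    proof -
      obtain x' where x': "x' \<in> {..<r 0} \<rightarrow>\<^sub>E carrier M" "y' = dual_map M (r 1) (r 0) (D 0) x'"
        using y' unfolding B_def' by blast
      have "y \<oplus>\<^bsub>?Z\<^esub> y' = dual_map M (r 1) (r 0) (D 0) (\<lambda>i\<in>{..<r 0}. x i \<oplus>\<^bsub>M\<^esub> x' i)"
        unfolding lin1[OF x(1) x'(1)] x(2) x'(2) by simp
      moreover have "(\<lambda>i\<in>{..<r 0}. x i \<oplus>\<^bsub>M\<^esub> x' i) \<in> {..<r 0} \<rightarrow>\<^sub>E carrier M"
        using x(1) x'(1) by (auto simp: PiE_iff)
      ultimately show ?thesis unfolding B_def' by blast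
    qed
    show "a \<odot>\<^bsub>?Z\<^esub> y \<in> B" if a: "a \<in> carrier R" for a
    proof -
      have aA: "a \<in> A" using a by simp
      have "a \<odot>\<^bsub>?Z\<^esub> y = dual_map M (r 1) (r 0) (D 0) (\<lambda>i\<in>{..<r 0}. a \<odot>\<^bsub>M\<^esub> x i)"
        unfolding lin2[OF x(1) aA] x(2) by simp
      moreover have "(\<lambda>i\<in>{..<r 0}. a \<odot>\<^bsub>M\<^esub> x i) \<in> {..<r 0} \<rightarrow>\<^sub>E carrier M"
        using x(1) smult_closed[OF a] by (auto simp: PiE_iff)
      ultimately show ?thesis unfolding B_def' by blast
    qed
  qed
  interpret Q: submodule_quotient R ?Z B
    by (intro submodule_quotient.intro submodule_quotient_axioms.intro Z.module_axioms Bsub)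
  let ?Q = "quotient_module ?Z B"
  have Q: "ext_module M r D 1 = ?Q" unfolding ext_module_def Z_def B_def ..
  let ?k = "residue_field_module (R :: 'k fls ring)"
  obtain \<theta> where \<theta>: "\<theta> \<in> module_hom R ?Q ?k" "bij_betw \<theta> (carrier ?Q) (carrier ?k)"
    using iso unfolding Q module_isomorphic_def by blast
  have \<theta>_add: "\<theta> (x \<oplus>\<^bsub>?Q\<^esub> y) = \<theta> x \<oplus>\<^bsub>?k\<^esub> \<theta> y" if "x \<in> carrier ?Q" "y \<in> carrier ?Q" for x y
    using \<theta>(1) that unfolding module_hom_def by blast
  have \<theta>_smult: "\<theta> (a \<odot>\<^bsub>?Q\<^esub> x) = a \<odot>\<^bsub>?k\<^esub> \<theta> x" if "a \<in> A" "x \<in> carrier ?Q" for a x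
    using \<theta>(1) that unfolding module_hom_def ring_on_simps by blast
  have k: "module R ?k"
    unfolding residue_field_R by (rule submodule_quotient.quotient_is_module[OF residue_quotient])
  have \<theta>0: "\<theta> B = \<zero>\<^bsub>?k\<^esub>" using module_hom_zero[OF Q.quotient_is_module k \<theta>(1)] by simp
  have cosZ: "B +>\<^bsub>?Z\<^esub> f \<in> carrier ?Q" if "f \<in> Z" for f using that by simp
  have BQ: "B \<in> carrier ?Q"
    using module.axioms(2)[OF Q.quotient_is_module]
    by (metis Q.quotient_simps(2) abelian_group.axioms(1) abelian_monoid.zero_closed)
  have ker: "f \<in> B" if f: "f \<in> Z" "\<theta> (B +>\<^bsub>?Z\<^esub> f) = \<zero>\<^bsub>?k\<^esub>" for f
  proof -
    have "\<theta> (B +>\<^bsub>?Z\<^esub> f) = \<theta> B" using f \<theta>0 by simp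
    then have "B +>\<^bsub>?Z\<^esub> f = B" using \<theta>(2) cosZ[OF f(1)] BQ by (metis bij_betw_imp_inj_on inj_on_def)
    then show ?thesis using Q.coset_eq_N_iff[of f] f(1) by simp
  qed
  show "\<exists>f\<in>ext_cocycles M r D 1. f \<notin> ext_coboundaries M r D 1"
  proof (rule ccontr)
    assume "\<not> ?thesis"
    then have "Z \<subseteq> B" unfolding Z_def B_def by blast
    then have "carrier ?Q \<subseteq> {B}" using Q.coset_eq_N_iff by auto
    then have "\<theta> ` carrier ?Q \<subseteq> \<theta> ` {B}" by (rule image_mono)
    then have "carrier ?k \<subseteq> {\<zero>\<^bsub>?k\<^esub>}" using bij_betw_imp_surj_on[OF \<theta>(2)] \<theta>0 by simp
    moreover have "\<mm> +>\<^bsub>self_module R\<^esub> 1 \<in> carrier ?k" unfolding residue_carrier using one_A by blast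
    ultimately have "\<mm> +>\<^bsub>self_module R\<^esub> 1 = \<zero>\<^bsub>?k\<^esub>" by blast
    then show False using residue_eq_zero_iff[OF one_A] one_notin_mm by blast
  qed
  show "\<exists>c c'. (c \<noteq> 0 \<or> c' \<noteq> 0) \<and>
        (\<lambda>j\<in>{..<r 1}. fls_const c \<odot>\<^bsub>M\<^esub> f j \<oplus>\<^bsub>M\<^esub> fls_const c' \<odot>\<^bsub>M\<^esub> f' j) \<in> ext_coboundaries M r D 1"
    if f: "f \<in> ext_cocycles M r D 1" and f': "f' \<in> ext_cocycles M r D 1" for f f'
  proof -
    have fZ: "f \<in> Z" "f' \<in> Z" using f f' unfolding Z_def by auto
    have "\<theta> (B +>\<^bsub>?Z\<^esub> f) \<in> carrier ?k" "\<theta> (B +>\<^bsub>?Z\<^esub> f') \<in> carrier ?k"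
      using \<theta>(2) cosZ fZ by (metis bij_betw_apply)+
    then obtain \<alpha> \<alpha>' where \<alpha>: "\<alpha> \<in> A" "\<theta> (B +>\<^bsub>?Z\<^esub> f) = \<mm> +>\<^bsub>self_module R\<^esub> \<alpha>"
      and \<alpha>': "\<alpha>' \<in> A" "\<theta> (B +>\<^bsub>?Z\<^esub> f') = \<mm> +>\<^bsub>self_module R\<^esub> \<alpha>'"
      unfolding residue_carrier by blast
    \<comment> \<open>The condition says that the combination of the two classes maps to an element
      of \<mm>, that is, to zero in the residue field. Afterwards it is solved nontrivially: by (1,
      0) if the first constant term vanishes, and by crossing the two constant terms
      otherwise.\<close>
    have main: "(\<lambda>j\<in>{..<r 1}. fls_const c \<odot>\<^bsub>M\<^esub> f j \<oplus>\<^bsub>M\<^esub> fls_const c' \<odot>\<^bsub>M\<^esub> f' j) \<in> B"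
      if c: "c * \<alpha> $$ 0 + c' * \<alpha>' $$ 0 = 0" for c c'
    proof -
      let ?g = "fls_const c \<odot>\<^bsub>?Z\<^esub> f \<oplus>\<^bsub>?Z\<^esub> fls_const c' \<odot>\<^bsub>?Z\<^esub> f'"
      have cf: "fls_const c \<odot>\<^bsub>?Z\<^esub> f \<in> Z" "fls_const c' \<odot>\<^bsub>?Z\<^esub> f' \<in> Z"
        using Z.smult_closed[of "fls_const c" f] Z.smult_closed[of "fls_const c'" f'] fZ by auto
      have gZ: "?g \<in> Z" using Z.M.a_closed[of "fls_const c \<odot>\<^bsub>?Z\<^esub> f" "fls_const c' \<odot>\<^bsub>?Z\<^esub> f'"] cf by simp
      have eq: "B +>\<^bsub>?Z\<^esub> ?g = (fls_const c \<odot>\<^bsub>?Q\<^esub> (B +>\<^bsub>?Z\<^esub> f)) \<oplus>\<^bsub>?Q\<^esub> (fls_const c' \<odot>\<^bsub>?Q\<^esub> (B +>\<^bsub>?Z\<^esub> f'))"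
        using Q.quotient_add[of "fls_const c \<odot>\<^bsub>?Z\<^esub> f" "fls_const c' \<odot>\<^bsub>?Z\<^esub> f'"]
          Q.quotient_smult[of "fls_const c" f] Q.quotient_smult[of "fls_const c'" f'] cf fZ by simp
      have cc: "fls_const c \<odot>\<^bsub>?Q\<^esub> (B +>\<^bsub>?Z\<^esub> f) \<in> carrier ?Q" "fls_const c' \<odot>\<^bsub>?Q\<^esub> (B +>\<^bsub>?Z\<^esub> f') \<in> carrier ?Q"
        using module.smult_closed[OF Q.quotient_is_module] cosZ fZ const_A by (metis ring_on_simps(1))+
      have "\<theta> (B +>\<^bsub>?Z\<^esub> ?g) = \<theta> (fls_const c \<odot>\<^bsub>?Q\<^esub> (B +>\<^bsub>?Z\<^esub> f)) \<oplus>\<^bsub>?k\<^esub> \<theta> (fls_const c' \<odot>\<^bsub>?Q\<^esub> (B +>\<^bsub>?Z\<^esub> f'))"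
        unfolding eq by (rule \<theta>_add[OF cc])
      also have "\<theta> (fls_const c \<odot>\<^bsub>?Q\<^esub> (B +>\<^bsub>?Z\<^esub> f)) = \<mm> +>\<^bsub>self_module R\<^esub> (fls_const c * \<alpha>)"
        using \<theta>_smult[OF const_A cosZ[OF fZ(1)]] \<alpha> residue_smult[OF const_A \<alpha>(1)] by simp
      also have "\<theta> (fls_const c' \<odot>\<^bsub>?Q\<^esub> (B +>\<^bsub>?Z\<^esub> f')) = \<mm> +>\<^bsub>self_module R\<^esub> (fls_const c' * \<alpha>')"
        using \<theta>_smult[OF const_A cosZ[OF fZ(2)]] \<alpha>' residue_smult[OF const_A \<alpha>'(1)] by simp
      also have "(\<mm> +>\<^bsub>self_module R\<^esub> (fls_const c * \<alpha>)) \<oplus>\<^bsub>?k\<^esub> (\<mm> +>\<^bsub>self_module R\<^esub> (fls_const c' * \<alpha>'))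
          = \<mm> +>\<^bsub>self_module R\<^esub> (fls_const c * \<alpha> + fls_const c' * \<alpha>')"
        by (rule residue_add) (use \<alpha>(1) \<alpha>'(1) in \<open>auto intro: mult_A\<close>)
      also have "\<dots> = \<zero>\<^bsub>?k\<^esub>"
      proof -
        have s: "fls_const c * \<alpha> + fls_const c' * \<alpha>' \<in> A"
          using \<alpha>(1) \<alpha>'(1) by (intro series_on_add mult_A const_A)
        then have "fls_const c * \<alpha> + fls_const c' * \<alpha>' \<in> \<mm>" using c by (simp add: mm_iff)
        then show ?thesis using residue_eq_zero_iff[OF s] by blast
      qed
      finally have "?g \<in> B" by (rule ker[OF gZ])
      moreover have "?g = (\<lambda>j\<in>{..<r 1}. fls_const c \<odot>\<^bsub>M\<^esub> f j \<oplus>\<^bsub>M\<^esub> fls_const c' \<odot>\<^bsub>M\<^esub> f' j)"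
        by (auto intro!: restrict_ext)
      ultimately show ?thesis by simp
    qed
    show ?thesis
    proof (cases "\<alpha> $$ 0 = 0")
      case True
      then have "1 * \<alpha> $$ 0 + 0 * \<alpha>' $$ 0 = 0" by simp
      note m = main[OF this]
      show ?thesis unfolding B_def[symmetric]
        by (rule exI[of _ 1], rule exI[of _ 0], rule conjI, simp, rule m)
    next
      case False
      have "\<alpha>' $$ 0 * \<alpha> $$ 0 + - \<alpha> $$ 0 * \<alpha>' $$ 0 = 0" by simp
      note m = main[OF this]
      show ?thesis unfolding B_def[symmetric]
        by (rule exI, rule exI, rule conjI[OF _ m]) (use False in simp)
    qed
  qed
qed

declare One_nat_def [simp]

end

section \<open>Ext^1 as the socle of a quotient of a space of Laurent series\<close>

declare One_nat_def [simp del]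

text \<open>The part of a free resolution of the residue field that matters for \<open>Ext\<^sup>0\<close> and \<open>Ext\<^sup>1\<close>;
  \<open>\<kappa> l\<close> represents the image of the \<open>l\<close>-th basis vector of \<open>F\<^sub>0\<close> in the residue field.\<close>

locale resolution_data = numerical_semigroup H F for H F +
  fixes r :: "nat \<Rightarrow> nat" and D :: "nat \<Rightarrow> nat \<Rightarrow> nat \<Rightarrow> 'k::field fls" and \<kappa> :: "nat \<Rightarrow> 'k fls"
  assumes \<kappa>A: "l < r 0 \<Longrightarrow> \<kappa> l \<in> A"
    and \<kappa>_unit: "\<exists>l<r 0. \<kappa> l \<notin> \<mm>"
    and D: "j < r (Suc i) \<Longrightarrow> l < r i \<Longrightarrow> D i j l \<in> A"
    and lift0: "(\<And>l. l < r 0 \<Longrightarrow> v l \<in> A) \<Longrightarrow> (\<Sum>l<r 0. v l * \<kappa> l) \<in> \<mm> \<Longrightarrow>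
      \<exists>u. (\<forall>j<r 1. u j \<in> A) \<and> (\<forall>l<r 0. v l = (\<Sum>j<r 1. u j * D 0 j l))"
    and D\<kappa>: "j < r 1 \<Longrightarrow> (\<Sum>l<r 0. D 0 j l * \<kappa> l) \<in> \<mm>"
    and lift1: "(\<And>j. j < r 1 \<Longrightarrow> u j \<in> A) \<Longrightarrow> (\<forall>l<r 0. (\<Sum>j<r 1. u j * D 0 j l) = 0) \<Longrightarrow>
      \<exists>w. (\<forall>i<r 2. w i \<in> A) \<and> (\<forall>j<r 1. u j = (\<Sum>i<r 2. w i * D 1 i j))"
    and DD: "i < r 2 \<Longrightarrow> l < r 0 \<Longrightarrow> (\<Sum>j<r 1. D 1 i j * D 0 j l) = 0"

lemma (in numerical_semigroup) ex_resolution_data: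
  fixes D :: "nat \<Rightarrow> nat \<Rightarrow> nat \<Rightarrow> 'k::field fls"
  assumes "free_resolution R (residue_field_module R) r D g"
  shows "\<exists>\<kappa>. resolution_data H F r D \<kappa>"
proof (rule residue_resolution[OF assms], goal_cases)
  case (1 \<kappa>)
  have D\<kappa>: "(\<Sum>l<r 0. D 0 j l * \<kappa> l) \<in> \<mm>" if j: "j < r 1" for j
  proof -
    \<comment> \<open>The general statement about combinations of rows, evaluated at a unit vector,
      isolates the single row j.\<close>
    have "(\<Sum>i<r 1. (if i = j then 1 else 0) * D 0 i l) = (\<Sum>i<r 1. if i = j then D 0 i l else 0)" for l
      by (rule sum.cong) auto
    also have "\<dots> l = D 0 j l" for l using j by (simp add: sum.delta)
    finally have "(\<Sum>i<r 1. (if i = j then 1 else 0) * D 0 i l) = D 0 j l" for l .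
    then show ?thesis using 1(5)[of "\<lambda>i. if i = j then 1 else 0"] by simp
  qed
  have DD: "(\<Sum>j<r 1. D 1 i j * D 0 j l) = 0" if i: "i < r 2" and l: "l < r 0" for i l
  proof -
    have "(\<Sum>i'<r 2. (if i' = i then 1 else 0) * D 1 i' j) = (\<Sum>i'<r 2. if i' = i then D 1 i' j else 0)" for j
      by (rule sum.cong) auto
    also have "\<dots> j = D 1 i j" for j using i by (simp add: sum.delta)
    finally have "(\<Sum>i'<r 2. (if i' = i then 1 else 0) * D 1 i' j) = D 1 i j" for j .
    then show ?thesis using 1(7)[of "\<lambda>i'. if i' = i then 1 else 0" l] l by simp
  qed
  have "resolution_data H F r D \<kappa>"
    by (intro resolution_data.intro resolution_data_axioms.intro numerical_semigroup_axioms)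
      (fact 1 D\<kappa> DD)+
  then show ?case by blast
qed

text \<open>The module is identified with a lattice L in the space V of families of Laurent series.
  The common lower bound n on orders guarantees that L contains no full line over the field of
  Laurent series, which later gives injectivity of the duality map.\<close>

locale embedded_module = numerical_semigroup H F for H F +
  fixes M :: "('k::field fls, 'b, 'n) module_scheme" and \<iota> :: "'b \<Rightarrow> 'b \<Rightarrow> 'k fls" and n :: int
  assumes M: "module R M"
    and \<iota>_add: "x \<in> carrier M \<Longrightarrow> y \<in> carrier M \<Longrightarrow> \<iota> (x \<oplus>\<^bsub>M\<^esub> y) b = \<iota> x b + \<iota> y b"
    and \<iota>_smult: "r \<in> A \<Longrightarrow> x \<in> carrier M \<Longrightarrow> \<iota> (r \<odot>\<^bsub>M\<^esub> x) b = r * \<iota> x b"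
    and \<iota>_inj: "inj_on \<iota> (carrier M)"
    and \<iota>_bound: "x \<in> carrier M \<Longrightarrow> \<iota> x b \<in> series_on {n..}"
begin

interpretation module R M by (rule M)

definition L :: "('b \<Rightarrow> 'k fls) set" where "L = \<iota> ` carrier M"

text \<open>The preimage in V of the socle of V/L. In the long exact sequence of 0 \<rightarrow> L
  \<rightarrow> V \<rightarrow> V/L \<rightarrow> 0 the space V contributes neither Hom nor Ext^1
  from k, so Ext^1(k, L) is this set modulo L. The lemmas \<open>socle_nontrivial\<close> and
  \<open>socle_simple\<close> carry out the identification on the resolution.\<close>

definition socle :: "('b \<Rightarrow> 'k fls) set" where "socle = {w. \<forall>s\<in>\<mm>. (\<lambda>b. s * w b) \<in> L}"

lemma \<iota>_zero: "\<iota> \<zero>\<^bsub>M\<^esub> b = 0"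
  using \<iota>_smult[of 0 "\<zero>\<^bsub>M\<^esub>" b] smult_l_null[of "\<zero>\<^bsub>M\<^esub>"] by simp

lemma \<iota>_zero_iff: "x \<in> carrier M \<Longrightarrow> (\<And>b. \<iota> x b = 0) \<Longrightarrow> x = \<zero>\<^bsub>M\<^esub>"
  using \<iota>_inj \<iota>_zero M.zero_closed by (metis ext inj_onD)

lemma \<iota>_sum:
  assumes "\<And>i. i \<in> Y \<Longrightarrow> a i \<in> A" "\<And>i. i \<in> Y \<Longrightarrow> x i \<in> carrier M"
  shows "\<iota> (\<Oplus>\<^bsub>M\<^esub>i\<in>Y. a i \<odot>\<^bsub>M\<^esub> x i) b = (\<Sum>i\<in>Y. a i * \<iota> (x i) b)"
  using assms
proof (induction Y rule: infinite_finite_induct)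
  case (infinite Y)
  then show ?case by (simp add: M.finsum_infinite \<iota>_zero)
next
  case empty
  then show ?case by (simp add: \<iota>_zero)
next
  case (insert y Y)
  have ax: "(\<lambda>i. a i \<odot>\<^bsub>M\<^esub> x i) \<in> Y \<rightarrow> carrier M" "a y \<odot>\<^bsub>M\<^esub> x y \<in> carrier M"
    using insert.prems smult_closed by auto
  have "\<iota> (\<Oplus>\<^bsub>M\<^esub>i\<in>insert y Y. a i \<odot>\<^bsub>M\<^esub> x i) b = \<iota> (a y \<odot>\<^bsub>M\<^esub> x y) b + \<iota> (\<Oplus>\<^bsub>M\<^esub>i\<in>Y. a i \<odot>\<^bsub>M\<^esub> x i) b"
    using insert.hyps ax M.finsum_closed[OF ax(1)] by (simp add: M.finsum_insert \<iota>_add)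
  also have "\<iota> (\<Oplus>\<^bsub>M\<^esub>i\<in>Y. a i \<odot>\<^bsub>M\<^esub> x i) b = (\<Sum>i\<in>Y. a i * \<iota> (x i) b)" using insert by auto
  also have "\<iota> (a y \<odot>\<^bsub>M\<^esub> x y) b = a y * \<iota> (x y) b" using insert.prems by (simp add: \<iota>_smult)
  finally show ?case using insert.hyps by simp
qed

lemma L_zero: "(\<lambda>_. 0) \<in> L"
  unfolding L_def using \<iota>_zero M.zero_closed by (intro image_eqI[of _ _ "\<zero>\<^bsub>M\<^esub>"]) auto

lemma L_add: "v \<in> L \<Longrightarrow> w \<in> L \<Longrightarrow> (\<lambda>b. v b + w b) \<in> L"
proof -
  assume "v \<in> L" "w \<in> L"
  then obtain x y where xy: "x \<in> carrier M" "y \<in> carrier M" "v = \<iota> x" "w = \<iota> y" unfolding L_def by blast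
  then show ?thesis unfolding L_def by (intro image_eqI[of _ _ "x \<oplus>\<^bsub>M\<^esub> y"]) (auto simp: \<iota>_add)
qed

lemma L_mult: "a \<in> A \<Longrightarrow> w \<in> L \<Longrightarrow> (\<lambda>b. a * w b) \<in> L"
proof -
  assume a: "a \<in> A" and "w \<in> L"
  then obtain x where x: "x \<in> carrier M" "w = \<iota> x" unfolding L_def by blast
  then show ?thesis unfolding L_def
    using a smult_closed by (intro image_eqI[of _ _ "a \<odot>\<^bsub>M\<^esub> x"]) (auto simp: \<iota>_smult)
qed

end

locale embedded_resolution = embedded_module H F M \<iota> n + resolution_data H F r D \<kappa>
  for H F and M :: "('k::field fls, 'b, 'n) module_scheme" and \<iota> n r
    and D :: "nat \<Rightarrow> nat \<Rightarrow> nat \<Rightarrow> 'k fls" and \<kappa>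
begin

interpretation module R M by (rule M)

lemma D0: "j < r 1 \<Longrightarrow> l < r 0 \<Longrightarrow> D 0 j l \<in> A"
  using D[of j 0 l] by (simp add: One_nat_def)

lemma D1: "j < r 2 \<Longrightarrow> l < r 1 \<Longrightarrow> D 1 j l \<in> A"
  using D[of j 1 l] by (simp add: numeral_2_eq_2 One_nat_def)

text \<open>\<mm> kills the residue field, so s times a basis vector of F_0 lies in the kernel of
  the augmentation and comes from F_1.\<close>

lemma unit_lift:
  assumes "s \<in> \<mm>" "l < r 0"
  obtains u where "\<And>j. j < r 1 \<Longrightarrow> u j \<in> A"
    "\<And>l'. l' < r 0 \<Longrightarrow> (\<Sum>j<r 1. u j * D 0 j l') = (if l' = l then s else 0)"
proof -
  have sA: "s \<in> A" using assms(1) mm_subset_A by blast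
  have "(\<Sum>l'<r 0. (if l' = l then s else 0) * \<kappa> l') = (\<Sum>l'<r 0. if l' = l then s * \<kappa> l' else 0)"
    by (rule sum.cong) auto
  also have "\<dots> = s * \<kappa> l" using assms(2) by (simp add: sum.delta)
  also have "\<dots> \<in> \<mm>" using A_mm[OF \<kappa>A[OF assms(2)] assms(1)] by (simp add: mult.commute)
  finally have "\<exists>u. (\<forall>j<r 1. u j \<in> A) \<and> (\<forall>l'<r 0. (if l' = l then s else 0) = (\<Sum>j<r 1. u j * D 0 j l'))"
    by (intro lift0) (use sA in auto)
  then obtain u where u: "\<forall>j<r 1. u j \<in> A" "\<forall>l'<r 0. (if l' = l then s else 0) = (\<Sum>j<r 1. u j * D 0 j l')"
    by blast
  show ?thesis by (rule that[of u]) (use u in simp_all)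
qed

text \<open>By exactness, a combination of basis vectors of F_1 that maps to zero in F_0 comes from
  F_2, where a cocycle vanishes. Hence a cocycle is a well-defined function on the image of F_1 in
  F_0.\<close>

lemma cocycle_annihilates:
  assumes f: "f \<in> ext_cocycles M r D 1" and u: "\<And>j. j < r 1 \<Longrightarrow> u j \<in> A"
    and uD: "\<And>l. l < r 0 \<Longrightarrow> (\<Sum>j<r 1. u j * D 0 j l) = 0"
  shows "(\<Sum>j<r 1. u j * \<iota> (f j) b) = 0"
proof -
  have f': "f \<in> {..<r 1} \<rightarrow>\<^sub>E carrier M" "dual_map M (r 2) (r 1) (D 1) f = (\<lambda>i\<in>{..<r 2}. \<zero>\<^bsub>M\<^esub>)"
    using f unfolding ext_cocycles_def by (auto simp: numeral_2_eq_2 One_nat_def)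
  have fM: "f j \<in> carrier M" if "j < r 1" for j using f'(1) that by (auto simp: PiE_iff)
  have "\<exists>w. (\<forall>i<r 2. w i \<in> A) \<and> (\<forall>j<r 1. u j = (\<Sum>i<r 2. w i * D 1 i j))"
    by (rule lift1) (use u uD in auto)
  then obtain w where w: "\<forall>i<r 2. w i \<in> A" "\<forall>j<r 1. u j = (\<Sum>i<r 2. w i * D 1 i j)" by blast
  have D1f: "(\<Sum>j<r 1. D 1 i j * \<iota> (f j) b) = 0" if i: "i < r 2" for i
  proof -
    have "(\<Oplus>\<^bsub>M\<^esub>j\<in>{..<r 1}. D 1 i j \<odot>\<^bsub>M\<^esub> f j) = \<zero>\<^bsub>M\<^esub>"
      using fun_cong[OF f'(2), of i] i by (simp add: dual_map_def)
    moreover have "\<iota> (\<Oplus>\<^bsub>M\<^esub>j\<in>{..<r 1}. D 1 i j \<odot>\<^bsub>M\<^esub> f j) b = (\<Sum>j<r 1. D 1 i j * \<iota> (f j) b)"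
      by (rule \<iota>_sum) (use fM D1[OF i] in auto)
    ultimately show ?thesis using \<iota>_zero by simp
  qed
  have "(\<Sum>j<r 1. u j * \<iota> (f j) b) = (\<Sum>j<r 1. \<Sum>i<r 2. w i * (D 1 i j * \<iota> (f j) b))"
    by (rule sum.cong) (use w(2) in \<open>auto simp: sum_distrib_right mult.assoc\<close>)
  also have "\<dots> = (\<Sum>i<r 2. \<Sum>j<r 1. w i * (D 1 i j * \<iota> (f j) b))" by (rule sum.swap)
  also have "\<dots> = (\<Sum>i<r 2. w i * (\<Sum>j<r 1. D 1 i j * \<iota> (f j) b))" by (simp add: sum_distrib_left)
  also have "\<dots> = 0" using D1f by simp
  finally show ?thesis .
qed

lemma coboundaryD:
  assumes "f \<in> ext_coboundaries M r D 1"
  shows "\<exists>x. (\<forall>l<r 0. x l \<in> carrier M) \<and> (\<forall>j<r 1. \<forall>b. \<iota> (f j) b = (\<Sum>l<r 0. D 0 j l * \<iota> (x l) b))"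
proof -
  obtain x where x: "x \<in> {..<r 0} \<rightarrow>\<^sub>E carrier M" "f = dual_map M (r 1) (r 0) (D 0) x"
    using assms by (auto simp: One_nat_def)
  have xM: "x l \<in> carrier M" if "l < r 0" for l using x(1) that by (auto simp: PiE_iff)
  have "\<iota> (f j) b = (\<Sum>l<r 0. D 0 j l * \<iota> (x l) b)" if j: "j < r 1" for j b
  proof -
    have "\<iota> (\<Oplus>\<^bsub>M\<^esub>l\<in>{..<r 0}. D 0 j l \<odot>\<^bsub>M\<^esub> x l) b = (\<Sum>l<r 0. D 0 j l * \<iota> (x l) b)"
      by (rule \<iota>_sum) (use xM D0[OF j] in auto)
    then show ?thesis using j by (simp add: x(2) dual_map_def)
  qed
  then show ?thesis using xM by blast
qed

lemma coboundaryI: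
  assumes f: "f \<in> {..<r 1} \<rightarrow>\<^sub>E carrier M" and x: "\<And>l. l < r 0 \<Longrightarrow> x l \<in> carrier M"
    and eq: "\<And>j b. j < r 1 \<Longrightarrow> \<iota> (f j) b = (\<Sum>l<r 0. D 0 j l * \<iota> (x l) b)"
  shows "f \<in> ext_coboundaries M r D 1"
proof -
  let ?x = "\<lambda>l\<in>{..<r 0}. x l"
  have "f = dual_map M (r 1) (r 0) (D 0) ?x"
  proof
    fix j
    show "f j = dual_map M (r 1) (r 0) (D 0) ?x j"
    proof (cases "j < r 1")
      case True
      let ?y = "\<Oplus>\<^bsub>M\<^esub>l\<in>{..<r 0}. D 0 j l \<odot>\<^bsub>M\<^esub> ?x l"
      have yM: "?y \<in> carrier M"
        using x D0[OF True] smult_closed by (intro M.finsum_closed) auto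
      have "\<iota> ?y b = (\<Sum>l<r 0. D 0 j l * \<iota> (?x l) b)" for b
        by (rule \<iota>_sum) (use x D0[OF True] in auto)
      then have "\<iota> ?y b = \<iota> (f j) b" for b using eq[OF True] by simp
      moreover have "f j \<in> carrier M" using f True by (auto simp: PiE_iff)
      ultimately have "?y = f j" using \<iota>_inj yM by (metis ext inj_onD)
      then show ?thesis using True by (simp add: dual_map_def)
    next
      case False
      then show ?thesis using f by (simp add: dual_map_def PiE_iff extensional_def)
    qed
  qed
  moreover have "?x \<in> carrier (power_module M (r 0))" using x by auto
  ultimately have "f \<in> dual_map M (r 1) (r 0) (D 0) ` carrier (power_module M (r 0))"
    by (rule image_eqI)
  then show ?thesis by (simp add: One_nat_def)
qed

text \<open>A cocycle is a function on the image of F_1 in F_0, and that image contains \<tau> times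
  every basis vector; dividing by \<tau> extends the cocycle to F_0 with values y l in V. These
  values lie in the socle. If the socle were inside L, they would come from the module and exhibit
  the cocycle as a coboundary.\<close>

lemma socle_nontrivial:
  assumes "f \<in> ext_cocycles M r D 1" "f \<notin> ext_coboundaries M r D 1"
  shows "\<exists>w\<in>socle. w \<notin> L"
proof (rule ccontr)
  assume neg: "\<not> ?thesis"
  have f': "f \<in> {..<r 1} \<rightarrow>\<^sub>E carrier M" using assms(1) unfolding ext_cocycles_def by auto
  have fM: "f j \<in> carrier M" if "j < r 1" for j using f' that by (auto simp: PiE_iff)
  \<comment> \<open>Any nonzero element of \<mm> serves as the common denominator.\<close>
  define \<tau> :: "'k fls" where "\<tau> = fls_mono (F + 2)"
  have \<tau>: "\<tau> \<in> \<mm>" "\<tau> \<noteq> 0" "\<tau> \<in> A" unfolding \<tau>_def using mm_nonzero mm_subset_A by auto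
  have "\<exists>u. (\<forall>j<r 1. u j \<in> A) \<and> (\<forall>l'<r 0. (\<Sum>j<r 1. u j * D 0 j l') = (if l' = l then \<tau> else 0))"
    if "l < r 0" for l using unit_lift[OF \<tau>(1) that] by metis
  then obtain u where uA: "\<And>l j. l < r 0 \<Longrightarrow> j < r 1 \<Longrightarrow> u l j \<in> A"
    and u: "\<And>l l'. l < r 0 \<Longrightarrow> l' < r 0 \<Longrightarrow> (\<Sum>j<r 1. u l j * D 0 j l') = (if l' = l then \<tau> else 0)"
    by metis
  define y where "y l b = (\<Sum>j<r 1. u l j * \<iota> (f j) b) / \<tau>" for l b
  have ys: "y l \<in> socle" if l: "l < r 0" for l
    unfolding socle_def
  proof (rule CollectI, rule ballI)
    fix s :: "'k fls" assume s: "s \<in> \<mm>"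
    then have sA: "s \<in> A" using mm_subset_A by blast
    obtain v where vA: "\<And>j. j < r 1 \<Longrightarrow> v j \<in> A"
      and v: "\<And>l'. l' < r 0 \<Longrightarrow> (\<Sum>j<r 1. v j * D 0 j l') = (if l' = l then s else 0)"
      using unit_lift[OF s l] by metis
    \<comment> \<open>Both \<tau> v and s u map to s \<tau> times the l-th basis vector of F_0, so
      the cocycle cannot distinguish them; after division by \<tau>, s times y l is a value of the
      cocycle on F_1 and thus lies in L.\<close>
    have "(\<Sum>j<r 1. (\<tau> * v j - s * u l j) * \<iota> (f j) b) = 0" for b
    proof (rule cocycle_annihilates[OF assms(1)])
      show "\<tau> * v j - s * u l j \<in> A" if "j < r 1" for j
        using \<tau>(3) vA[OF that] sA uA[OF l that] by (intro series_on_diff mult_A)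
      fix l' assume l': "l' < r 0"
      have "(\<Sum>j<r 1. (\<tau> * v j - s * u l j) * D 0 j l')
          = \<tau> * (\<Sum>j<r 1. v j * D 0 j l') - s * (\<Sum>j<r 1. u l j * D 0 j l')"
        by (simp add: sum_distrib_left left_diff_distrib sum_subtractf mult.assoc)
      then show "(\<Sum>j<r 1. (\<tau> * v j - s * u l j) * D 0 j l') = 0"
        using v[OF l'] u[OF l l'] by simp
    qed
    then have eq: "\<tau> * (\<Sum>j<r 1. v j * \<iota> (f j) b) = s * (\<Sum>j<r 1. u l j * \<iota> (f j) b)" for b
      by (simp add: sum_distrib_left left_diff_distrib sum_subtractf mult.assoc)
    have "s * y l b = (\<Sum>j<r 1. v j * \<iota> (f j) b)" for b
    proof -
      have "s * y l b = (s * (\<Sum>j<r 1. u l j * \<iota> (f j) b)) / \<tau>" by (simp add: y_def)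
      also have "\<dots> = (\<tau> * (\<Sum>j<r 1. v j * \<iota> (f j) b)) / \<tau>" by (simp only: eq)
      also have "\<dots> = (\<Sum>j<r 1. v j * \<iota> (f j) b)" using \<tau>(2) by simp
      finally show ?thesis .
    qed
    moreover have "\<iota> (\<Oplus>\<^bsub>M\<^esub>j\<in>{..<r 1}. v j \<odot>\<^bsub>M\<^esub> f j) b = (\<Sum>j<r 1. v j * \<iota> (f j) b)" for b
      by (rule \<iota>_sum) (use fM vA in auto)
    ultimately have "(\<lambda>b. s * y l b) = \<iota> (\<Oplus>\<^bsub>M\<^esub>j\<in>{..<r 1}. v j \<odot>\<^bsub>M\<^esub> f j)" by (intro ext) simp
    moreover have "(\<Oplus>\<^bsub>M\<^esub>j\<in>{..<r 1}. v j \<odot>\<^bsub>M\<^esub> f j) \<in> carrier M"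
      using fM vA smult_closed by (intro M.finsum_closed) auto
    ultimately show "(\<lambda>b. s * y l b) \<in> L" unfolding L_def by blast
  qed
  then have "\<exists>x. x \<in> carrier M \<and> y l = \<iota> x" if "l < r 0" for l
    using neg that unfolding L_def by blast
  then obtain x where xM: "\<And>l. l < r 0 \<Longrightarrow> x l \<in> carrier M" and x: "\<And>l. l < r 0 \<Longrightarrow> y l = \<iota> (x l)"
    by metis
  have "f \<in> ext_coboundaries M r D 1"
  proof (rule coboundaryI[OF f' xM])
    fix j b assume j: "j < r 1"
    have DuA: "(\<Sum>l<r 0. D 0 j l * u l j') \<in> A" if "j' < r 1" for j'
      by (intro series_on_sum mult_A) (use D0[OF j] uA that in auto)
    \<comment> \<open>The j-th basis vector of F_1 times \<tau> has the same image in F_0 as the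
      combination of the lifts u l with coefficients D 0 j l. Comparing the values of the cocycle
      expresses f j through the y l.\<close>
    have "(\<Sum>j'<r 1. ((if j' = j then \<tau> else 0) - (\<Sum>l<r 0. D 0 j l * u l j')) * \<iota> (f j') b) = 0"
    proof (rule cocycle_annihilates[OF assms(1)])
      show "(if j' = j then \<tau> else 0) - (\<Sum>l<r 0. D 0 j l * u l j') \<in> A" if "j' < r 1" for j'
        by (intro series_on_diff DuA[OF that]) (use \<tau>(3) in simp)
      fix l' assume l': "l' < r 0"
      have "(\<Sum>j'<r 1. ((if j' = j then \<tau> else 0) - (\<Sum>l<r 0. D 0 j l * u l j')) * D 0 j' l')
        = (\<Sum>j'<r 1. (if j' = j then \<tau> * D 0 j' l' else 0)) - (\<Sum>j'<r 1. \<Sum>l<r 0. D 0 j l * (u l j' * D 0 j' l'))"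
        unfolding sum_subtractf[symmetric]
        by (rule sum.cong) (auto simp: left_diff_distrib sum_distrib_right mult.assoc)
      also have "(\<Sum>j'<r 1. (if j' = j then \<tau> * D 0 j' l' else 0)) = \<tau> * D 0 j l'"
        using j by (simp add: sum.delta)
      also have "(\<Sum>j'<r 1. \<Sum>l<r 0. D 0 j l * (u l j' * D 0 j' l')) = (\<Sum>l<r 0. \<Sum>j'<r 1. D 0 j l * (u l j' * D 0 j' l'))"
        by (rule sum.swap)
      also have "\<dots> = (\<Sum>l<r 0. D 0 j l * (\<Sum>j'<r 1. u l j' * D 0 j' l'))" by (simp add: sum_distrib_left)
      also have "\<dots> = (\<Sum>l<r 0. if l = l' then D 0 j l * \<tau> else 0)"
        by (rule sum.cong) (use u l' in auto)
      also have "\<dots> = D 0 j l' * \<tau>" using l' by (simp add: sum.delta)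
      finally show "(\<Sum>j'<r 1. ((if j' = j then \<tau> else 0) - (\<Sum>l<r 0. D 0 j l * u l j')) * D 0 j' l') = 0"
        by simp
    qed
    also have "(\<Sum>j'<r 1. ((if j' = j then \<tau> else 0) - (\<Sum>l<r 0. D 0 j l * u l j')) * \<iota> (f j') b)
        = (\<Sum>j'<r 1. (if j' = j then \<tau> * \<iota> (f j') b else 0)) - (\<Sum>j'<r 1. \<Sum>l<r 0. D 0 j l * (u l j' * \<iota> (f j') b))"
      unfolding sum_subtractf[symmetric]
      by (rule sum.cong) (auto simp: left_diff_distrib sum_distrib_right mult.assoc)
    also have "(\<Sum>j'<r 1. (if j' = j then \<tau> * \<iota> (f j') b else 0)) = \<tau> * \<iota> (f j) b"
      using j by (simp add: sum.delta)
    also have "(\<Sum>j'<r 1. \<Sum>l<r 0. D 0 j l * (u l j' * \<iota> (f j') b)) = (\<Sum>l<r 0. \<Sum>j'<r 1. D 0 j l * (u l j' * \<iota> (f j') b))"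
      by (rule sum.swap)
    also have "\<dots> = (\<Sum>l<r 0. \<tau> * (D 0 j l * \<iota> (x l) b))"
    proof (rule sum.cong)
      fix l assume l: "l \<in> {..<r 0}"
      have "(\<Sum>j'<r 1. u l j' * \<iota> (f j') b) = \<tau> * \<iota> (x l) b"
        using fun_cong[OF x, of l b] l \<tau>(2) unfolding y_def by (auto simp: field_simps)
      then show "(\<Sum>j'<r 1. D 0 j l * (u l j' * \<iota> (f j') b)) = \<tau> * (D 0 j l * \<iota> (x l) b)"
        by (simp only: sum_distrib_left[symmetric] mult.left_commute[of \<tau>])
    qed simp
    also have "\<dots> = \<tau> * (\<Sum>l<r 0. D 0 j l * \<iota> (x l) b)" by (simp add: sum_distrib_left)
    finally show "\<iota> (f j) b = (\<Sum>l<r 0. D 0 j l * \<iota> (x l) b)" using \<tau>(2) by simp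
  qed
  then show False using assms(2) by simp
qed

text \<open>A socle vector w defines the V-valued 0-cochain \<kappa> l w. Its coboundary \<rho> j w
  has values in L since \<rho> j is in \<mm>, so it is a cocycle of the module. A dependence between
  two such cocycles modulo coboundaries pulls back to a dependence between the vectors modulo L,
  because some \<kappa> l is a unit.\<close>

lemma socle_simple:
  assumes E2: "\<And>f f'. f \<in> ext_cocycles M r D 1 \<Longrightarrow> f' \<in> ext_cocycles M r D 1 \<Longrightarrow>
      \<exists>c c'. (c \<noteq> 0 \<or> c' \<noteq> 0) \<and>
        (\<lambda>j\<in>{..<r 1}. fls_const c \<odot>\<^bsub>M\<^esub> f j \<oplus>\<^bsub>M\<^esub> fls_const c' \<odot>\<^bsub>M\<^esub> f' j) \<in> ext_coboundaries M r D 1"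
    and w: "w \<in> socle" "w' \<in> socle"
  shows "\<exists>c c'. (c \<noteq> 0 \<or> c' \<noteq> 0) \<and> (\<lambda>b. fls_const c * w b + fls_const c' * w' b) \<in> L"
proof -
  define \<rho> where "\<rho> j = (\<Sum>l<r 0. D 0 j l * \<kappa> l)" for j
  have D1\<rho>: "(\<Sum>j<r 1. D 1 i j * \<rho> j) = 0" if i: "i < r 2" for i
  proof -
    have "(\<Sum>j<r 1. D 1 i j * \<rho> j) = (\<Sum>j<r 1. \<Sum>l<r 0. D 1 i j * D 0 j l * \<kappa> l)"
      unfolding \<rho>_def by (simp add: sum_distrib_left mult.assoc)
    also have "\<dots> = (\<Sum>l<r 0. \<Sum>j<r 1. D 1 i j * D 0 j l * \<kappa> l)" by (rule sum.swap)
    also have "\<dots> = (\<Sum>l<r 0. (\<Sum>j<r 1. D 1 i j * D 0 j l) * \<kappa> l)" by (simp add: sum_distrib_right)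
    also have "\<dots> = 0" using DD[OF i] by simp
    finally show ?thesis .
  qed
  have "\<exists>f\<in>ext_cocycles M r D 1. \<forall>j<r 1. \<forall>b. \<iota> (f j) b = \<rho> j * w b" if w: "w \<in> socle" for w
  proof -
    have "\<exists>z. z \<in> carrier M \<and> (\<lambda>b. \<rho> j * w b) = \<iota> z" if "j < r 1" for j
      using w D\<kappa>[OF that] unfolding socle_def L_def \<rho>_def by blast
    then obtain f where fM: "\<And>j. j < r 1 \<Longrightarrow> f j \<in> carrier M"
      and f: "\<And>j. j < r 1 \<Longrightarrow> (\<lambda>b. \<rho> j * w b) = \<iota> (f j)" by metis
    let ?f = "\<lambda>j\<in>{..<r 1}. f j"
    have "(\<Oplus>\<^bsub>M\<^esub>j\<in>{..<r 1}. D 1 i j \<odot>\<^bsub>M\<^esub> ?f j) = \<zero>\<^bsub>M\<^esub>" if i: "i < r 2" for i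
    proof (rule \<iota>_zero_iff)
      show "(\<Oplus>\<^bsub>M\<^esub>j\<in>{..<r 1}. D 1 i j \<odot>\<^bsub>M\<^esub> ?f j) \<in> carrier M"
        using fM D1[OF i] smult_closed by (intro M.finsum_closed) auto
      fix b
      have "\<iota> (\<Oplus>\<^bsub>M\<^esub>j\<in>{..<r 1}. D 1 i j \<odot>\<^bsub>M\<^esub> ?f j) b = (\<Sum>j<r 1. D 1 i j * \<iota> (?f j) b)"
        by (rule \<iota>_sum) (use fM D1[OF i] in auto)
      also have "\<dots> = (\<Sum>j<r 1. D 1 i j * \<rho> j * w b)"
        by (rule sum.cong) (use f[symmetric] in \<open>auto simp: mult.assoc\<close>)
      also have "\<dots> = (\<Sum>j<r 1. D 1 i j * \<rho> j) * w b" by (simp add: sum_distrib_right)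
      finally show "\<iota> (\<Oplus>\<^bsub>M\<^esub>j\<in>{..<r 1}. D 1 i j \<odot>\<^bsub>M\<^esub> ?f j) b = 0" using D1\<rho>[OF i] by simp
    qed
    then have "dual_map M (r (Suc 1)) (r 1) (D 1) ?f = (\<lambda>i\<in>{..<r (Suc 1)}. \<zero>\<^bsub>M\<^esub>)"
      unfolding dual_map_def by (intro restrict_ext) (simp add: numeral_2_eq_2 One_nat_def)
    then have "?f \<in> ext_cocycles M r D 1" unfolding ext_cocycles_def using fM by auto
    moreover have "\<iota> (?f j) b = \<rho> j * w b" if "j < r 1" for j b
      using fun_cong[OF f[OF that], of b] that by simp
    ultimately show ?thesis by blast
  qed
  note ex = this
  obtain f where f: "f \<in> ext_cocycles M r D 1" and f2: "\<forall>j<r 1. \<forall>b. \<iota> (f j) b = \<rho> j * w b"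
    using ex[OF w(1)] by blast
  obtain f' where f': "f' \<in> ext_cocycles M r D 1" and f'2: "\<forall>j<r 1. \<forall>b. \<iota> (f' j) b = \<rho> j * w' b"
    using ex[OF w(2)] by blast
  have fM: "f j \<in> carrier M" "f' j \<in> carrier M" if "j < r 1" for j
    using f f' that unfolding ext_cocycles_def by (auto simp: PiE_iff)
  obtain c c' where c: "c \<noteq> 0 \<or> c' \<noteq> 0"
    and g: "(\<lambda>j\<in>{..<r 1}. fls_const c \<odot>\<^bsub>M\<^esub> f j \<oplus>\<^bsub>M\<^esub> fls_const c' \<odot>\<^bsub>M\<^esub> f' j) \<in> ext_coboundaries M r D 1"
    using E2[OF f f'] by blast
  define Y where "Y b = fls_const c * w b + fls_const c' * w' b" for b
  let ?g = "\<lambda>j\<in>{..<r 1}. fls_const c \<odot>\<^bsub>M\<^esub> f j \<oplus>\<^bsub>M\<^esub> fls_const c' \<odot>\<^bsub>M\<^esub> f' j"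
  obtain x where xM': "\<forall>l<r 0. x l \<in> carrier M"
    and x': "\<forall>j<r 1. \<forall>b. \<iota> (?g j) b = (\<Sum>l<r 0. D 0 j l * \<iota> (x l) b)"
    using coboundaryD[OF g] by blast
  have xM: "x l \<in> carrier M" if "l < r 0" for l using xM' that by blast
  have x: "\<iota> (?g j) b = (\<Sum>l<r 0. D 0 j l * \<iota> (x l) b)" if "j < r 1" for j b using x' that by blast
  have eq: "(\<Sum>l<r 0. D 0 j l * (\<kappa> l * Y b - \<iota> (x l) b)) = 0" if j: "j < r 1" for j b
  proof -
    have cM: "fls_const c \<odot>\<^bsub>M\<^esub> f j \<in> carrier M" "fls_const c' \<odot>\<^bsub>M\<^esub> f' j \<in> carrier M"
      by (rule smult_closed; use fM[OF j] in simp)+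
    have "(\<Sum>l<r 0. D 0 j l * \<iota> (x l) b) = fls_const c * (\<rho> j * w b) + fls_const c' * (\<rho> j * w' b)"
      using x[OF j, of b] j cM fM[OF j] f2 f'2 by (simp add: \<iota>_add \<iota>_smult)
    also have "\<dots> = \<rho> j * Y b" unfolding Y_def by (simp add: algebra_simps)
    also have "\<dots> = (\<Sum>l<r 0. D 0 j l * (\<kappa> l * Y b))"
      unfolding \<rho>_def by (simp add: sum_distrib_right mult.assoc)
    finally show ?thesis by (simp add: right_diff_distrib sum_subtractf)
  qed
  obtain l where l: "l < r 0" "\<kappa> l \<notin> \<mm>" using \<kappa>_unit by blast
  then have \<kappa>0: "\<kappa> l $$ 0 \<noteq> 0" using \<kappa>A mm_iff by blast
  define \<tau> :: "'k fls" where "\<tau> = fls_mono (F + 2)"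
  have \<tau>: "\<tau> \<in> \<mm>" "\<tau> \<noteq> 0" unfolding \<tau>_def using mm_nonzero by auto
  \<comment> \<open>The lift of \<tau> times the l-th basis vector is used to cancel the matrix D 0
    from the equations \<open>eq\<close>.\<close>
  obtain u where u: "\<And>l'. l' < r 0 \<Longrightarrow> (\<Sum>j<r 1. u j * D 0 j l') = (if l' = l then \<tau> else 0)"
    using unit_lift[OF \<tau>(1) l(1)] by metis
  have "\<kappa> l * Y b = \<iota> (x l) b" for b
  proof -
    have "0 = (\<Sum>j<r 1. u j * (\<Sum>l<r 0. D 0 j l * (\<kappa> l * Y b - \<iota> (x l) b)))" using eq by simp
    also have "\<dots> = (\<Sum>j<r 1. \<Sum>l<r 0. (u j * D 0 j l) * (\<kappa> l * Y b - \<iota> (x l) b))"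
      by (simp add: sum_distrib_left mult.assoc)
    also have "\<dots> = (\<Sum>l<r 0. \<Sum>j<r 1. (u j * D 0 j l) * (\<kappa> l * Y b - \<iota> (x l) b))" by (rule sum.swap)
    also have "\<dots> = (\<Sum>l<r 0. (\<Sum>j<r 1. u j * D 0 j l) * (\<kappa> l * Y b - \<iota> (x l) b))"
      by (simp add: sum_distrib_right)
    also have "\<dots> = (\<Sum>l'<r 0. if l' = l then \<tau> * (\<kappa> l' * Y b - \<iota> (x l') b) else 0)"
    proof (rule sum.cong)
      fix l' assume "l' \<in> {..<r 0}"
      then show "(\<Sum>j<r 1. u j * D 0 j l') * (\<kappa> l' * Y b - \<iota> (x l') b)
          = (if l' = l then \<tau> * (\<kappa> l' * Y b - \<iota> (x l') b) else 0)"
        using u[of l'] by (cases "l' = l") simp_all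
    qed simp
    also have "\<dots> = \<tau> * (\<kappa> l * Y b - \<iota> (x l) b)" using l(1) by (simp add: sum.delta)
    finally show ?thesis using \<tau>(2) by simp
  qed
  then have "Y b = inverse (\<kappa> l) * \<iota> (x l) b" for b
    using \<kappa>0 by (metis fls_zero_nth left_inverse mult.assoc mult_1)
  then have "Y = (\<lambda>b. inverse (\<kappa> l) * \<iota> (x l) b)" by blast
  moreover have "\<iota> (x l) \<in> L" unfolding L_def using xM[OF l(1)] by blast
  ultimately have "Y \<in> L" using L_mult[OF inverse_A[OF \<kappa>A[OF l(1)] \<kappa>0], of "\<iota> (x l)"] by simp
  then show ?thesis using c unfolding Y_def by blast
qed

end

declare One_nat_def [simp]

section \<open>The canonical module\<close>

context numerical_semigroup begin

text \<open>Take the largest h in H whose monomial is outside \<open>J\<close>; it exists because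
  \<open>J\<close> contains a tail. Adding a positive element of H leads past h, hence into
  \<open>J\<close>.\<close>

lemma socle_exists:
  fixes J :: "'k::field fls set"
  assumes J: "ksubspace J" "series_on {n..} \<subseteq> J" "1 \<notin> J"
  shows "\<exists>h\<in>H. fls_mono h \<notin> J \<and> (\<forall>s\<in>\<mm>. s * fls_mono h \<in> J)"
proof -
  define S where "S = {h\<in>H. (fls_mono h :: 'k fls) \<notin> J}"
  have "S \<subseteq> {0..<n}"
  proof
    fix h assume h: "h \<in> S"
    then have "\<not> n \<le> h" using J(2) unfolding S_def by (auto simp: subset_iff)
    then show "h \<in> {0..<n}" using h nonneg unfolding S_def by auto
  qed
  then have fin: "finite S" by (rule finite_subset) simp
  have "0 \<in> S" unfolding S_def using zero_in J(3) by simp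
  then have "S \<noteq> {}" by blast
  then have max: "Max S \<in> S" "\<And>h. h \<in> S \<Longrightarrow> h \<le> Max S" using fin by auto
  have "s * fls_mono (Max S) \<in> J" if s: "s \<in> \<mm>" for s
  proof (rule ksubspace_memI[OF J(1,2)])
    fix i assume "i < n" "(s * fls_mono (Max S)) $$ i \<noteq> 0"
    then have "s $$ (i - Max S) \<noteq> 0" by simp
    then have "i - Max S \<in> H - {0}" by (rule series_onD[OF s])
    then have "i - Max S \<in> H" "i - Max S > 0" using nonneg[of "i - Max S"] by auto
    then have "i \<in> H" "i \<notin> S" using add_in[of "i - Max S" "Max S"] max unfolding S_def by force+
    then show "fls_mono i \<in> J" unfolding S_def by simp
  qed
  then show ?thesis using max(1) unfolding S_def by blast
qed

text \<open>\<open>\<omega>\<close> is the standard canonical fractional ideal.\<close>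

abbreviation \<omega> :: "'k::field fls set" where "\<omega> \<equiv> series_on {j. F - j \<notin> H}"

end

context embedded_module begin

interpretation module R M by (rule M)

text \<open>The duality map. \<Phi> w is the series that represents the functional f \<mapsto> ev (f
  w) through the coefficient at F of the product. A vector w of L makes this functional vanish on
  all of \<open>A\<close>, so \<Phi> w has no coefficient at F - h for h in H, which means \<Phi> w
  \<in> \<omega>. The converse is where simplicity of the socle enters.\<close>

lemma canonical_embedding:
  assumes w0: "w0 \<in> socle" "w0 \<notin> L"
    and simple: "\<And>w w'. w \<in> socle \<Longrightarrow> w' \<in> socle \<Longrightarrow>
      \<exists>c c'. (c \<noteq> 0 \<or> c' \<noteq> 0) \<and> (\<lambda>b. fls_const c * w b + fls_const c' * w' b) \<in> L"
  shows "\<exists>\<Psi>. (\<forall>x\<in>carrier M. \<forall>y\<in>carrier M. \<Psi> (x \<oplus>\<^bsub>M\<^esub> y) = \<Psi> x + \<Psi> y) \<and>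
    (\<forall>r\<in>A. \<forall>x\<in>carrier M. \<Psi> (r \<odot>\<^bsub>M\<^esub> x) = r * \<Psi> x) \<and> bij_betw \<Psi> (carrier M) \<omega>"
proof -
  have Lsc: "(\<lambda>b. fls_const c * w b) \<in> L" if "w \<in> L" for c w by (rule L_mult[OF const_A that])
  obtain ev :: "('b \<Rightarrow> 'k fls) \<Rightarrow> 'k" where ev: "(\<forall>v w. ev (\<lambda>b. v b + w b) = ev v + ev w) \<and>
    (\<forall>c w. ev (\<lambda>b. fls_const c * w b) = c * ev w) \<and> (\<forall>w\<in>L. ev w = 0) \<and> ev w0 = 1"
    using separating_functional[of L w0, OF L_zero L_add Lsc w0(2)] by blast
  note ev_add = ev[THEN conjunct1, THEN spec, THEN spec]
    and ev_sc = ev[THEN conjunct2, THEN conjunct1, THEN spec, THEN spec]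
    and ev_L = ev[THEN conjunct2, THEN conjunct2, THEN conjunct1, THEN bspec]
    and ev_w0 = ev[THEN conjunct2, THEN conjunct2, THEN conjunct2]
  \<comment> \<open>The vectors that all series of high order move into L. On these f \<mapsto> ev
    (f w) vanishes on a tail, so finitely many coefficients of f decide its value and a Laurent
    series can represent it.\<close>
  define QL where "QL = {w :: 'b \<Rightarrow> 'k fls. \<exists>m. \<forall>f\<in>series_on {m..}. (\<lambda>b. f * w b) \<in> L}"
  have QL_add: "(\<lambda>b. v b + w b) \<in> QL" if vw: "v \<in> QL" "w \<in> QL" for v w
  proof -
    obtain m1 where m1: "\<forall>f\<in>series_on {m1..}. (\<lambda>b. f * v b) \<in> L" using vw(1) unfolding QL_def by blast
    obtain m2 where m2: "\<forall>f\<in>series_on {m2..}. (\<lambda>b. f * w b) \<in> L" using vw(2) unfolding QL_def by blast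
    have "(\<lambda>b. f * (v b + w b)) \<in> L" if f: "f \<in> series_on {max m1 m2..}" for f
    proof -
      have "f \<in> series_on {m1..}" "f \<in> series_on {m2..}"
        using f series_on_mono[of "{max m1 m2..}" "{m1..}"] series_on_mono[of "{max m1 m2..}" "{m2..}"] by auto
      then have "(\<lambda>b. f * v b + f * w b) \<in> L" using L_add m1 m2 by blast
      then show ?thesis by (simp add: distrib_left)
    qed
    then show ?thesis unfolding QL_def by blast
  qed
  have QL_mult: "(\<lambda>b. g * w b) \<in> QL" if w: "w \<in> QL" for w g
  proof -
    obtain m where m: "\<forall>f\<in>series_on {m..}. (\<lambda>b. f * w b) \<in> L" using w unfolding QL_def by blast
    have "(\<lambda>b. f * (g * w b)) \<in> L" if f: "f \<in> series_on {m - fls_subdegree g..}" for f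
    proof -
      have "f * g \<in> series_on {m..}" by (rule series_on_mult[OF f series_on_subdegree]) auto
      then show ?thesis using m by (simp add: mult.assoc[symmetric])
    qed
    then show ?thesis unfolding QL_def by blast
  qed
  have L_QL: "w \<in> QL" if w: "w \<in> L" for w
  proof -
    have "(\<lambda>b. f * w b) \<in> L" if "f \<in> series_on {F + 1..}" for f
      by (rule L_mult[OF subsetD[OF tail_A that] w])
    then show ?thesis unfolding QL_def by blast
  qed
  have socle_QL: "w \<in> QL" if w: "w \<in> socle" for w
  proof -
    have "(\<lambda>b. f * w b) \<in> L" if f: "f \<in> series_on {F + 2..}" for f
    proof -
      have "{F + 2..} \<subseteq> H - {0}" using above_F F_ge by auto
      then have "f \<in> \<mm>" using f series_on_mono by blast
      then show ?thesis using w unfolding socle_def by blast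
    qed
    then show ?thesis unfolding QL_def by blast
  qed
  \<comment> \<open>The index F - j is chosen so that the coefficient at F of the product of f with
    \<Phi> w becomes ev (f w), as \<open>pairing\<close> states.\<close>
  define \<Phi> where "\<Phi> w = Abs_fls (\<lambda>j. ev (\<lambda>b. fls_mono (F - j) * w b))" for w
  have \<Phi>_nth: "\<Phi> w $$ j = ev (\<lambda>b. fls_mono (F - j) * w b)" if w: "w \<in> QL" for w j
  proof -
    obtain m where m: "\<forall>f\<in>series_on {m..}. (\<lambda>b. f * w b) \<in> L" using w unfolding QL_def by blast
    have "ev (\<lambda>b. fls_mono (F - j) * w b) = 0" if "j < F - m" for j
    proof -
      have "fls_mono (F - j) \<in> series_on {m..}" using that by simp
      then show ?thesis using m ev_L by blast
    qed
    then show ?thesis unfolding \<Phi>_def by (intro nth_Abs_fls_lower_bound) blast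
  qed
  have pairing: "(f * \<Phi> w) $$ F = ev (\<lambda>b. f * w b)" if w: "w \<in> QL" for f w
  proof -
    obtain m where m: "\<forall>f\<in>series_on {m..}. (\<lambda>b. f * w b) \<in> L" using w unfolding QL_def by blast
    define d where "d = fls_subdegree f"
    define s where "s = (\<Sum>i\<in>{d..<m}. fls_const (f $$ i) * fls_mono i)"
    have t: "f - s \<in> series_on {m..}"
      using fls_split[OF series_on_subdegree, of f m] series_on_mono[of "{max d m..}" "{m..}"]
      unfolding s_def d_def by auto
    have ev_sum: "ev (\<lambda>b. (\<Sum>i\<in>I. fls_const (f $$ i) * fls_mono i) * w b) = (\<Sum>i\<in>I. f $$ i * ev (\<lambda>b. fls_mono i * w b))"
      if "finite I" for I
      using that
    proof (induction I)
      case empty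
      have "(\<lambda>b. 0) = (\<lambda>b::'b. fls_const 0 * (0 :: 'k fls))" by simp
      then have "ev (\<lambda>b. 0) = 0 * ev (\<lambda>b. 0)" using ev_sc[of 0 "\<lambda>b. 0"] by simp
      then show ?case by simp
    next
      case (insert i I)
      have "(\<lambda>b. (\<Sum>i\<in>insert i I. fls_const (f $$ i) * fls_mono i) * w b)
        = (\<lambda>b. fls_const (f $$ i) * (fls_mono i * w b) + (\<Sum>i\<in>I. fls_const (f $$ i) * fls_mono i) * w b)"
        using insert.hyps by (simp add: distrib_right mult.assoc)
      then show ?case using insert ev_add ev_sc by simp
    qed
    have "ev (\<lambda>b. f * w b) = ev (\<lambda>b. s * w b + (f - s) * w b)" by (simp add: distrib_right[symmetric])
    also have "\<dots> = ev (\<lambda>b. s * w b) + ev (\<lambda>b. (f - s) * w b)" by (rule ev_add)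
    also have "ev (\<lambda>b. (f - s) * w b) = 0" using m t ev_L by blast
    also have "ev (\<lambda>b. s * w b) = (\<Sum>i\<in>{d..<m}. f $$ i * \<Phi> w $$ (F - i))"
      unfolding s_def by (subst ev_sum) (simp_all add: \<Phi>_nth[OF w])
    finally have e1: "ev (\<lambda>b. f * w b) = (\<Sum>i\<in>{d..<m}. f $$ i * \<Phi> w $$ (F - i))" by simp
    have "(f * \<Phi> w) $$ F = (s * \<Phi> w) $$ F + ((f - s) * \<Phi> w) $$ F"
      by (simp add: fls_plus_nth[symmetric] distrib_right[symmetric])
    also have "((f - s) * \<Phi> w) $$ F = 0"
    proof (rule ccontr)
      assume "((f - s) * \<Phi> w) $$ F \<noteq> 0"
      then obtain i j where ij: "i + j = F" "(f - s) $$ i \<noteq> 0" "\<Phi> w $$ j \<noteq> 0" by (rule fls_mult_nth_nonzero)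
      then have "i \<ge> m" "j = F - i" using series_onD[OF t] by auto
      then have "(\<lambda>b. fls_mono i * w b) \<in> L" "ev (\<lambda>b. fls_mono i * w b) \<noteq> 0"
        using m ij(3) \<Phi>_nth[OF w, of j] by auto
      then show False using ev_L by blast
    qed
    also have "(s * \<Phi> w) $$ F = (\<Sum>i\<in>{d..<m}. f $$ i * \<Phi> w $$ (F - i))"
      unfolding s_def by (simp add: sum_distrib_right fls_nth_sum mult.assoc)
    finally show ?thesis using e1 by simp
  qed
  have \<Phi>_add: "\<Phi> (\<lambda>b. v b + w b) = \<Phi> v + \<Phi> w" if "v \<in> QL" "w \<in> QL" for v w
    by (rule fls_eqI) (use that in \<open>simp add: \<Phi>_nth QL_add distrib_left ev_add\<close>)
  have \<Phi>_mult: "\<Phi> (\<lambda>b. g * w b) = g * \<Phi> w" if w: "w \<in> QL" for g w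
  proof (rule fls_eqI)
    fix j
    have "\<Phi> (\<lambda>b. g * w b) $$ j = ev (\<lambda>b. (fls_mono (F - j) * g) * w b)"
      using \<Phi>_nth[OF QL_mult[OF w]] by (simp add: mult.assoc)
    also have "\<dots> = (fls_mono (F - j) * g * \<Phi> w) $$ F" using pairing[OF w] by simp
    also have "\<dots> = (g * \<Phi> w) $$ j" by (simp add: mult.assoc)
    finally show "\<Phi> (\<lambda>b. g * w b) $$ j = (g * \<Phi> w) $$ j" .
  qed
  have \<Phi>_L: "w \<in> L \<longleftrightarrow> \<Phi> w \<in> \<omega>" if w: "w \<in> QL" for w
  proof
    assume wL: "w \<in> L"
    show "\<Phi> w \<in> \<omega>"
    proof (rule series_onI)
      fix j assume "\<Phi> w $$ j \<noteq> 0"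
      then have "ev (\<lambda>b. fls_mono (F - j) * w b) \<noteq> 0" using \<Phi>_nth[OF w] by simp
      then have "(\<lambda>b. fls_mono (F - j) * w b) \<notin> L" using ev_L by blast
      then have "fls_mono (F - j) \<notin> (A :: 'k fls set)" using L_mult wL by blast
      then show "j \<in> {j. F - j \<notin> H}" by simp
    qed
  next
    assume \<Phi>w: "\<Phi> w \<in> \<omega>"
    show "w \<in> L"
    proof (rule ccontr)
      assume nL: "w \<notin> L"
      \<comment> \<open>If w is not in L, this set is a proper subspace containing a tail, and
        \<open>socle_exists\<close> yields a monomial of \<open>A\<close> that moves w into the
        socle but not into L.\<close>
      define J where "J = {f. (\<lambda>b. f * w b) \<in> L}"
      obtain m where m: "\<forall>f\<in>series_on {m..}. (\<lambda>b. f * w b) \<in> L" using w unfolding QL_def by blast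
      have "ksubspace J"
        unfolding ksubspace_def
      proof (intro conjI ballI allI)
        show "0 \<in> J" unfolding J_def using L_zero by simp
        show "x + y \<in> J" if xy: "x \<in> J" "y \<in> J" for x y
          using L_add[of "\<lambda>b. x * w b" "\<lambda>b. y * w b"] xy unfolding J_def by (simp add: distrib_right)
        show "fls_const c * x \<in> J" if x: "x \<in> J" for c x
          using Lsc[of "\<lambda>b. x * w b" c] x unfolding J_def by (simp add: mult.assoc)
      qed
      moreover have "series_on {m..} \<subseteq> J" unfolding J_def using m by blast
      moreover have "1 \<notin> J" unfolding J_def using nL by simp
      ultimately obtain h where h: "h \<in> H" "fls_mono h \<notin> J" "\<forall>s\<in>\<mm>. s * fls_mono h \<in> J"
        using socle_exists by blast
      define w1 where "w1 b = fls_mono h * w b" for b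
      have w1: "w1 \<in> socle" "w1 \<notin> L"
        using h(2,3) unfolding socle_def J_def w1_def by (auto simp: mult.assoc)
      \<comment> \<open>Since ev is 1 on w0 and 0 on w1 and vanishes on L, the coefficient of w0 in
        this relation is zero. Then w1 itself lies in L, a contradiction.\<close>
      obtain c c' where c: "c \<noteq> 0 \<or> c' \<noteq> 0" "(\<lambda>b. fls_const c * w0 b + fls_const c' * w1 b) \<in> L"
        using simple[OF w0(1) w1(1)] by blast
      have "ev w1 = 0"
      proof -
        have "F - (F - h) \<in> H" using h(1) by simp
        then have "\<Phi> w $$ (F - h) = 0" using series_on_zero[OF \<Phi>w, of "F - h"] by simp
        then show ?thesis using \<Phi>_nth[OF w, of "F - h"] unfolding w1_def by simp
      qed
      moreover have "ev (\<lambda>b. fls_const c * w0 b + fls_const c' * w1 b) = c * ev w0 + c' * ev w1"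
        unfolding ev_add[of "\<lambda>b. fls_const c * w0 b"] ev_sc ..
      ultimately have c0: "c = 0" using ev_L[OF c(2)] ev_w0 by simp
      then have c': "c' \<noteq> 0" using c(1) by simp
      have "(\<lambda>b. fls_const c' * w1 b) \<in> L" using c(2) c0 by simp
      from Lsc[OF this, of "inverse c'"] have "(\<lambda>b. fls_const (inverse c' * c') * w1 b) \<in> L"
        by (simp only: mult.assoc[symmetric] fls_const_mult_const)
      then show False using w1(2) c' by simp
    qed
  qed
  have \<Phi>_inj0: "w = (\<lambda>_. 0)" if w: "w \<in> QL" "\<Phi> w = 0" for w
  proof (rule ccontr)
    assume "w \<noteq> (\<lambda>_. 0)"
    then obtain b where b: "w b \<noteq> 0" by auto
    \<comment> \<open>If \<Phi> w = 0, every multiple of w is in L; this exponent brings the b-th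
      component to order n - 1, just below the bound for L.\<close>
    define k where "k = n - 1 - fls_subdegree (w b)"
    have "\<Phi> (\<lambda>b. fls_mono k * w b) \<in> \<omega>" using \<Phi>_mult[OF w(1)] w(2) by simp
    then have "(\<lambda>b. fls_mono k * w b) \<in> L" using \<Phi>_L[OF QL_mult[OF w(1)]] by blast
    then have "fls_mono k * w b \<in> series_on {n..}" unfolding L_def using \<iota>_bound by (auto dest: fun_cong[of _ _ b])
    then show False using b unfolding k_def by (auto simp: series_on_atLeast_iff)
  qed
  have \<iota>L: "\<iota> x \<in> L" if "x \<in> carrier M" for x unfolding L_def using that by blast
  note \<iota>Q = L_QL[OF \<iota>L]
  define \<Psi> where "\<Psi> x = \<Phi> (\<iota> x)" for x
  have add: "\<Psi> (x \<oplus>\<^bsub>M\<^esub> y) = \<Psi> x + \<Psi> y" if "x \<in> carrier M" "y \<in> carrier M" for x y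
  proof -
    have "\<iota> (x \<oplus>\<^bsub>M\<^esub> y) = (\<lambda>b. \<iota> x b + \<iota> y b)" using \<iota>_add[OF that] by blast
    then show ?thesis unfolding \<Psi>_def using \<Phi>_add[OF \<iota>Q[OF that(1)] \<iota>Q[OF that(2)]] by simp
  qed
  have mult: "\<Psi> (r \<odot>\<^bsub>M\<^esub> x) = r * \<Psi> x" if "r \<in> A" "x \<in> carrier M" for r x
  proof -
    have "\<iota> (r \<odot>\<^bsub>M\<^esub> x) = (\<lambda>b. r * \<iota> x b)" using \<iota>_smult[OF that] by blast
    then show ?thesis unfolding \<Psi>_def using \<Phi>_mult[OF \<iota>Q[OF that(2)]] by simp
  qed
  have "inj_on \<Psi> (carrier M)"
  proof (rule inj_onI)
    fix x y assume xy: "x \<in> carrier M" "y \<in> carrier M" "\<Psi> x = \<Psi> y"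
    have "\<Phi> (\<lambda>b. \<iota> x b + (- 1) * \<iota> y b) = \<Phi> (\<iota> x) + (- 1) * \<Phi> (\<iota> y)"
      using \<Phi>_add[OF \<iota>Q[OF xy(1)] QL_mult[OF \<iota>Q[OF xy(2)]], of "-1"] \<Phi>_mult[OF \<iota>Q[OF xy(2)], of "-1"] by simp
    also have "\<dots> = 0" using xy(3) unfolding \<Psi>_def by simp
    finally have "(\<lambda>b. \<iota> x b + (- 1) * \<iota> y b) = (\<lambda>_. 0)"
      by (rule \<Phi>_inj0[OF QL_add[OF \<iota>Q[OF xy(1)] QL_mult[OF \<iota>Q[OF xy(2)]]]])
    then have "\<iota> x = \<iota> y" by (auto simp: fun_eq_iff)
    then show "x = y" using \<iota>_inj xy by (auto dest: inj_onD)
  qed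
  moreover have "\<Psi> ` carrier M = \<omega>"
  proof (intro equalityI subsetI)
    fix y assume "y \<in> \<Psi> ` carrier M"
    then show "y \<in> \<omega>" unfolding \<Psi>_def using \<Phi>_L \<iota>L \<iota>Q by blast
  next
    fix y :: "'k fls" assume y: "y \<in> \<omega>"
    have w0Q: "w0 \<in> QL" by (rule socle_QL[OF w0(1)])
    have nz: "\<Phi> w0 \<noteq> 0"
    proof
      assume "\<Phi> w0 = 0"
      then have "\<Phi> w0 \<in> \<omega>" by simp
      then show False using \<Phi>_L[OF w0Q] w0(2) by blast
    qed
    \<comment> \<open>\<Phi> is linear over the whole field of Laurent series, so multiples of a
      single vector with nonzero image already reach everything.\<close>
    have eq: "\<Phi> (\<lambda>b. (y / \<Phi> w0) * w0 b) = y" unfolding \<Phi>_mult[OF w0Q] using nz by simp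
    have "\<Phi> (\<lambda>b. (y / \<Phi> w0) * w0 b) \<in> \<omega>" unfolding eq by (rule y)
    then have "(\<lambda>b. (y / \<Phi> w0) * w0 b) \<in> L" by (rule iffD2[OF \<Phi>_L[OF QL_mult[OF w0Q]]])
    then obtain x where "x \<in> carrier M" "(\<lambda>b. (y / \<Phi> w0) * w0 b) = \<iota> x" unfolding L_def by blast
    then show "y \<in> \<Psi> ` carrier M" using eq unfolding \<Psi>_def by force
  qed
  ultimately have "bij_betw \<Psi> (carrier M) \<omega>" by (simp add: bij_betw_def)
  then show ?thesis using add mult by blast
qed

end

context numerical_semigroup begin

text \<open>The annihilator of a torsion element z contains a tail. By \<open>socle_exists\<close>
  some monomial multiple of z is then nonzero and killed by \<mm>, which \<open>soc\<close>
  excludes.\<close>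

lemma torsion_free:
  fixes M :: "('k::field fls, 'b, 'n) module_scheme"
  assumes M: "module R M"
    and soc: "\<And>z. z \<in> carrier M \<Longrightarrow> (\<And>s. s \<in> \<mm> \<Longrightarrow> s \<odot>\<^bsub>M\<^esub> z = \<zero>\<^bsub>M\<^esub>) \<Longrightarrow> z = \<zero>\<^bsub>M\<^esub>"
    and rz: "r \<in> A" "z \<in> carrier M" "r \<odot>\<^bsub>M\<^esub> z = \<zero>\<^bsub>M\<^esub>"
  shows "r = 0 \<or> z = \<zero>\<^bsub>M\<^esub>"
proof (rule ccontr)
  interpret module R M by fact
  assume "\<not> ?thesis"
  then have nz: "r \<noteq> 0" "z \<noteq> \<zero>\<^bsub>M\<^esub>" by auto
  have sm: "(a * c) \<odot>\<^bsub>M\<^esub> z = a \<odot>\<^bsub>M\<^esub> (c \<odot>\<^bsub>M\<^esub> z)" if "a \<in> A" "c \<in> A" for a c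
    using smult_assoc1[of a c z] that rz(2) by simp
  define J where "J = {f\<in>A. f \<odot>\<^bsub>M\<^esub> z = \<zero>\<^bsub>M\<^esub>}"
  have "ksubspace J"
    unfolding ksubspace_def
  proof (intro conjI ballI allI)
    show "0 \<in> J" unfolding J_def using smult_l_null[OF rz(2)] by simp
    show "x + y \<in> J" if xy: "x \<in> J" "y \<in> J" for x y
      using xy smult_l_distr[of x y z] rz(2) unfolding J_def by (simp add: series_on_add)
    show "fls_const c * x \<in> J" if x: "x \<in> J" for c x
      using x sm[of "fls_const c" x] smult_r_null[of "fls_const c"] unfolding J_def by (simp add: mult_A)
  qed
  moreover have "series_on {F + 1 + fls_subdegree r..} \<subseteq> J"
  proof
    fix f :: "'k fls" assume f: "f \<in> series_on {F + 1 + fls_subdegree r..}"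
    have "f / r \<in> series_on {F + 1..}"
      using f nz(1) by (cases "f = 0") (auto simp: series_on_atLeast_iff fls_divide_subdegree)
    then have q: "f / r \<in> A" using tail_A by blast
    then have "(f / r) * r \<in> A" using rz(1) by (rule mult_A)
    moreover have "((f / r) * r) \<odot>\<^bsub>M\<^esub> z = \<zero>\<^bsub>M\<^esub>"
      using sm[OF q rz(1)] rz(3) smult_r_null[of "f / r"] q by simp
    ultimately show "f \<in> J" using nz(1) unfolding J_def by simp
  qed
  moreover have "1 \<notin> J" unfolding J_def using nz(2) smult_one[OF rz(2)] by simp
  ultimately obtain h where h: "h \<in> H" "fls_mono h \<notin> J" "\<forall>s\<in>\<mm>. s * fls_mono h \<in> J"
    using socle_exists by blast
  have hA: "fls_mono h \<in> (A :: 'k fls set)" using h(1) by simp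
  have "fls_mono h \<odot>\<^bsub>M\<^esub> z = \<zero>\<^bsub>M\<^esub>"
  proof (rule soc)
    show "fls_mono h \<odot>\<^bsub>M\<^esub> z \<in> carrier M" using hA rz(2) smult_closed by simp
    fix s :: "'k fls" assume s: "s \<in> \<mm>"
    then show "s \<odot>\<^bsub>M\<^esub> (fls_mono h \<odot>\<^bsub>M\<^esub> z) = \<zero>\<^bsub>M\<^esub>"
      using h(3) sm[OF subsetD[OF mm_subset_A s] hA] unfolding J_def by auto
  qed
  then show False using h(2) hA unfolding J_def by blast
qed

text \<open>Uniqueness of the canonical module in the form in which it is used: a canonical ideal,
  \<open>A\<close> itself in the Gorenstein case, and the abstract module of a generalized
  Gorenstein ring are all compared with the one concrete set \<omega>.\<close>

theorem canonical_module_iso: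
  fixes M :: "('k::field fls, 'b, 'n) module_scheme"
  assumes can: "canonical_module R M"
  shows "\<exists>\<Psi>. (\<forall>x\<in>carrier M. \<forall>y\<in>carrier M. \<Psi> (x \<oplus>\<^bsub>M\<^esub> y) = \<Psi> x + \<Psi> y) \<and>
    (\<forall>r\<in>A. \<forall>x\<in>carrier M. \<Psi> (r \<odot>\<^bsub>M\<^esub> x) = r * \<Psi> x) \<and> bij_betw \<Psi> (carrier M) \<omega>"
proof -
  have fg: "finitely_generated_module R M" using can unfolding canonical_module_def by blast
  then have M: "module R M" unfolding finitely_generated_module_def by blast
  interpret module R M by fact
  obtain Y where Y: "Y \<subseteq> carrier M" "finite Y" "submodule_generated R M Y = carrier M"
    using fg unfolding finitely_generated_module_def by blast
  obtain r D g where FR: "free_resolution R (residue_field_module R) r D g"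
    and ext: "\<forall>i. if enat i = krull_dim (R :: 'k fls ring)
              then module_isomorphic R (ext_module M r D i) (residue_field_module R)
              else carrier (ext_module M r D i) = {\<zero>\<^bsub>ext_module M r D i\<^esub>}"
    using can unfolding canonical_module_def by blast
  have ext0: "carrier (ext_module M r D 0) = {\<zero>\<^bsub>ext_module M r D 0\<^esub>}"
    using spec[OF ext, of 0] by (simp add: krull_dim_R enat_0)
  have ext1: "module_isomorphic R (ext_module M r D 1) (residue_field_module R)"
    using spec[OF ext, of 1] by (simp only: krull_dim_R one_enat_def[symmetric] if_True simp_thms)
  obtain \<kappa> where \<kappa>: "resolution_data H F r D \<kappa>" using ex_resolution_data[OF FR] by blast
  interpret \<kappa>: resolution_data H F r D \<kappa> by (rule \<kappa>)
  note E0 = ext0_vanishes_imp[OF M \<kappa>.\<kappa>A \<kappa>.\<kappa>_unit \<kappa>.D \<kappa>.D\<kappa> ext0]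
  have tf: "r = 0 \<or> z = \<zero>\<^bsub>M\<^esub>" if "r \<in> A" "z \<in> carrier M" "r \<odot>\<^bsub>M\<^esub> z = \<zero>\<^bsub>M\<^esub>" for r z
    by (rule torsion_free[OF M _ that]) (rule E0)
  obtain N and \<iota> :: "'b \<Rightarrow> 'b \<Rightarrow> 'k fls" and n where N: "submodule N R M" "Y \<subseteq> N"
    and \<iota>_add: "\<forall>x\<in>N. \<forall>y\<in>N. \<forall>b. \<iota> (x \<oplus>\<^bsub>M\<^esub> y) b = \<iota> x b + \<iota> y b"
    and \<iota>_smult: "\<forall>r\<in>A. \<forall>x\<in>N. \<forall>b. \<iota> (r \<odot>\<^bsub>M\<^esub> x) b = r * \<iota> x b"
    and \<iota>_inj: "inj_on \<iota> N" and \<iota>_bound: "\<forall>x\<in>N. \<forall>b. \<iota> x b \<in> series_on {n..} \<and> (b \<notin> Y \<longrightarrow> \<iota> x b = 0)"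
    using finitely_generated_embedding[OF M tf Y(2,1)] by blast
  have "carrier M \<subseteq> N" using N unfolding Y(3)[symmetric] submodule_generated_def by blast
  then have NM: "N = carrier M" using submoduleE(1)[OF N(1)] by blast
  interpret E: embedded_module H F M \<iota> n
    by (intro embedded_module.intro embedded_module_axioms.intro numerical_semigroup_axioms M)
      (use \<iota>_add \<iota>_smult \<iota>_inj \<iota>_bound in \<open>auto simp: NM\<close>)
  interpret ER: embedded_resolution H F M \<iota> n r D \<kappa> ..
  obtain f where f: "f \<in> ext_cocycles M r D 1" "f \<notin> ext_coboundaries M r D 1"
    using ext1_residue_field_imp(1)[OF M \<kappa>.D \<kappa>.DD ext1] by blast
  obtain w0 where w0: "w0 \<in> E.socle" "w0 \<notin> E.L"
    using ER.socle_nontrivial[OF f] by blast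
  show ?thesis
  proof (rule E.canonical_embedding[OF w0])
    fix w w' assume w: "w \<in> E.socle" "w' \<in> E.socle"
    show "\<exists>c c'. (c \<noteq> 0 \<or> c' \<noteq> 0) \<and> (\<lambda>b. fls_const c * w b + fls_const c' * w' b) \<in> E.L"
      by (rule ER.socle_simple[OF _ w]) (rule ext1_residue_field_imp(2)[OF M \<kappa>.D \<kappa>.DD ext1])
  qed
qed

end

section \<open>Values and length\<close>

text \<open>The zero series is removed because its \<open>fls_subdegree\<close> is 0 by convention
  and would add a spurious value.\<close>

definition vals :: "'k::field fls set \<Rightarrow> int set" where "vals W = fls_subdegree ` (W - {0})"

lemma vals_memI: "x \<in> W \<Longrightarrow> x \<noteq> 0 \<Longrightarrow> fls_subdegree x = d \<Longrightarrow> d \<in> vals W"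
  by (auto simp: vals_def)

lemma vals_memE: "d \<in> vals W \<Longrightarrow> (\<And>x. x \<in> W \<Longrightarrow> x \<noteq> 0 \<Longrightarrow> fls_subdegree x = d \<Longrightarrow> P) \<Longrightarrow> P"
  by (auto simp: vals_def)

lemma vals_mono: "W \<subseteq> W' \<Longrightarrow> vals W \<subseteq> vals W'"
  by (auto simp: vals_def)

lemma vals_series_on: "vals (series_on T) = T"
proof (intro equalityI subsetI)
  fix d assume "d \<in> vals (series_on T :: 'a fls set)"
  then show "d \<in> T" by (elim vals_memE) (auto dest: subdegree_in_series_on)
next
  fix d assume "d \<in> T"
  then show "d \<in> vals (series_on T :: 'a fls set)" by (intro vals_memI[of "fls_mono d"]) auto
qed

lemma vals_mult_image:
  fixes g :: "'k::field fls"
  assumes "g \<noteq> 0"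
  shows "vals ((*) g ` W) = (+) (fls_subdegree g) ` vals W"
proof -
  have "(*) g ` W - {0} = (*) g ` (W - {0})" using assms by auto
  then have "vals ((*) g ` W) = (\<lambda>x. fls_subdegree (g * x)) ` (W - {0})"
    unfolding vals_def by (simp add: image_image)
  also have "\<dots> = (\<lambda>x. fls_subdegree g + fls_subdegree x) ` (W - {0})"
    by (rule image_cong) (use assms in auto)
  finally show ?thesis unfolding vals_def by (simp add: image_image)
qed

text \<open>Leading terms can be cancelled until only a series of high order is left.\<close>

lemma subset_if_vals_subset:
  assumes N: "ksubspace N" and N': "ksubspace N'" and sub: "N \<subseteq> N'" and tail: "series_on {n..} \<subseteq> N"
    and vals: "vals N' \<subseteq> vals N"
  shows "N' \<subseteq> N"
proof
  fix x assume "x \<in> N'"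
  then show "x \<in> N"
  proof (induction "nat (n - fls_subdegree x)" arbitrary: x rule: less_induct)
    case less
    show ?case
    proof (cases "x = 0 \<or> n \<le> fls_subdegree x")
      case True
      then have "x \<in> series_on {n..}" by (simp add: series_on_atLeast_iff)
      then show ?thesis using tail by blast
    next
      case False
      define d where "d = fls_subdegree x"
      have "d \<in> vals N'" using less.prems False by (auto simp: d_def intro: vals_memI)
      then have "d \<in> vals N" using vals by blast
      then obtain y where y: "y \<in> N" "y \<noteq> 0" "fls_subdegree y = d" by (rule vals_memE)
      have y0: "y $$ d \<noteq> 0" using y(2,3) nth_fls_subdegree_nonzero by blast
      define x' where "x' = x - fls_const (x $$ d / y $$ d) * y"
      have x'N: "x' \<in> N'" unfolding x'_def using N' less.prems y(1) sub by (meson ksubspaceD subsetD)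
      have "x' \<in> N"
      proof (cases "x' = 0")
        case True
        then show ?thesis using ksubspaceD(1)[OF N] by simp
      next
        case nz: False
        have "d < fls_subdegree x'"
        proof (rule fls_subdegree_greaterI)
          fix k assume k: "k \<le> d"
          show "x' $$ k = 0"
          proof (cases "k = d")
            case True
            then show ?thesis unfolding x'_def using y0 by simp
          next
            case False
            then show ?thesis using k y(3) unfolding x'_def d_def by simp
          qed
        qed (rule nz)
        then show ?thesis using less.hyps[OF _ x'N] False unfolding d_def by simp
      qed
      then have "x' + fls_const (x $$ d / y $$ d) * y \<in> N" using N y(1) by (meson ksubspaceD)
      then show ?thesis unfolding x'_def by simp
    qed
  qed
qed

lemma vals_psubset:
  assumes "ksubspace N" "ksubspace N'" "N \<subset> N'" "series_on {n..} \<subseteq> N"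
  shows "vals N \<subset> vals N'"
  using subset_if_vals_subset[OF assms(1,2) _ assms(4)] vals_mono[of N N'] assms(3) by blast

lemma finite_vals_diff:
  assumes "series_on {n..} \<subseteq> N" "L \<subseteq> series_on {m..}"
  shows "finite (vals L - vals N)"
proof -
  have "vals L \<subseteq> {m..}" using vals_mono[OF assms(2)] by (simp add: vals_series_on)
  moreover have "{n..} \<subseteq> vals N" using vals_mono[OF assms(1)] by (simp add: vals_series_on)
  ultimately have "vals L - vals N \<subseteq> {m..<n}"
    by (meson DiffE atLeastLessThan_iff atLeast_iff linorder_not_le subset_iff)
  then show ?thesis by (rule finite_subset) simp
qed

lemma ksubspace_insert_line:
  assumes "ksubspace W"
  shows "ksubspace {w + fls_const c * y | w c. w \<in> W}"
  unfolding ksubspace_def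
proof (intro conjI ballI allI)
  have "0 \<in> W" by (rule ksubspaceD(1)[OF assms])
  then have "0 + fls_const 0 * y \<in> {w + fls_const c * y | w c. w \<in> W}" by blast
  then show "0 \<in> {w + fls_const c * y | w c. w \<in> W}" by simp
  fix x assume "x \<in> {w + fls_const c * y | w c. w \<in> W}"
  then obtain w c where x: "w \<in> W" "x = w + fls_const c * y" by blast
  show "x + x' \<in> {w + fls_const c * y | w c. w \<in> W}" if x': "x' \<in> {w + fls_const c * y | w c. w \<in> W}" for x'
  proof -
    obtain w' c' where x': "w' \<in> W" "x' = w' + fls_const c' * y" using x' by blast
    have "x + x' = (w + w') + fls_const (c + c') * y"
      using x x' by (simp add: algebra_simps fls_plus_const[symmetric])
    moreover have "w + w' \<in> W" using ksubspaceD(2)[OF assms] x x' by blast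
    ultimately show ?thesis by blast
  qed
  show "fls_const a * x \<in> {w + fls_const c * y | w c. w \<in> W}" for a
  proof -
    have "fls_const a * x = fls_const a * w + fls_const (a * c) * y"
      using x by (simp add: distrib_left flip: mult.assoc)
    moreover have "fls_const a * w \<in> W" using ksubspaceD(3)[OF assms] x by blast
    ultimately show ?thesis by blast
  qed
qed

text \<open>If s < s' were both new, eliminating y between the two elements that attain them would
  leave an element of W whose order is s.\<close>

lemma vals_insert_line:
  assumes W: "ksubspace W" and s: "s \<in> vals {w + fls_const c * y | w c. w \<in> W} - vals W"
    and s': "s' \<in> vals {w + fls_const c * y | w c. w \<in> W} - vals W"
  shows "s = s'"
proof -
  have *: "\<not> s < s'" if s: "s \<in> vals {w + fls_const c * y | w c. w \<in> W} - vals W"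
    and s': "s' \<in> vals {w + fls_const c * y | w c. w \<in> W} - vals W" for s s'
  proof
    assume lt: "s < s'"
    obtain w c where x: "w \<in> W" "w + fls_const c * y \<noteq> 0" "fls_subdegree (w + fls_const c * y) = s"
      using s by (auto elim!: vals_memE)
    obtain w' c' where x': "w' \<in> W" "w' + fls_const c' * y \<noteq> 0" "fls_subdegree (w' + fls_const c' * y) = s'"
      using s' by (auto elim!: vals_memE)
    have "c' \<noteq> 0"
    proof
      assume "c' = 0"
      then have "s' \<in> vals W" using x' by (intro vals_memI[of w']) auto
      then show False using s' by blast
    qed
    define z where "z = (w + fls_const c * y) - fls_const (c / c') * (w' + fls_const c' * y)"
    have "z = w - fls_const (c / c') * w'"
      unfolding z_def using \<open>c' \<noteq> 0\<close> by (simp add: distrib_left flip: mult.assoc)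
    then have zW: "z \<in> W" using W x(1) x'(1) by (simp add: ksubspaceD)
    have "z $$ s \<noteq> 0"
    proof -
      have "(w + fls_const c * y) $$ s \<noteq> 0" using x(2,3) nth_fls_subdegree_nonzero by blast
      moreover have "(w' + fls_const c' * y) $$ s = 0" using lt x'(3) fls_eq0_below_subdegree by metis
      ultimately show ?thesis unfolding z_def by (simp only: fls_minus_nth fls_const_mult_nth) simp
    qed
    moreover have "z $$ k = 0" if "k < s" for k
    proof -
      have "(w + fls_const c * y) $$ k = 0" using that x(3) fls_eq0_below_subdegree by metis
      moreover have "(w' + fls_const c' * y) $$ k = 0" using that lt x'(3) fls_eq0_below_subdegree by (metis less_trans)
      ultimately show ?thesis unfolding z_def by (simp only: fls_minus_nth fls_const_mult_nth) simp
    qed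
    ultimately have "z \<noteq> 0" "fls_subdegree z = s" by (auto intro: fls_subdegree_eqI)
    then have "s \<in> vals W" using zW by (auto intro: vals_memI)
    then show False using s by blast
  qed
  show ?thesis using *[OF s s'] *[OF s' s] by simp
qed

section \<open>Dimension counts by orders of series\<close>

definition span_mod :: "'k::field fls set \<Rightarrow> ('i \<Rightarrow> 'k fls) \<Rightarrow> 'i set \<Rightarrow> 'k fls set" where
  "span_mod W x I = {w + (\<Sum>i\<in>I. fls_const (c i) * x i) | w c. w \<in> W}"

lemma span_mod_insert:
  assumes "finite I" "i \<notin> I"
  shows "span_mod W x (insert i I) = {w + fls_const c * x i | w c. w \<in> span_mod W x I}"
proof (intro equalityI subsetI)
  fix z assume "z \<in> span_mod W x (insert i I)"
  then obtain w c where z: "w \<in> W" "z = w + (\<Sum>i\<in>insert i I. fls_const (c i) * x i)"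
    unfolding span_mod_def by blast
  then have "z = (w + (\<Sum>i\<in>I. fls_const (c i) * x i)) + fls_const (c i) * x i" using assms by simp
  then show "z \<in> {w + fls_const c * x i | w c. w \<in> span_mod W x I}" using z(1) unfolding span_mod_def by blast
next
  fix z assume "z \<in> {w + fls_const c * x i | w c. w \<in> span_mod W x I}"
  then obtain w c d where z: "w \<in> W" "z = (w + (\<Sum>i\<in>I. fls_const (c i) * x i)) + fls_const d * x i"
    unfolding span_mod_def by blast
  have "z = w + (\<Sum>j\<in>insert i I. fls_const ((c(i := d)) j) * x j)"
  proof -
    have "(\<Sum>j\<in>I. fls_const ((c(i := d)) j) * x j) = (\<Sum>j\<in>I. fls_const (c j) * x j)"
      by (rule sum.cong) (use assms in auto)
    then show ?thesis using assms z(2) by simp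
  qed
  then show "z \<in> span_mod W x (insert i I)" unfolding span_mod_def using z(1) by blast
qed

lemma span_mod_empty: "span_mod W x {} = W"
  by (auto simp: span_mod_def)

lemma ksubspace_span_mod:
  assumes "ksubspace W" "finite I"
  shows "ksubspace (span_mod W x I)"
  using assms(2)
proof (induction I)
  case (insert i I)
  show ?case unfolding span_mod_insert[OF insert.hyps] by (rule ksubspace_insert_line[OF insert.IH])
qed (simp add: span_mod_empty assms(1))

lemma subset_span_mod: "W \<subseteq> span_mod W x I"
proof
  fix w assume "w \<in> W"
  then show "w \<in> span_mod W x I"
    unfolding span_mod_def by (intro CollectI exI[of _ w] exI[of _ "\<lambda>_. 0"]) simp
qed

text \<open>Each further generator contributes at most one new value, by
  \<open>vals_insert_line\<close>.\<close>

lemma card_vals_span_mod: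
  assumes "ksubspace W" "finite I"
  shows "finite (vals (span_mod W x I) - vals W) \<and> card (vals (span_mod W x I) - vals W) \<le> card I"
  using assms(2)
proof (induction I)
  case empty
  then show ?case by (simp add: span_mod_empty)
next
  case (insert i I)
  let ?V = "vals (span_mod W x I)" and ?V' = "vals (span_mod W x (insert i I))"
  have k: "ksubspace (span_mod W x I)" by (rule ksubspace_span_mod[OF assms(1) insert.hyps(1)])
  have one: "s = s'" if "s \<in> ?V' - ?V" "s' \<in> ?V' - ?V" for s s'
    using vals_insert_line[OF k] that unfolding span_mod_insert[OF insert.hyps] by blast
  have "\<exists>a. ?V' - ?V \<subseteq> {a}"
  proof (cases "?V' - ?V = {}")
    case False
    then obtain a where "a \<in> ?V' - ?V" by blast
    then show ?thesis using one by blast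
  next
    case True
    then show ?thesis by (metis empty_subsetI)
  qed
  then obtain a where "?V' - ?V \<subseteq> {a}" by blast
  then have sub: "?V' - vals W \<subseteq> insert a (?V - vals W)" by blast
  have "card (?V' - vals W) \<le> card (insert a (?V - vals W))"
    by (rule card_mono) (use sub insert.IH in auto)
  also have "\<dots> \<le> Suc (card (?V - vals W))" by (rule card_insert_le_m1) (auto simp: insert.IH)
  finally show ?case using insert finite_subset[OF sub] by simp
qed

text \<open>Each further independent vector enlarges the subspace properly, and a proper enlargement
  above a tail gains a value by \<open>vals_psubset\<close>.\<close>

lemma card_independent_le:
  assumes W: "ksubspace W" and U: "ksubspace U" "W \<subseteq> U" and tail: "series_on {n..} \<subseteq> W"
    and bound: "U \<subseteq> series_on {m..}" and I: "finite I" "\<And>i. i \<in> I \<Longrightarrow> x i \<in> U"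
    and indep: "\<And>c. (\<Sum>i\<in>I. fls_const (c i) * x i) \<in> W \<Longrightarrow> (\<forall>i\<in>I. c i = 0)"
  shows "card I \<le> card (vals U - vals W)"
proof -
  have "card I \<le> card (vals (span_mod W x I) - vals W) \<and> span_mod W x I \<subseteq> U"
    using I indep
  proof (induction I)
    case empty
    then show ?case using U by (simp add: span_mod_empty)
  next
    case (insert i I)
    have indI: "\<forall>i\<in>I. c i = 0" if c: "(\<Sum>i\<in>I. fls_const (c i) * x i) \<in> W" for c
    proof -
      have "(\<Sum>j\<in>insert i I. fls_const ((c(i := 0)) j) * x j) = (\<Sum>j\<in>I. fls_const (c j) * x j)"
        using insert.hyps by (simp add: sum.insert) (rule sum.cong, auto)
      then have "\<forall>j\<in>insert i I. (c(i := 0)) j = 0" using insert.prems(2)[of "c(i := 0)"] c by simp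
      then show ?thesis using insert.hyps(2) by (metis fun_upd_other insertCI)
    qed
    then have IH: "card I \<le> card (vals (span_mod W x I) - vals W)" "span_mod W x I \<subseteq> U"
      using insert by auto
    let ?S = "span_mod W x I" and ?S' = "span_mod W x (insert i I)"
    have k: "ksubspace ?S" "ksubspace ?S'"
      by (rule ksubspace_span_mod[OF W]; use insert.hyps in simp)+
    have "x i \<in> ?S'"
    proof -
      have "x i = 0 + fls_const 1 * x i" by simp
      then show ?thesis unfolding span_mod_insert[OF insert.hyps] using ksubspaceD(1)[OF k(1)] by blast
    qed
    moreover have "x i \<notin> ?S"
    proof
      assume "x i \<in> ?S"
      then obtain w c where w: "w \<in> W" "x i = w + (\<Sum>j\<in>I. fls_const (c j) * x j)"
        unfolding span_mod_def by blast
      define c' where "c' = (\<lambda>j. if j = i then 1 else - c j)"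
      have "(\<Sum>j\<in>I. fls_const (c' j) * x j) = (\<Sum>j\<in>I. - (fls_const (c j) * x j))"
        by (rule sum.cong) (use insert.hyps in \<open>auto simp: c'_def\<close>)
      then have "(\<Sum>j\<in>insert i I. fls_const (c' j) * x j) = x i - (\<Sum>j\<in>I. fls_const (c j) * x j)"
        using insert.hyps by (simp add: c'_def sum_negf)
      then have "(\<Sum>j\<in>insert i I. fls_const (c' j) * x j) \<in> W" using w by simp
      then have "c' i = 0" using insert.prems(2)[of c'] by blast
      then show False by (simp add: c'_def)
    qed
    moreover have "?S \<subseteq> ?S'"
    proof
      fix z assume "z \<in> ?S"
      moreover have "z = z + fls_const 0 * x i" by simp
      ultimately show "z \<in> ?S'" unfolding span_mod_insert[OF insert.hyps] by blast
    qed
    ultimately have "?S \<subset> ?S'" by blast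
    moreover have "series_on {n..} \<subseteq> ?S" using tail subset_span_mod[of W x I] by blast
    ultimately have "vals ?S \<subset> vals ?S'" by (rule vals_psubset[OF k])
    moreover have S'U: "?S' \<subseteq> U"
    proof
      fix z assume "z \<in> ?S'"
      then obtain w c where z: "w \<in> ?S" "z = w + fls_const c * x i"
        unfolding span_mod_insert[OF insert.hyps] by blast
      have "x i \<in> U" using insert.prems(1) by simp
      then show "z \<in> U" using z IH(2) ksubspaceD(2,3)[OF U(1)] by blast
    qed
    moreover have "finite (vals ?S' - vals W)"
      by (rule finite_vals_diff[OF tail]) (use S'U bound in blast)
    moreover have "vals W \<subseteq> vals ?S" by (rule vals_mono[OF subset_span_mod])
    ultimately have "card (vals ?S - vals W) < card (vals ?S' - vals W)"
      by (intro psubset_card_mono) auto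
    then show ?case using IH S'U insert.hyps by simp
  qed
  moreover have "card (vals (span_mod W x I) - vals W) \<le> card (vals U - vals W)" if "span_mod W x I \<subseteq> U"
    using finite_vals_diff[OF tail bound] vals_mono[OF that] by (intro card_mono) auto
  ultimately show ?thesis by linarith
qed

context numerical_semigroup begin

text \<open>A strict step in a chain above a tail gains a value, so a chain cannot be longer than
  the number of values missing in N. A chain of that length arises by adding to N all elements of
  order at least s, where s descends through the missing values.\<close>

lemma length_above_fls:
  fixes M :: "('k::field fls, 'k fls, 'n) module_scheme"
  assumes M: "module R M" and z: "\<zero>\<^bsub>M\<^esub> = 0" and pl: "\<And>x y. x \<oplus>\<^bsub>M\<^esub> y = x + y"
    and sm: "\<And>r x. r \<odot>\<^bsub>M\<^esub> x = r * x" and N: "submodule N R M"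
    and tail: "series_on {n..} \<subseteq> N" and bound: "carrier M \<subseteq> series_on {m..}"
  shows "length_above R M N = enat (card (vals (carrier M) - vals N))"
proof -
  note sub_iff = submodule_iff_set[OF M z pl sm]
  have ksub: "ksubspace P" if "submodule P R M" for P
    using that const_A unfolding sub_iff ksubspace_def by blast
  have carr: "submodule (carrier M) R M" by (rule module.carrier_is_submodule[OF M])
  define V where "V = vals (carrier M) - vals N"
  have finV: "finite V" unfolding V_def by (rule finite_vals_diff[OF tail bound])
  show ?thesis
  proof (rule antisym)
    show "length_above R M N \<le> enat (card (vals (carrier M) - vals N))"
    proof (rule length_above_le)
      fix P k assume P: "\<forall>i\<le>k. submodule (P i) R M \<and> N \<subseteq> P i" "\<forall>i<k. P i \<subset> P (Suc i)"
      have "i \<le> k \<Longrightarrow> i \<le> card (vals (P i) - vals N)" for i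
      proof (induction i)
        case (Suc i)
        have s: "submodule (P i) R M" "N \<subseteq> P i" "submodule (P (Suc i)) R M" "N \<subseteq> P (Suc i)" "P i \<subset> P (Suc i)"
          using P Suc.prems by auto
        have "vals (P i) \<subset> vals (P (Suc i))"
          by (rule vals_psubset[OF ksub ksub]) (use s tail in auto)
        moreover have "vals N \<subseteq> vals (P i)" by (rule vals_mono[OF s(2)])
        moreover have "P (Suc i) \<subseteq> carrier M" using s(3) unfolding sub_iff by blast
        then have "finite (vals (P (Suc i)) - vals N)"
          by (intro finite_vals_diff[OF tail]) (use bound in blast)
        ultimately have "card (vals (P i) - vals N) < card (vals (P (Suc i)) - vals N)"
          by (intro psubset_card_mono) auto
        then show ?case using Suc by simp
      qed simp
      then have "k \<le> card (vals (P k) - vals N)" by simp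
      also have "\<dots> \<le> card V"
      proof (rule card_mono[OF finV])
        have "submodule (P k) R M" using P by simp
        then have "P k \<subseteq> carrier M" unfolding sub_iff by blast
        then show "vals (P k) - vals N \<subseteq> V" unfolding V_def using vals_mono by blast
      qed
      finally show "k \<le> card (vals (carrier M) - vals N)" unfolding V_def .
    qed
  next
    define k where "k = card V"
    define xs where "xs = sorted_list_of_set V"
    have xs: "set xs = V" "length xs = k" "sorted_wrt (<) xs"
      unfolding xs_def k_def using finV by simp_all
    define Q where "Q s = {x + y | x y. x \<in> N \<and> y \<in> carrier M \<and> y \<in> series_on {s..}}" for s :: int
    \<comment> \<open>The list is ascending, so the index k - i starts at the largest missing value
      and moves down. For i = 0 it would lie beyond the end of the list, whence the separate
      case.\<close>
    define P where "P i = (if i = 0 then N else Q (xs ! (k - i)))" for i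
    have N0: "0 \<in> N" and N_add: "\<And>x y. x \<in> N \<Longrightarrow> y \<in> N \<Longrightarrow> x + y \<in> N"
      and N_mult: "\<And>r x. r \<in> A \<Longrightarrow> x \<in> N \<Longrightarrow> r * x \<in> N" and NC: "N \<subseteq> carrier M"
      using N unfolding sub_iff by blast+
    have C0: "0 \<in> carrier M" and C_add: "\<And>x y. x \<in> carrier M \<Longrightarrow> y \<in> carrier M \<Longrightarrow> x + y \<in> carrier M"
      and C_mult: "\<And>r x. r \<in> A \<Longrightarrow> x \<in> carrier M \<Longrightarrow> r * x \<in> carrier M"
      using carr unfolding sub_iff by blast+
    have QI: "x + y \<in> Q s" if "x \<in> N" "y \<in> carrier M" "y \<in> series_on {s..}" for x y s
      unfolding Q_def using that by blast
    have NQ: "N \<subseteq> Q s" for s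
      using QI[OF _ C0 zero_in_series_on] by auto
    have Qs: "submodule (Q s) R M" for s
      unfolding sub_iff
    proof (intro conjI ballI subsetI)
      show "x \<in> carrier M" if x: "x \<in> Q s" for x
      proof -
        obtain u v where "x = u + v" "u \<in> N" "v \<in> carrier M" using x unfolding Q_def by blast
        then show ?thesis using NC C_add by blast
      qed
      show "0 \<in> Q s" using NQ N0 by blast
      fix x assume "x \<in> Q s"
      then obtain u v where x: "x = u + v" "u \<in> N" "v \<in> carrier M" "v \<in> series_on {s..}" unfolding Q_def by blast
      show "x + x' \<in> Q s" if x': "x' \<in> Q s" for x'
      proof -
        obtain u' v' where x': "x' = u' + v'" "u' \<in> N" "v' \<in> carrier M" "v' \<in> series_on {s..}"
          using x' unfolding Q_def by blast
        have "x + x' = (u + u') + (v + v')" using x x' by simp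
        then show ?thesis
          using QI[OF N_add[OF x(2) x'(2)] C_add[OF x(3) x'(3)] series_on_add[OF x(4) x'(4)]] by simp
      qed
      show "r * x \<in> Q s" if r: "r \<in> A" for r
      proof -
        have "r * v \<in> series_on {s..}" by (rule series_on_mult[OF r x(4)]) (use nonneg in force)
        then show ?thesis using QI[OF N_mult[OF r x(2)] C_mult[OF r x(3)]] x(1) by (simp add: distrib_left)
      qed
    qed
    have Q_anti: "Q s' \<subseteq> Q s" if "s \<le> s'" for s s'
    proof -
      have "series_on {s'..} \<subseteq> (series_on {s..} :: 'k fls set)" using that by (intro series_on_mono) auto
      then show ?thesis unfolding Q_def by blast
    qed
    have in_Q: "s \<in> vals (Q s)" if s: "s \<in> V" for s
    proof -
      obtain x where x: "x \<in> carrier M" "x \<noteq> 0" "fls_subdegree x = s"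
        using s unfolding V_def by (auto elim: vals_memE)
      have "0 + x \<in> Q s" using QI[OF N0 x(1)] series_on_subdegree[of x] x(3) by blast
      then show ?thesis using x(2,3) by (intro vals_memI[of x]) auto
    qed
    have notin_Q: "s \<notin> vals (Q s')" if "s \<in> V" "s < s'" for s s'
    proof
      assume "s \<in> vals (Q s')"
      then obtain x where x: "x \<in> Q s'" "x \<noteq> 0" "fls_subdegree x = s" by (rule vals_memE)
      obtain u v where uv: "x = u + v" "u \<in> N" "v \<in> series_on {s'..}" using x(1) unfolding Q_def by blast
      have v0: "v $$ j = 0" if "j \<le> s" for j using series_on_zero[OF uv(3)] that \<open>s < s'\<close> by simp
      have "u $$ s \<noteq> 0" using x(2,3) v0[of s] uv(1) nth_fls_subdegree_nonzero[OF x(2)] by simp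
      moreover have "u $$ j = 0" if "j < s" for j
        using fls_eq0_below_subdegree[of j x] x(3) v0[of j] uv(1) that by simp
      ultimately have "u \<noteq> 0" "fls_subdegree u = s" by (auto intro: fls_subdegree_eqI)
      then have "s \<in> vals N" using uv(2) by (auto intro: vals_memI)
      then show False using that(1) unfolding V_def by blast
    qed
    show "enat (card (vals (carrier M) - vals N)) \<le> length_above R M N"
      unfolding V_def[symmetric] k_def[symmetric]
    proof (rule length_above_ge[of k P])
      show "\<forall>i\<le>k. submodule (P i) R M \<and> N \<subseteq> P i" unfolding P_def using Qs NQ N by simp
      show "\<forall>i<k. P i \<subset> P (Suc i)"
      proof (intro allI impI)
        fix i assume i: "i < k"
        define s where "s = xs ! (k - Suc i)"
        have sV: "s \<in> V" unfolding s_def using i xs by (metis diff_less nth_mem zero_less_Suc less_nat_zero_code not_gr0)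
        have PS: "P (Suc i) = Q s" unfolding P_def s_def by simp
        show "P i \<subset> P (Suc i)"
        proof (cases "i = 0")
          case True
          have "s \<notin> vals N" using sV unfolding V_def by blast
          then have "N \<noteq> Q s" using in_Q[OF sV] by blast
          then show ?thesis unfolding PS using NQ[of s] True by (auto simp: P_def)
        next
          case False
          define s' where "s' = xs ! (k - i)"
          have "s < s'" unfolding s_def s'_def
            by (rule sorted_wrt_nth_less[OF xs(3)]) (use i False xs(2) in auto)
          then have "s \<notin> vals (Q s')" "Q s' \<subseteq> Q s" using notin_Q[OF sV] Q_anti[of s s'] by auto
          then have "Q s' \<subseteq> Q s" "Q s' \<noteq> Q s" using in_Q[OF sV] by metis+
          then show ?thesis unfolding PS using False by (auto simp: P_def s'_def)
        qed
      qed
    qed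
  qed
qed

lemma ideal_submodule: "ideal J R \<Longrightarrow> submodule J R (self_module R)"
  unfolding submodule_self_iff using ideal_ring_onD[of J A] by blast

lemma module_length_quotient_ring:
  fixes J :: "'k::field fls set"
  assumes J: "ideal J R" and tail: "series_on {n..} \<subseteq> J"
  shows "module_length R (quotient_module (self_module R) J) = enat (card (H - vals J))"
proof -
  interpret submodule_quotient R "self_module R" J
    by (intro submodule_quotient.intro submodule_quotient_axioms.intro self_module_R ideal_submodule J)
  have "length_above R (self_module R) J = enat (card (vals (carrier (self_module (R :: 'k fls ring))) - vals J))"
    using length_above_fls[OF self_module_R _ _ _ ideal_submodule[OF J] tail, of 0] A_series_nat[where 'a = 'k] by simp
  then show ?thesis unfolding module_length_quotient by (simp add: vals_series_on)
qed

end

section \<open>Multiplicity and embedding dimension\<close>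

definition sumset :: "int set \<Rightarrow> int set \<Rightarrow> int set" where
  "sumset S T = {s + t | s t. s \<in> S \<and> t \<in> T}"

lemma sumsetI: "s \<in> S \<Longrightarrow> t \<in> T \<Longrightarrow> s + t \<in> sumset S T"
  by (auto simp: sumset_def)

lemma sumsetE: "x \<in> sumset S T \<Longrightarrow> (\<And>s t. s \<in> S \<Longrightarrow> t \<in> T \<Longrightarrow> x = s + t \<Longrightarrow> P) \<Longrightarrow> P"
  by (auto simp: sumset_def)

text \<open>The elements counted are the smallest ones in each residue class modulo \<open>e\<close>.\<close>

lemma card_diff_translate:
  fixes T :: "int set"
  assumes e: "0 < e" and low: "T \<subseteq> {m..}" and up: "{c..} \<subseteq> T" and step: "\<And>t. t \<in> T \<Longrightarrow> e + t \<in> T"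
  shows "finite (T - (+) e ` T) \<and> int (card (T - (+) e ` T)) = e"
proof -
  have mem: "x \<in> T - (+) e ` T \<longleftrightarrow> x \<in> T \<and> x - e \<notin> T" for x
    by (auto simp: image_iff)
  have up': "t + int k * e \<in> T" if "t \<in> T" for t k
  proof (induction k)
    case (Suc k)
    then show ?case using step[of "t + int k * e"] by (simp add: algebra_simps)
  qed (use that in simp)
  have inj: "inj_on (\<lambda>x. x mod e) (T - (+) e ` T)"
  proof -
    have *: "\<not> x < y" if xy: "x \<in> T - (+) e ` T" "y \<in> T - (+) e ` T" "x mod e = y mod e" for x y
    proof
      assume lt: "x < y"
      obtain q where q: "y - x = e * q" using xy(3) by (metis mod_eq_dvd_iff dvdE)
      then have "q > 0" using lt e by (metis diff_gt_0_iff_gt zero_less_mult_pos)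
      then have "y - e = x + int (nat (q - 1)) * e" using q by (simp add: algebra_simps)
      then have "y - e \<in> T" using up'[of x "nat (q - 1)"] xy(1) by auto
      then show False using xy(2) mem by blast
    qed
    show ?thesis by (rule inj_onI) (metis * linorder_neqE)
  qed
  have img: "(\<lambda>x. x mod e) ` (T - (+) e ` T) = {0..<e}"
  proof (intro equalityI subsetI)
    fix j assume "j \<in> (\<lambda>x. x mod e) ` (T - (+) e ` T)"
    then show "j \<in> {0..<e}" using e by auto
  next
    fix j assume j: "j \<in> {0..<e}"
    define S where "S = {k :: nat. m - 1 - \<bar>m\<bar> * e + j + int k * e \<in> T}"
    let ?b = "m - 1 - \<bar>m\<bar> * e"
    \<comment> \<open>Runs upwards through the residue class of j from a term below m. The first
      term in T therefore has a predecessor, which is outside T.\<close>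
    define f where "f k = j + (int k - \<bar>m\<bar> - 1) * e" for k :: nat
    have f0: "f 0 < m"
    proof -
      have "\<bar>m\<bar> * 1 \<le> \<bar>m\<bar> * e" using e by (intro mult_left_mono) auto
      moreover have "f 0 = j - \<bar>m\<bar> * e - e" unfolding f_def by (simp add: algebra_simps)
      ultimately show ?thesis using j by auto
    qed
    have ex: "\<exists>k. f k \<in> T"
    proof -
      have "\<bar>c\<bar> * 1 \<le> \<bar>c\<bar> * e" using e by (intro mult_left_mono) auto
      then have "c \<le> \<bar>c\<bar> * e" by linarith
      then have "c \<le> f (nat (\<bar>m\<bar> + 1 + \<bar>c\<bar>))" using j unfolding f_def by simp
      then show ?thesis using up by blast
    qed
    define k where "k = (LEAST k. f k \<in> T)"
    have k: "f k \<in> T" unfolding k_def by (rule LeastI_ex[OF ex])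
    have "k \<noteq> 0" using k f0 low by (metis atLeast_iff linorder_not_le subsetD)
    then obtain k' where k': "k = Suc k'" using not0_implies_Suc by blast
    have "f k' \<notin> T" using not_less_Least[of k' "\<lambda>k. f k \<in> T"] k' unfolding k_def by simp
    moreover have "f k' = f k - e" unfolding k' f_def by (simp add: algebra_simps)
    ultimately have "f k \<in> T - (+) e ` T" unfolding mem using k by simp
    moreover have "f k mod e = j" using j unfolding f_def by simp
    ultimately show "j \<in> (\<lambda>x. x mod e) ` (T - (+) e ` T)" by (metis imageI)
  qed
  have bij: "bij_betw (\<lambda>x. x mod e) (T - (+) e ` T) {0..<e}" using inj img by (simp add: bij_betw_def)
  then show ?thesis using bij_betw_finite[OF bij] bij_betw_same_card[OF bij] e by simp
qed

lemma antimono_finite_stabilises: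
  fixes U :: "nat \<Rightarrow> 'a set"
  assumes fin: "finite (U 0)" and dec: "\<And>n. U (Suc n) \<subseteq> U n"
  shows "\<exists>n0. \<forall>n\<ge>n0. U (Suc n) = U n"
proof -
  have fin': "finite (U n)" for n
    by (induction n) (rule fin, rule finite_subset[OF dec])
  define c where "c = (LEAST c. \<exists>n. card (U n) = c)"
  have "\<exists>n. card (U n) = c" unfolding c_def by (rule LeastI_ex) blast
  then obtain n0 where n0: "card (U n0) = c" by blast
  have c_le: "c \<le> card (U n)" for n unfolding c_def by (rule Least_le) blast
  have "U n = U n0" if "n \<ge> n0" for n
    using that
  proof (induction n rule: dec_induct)
    case (step n)
    have "U (Suc n) = U n"
      by (rule card_subset_eq[OF fin' dec]) (use c_le[of "Suc n"] card_mono[OF fin' dec, of n] step n0 in auto)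
    then show ?case using step by simp
  qed simp
  then show ?thesis by (metis le_SucI)
qed

section \<open>Monomial ideals and their powers\<close>

context numerical_semigroup begin

lemma mono_ideal_tail:
  fixes J :: "'k::field fls set"
  assumes J: "ideal J R" and s: "fls_mono s \<in> J"
  shows "series_on {s + F + 1..} \<subseteq> J"
proof
  fix f :: "'k fls" assume f: "f \<in> series_on {s + F + 1..}"
  have "fls_mono (- s) * f \<in> series_on {F + 1..}"
    by (rule series_on_mult[OF _ f, of _ "{- s}"]) auto
  then have "fls_mono (- s) * f \<in> A" using tail_A by blast
  then have "fls_mono (- s) * f * fls_mono s \<in> J" using ideal_ring_onD(4)[OF J] s by blast
  moreover have "fls_mono (- s) * f * fls_mono s = f" by (rule fls_eqI) simp
  ultimately show "f \<in> J" by simp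
qed

lemma ideal_ksubspace:
  assumes "ideal J R"
  shows "ksubspace J"
  unfolding ksubspace_def
  using ideal_ring_onD(2)[OF assms] ideal_ring_onD(3)[OF assms] ideal_ring_onD(4)[OF assms const_A]
  by simp

text \<open>Nonemptiness is included so that \<open>series_on T\<close> contains a monomial and with
  it a tail.\<close>

definition H_ideal :: "int set \<Rightarrow> bool" where
  "H_ideal T \<longleftrightarrow> T \<subseteq> H \<and> T \<noteq> {} \<and> (\<forall>t\<in>T. \<forall>h\<in>H. t + h \<in> T)"

lemma H_ideal_ideal: "H_ideal T \<Longrightarrow> ideal (series_on T) R"
proof (rule ideal_ring_onI[OF cring_R])
  assume T: "H_ideal T"
  show "series_on T \<subseteq> A" using T unfolding H_ideal_def by (intro series_on_mono) auto
  fix r x :: "'a fls" assume "r \<in> A" "x \<in> series_on T"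
  then show "r * x \<in> series_on T"
  proof (rule series_on_mult)
    fix i j assume "i \<in> H" "j \<in> T"
    then have "j + i \<in> T" using T unfolding H_ideal_def by blast
    then show "i + j \<in> T" by (simp add: add.commute)
  qed
qed (auto intro: series_on_add)

lemma series_on_subset_ideal:
  fixes J :: "'k::field fls set"
  assumes J: "ideal J R" and T: "T \<noteq> {}" "\<And>t. t \<in> T \<Longrightarrow> fls_mono t \<in> J"
  shows "series_on T \<subseteq> J"
proof
  fix f :: "'k fls" assume f: "f \<in> series_on T"
  obtain s where s: "s \<in> T" using T(1) by blast
  show "f \<in> J"
    by (rule ksubspace_memI[OF ideal_ksubspace[OF J] mono_ideal_tail[OF J T(2)[OF s]]])
      (use series_onD[OF f] T(2) in blast)
qed

lemma H_ideal_sumset: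
  assumes S: "H_ideal S" and T: "H_ideal T"
  shows "H_ideal (sumset S T)"
  unfolding H_ideal_def
proof (intro conjI ballI)
  show "sumset S T \<subseteq> H"
  proof
    fix x assume "x \<in> sumset S T"
    then obtain s t where "s \<in> S" "t \<in> T" "x = s + t" by (rule sumsetE)
    then show "x \<in> H" using S T add_in unfolding H_ideal_def by blast
  qed
  obtain s t where "s \<in> S" "t \<in> T" using S T unfolding H_ideal_def by blast
  then have "s + t \<in> sumset S T" by (rule sumsetI)
  then show "sumset S T \<noteq> {}" by blast
  fix x h assume "x \<in> sumset S T" and h: "h \<in> H"
  then obtain s t where x: "s \<in> S" "t \<in> T" "x = s + t" by (elim sumsetE)
  have "t + h \<in> T" using T x(2) h unfolding H_ideal_def by blast
  then have "s + (t + h) \<in> sumset S T" by (rule sumsetI[OF x(1)])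
  then show "x + h \<in> sumset S T" using x(3) by (simp add: add.assoc)
qed

text \<open>\<open>ideal_prod\<close> consists of finite sums of products. A series with infinitely
  many terms is still reached, because an ideal containing a monomial contains a tail.\<close>

lemma ideal_prod_series_on:
  assumes S: "H_ideal S" and T: "H_ideal T"
  shows "ideal_prod R (series_on S) (series_on T) = (series_on (sumset S T) :: 'k::field fls set)"
proof
  show "ideal_prod R (series_on S) (series_on T) \<subseteq> (series_on (sumset S T) :: 'k fls set)"
  proof
    fix x :: "'k fls" assume "x \<in> ideal_prod R (series_on S) (series_on T)"
    then show "x \<in> series_on (sumset S T)"
    proof induction
      case (prod i j)
      then show ?case unfolding ring_on_simps by (rule series_on_mult) (rule sumsetI)
    next
      case (sum s1 s2)
      then show ?case by (simp add: series_on_add)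
    qed
  qed
  have I: "ideal (ideal_prod R (series_on S) (series_on T)) (R :: 'k fls ring)"
    by (rule ring.ideal_prod_is_ideal[OF cring.axioms(1)[OF cring_R] H_ideal_ideal[OF S] H_ideal_ideal[OF T]])
  show "series_on (sumset S T) \<subseteq> ideal_prod R (series_on S) (series_on T :: 'k fls set)"
  proof (rule series_on_subset_ideal[OF I])
    show "sumset S T \<noteq> {}" using H_ideal_sumset[OF S T] unfolding H_ideal_def by blast
    fix t assume "t \<in> sumset S T"
    then obtain a b where ab: "a \<in> S" "b \<in> T" "t = a + b" by (rule sumsetE)
    have "fls_mono a \<otimes>\<^bsub>R\<^esub> fls_mono b \<in> ideal_prod R (series_on S) (series_on T :: 'k fls set)"
      by (rule ideal_prod.prod) (use ab in auto)
    then show "fls_mono t \<in> ideal_prod R (series_on S) (series_on T :: 'k fls set)"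
      using ab by (simp add: fls_mono_mult)
  qed
qed

primrec nfold :: "int set \<Rightarrow> nat \<Rightarrow> int set" where
  "nfold T 0 = H"
| "nfold T (Suc n) = sumset (nfold T n) T"

lemma H_ideal_H: "H_ideal H"
  unfolding H_ideal_def using zero_in add_in by blast

lemma H_ideal_nfold: "H_ideal T \<Longrightarrow> H_ideal (nfold T n)"
  by (induction n) (auto simp: H_ideal_H H_ideal_sumset)

lemma ideal_power_series_on:
  "H_ideal T \<Longrightarrow> ideal_power R (series_on T) n = series_on (nfold T n)"
  by (induction n) (simp_all add: ideal_prod_series_on H_ideal_nfold)

text \<open>Shifted back by n d, the n-fold sums increase with n, stay nonnegative and contain
  everything above F. Their gaps form a decreasing sequence of finite sets, which becomes constant.
  In terms of ideals, the monomial of exponent d generates a reduction.\<close>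

lemma nfold_stabilises:
  assumes T: "H_ideal T" and d: "d \<in> T" "\<And>t. t \<in> T \<Longrightarrow> d \<le> t"
  shows "\<exists>n0. \<forall>n\<ge>n0. nfold T (Suc n) = (+) d ` nfold T n"
proof -
  have low: "int n * d \<le> x" if "x \<in> nfold T n" for n x
    using that
  proof (induction n arbitrary: x)
    case 0
    then show ?case by (simp add: nonneg)
  next
    case (Suc n)
    from Suc.prems obtain s t where "s \<in> nfold T n" "t \<in> T" "x = s + t" by (auto elim: sumsetE)
    then show ?case using Suc.IH[of s] d(2)[of t] by (simp add: algebra_simps)
  qed
  have up: "d + x \<in> nfold T (Suc n)" if "x \<in> nfold T n" for n x
    using sumsetI[OF that d(1)] by (simp add: add.commute)
  define U where "U n = {j \<in> {0..F}. j + int n * d \<notin> nfold T n}" for n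
  have high: "j + int n * d \<in> nfold T n" if "j > F" for j n
  proof (induction n)
    case 0
    then show ?case using that above_F by simp
  next
    case (Suc n)
    then show ?case using up[OF Suc] by (simp add: algebra_simps)
  qed
  have "\<exists>n0. \<forall>n\<ge>n0. U (Suc n) = U n"
  proof (rule antimono_finite_stabilises)
    show "finite (U 0)" unfolding U_def by (rule finite_subset[of _ "{0..F}"]) auto
    fix n
    have "j + int (Suc n) * d \<in> nfold T (Suc n)" if "j + int n * d \<in> nfold T n" for j
      using up[OF that] by (simp add: algebra_simps)
    then show "U (Suc n) \<subseteq> U n" unfolding U_def by blast
  qed
  then obtain n0 where n0: "\<And>n. n \<ge> n0 \<Longrightarrow> U (Suc n) = U n" by blast
  have "nfold T (Suc n) = (+) d ` nfold T n" if n: "n \<ge> n0" for n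
  proof (intro equalityI subsetI)
    fix x assume x: "x \<in> nfold T (Suc n)"
    define j where "j = x - int (Suc n) * d"
    have "j \<ge> 0" using low[OF x] unfolding j_def by simp
    have "j + int (Suc n) * d \<in> nfold T (Suc n)" using x unfolding j_def by simp
    then have "j \<notin> U (Suc n)" unfolding U_def by blast
    then have "j \<notin> U n" using n0[OF n] by simp
    then have "j + int n * d \<in> nfold T n"
      using \<open>j \<ge> 0\<close> high[of j n] unfolding U_def by (cases "j > F") auto
    moreover have "x = d + (j + int n * d)" unfolding j_def by (simp add: algebra_simps)
    ultimately show "x \<in> (+) d ` nfold T n" by blast
  next
    fix x assume "x \<in> (+) d ` nfold T n"
    then show "x \<in> nfold T (Suc n)" using up by blast
  qed
  then show ?thesis by blast
qed

definition e :: int where "e = (LEAST h. h \<in> H \<and> h > 0)"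

lemma e_props: "e \<in> H" "e > 0" "\<And>h. h \<in> H \<Longrightarrow> h > 0 \<Longrightarrow> e \<le> h"
proof -
  have ex: "\<exists>h. h \<in> H \<and> h > 0" using above_F[of "F + 2"] F_ge by (intro exI[of _ "F + 2"]) auto
  \<comment> \<open>The integers are not well ordered, so the minimum is taken among naturals and
    transferred back.\<close>
  define S where "S = nat ` {h\<in>H. h > 0}"
  have "S \<noteq> {}" using ex unfolding S_def by blast
  define k where "k = (LEAST k. k \<in> S)"
  have k: "k \<in> S" unfolding k_def using \<open>S \<noteq> {}\<close> by (metis LeastI ex_in_conv)
  then obtain h0 where h0: "h0 \<in> H" "h0 > 0" "k = nat h0" unfolding S_def by blast
  have min: "h0 \<le> h" if "h \<in> H" "h > 0" for h
  proof -
    have "nat h \<in> S" using that unfolding S_def by blast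
    then have "k \<le> nat h" unfolding k_def by (rule Least_le)
    then show ?thesis using h0 that by simp
  qed
  have "e = h0" unfolding e_def by (rule Least_equality) (use h0 min in auto)
  then show "e \<in> H" "e > 0" "\<And>h. h \<in> H \<Longrightarrow> h > 0 \<Longrightarrow> e \<le> h" using h0 min by auto
qed

lemma H_ideal_mm: "H_ideal (H - {0})"
proof -
  have "t + h \<in> H - {0}" if "t \<in> H - {0}" "h \<in> H" for t h
    using that add_in nonneg[of t] nonneg[of h] by auto
  moreover have "e \<in> H - {0}" using e_props(1,2) by simp
  ultimately show ?thesis unfolding H_ideal_def by blast
qed

lemma ideal_smult_self:
  assumes J: "ideal J R"
  shows "ideal_smult R J (self_module R) = J"
proof
  have "submodule J R (self_module R)" by (rule ideal_submodule[OF J])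
  moreover have "{r \<odot>\<^bsub>self_module R\<^esub> x |r x. r \<in> J \<and> x \<in> carrier (self_module R)} \<subseteq> J"
    using ideal_ring_onD(5)[OF J] by auto
  ultimately show "ideal_smult R J (self_module R) \<subseteq> J"
    unfolding ideal_smult_def submodule_generated_def by blast
  show "J \<subseteq> ideal_smult R J (self_module R)"
  proof
    fix x assume x: "x \<in> J"
    have "x \<in> {r \<odot>\<^bsub>self_module R\<^esub> x |r x. r \<in> J \<and> x \<in> carrier (self_module R)}"
      using x one_A by (intro CollectI exI[of _ x] exI[of _ 1]) auto
    then show "x \<in> ideal_smult R J (self_module R)"
      unfolding ideal_smult_def submodule_generated_def by blast
  qed
qed

text \<open>Once the n-fold sums of the maximal ideal of H are translates of each other by e, each
  step removes exactly e values. The length of A modulo the n-th power of \<mm> is then eventually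
  linear in n with slope e.\<close>

theorem ring_multiplicity_R: "ring_multiplicity (R :: 'k::field fls ring) = real_of_int e"
proof -
  have "annihilator R (self_module R) = {0 :: 'k fls}"
  proof -
    have "r = 0" if "\<forall>x\<in>A. r * x = 0" for r :: "'k fls" using bspec[OF that one_A] by simp
    moreover have "(0 :: 'k fls) \<in> annihilator R (self_module R)" unfolding annihilator_def by simp
    ultimately show ?thesis unfolding annihilator_def self_module_simps ring_on_simps by blast
  qed
  then have dim: "the_enat (module_dim R (self_module (R :: 'k fls ring))) = 1"
    using krull_dim_R[where 'k = 'k] unfolding module_dim_def krull_dim_def by (simp add: one_enat_def)
  let ?T = "\<lambda>n. nfold (H - {0}) n"
  define c where "c n = card (H - ?T n)" for n
  have Tid: "H_ideal (?T n)" for n by (rule H_ideal_nfold[OF H_ideal_mm])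
  have len: "the_enat (module_length R (quotient_module (self_module R)
      (ideal_smult R (ideal_power R (max_ideal R) n) (self_module (R :: 'k fls ring))))) = c n" for n
  proof -
    let ?J = "series_on (?T n) :: 'k fls set"
    have id: "ideal ?J R" by (rule H_ideal_ideal[OF Tid])
    obtain t where t: "t \<in> ?T n" using Tid[of n] unfolding H_ideal_def by blast
    have "series_on {t + F + 1..} \<subseteq> ?J" by (rule mono_ideal_tail[OF id]) (use t in simp)
    then have "module_length R (quotient_module (self_module R) ?J) = enat (card (H - vals ?J))"
      by (rule module_length_quotient_ring[OF id])
    then show ?thesis
      using ideal_smult_self[OF id]
      by (simp add: max_ideal_R ideal_power_series_on[OF H_ideal_mm] vals_series_on c_def)
  qed
  have e_min: "e \<le> t" if "t \<in> H - {0}" for t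
    by (rule e_props(3)) (use that nonneg[of t] in auto)
  obtain n0 where n0: "\<And>n. n \<ge> n0 \<Longrightarrow> ?T (Suc n) = (+) e ` ?T n"
    using nfold_stabilises[OF H_ideal_mm, of e] e_min e_props(1,2) by auto
  have fin: "finite (H - ?T n)" for n
  proof -
    obtain t where t: "t \<in> ?T n" using Tid unfolding H_ideal_def by blast
    have "H - ?T n \<subseteq> {0..t + F}"
    proof
      fix x assume x: "x \<in> H - ?T n"
      have "\<not> x - t > F"
      proof
        assume "x - t > F"
        then have "x - t \<in> H" by (rule above_F)
        then have "t + (x - t) \<in> ?T n" using t Tid[of n] unfolding H_ideal_def by blast
        then show False using x by simp
      qed
      then show "x \<in> {0..t + F}" using nonneg x by auto
    qed
    then show ?thesis by (rule finite_subset) simp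
  qed
  have step: "int (c (Suc n)) = int (c n) + e" if n: "n \<ge> n0" for n
  proof -
    have sub: "?T n \<subseteq> H" "?T (Suc n) \<subseteq> ?T n"
    proof -
      show "?T n \<subseteq> H" using Tid[of n] unfolding H_ideal_def by blast
      show "?T (Suc n) \<subseteq> ?T n" using Tid[of n] unfolding H_ideal_def by (auto elim!: sumsetE)
    qed
    obtain t where t: "t \<in> ?T n" using Tid[of n] unfolding H_ideal_def by blast
    have "finite (?T n - (+) e ` ?T n) \<and> int (card (?T n - (+) e ` ?T n)) = e"
    proof (rule card_diff_translate[OF e_props(2), of _ 0 "t + F + 1"])
      show "?T n \<subseteq> {0..}" using sub(1) nonneg by auto
      show "{t + F + 1..} \<subseteq> ?T n"
      proof
        fix x assume "x \<in> {t + F + 1..}"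
        then have "x - t \<in> H" using above_F[of "x - t"] by simp
        then have "t + (x - t) \<in> ?T n" using t Tid[of n] unfolding H_ideal_def by blast
        then show "x \<in> ?T n" by simp
      qed
      show "e + x \<in> ?T n" if "x \<in> ?T n" for x
        using that Tid[of n] e_props(1) unfolding H_ideal_def by (metis add.commute)
    qed
    moreover have "H - ?T (Suc n) = (H - ?T n) \<union> (?T n - ?T (Suc n))" using sub by blast
    then have "c (Suc n) = c n + card (?T n - ?T (Suc n))"
      unfolding c_def using fin[of n] fin[of "Suc n"]
      by (subst card_Un_disjoint[symmetric]) (auto intro: finite_subset)
    ultimately show ?thesis using n0[OF n] by simp
  qed
  have lin: "int (c (n0 + k)) = int (c n0) + int k * e" for k
    by (induction k) (use step in \<open>auto simp: algebra_simps\<close>)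
  have "(\<lambda>k. (real (c n0) + real k * real_of_int e) / real (n0 + k)) \<longlonglongrightarrow> real_of_int e"
  proof (rule Lim_transform_eventually)
    have "(\<lambda>k. real_of_int e + (real (c n0) - real n0 * real_of_int e) / real (n0 + k)) \<longlonglongrightarrow> real_of_int e + 0"
      by (intro tendsto_add tendsto_const tendsto_divide_0[OF tendsto_const] filterlim_at_top_imp_at_infinity
          filterlim_compose[OF filterlim_real_sequentially]) (simp add: filterlim_add_const_nat_at_top filterlim_subseq strict_mono_def)
    then show "(\<lambda>k. real_of_int e + (real (c n0) - real n0 * real_of_int e) / real (n0 + k)) \<longlonglongrightarrow> real_of_int e" by simp
    show "\<forall>\<^sub>F k in sequentially. real_of_int e + (real (c n0) - real n0 * real_of_int e) / real (n0 + k)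
      = (real (c n0) + real k * real_of_int e) / real (n0 + k)"
      by (rule eventually_sequentiallyI[of 1]) (simp add: field_simps)
  qed
  moreover have "real (c (n0 + k)) = real (c n0) + real k * real_of_int e" for k
    using lin[of k] by (metis (mono_tags, lifting) of_int_add of_int_mult of_int_of_nat_eq)
  ultimately have "(\<lambda>k. real (c (k + n0)) / real (k + n0)) \<longlonglongrightarrow> real_of_int e"
    by (simp add: add.commute)
  then have "(\<lambda>n. real (c n) / real n) \<longlonglongrightarrow> real_of_int e" by (rule LIMSEQ_offset)
  then have "lim (\<lambda>n. real (c n) / real n) = real_of_int e" by (rule limI)
  then show ?thesis
    unfolding ring_multiplicity_def multiplicity_wrt_def dim Let_def len by simp
qed

text \<open>A decomposable element is a sum of two smaller ones, so its monomial is a product of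
  monomials already known to lie in \<open>J\<close>.\<close>

lemma mm_generated:
  assumes J: "ideal J R" and "\<And>a. a \<in> (H - {0}) - sumset (H - {0}) (H - {0}) \<Longrightarrow> fls_mono a \<in> J"
  shows "\<mm> \<subseteq> J"
proof (rule series_on_subset_ideal[OF J])
  show "H - {0} \<noteq> {}" using H_ideal_mm unfolding H_ideal_def by blast
  fix t assume "t \<in> H - {0}"
  then show "fls_mono t \<in> J"
  proof (induction "nat t" arbitrary: t rule: less_induct)
    case less
    show ?case
    proof (cases "t \<in> sumset (H - {0}) (H - {0})")
      case True
      then obtain x y where xy: "x \<in> H - {0}" "y \<in> H - {0}" "t = x + y" by (rule sumsetE)
      then have "x > 0" "y > 0" using nonneg[of x] nonneg[of y] by auto
      then have "fls_mono x \<in> J" using less.hyps[of x] xy by simp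
      then have "fls_mono y * fls_mono x \<in> J" using ideal_ring_onD(4)[OF J, of "fls_mono y"] xy by simp
      then show ?thesis using xy by (simp add: fls_mono_mult add.commute)
    next
      case False
      then show ?thesis using assms(2) less.prems by blast
    qed
  qed
qed

text \<open>The monomials of the indecomposable elements generate. Conversely, any generating set
  spans \<mm> over k modulo its square, so it has at least as many elements as there are values of
  \<mm> that are not values of the square.\<close>

theorem embedding_dim_R:
  "embedding_dim (R :: 'k::field fls ring) = card ((H - {0}) - sumset (H - {0}) (H - {0}))"
proof -
  let ?M = "H - {0}"
  define G where "G = ?M - sumset ?M ?M"
  have S2: "H_ideal (sumset ?M ?M)" by (rule H_ideal_sumset[OF H_ideal_mm H_ideal_mm])
  have S2M: "sumset ?M ?M \<subseteq> ?M" using H_ideal_mm unfolding H_ideal_def by (auto elim!: sumsetE)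
  let ?W = "series_on (sumset ?M ?M) :: 'k fls set"
  have tail: "series_on {e + e + F + 1..} \<subseteq> ?W"
  proof (rule mono_ideal_tail[OF H_ideal_ideal[OF S2]])
    have "e + e \<in> sumset ?M ?M" by (rule sumsetI) (use e_props(1,2) in auto)
    then show "fls_mono (e + e) \<in> ?W" unfolding fls_mono_in_series_on .
  qed
  have mmb: "(\<mm> :: 'k fls set) \<subseteq> series_on {0..}" using mm_subset_A A_series_nat by blast
  have finG: "finite G"
    using finite_vals_diff[OF tail mmb] unfolding G_def by (simp add: vals_series_on)
  interpret cring "R :: 'k fls ring" by (rule cring_R)
  have "embedding_dim (R :: 'k fls ring) = card G"
    unfolding embedding_dim_def max_ideal_R
  proof (rule Least_equality)
    let ?Y = "fls_mono ` G :: 'k fls set"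
    have Y: "?Y \<subseteq> carrier R" unfolding G_def by auto
    have "inj_on (fls_mono :: int \<Rightarrow> 'k fls) G" by (rule inj_onI) (metis fls_mono_subdegree)
    then have "card ?Y = card G" by (rule card_image)
    moreover have "genideal R ?Y = \<mm>"
    proof
      show "genideal R ?Y \<subseteq> \<mm>" by (rule genideal_minimal[OF ideal_mm]) (auto simp: G_def)
      show "\<mm> \<subseteq> genideal R ?Y"
        by (rule mm_generated[OF genideal_ideal[OF Y]]) (use genideal_self[OF Y] in \<open>auto simp: G_def\<close>)
    qed
    ultimately show "\<exists>Y\<subseteq>carrier (R :: 'k fls ring). finite Y \<and> card Y = card G \<and> genideal R Y = \<mm>"
      using Y finG by blast
  next
    fix n assume "\<exists>Y\<subseteq>carrier (R :: 'k fls ring). finite Y \<and> card Y = n \<and> genideal R Y = \<mm>"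
    then obtain Y :: "'k fls set" where Y: "Y \<subseteq> carrier R" "finite Y" "card Y = n" "genideal R Y = \<mm>" by blast
    have kW: "ksubspace ?W" by (rule ksubspace_series_on)
    let ?S = "span_mod ?W (\<lambda>x. x) Y"
    have Ymm: "Y \<subseteq> \<mm>" using genideal_self[OF Y(1)] Y(4) by simp
    have kS: "ksubspace ?S" by (rule ksubspace_span_mod[OF kW Y(2)])
    have Ssub: "?S \<subseteq> \<mm>"
    proof
      fix z assume "z \<in> ?S"
      then obtain w c where z: "w \<in> ?W" "z = w + (\<Sum>y\<in>Y. fls_const (c y) * y)" unfolding span_mod_def by blast
      have "w \<in> \<mm>" using z(1) series_on_mono[OF S2M] by blast
      moreover have "(\<Sum>y\<in>Y. fls_const (c y) * y) \<in> \<mm>"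
        by (intro series_on_sum series_on_const_mult) (use Ymm in blast)
      ultimately show "z \<in> \<mm>" unfolding z(2) by (rule series_on_add)
    qed
    \<comment> \<open>A series minus its constant term is in \<mm> and moves \<mm> into the square
      of \<mm>. So \<open>A\<close> acts on the quotient through constants, and a k-span modulo the
      square is already an ideal.\<close>
    have "ideal ?S R"
    proof (rule ideal_ring_onI[OF cring_R])
      show "?S \<subseteq> A" using Ssub mm_subset_A by blast
      fix r x :: "'k fls" assume r: "r \<in> A" and x: "x \<in> ?S"
      have "r - fls_const (r $$ 0) \<in> \<mm>" unfolding mm_iff using r by (auto intro!: series_on_diff)
      then have "(r - fls_const (r $$ 0)) * x \<in> ?W"
        using Ssub x by (intro series_on_mult[of _ ?M _ ?M]) (auto intro: sumsetI)
      then have "(r - fls_const (r $$ 0)) * x \<in> ?S" using subset_span_mod[of ?W "\<lambda>x. x" Y] by blast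
      moreover have "fls_const (r $$ 0) * x \<in> ?S" by (rule ksubspaceD(3)[OF kS x])
      ultimately have "(r - fls_const (r $$ 0)) * x + fls_const (r $$ 0) * x \<in> ?S" by (rule ksubspaceD(2)[OF kS])
      then show "r * x \<in> ?S" by (simp add: left_diff_distrib)
    next
      show "0 \<in> ?S" by (rule ksubspaceD(1)[OF kS])
      show "x + y \<in> ?S" if "x \<in> ?S" "y \<in> ?S" for x y by (rule ksubspaceD(2)[OF kS that])
    qed
    moreover have "Y \<subseteq> ?S"
    proof
      fix y assume y: "y \<in> Y"
      have "(\<Sum>z\<in>Y. fls_const (if z = y then 1 else 0) * z) = (\<Sum>z\<in>Y. if z = y then z else 0)"
        by (rule sum.cong) auto
      then have eq: "y = 0 + (\<Sum>z\<in>Y. fls_const (if z = y then 1 else 0) * z)" using y Y(2) by (simp add: sum.delta)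
      show "y \<in> ?S" unfolding span_mod_def
        by (intro CollectI exI[of _ 0] exI[of _ "\<lambda>z. if z = y then 1 else 0"] conjI) (rule eq, rule zero_in_series_on)
    qed
    ultimately have "\<mm> \<subseteq> ?S" using genideal_minimal Y(4) by metis
    then have "?S = \<mm>" using Ssub by blast
    then have "card (vals (\<mm> :: 'k fls set) - vals ?W) \<le> card Y" using card_vals_span_mod[OF kW Y(2), of "\<lambda>x. x"] by simp
    then show "card G \<le> n" using Y(3) unfolding G_def by (simp add: vals_series_on)
  qed
  then show ?thesis unfolding G_def .
qed

text \<open>Minimal multiplicity means that \<open>e\<close> is a reduction of the maximal ideal of the semigroup.\<close>

theorem minimal_multiplicity_iff:
  "minimal_multiplicity (R :: 'k::field fls ring) \<longleftrightarrow> (\<forall>x\<in>H - {0}. \<forall>y\<in>H - {0}. x + y - e \<in> H - {0})"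
proof -
  let ?M = "H - {0}"
  have diff_eq_iff: "M - B = M - C \<longleftrightarrow> C \<subseteq> B" if "B \<subseteq> C" "C \<subseteq> M" for M B C :: "int set"
    using that by blast
  have S2M: "sumset ?M ?M \<subseteq> ?M" using H_ideal_mm unfolding H_ideal_def by (auto elim!: sumsetE)
  have eM: "e \<in> ?M" using e_props(1,2) by simp
  have sub: "(+) e ` ?M \<subseteq> sumset ?M ?M" using eM by (auto intro: sumsetI)
  have "finite (?M - (+) e ` ?M) \<and> int (card (?M - (+) e ` ?M)) = e"
  proof (rule card_diff_translate[OF e_props(2), of _ 0 "F + 2"])
    show "?M \<subseteq> {0..}" using nonneg by auto
    show "{F + 2..} \<subseteq> ?M" using above_F F_ge by auto
    show "e + x \<in> ?M" if "x \<in> ?M" for x using sub S2M that by blast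
  qed
  then have fin: "finite (?M - (+) e ` ?M)" and card: "int (card (?M - (+) e ` ?M)) = e" by auto
  \<comment> \<open>The complement of e + M in M always has e elements and contains the complement
    of M + M, whose size is the embedding dimension. Equality of the two sizes therefore means that
    M + M lies in e + M.\<close>
  have "minimal_multiplicity (R :: 'k fls ring) \<longleftrightarrow> card (?M - (+) e ` ?M) = card (?M - sumset ?M ?M)"
    unfolding minimal_multiplicity_def ring_multiplicity_R embedding_dim_R using card
    by (metis of_int_of_nat_eq of_nat_eq_iff)
  also have "\<dots> \<longleftrightarrow> ?M - (+) e ` ?M = ?M - sumset ?M ?M"
  proof
    assume "card (?M - (+) e ` ?M) = card (?M - sumset ?M ?M)"
    moreover have "?M - sumset ?M ?M \<subseteq> ?M - (+) e ` ?M" using sub by blast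
    ultimately show "?M - (+) e ` ?M = ?M - sumset ?M ?M" using card_subset_eq[OF fin] by metis
  qed simp
  also have "\<dots> \<longleftrightarrow> sumset ?M ?M \<subseteq> (+) e ` ?M" using diff_eq_iff[OF sub S2M] .
  also have "\<dots> \<longleftrightarrow> (\<forall>x\<in>?M. \<forall>y\<in>?M. x + y - e \<in> ?M)"
  proof
    assume L: "sumset ?M ?M \<subseteq> (+) e ` ?M"
    show "\<forall>x\<in>?M. \<forall>y\<in>?M. x + y - e \<in> ?M"
    proof (intro ballI)
      fix x y assume "x \<in> ?M" "y \<in> ?M"
      then have "x + y \<in> (+) e ` ?M" by (intro subsetD[OF L] sumsetI)
      then obtain z where "z \<in> ?M" "x + y = e + z" by blast
      then show "x + y - e \<in> ?M" by simp
    qed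
  next
    assume R: "\<forall>x\<in>?M. \<forall>y\<in>?M. x + y - e \<in> ?M"
    show "sumset ?M ?M \<subseteq> (+) e ` ?M"
    proof
      fix z assume "z \<in> sumset ?M ?M"
      then obtain x y where "x \<in> ?M" "y \<in> ?M" "z = x + y" by (rule sumsetE)
      then have "x + y - e \<in> ?M" "z = e + (x + y - e)" using R by auto
      then show "z \<in> (+) e ` ?M" by blast
    qed
  qed
  finally show ?thesis .
qed

end

section \<open>Arf rings\<close>

context numerical_semigroup begin

definition Arf_semigroup :: bool where
  "Arf_semigroup \<longleftrightarrow> (\<forall>x\<in>H. \<forall>y\<in>H. \<forall>z\<in>H. z \<le> x \<longrightarrow> z \<le> y \<longrightarrow> x + y - z \<in> H)"

text \<open>A high power of t moves any Laurent series into the tail of \<open>A\<close>.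
  Consequently colons are taken in the full field of Laurent series.\<close>

lemma total_quotient_A: "total_quotient A = (UNIV :: 'k::field fls set)"
proof (intro equalityI subsetI)
  fix f :: "'k fls"
  define N where "N = max 0 (F + 1 - fls_subdegree f) + F + 1"
  have N: "N \<in> H" unfolding N_def using above_F[of N] F_ge above_F by (cases "N > F") (auto simp: N_def)
  have "fls_mono N * f \<in> series_on {F + 1..}"
    by (rule series_on_mult[OF _ series_on_subdegree, of _ "{N}"]) (use F_ge in \<open>auto simp: N_def\<close>)
  then have "fls_mono N * f \<in> A" using tail_A by blast
  moreover have "f = (fls_mono N * f) / fls_mono N" by simp
  ultimately show "f \<in> total_quotient A"
    unfolding total_quotient_def using N by (intro CollectI exI[of _ "fls_mono N * f"] exI[of _ "fls_mono N"]) auto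
qed simp

lemma colon_A: "colon (A :: 'k::field fls set) V W = {z. \<forall>w\<in>W. z * w \<in> V}"
  unfolding colon_def total_quotient_A by simp

abbreviation upper :: "int \<Rightarrow> int set" where "upper z \<equiv> H \<inter> {z..}"

lemma H_ideal_upper: "z \<in> H \<Longrightarrow> H_ideal (upper z)"
proof -
  assume z: "z \<in> H"
  have "t + h \<in> upper z" if "t \<in> upper z" "h \<in> H" for t h
    using that add_in nonneg[of h] by auto
  then show ?thesis unfolding H_ideal_def using z by blast
qed

lemma ideal_power_ideal: "ideal J R \<Longrightarrow> ideal (ideal_power R J n) R"
proof (induction n)
  case 0
  have "ideal (carrier R) R" by (rule ring.oneideal[OF cring.axioms(1)[OF cring_R]])
  then show ?case by simp
next
  case (Suc n)
  then show ?case using ring.ideal_prod_is_ideal[OF cring.axioms(1)[OF cring_R]] by simp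
qed

lemma power_in_ideal_power: "y \<in> J \<Longrightarrow> y ^ n \<in> ideal_power R J n"
proof (induction n)
  case (Suc n)
  then have "y ^ n \<otimes>\<^bsub>R\<^esub> y \<in> ideal_prod R (ideal_power R J n) J" by (intro ideal_prod.prod)
  then show ?case by (simp add: mult.commute)
qed simp

lemma ideal_power_bound: "J \<subseteq> series_on {z..} \<Longrightarrow> ideal_power R J n \<subseteq> (series_on {int n * z..} :: 'k::field fls set)"
proof (induction n)
  case 0
  then show ?case using A_series_nat[where 'a = 'k] by simp
next
  case (Suc n)
  show ?case
  proof
    fix x assume "x \<in> ideal_power R J (Suc n)"
    then have "x \<in> ideal_prod R (ideal_power R J n) J" by simp
    then show "x \<in> series_on {int (Suc n) * z..}"
    proof induction
      case (prod i j)
      then have "i \<in> series_on {int n * z..}" "j \<in> series_on {z..}" using Suc by blast+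
      then show ?case unfolding ring_on_simps by (rule series_on_mult) (simp add: algebra_simps)
    next
      case (sum s1 s2)
      then show ?case by (simp add: series_on_add)
    qed
  qed
qed

text \<open>If the order of x were below z, then in an integral equation \<open>x ^ n\<close> would
  be the only term contributing at n times that order, and it could not cancel.\<close>

lemma integrally_closed_upper:
  assumes z: "z \<in> H"
  shows "integrally_closed_ideal A (series_on (upper z) :: 'k::field fls set)"
  unfolding integrally_closed_ideal_def
proof (intro conjI ballI allI impI)
  let ?J = "series_on (upper z) :: 'k fls set"
  show "ideal ?J R" by (rule H_ideal_ideal[OF H_ideal_upper[OF z]])
  fix x :: "'k fls" and n :: nat and c
  assume x: "x \<in> A" and n: "0 < n"
    and c: "(\<forall>i\<in>{1..n}. c i \<in> ideal_power R ?J i) \<and> x ^ n + (\<Sum>i = 1..n. c i * x ^ (n - i)) = 0"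
  show "x \<in> ?J"
  proof (cases "x = 0 \<or> z \<le> fls_subdegree x")
    case True
    then have "x \<in> series_on {z..}" by (simp add: series_on_atLeast_iff)
    then show ?thesis using x unfolding series_on_def by simp
  next
    case False
    define d where "d = fls_subdegree x"
    have "?J \<subseteq> series_on {z..}" by (rule series_on_mono) simp
    note bound = ideal_power_bound[OF this]
    have "(c i * x ^ (n - i)) $$ (int n * d) = 0" if i: "i \<in> {1..n}" for i
    proof -
      have "c i \<in> series_on {int i * z..}" using bound c i by blast
      moreover have "x ^ (n - i) \<in> series_on {int (n - i) * d..}"
        by (simp add: series_on_atLeast_iff d_def fls_subdegree_pow)
      ultimately have "c i * x ^ (n - i) \<in> series_on {int i * z + int (n - i) * d..}"
        by (rule series_on_mult) simp
      moreover have "int n * d < int i * z + int (n - i) * d"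
      proof -
        have "int i * d < int i * z" using False i unfolding d_def by simp
        moreover have "int (n - i) * d = int n * d - int i * d" using i by (simp add: of_nat_diff algebra_simps)
        ultimately show ?thesis by linarith
      qed
      ultimately show ?thesis by (intro series_on_zero) auto
    qed
    then have "(\<Sum>i = 1..n. c i * x ^ (n - i)) $$ (int n * d) = 0" by (simp add: fls_nth_sum)
    moreover have "(x ^ n) $$ (int n * d) \<noteq> 0"
      using False nth_fls_subdegree_nonzero[of "x ^ n"] by (simp add: d_def fls_subdegree_pow)
    moreover have "(x ^ n + (\<Sum>i = 1..n. c i * x ^ (n - i))) $$ (int n * d) = 0" using c by simp
    ultimately show ?thesis by simp
  qed
qed

text \<open>Elements of \<open>k[[t]]\<close> are integral over \<open>A\<close>: up to a constant they have a power in the conductor.\<close>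

lemma integrally_closed_ideal_eq:
  fixes J :: "'k::field fls set"
  assumes J: "integrally_closed_ideal A J" and y: "y \<in> J" "y \<noteq> 0"
    and min: "\<And>x. x \<in> J \<Longrightarrow> x \<noteq> 0 \<Longrightarrow> fls_subdegree y \<le> fls_subdegree x"
  shows "J = series_on (upper (fls_subdegree y))"
proof (intro equalityI subsetI)
  have id: "ideal J R" using J unfolding integrally_closed_ideal_def by blast
  note JD = ideal_ring_onD[OF id]
  {
    fix x assume x: "x \<in> J"
    have "x \<in> A" "x \<in> series_on {fls_subdegree y..}"
      using JD(1) x min[OF x] by (auto simp: series_on_atLeast_iff)
    then show "x \<in> series_on (upper (fls_subdegree y))" unfolding series_on_def by simp
  }
  fix x :: "'k fls" assume x: "x \<in> series_on (upper (fls_subdegree y))"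
  then have xA: "x \<in> A" and xy: "x \<in> series_on {fls_subdegree y..}" unfolding series_on_def by simp_all
  define z where "z = x / y"
  have z: "z \<in> series_on {0..}"
    using xy y(2) unfolding z_def
    by (cases "x = 0") (auto simp: series_on_atLeast_iff fls_divide_subdegree)
  define c where "c = z $$ 0"
  define w where "w = z - fls_const c"
  \<comment> \<open>At least F + 1, so that \<open>w ^ N\<close>, with w of positive order, is in
    the tail; positive, so that the integral equation has positive degree and the case w = 0 is
    covered.\<close>
  define N where "N = Suc (nat (F + 1))"
  have w: "w \<in> series_on {1..}"
  proof (rule series_onI)
    fix i assume i: "w $$ i \<noteq> 0"
    then have "i \<noteq> 0" unfolding w_def c_def by auto
    moreover from this have "z $$ i \<noteq> 0" using i unfolding w_def by simp
    ultimately show "i \<in> {1..}" using series_onD[OF z, of i] by simp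
  qed
  have "w ^ N \<in> series_on {F + 1..}"
  proof (cases "w = 0")
    case False
    then have "int N * 1 \<le> int N * fls_subdegree w"
      using w by (intro mult_left_mono) (auto simp: series_on_atLeast_iff)
    moreover have "F + 1 \<le> int N" unfolding N_def by simp
    ultimately show ?thesis by (simp add: series_on_atLeast_iff fls_subdegree_pow)
  qed (simp add: N_def)
  then have wN: "w ^ N \<in> A" using tail_A by blast
  \<comment> \<open>The coefficients come from expanding (x - c y)^N = w^N y^N by the binomial
    theorem; the right-hand side is absorbed into the last coefficient.\<close>
  define a where "a i = (if i = N then (- (fls_const c * y)) ^ N - w ^ N * y ^ N
    else of_nat (N choose i) * (- (fls_const c * y)) ^ i)" for i
  have pow: "r * y ^ i \<in> ideal_power R J i" if "r \<in> A" for r i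
    by (rule ideal_ring_onD(4)[OF ideal_power_ideal[OF id] that power_in_ideal_power[OF y(1)]])
  have cyi: "(- (fls_const c * y)) ^ i = fls_const ((- c) ^ i) * y ^ i" for i
  proof -
    have "- (fls_const c * y) = fls_const (- c) * y" by simp
    then show ?thesis by (simp only: power_mult_distrib fls_const_power)
  qed
  have "a i \<in> ideal_power R J i" for i
  proof (cases "i = N")
    case True
    have "a i = (fls_const ((- c) ^ N) - w ^ N) * y ^ i"
      unfolding a_def using True cyi[of N] by (simp add: left_diff_distrib)
    then show ?thesis using pow[OF series_on_diff[OF const_A wN]] by simp
  next
    case False
    have "a i = fls_const (of_nat (N choose i) * (- c) ^ i) * y ^ i"
      unfolding a_def using False cyi[of i] by (simp add: fls_of_nat flip: mult.assoc)
    then show ?thesis using pow[OF const_A] by simp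
  qed
  moreover have "x ^ N + (\<Sum>i = 1..N. a i * x ^ (N - i)) = 0"
  proof -
    have "(\<Sum>i = 1..N. a i * x ^ (N - i)) = (\<Sum>i = 1..N. of_nat (N choose i) * (- (fls_const c * y)) ^ i * x ^ (N - i)
        - (if i = N then w ^ N * y ^ N else 0))"
      by (rule sum.cong) (auto simp: a_def)
    also have "\<dots> = (\<Sum>i = 1..N. of_nat (N choose i) * (- (fls_const c * y)) ^ i * x ^ (N - i)) - w ^ N * y ^ N"
      unfolding sum_subtractf by (simp add: sum.delta N_def)
    also have "x ^ N + \<dots> = (\<Sum>i\<le>N. of_nat (N choose i) * (- (fls_const c * y)) ^ i * x ^ (N - i)) - w ^ N * y ^ N"
      by (simp add: atMost_atLeast0 sum.atLeast_Suc_atMost[of 0])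
    also have "(\<Sum>i\<le>N. of_nat (N choose i) * (- (fls_const c * y)) ^ i * x ^ (N - i)) = (- (fls_const c * y) + x) ^ N"
      by (rule binomial_ring[symmetric])
    also have "- (fls_const c * y) + x = w * y"
      unfolding w_def z_def using y(2) by (simp add: left_diff_distrib)
    finally show ?thesis by (simp add: power_mult_distrib)
  qed
  moreover have "0 < N" unfolding N_def by simp
  ultimately show "x \<in> J" using J xA unfolding integrally_closed_ideal_def by blast
qed

text \<open>By the two preceding results the nonzero integrally closed ideals are the monomial
  ideals \<open>upper z\<close> with z in H. The blowup at such an ideal contains the monomials of
  exponent x - z for x \<ge> z in H, and stability says that they map the ideal into itself: this is
  the Arf condition at z.\<close>

theorem arf_ring_iff: "arf_ring (A :: 'k::field fls set) \<longleftrightarrow> Arf_semigroup"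
proof
  assume arf: "arf_ring (A :: 'k fls set)"
  show Arf_semigroup
    unfolding Arf_semigroup_def
  proof (intro ballI impI)
    fix x y z assume h: "x \<in> H" "y \<in> H" "z \<in> H" "z \<le> x" "z \<le> y"
    let ?J = "series_on (upper z) :: 'k fls set"
    have E: "H_ideal (upper z)" by (rule H_ideal_upper[OF h(3)])
    have "fls_mono z \<in> ?J" using h(3) by simp
    then have "\<exists>x\<in>?J. x \<noteq> 0" by (intro bexI[of _ "fls_mono z"]) simp
    then have st: "blowup A ?J = colon A ?J ?J"
      using arf integrally_closed_upper[OF h(3)] unfolding arf_ring_def stable_ideal_def by blast
    obtain n0 where n0: "\<And>n. n \<ge> n0 \<Longrightarrow> nfold (upper z) (Suc n) = (+) z ` nfold (upper z) n"
      using nfold_stabilises[OF E, of z] h(3) by auto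
    \<comment> \<open>The successor makes the exponent at least 1, as \<open>blowup\<close>
      requires, and keeps it in the stable range.\<close>
    define m where "m = Suc n0"
    have "fls_mono (x - z) \<in> colon A (ideal_power R ?J m) (ideal_power R ?J m)"
      unfolding colon_A ideal_power_series_on[OF E]
    proof (intro CollectI ballI)
      fix w :: "'k fls" assume w: "w \<in> series_on (nfold (upper z) m)"
      show "fls_mono (x - z) * w \<in> series_on (nfold (upper z) m)"
      proof (rule series_onI)
        fix j assume "(fls_mono (x - z) * w) $$ j \<noteq> 0"
        then have "j - (x - z) \<in> nfold (upper z) m" using series_onD[OF w] by simp
        then have "j - (x - z) + x \<in> nfold (upper z) (Suc m)" unfolding nfold.simps by (rule sumsetI) (use h in simp)
        then have "z + j \<in> (+) z ` nfold (upper z) m" using n0[of m] by (simp add: m_def algebra_simps)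
        then show "j \<in> nfold (upper z) m" by auto
      qed
    qed
    moreover have "m \<in> {1..}" unfolding m_def by simp
    ultimately have "fls_mono (x - z) \<in> blowup A ?J" unfolding blowup_def by blast
    then have "fls_mono (x - z) \<in> colon A ?J ?J" unfolding st .
    moreover have "fls_mono y \<in> ?J" using h by simp
    ultimately have "fls_mono (x - z) * fls_mono y \<in> ?J" unfolding colon_A by blast
    then have "x - z + y \<in> upper z" unfolding fls_mono_mult fls_mono_in_series_on .
    then show "x + y - z \<in> H" by (simp add: algebra_simps)
  qed
next
  assume arf: Arf_semigroup
  show "arf_ring (A :: 'k fls set)"
    unfolding arf_ring_def
  proof (intro allI impI)
    fix J :: "'k fls set" assume "integrally_closed_ideal A J \<and> (\<exists>x\<in>J. x \<noteq> 0)"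
    then have J: "integrally_closed_ideal A J" and ex: "\<exists>x. x \<in> J \<and> x \<noteq> 0" by blast+
    have JA: "J \<subseteq> A" using J ideal_ring_onD(1) unfolding integrally_closed_ideal_def by blast
    \<comment> \<open>Passing to \<open>nat\<close> loses nothing, since orders of elements of
      \<open>A\<close> are nonnegative.\<close>
    define y where "y = (ARG_MIN (\<lambda>x. nat (fls_subdegree x)) x. x \<in> J \<and> x \<noteq> 0)"
    obtain x0 where x0: "x0 \<in> J \<and> x0 \<noteq> 0" using ex by blast
    have y: "y \<in> J \<and> y \<noteq> 0" unfolding y_def by (rule arg_min_natI[of _ x0]) (rule x0)
    have min: "fls_subdegree y \<le> fls_subdegree x" if "x \<in> J" "x \<noteq> 0" for x
    proof -
      have "nat (fls_subdegree y) \<le> nat (fls_subdegree x)"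
        unfolding y_def by (rule arg_min_nat_le) (use that in simp)
      moreover have "0 \<le> fls_subdegree x" using A_subdegree JA that(1) by blast
      ultimately show ?thesis by simp
    qed
    define z where "z = fls_subdegree y"
    have Jeq: "J = series_on (upper z)" unfolding z_def
      by (rule integrally_closed_ideal_eq[OF J _ _ min]) (use y in auto)
    have zH: "z \<in> H" unfolding z_def using subdegree_in_series_on y JA by blast
    note E = H_ideal_upper[OF zH]
    \<comment> \<open>Each further summand can be traded for z by the Arf condition. All positive
      powers of the ideal are therefore translates of it and have the same colon.\<close>
    have nf: "nfold (upper z) (Suc n) = (+) (int n * z) ` upper z" for n
    proof (induction n)
      case 0
      show ?case
      proof (intro equalityI subsetI)
        fix x assume "x \<in> nfold (upper z) (Suc 0)"
        then obtain s t where "s \<in> H" "t \<in> upper z" "x = s + t" by (auto elim: sumsetE)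
        then show "x \<in> (+) (int 0 * z) ` upper z" using add_in nonneg[of s] by auto
      next
        fix x assume "x \<in> (+) (int 0 * z) ` upper z"
        then have "x \<in> upper z" by simp
        then have "0 + x \<in> sumset H (upper z)" using zero_in by (intro sumsetI)
        then show "x \<in> nfold (upper z) (Suc 0)" by simp
      qed
    next
      case (Suc n)
      show ?case
      proof (intro equalityI subsetI)
        fix x assume "x \<in> nfold (upper z) (Suc (Suc n))"
        then have "x \<in> sumset (nfold (upper z) (Suc n)) (upper z)" by (simp only: nfold.simps)
        then obtain s t where st: "s \<in> nfold (upper z) (Suc n)" "t \<in> upper z" "x = s + t" by (rule sumsetE)
        then obtain s' where s': "s' \<in> upper z" "s = int n * z + s'" unfolding Suc.IH by blast
        have "s' + t - z \<in> H" using arf s'(1) st(2) zH unfolding Arf_semigroup_def by auto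
        then have "s' + t - z \<in> upper z" using s'(1) st(2) by simp
        moreover have "x = int (Suc n) * z + (s' + t - z)" using st(3) s'(2) by (simp add: algebra_simps)
        ultimately show "x \<in> (+) (int (Suc n) * z) ` upper z" by blast
      next
        fix x assume "x \<in> (+) (int (Suc n) * z) ` upper z"
        then obtain s where s: "s \<in> upper z" "x = int (Suc n) * z + s" by blast
        have "int n * z + s \<in> nfold (upper z) (Suc n)" unfolding Suc.IH using s(1) by blast
        moreover have "z \<in> upper z" using zH by simp
        ultimately have "(int n * z + s) + z \<in> nfold (upper z) (Suc (Suc n))"
          unfolding nfold.simps(2)[of _ "Suc n"] by (rule sumsetI)
        then show "x \<in> nfold (upper z) (Suc (Suc n))" using s(2) by (simp add: algebra_simps del: nfold.simps)
      qed
    qed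
    have pw: "ideal_power R J (Suc n) = series_on ((+) (int n * z) ` upper z)" for n
      unfolding Jeq ideal_power_series_on[OF E] nf ..
    show "stable_ideal A J"
      unfolding stable_ideal_def blowup_def
    proof (intro equalityI subsetI)
      fix f :: "'k fls"
      assume "f \<in> (\<Union>n\<in>{1..}. colon A (ideal_power R J n) (ideal_power R J n))"
      then obtain n' where n': "n' \<in> {1..}" "f \<in> colon A (ideal_power R J n') (ideal_power R J n')" by blast
      define n where "n = n' - 1"
      have f: "f * w \<in> ideal_power R J (Suc n)" if "w \<in> ideal_power R J (Suc n)" for w
        using n' that unfolding colon_A n_def by simp
      show "f \<in> colon A J J"
        unfolding colon_A
      proof (intro CollectI ballI)
        fix w assume w: "w \<in> J"
        have "fls_mono (int n * z) * w \<in> ideal_power R J (Suc n)"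
          unfolding pw using w unfolding Jeq by (intro series_on_mult[of _ "{int n * z}" _ "upper z"]) auto
        then have "f * (fls_mono (int n * z) * w) \<in> series_on ((+) (int n * z) ` upper z)"
          using f unfolding pw by blast
        then have fw: "fls_mono (int n * z) * (f * w) \<in> series_on ((+) (int n * z) ` upper z)"
          by (simp add: mult.left_commute)
        show "f * w \<in> J"
          unfolding Jeq
        proof (rule series_onI)
          fix i assume "(f * w) $$ i \<noteq> 0"
          then have "(fls_mono (int n * z) * (f * w)) $$ (int n * z + i) \<noteq> 0" by simp
          then have "int n * z + i \<in> (+) (int n * z) ` upper z" by (rule series_onD[OF fw])
          then show "i \<in> upper z" by auto
        qed
      qed
    next
      fix f :: "'k fls" assume f: "f \<in> colon A J J"
      have "ideal_power R J 1 = J" using pw[of 0] unfolding Jeq by simp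
      then have "f \<in> colon A (ideal_power R J 1) (ideal_power R J 1)" using f by simp
      then show "f \<in> (\<Union>n\<in>{1..}. colon A (ideal_power R J n) (ideal_power R J n))" by blast
    qed
  qed
qed

end

section \<open>The combinatorics of the semigroup\<close>

lemma le_mult_pos: "0 \<le> x \<Longrightarrow> 0 < m \<Longrightarrow> x \<le> x * m" for x m :: int
  using mult_left_mono[of 1 m x] by simp

text \<open>Let m be the least positive element and suppose m \<ge> 3. Descending in steps of m from
  a suitable y above G, stop at w in T with w - m outside T. By symmetry v = G - (w - m) is in T,
  and the Arf condition for w, v and m puts w + v - m = G into T. What has to be arranged is that w
  and v are both at least m.\<close>

lemma symmetric_Arf_two:
  fixes T :: "int set"
  assumes T: "0 \<in> T" "\<And>x y. x \<in> T \<Longrightarrow> y \<in> T \<Longrightarrow> x + y \<in> T" "\<And>x. x \<in> T \<Longrightarrow> 0 \<le> x"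
    and G: "G \<notin> T" "\<And>z. G < z \<Longrightarrow> z \<in> T" "\<And>z. z \<notin> T \<Longrightarrow> G - z \<in> T"
    and arf: "\<And>x y z. x \<in> T \<Longrightarrow> y \<in> T \<Longrightarrow> z \<in> T \<Longrightarrow> z \<le> x \<Longrightarrow> z \<le> y \<Longrightarrow> x + y - z \<in> T"
  shows "2 \<in> T"
proof (rule ccontr)
  assume two: "2 \<notin> T"
  then have one: "1 \<notin> T" using T(2)[of 1 1] by auto
  interpret T: numerical_semigroup T G
    by unfold_locales (use T G in auto)
  define m where "m = T.e"
  have m: "m \<in> T" "m > 0" "\<And>h. h \<in> T \<Longrightarrow> h > 0 \<Longrightarrow> m \<le> h" unfolding m_def using T.e_props by auto
  have "m \<noteq> 1" "m \<noteq> 2" using one two m(1) by auto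
  then have m3: "m \<ge> 3" using m(2) by simp
  have "\<exists>y. (y = G + 1 \<or> y = G + 2) \<and> \<not> m dvd y"
  proof (rule ccontr)
    assume "\<not> ?thesis"
    then have "m dvd G + 1" "m dvd G + 2" by auto
    then have "m dvd (G + 2) - (G + 1)" by (rule dvd_diff[rotated])
    then show False using m3 by (auto dest: zdvd_imp_le)
  qed
  then obtain y where y: "y = G + 1 \<or> y = G + 2" "\<not> m dvd y" by blast
  have yT: "y \<in> T" using y(1) G(2) by auto
  have ex: "\<exists>k. y - int k * m \<notin> T"
  proof -
    have "y - int (nat (y + 1)) * m < 0"
    proof -
      have "0 \<le> y" using yT T(3) by blast
      have "y - (y + 1) * m \<le> y - (y + 1)"
        by (intro diff_left_mono le_mult_pos) (use m(2) \<open>0 \<le> y\<close> in auto)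
      also have "\<dots> < 0" by simp
      finally have "y - (y + 1) * m < 0" .
      then show ?thesis using \<open>0 \<le> y\<close> by simp
    qed
    then show ?thesis using T(3) by (metis linorder_not_le)
  qed
  define k where "k = (LEAST k. y - int k * m \<notin> T)"
  have k: "y - int k * m \<notin> T" unfolding k_def by (rule LeastI_ex[OF ex])
  have "k \<noteq> 0" using k yT by (intro notI) simp
  then obtain k' where k': "k = Suc k'" using not0_implies_Suc by blast
  define w where "w = y - int k' * m"
  have "w \<in> T" using not_less_Least[of k' "\<lambda>k. y - int k * m \<notin> T"] k' unfolding w_def k_def by simp
  have "w - m \<notin> T" using k unfolding k' w_def by (simp add: algebra_simps)
  then have v: "G - (w - m) \<in> T" by (rule G(3))
  have "w \<noteq> 0" using y(2) unfolding w_def by (metis dvd_triv_right eq_iff_diff_eq_0)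
  then have "m \<le> w" using m(3) \<open>w \<in> T\<close> T(3)[OF \<open>w \<in> T\<close>] by auto
  have "w \<le> y" unfolding w_def using m(2) by simp
  \<comment> \<open>From w \<le> y \<le> G + 2 this number is at least m - 2; here m \<ge> 3 is
    decisive.\<close>
  then have "G - (w - m) > 0" using y(1) m3 by auto
  then have "m \<le> G - (w - m)" using m(3) v by blast
  then have "w + (G - (w - m)) - m \<in> T" using arf[OF \<open>w \<in> T\<close> v m(1) \<open>m \<le> w\<close>] by blast
  then show False using G(1) by simp
qed

section \<open>Apery sets and the shape of H\<close>

context numerical_semigroup begin

definition K :: "int set" where "K = {j. F - j \<notin> H}"

inductive_set T :: "int set" where
  zero_T: "0 \<in> T"
| add_T: "x \<in> K \<Longrightarrow> y \<in> T \<Longrightarrow> x + y \<in> T"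

definition C :: "int set" where "C = {z. \<forall>t\<in>T. z + t \<in> H}"

lemma K_nonneg: "z \<in> K \<Longrightarrow> 0 \<le> z"
  unfolding K_def using above_F[of "F - z"] by force

lemma H_subset_K: "H \<subseteq> K"
  unfolding K_def using add_in F_notin by (metis add.commute diff_add_cancel mem_Collect_eq subsetI)

lemma K_add_H: "z \<in> K \<Longrightarrow> h \<in> H \<Longrightarrow> z + h \<in> K"
  unfolding K_def using add_in[of "F - (z + h)" h] by auto

lemma K_subset_T: "K \<subseteq> T"
  using add_T[OF _ zero_T] by auto

lemma H_subset_T: "H \<subseteq> T"
  using H_subset_K K_subset_T by blast

lemma T_nonneg: "t \<in> T \<Longrightarrow> 0 \<le> t"
  by (induction rule: T.induct) (auto dest: K_nonneg)

lemma T_add: "x \<in> T \<Longrightarrow> y \<in> T \<Longrightarrow> x + y \<in> T"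
  by (induction rule: T.induct) (auto simp: add.assoc intro: add_T)

lemma C_subset_H: "C \<subseteq> H"
  unfolding C_def using zero_T by force

lemma C_add_T: "z \<in> C \<Longrightarrow> t \<in> T \<Longrightarrow> z + t \<in> C"
  unfolding C_def using T_add by (auto simp: add.assoc)

lemma C_high: "F < z \<Longrightarrow> z \<in> C"
  unfolding C_def using T_nonneg above_F by force

lemma finite_H_minus_C: "finite (H - C)"
proof (rule finite_subset)
  show "H - C \<subseteq> {0..F}" using C_high nonneg by force
qed simp

lemma T_eq_H: "K \<subseteq> H \<Longrightarrow> T = H"
proof
  assume KH: "K \<subseteq> H"
  show "T \<subseteq> H"
  proof
    fix t assume "t \<in> T"
    then show "t \<in> H" by induction (use KH zero_in add_in in auto)
  qed
qed (rule H_subset_T)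

definition Apery :: "int set" where "Apery = {w \<in> H. w - e \<notin> H}"

lemma Apery_card: "finite Apery" "int (card Apery) = e"
proof -
  have eq: "Apery = H - (+) e ` H" unfolding Apery_def
  proof (intro equalityI subsetI)
    fix x assume "x \<in> {w \<in> H. w - e \<notin> H}"
    then show "x \<in> H - (+) e ` H" by auto
  next
    fix x assume x: "x \<in> H - (+) e ` H"
    have "x - e \<notin> H"
    proof
      assume "x - e \<in> H"
      then have "x \<in> (+) e ` H" by (rule rev_image_eqI) simp
      then show False using x by blast
    qed
    then show "x \<in> {w \<in> H. w - e \<notin> H}" using x by blast
  qed
  have "finite (H - (+) e ` H) \<and> int (card (H - (+) e ` H)) = e"
  proof (rule card_diff_translate[OF e_props(2)])
    show "H \<subseteq> {0..}" by (auto dest: nonneg)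
    show "{F + 1..} \<subseteq> H" by (auto intro: above_F)
    show "e + t \<in> H" if "t \<in> H" for t using e_props(1) that by (rule add_in)
  qed
  then show "finite Apery" "int (card Apery) = e" unfolding eq by auto
qed

lemma multiple_e: "int j * e \<in> H"
  by (rule mult_in[OF e_props(1)]) simp

lemma Apery_decomp:
  assumes "x \<in> H"
  obtains w j where "w \<in> Apery" "x = w + int j * e"
proof -
  have "\<exists>w\<in>Apery. \<exists>j. x = w + int j * e"
    using assms
  proof (induction "nat x" arbitrary: x rule: less_induct)
    case less
    show ?case
    proof (cases "x - e \<in> H")
      case True
      then have "nat (x - e) < nat x" using nonneg[OF True] e_props(2) by simp
      then obtain w j where "w \<in> Apery" "x - e = w + int j * e" using less.hyps True by blast
      then have "x = w + int (Suc j) * e" by (simp add: algebra_simps)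
      then show ?thesis using \<open>w \<in> Apery\<close> by blast
    next
      case False
      then have "x \<in> Apery" using less.prems unfolding Apery_def by simp
      moreover have "x = x + int 0 * e" by simp
      ultimately show ?thesis by blast
    qed
  qed
  then show ?thesis using that by blast
qed

lemma Apery_reach:
  assumes "x \<notin> H"
  obtains j where "x + int (Suc j) * e \<in> Apery"
proof -
  have "F < x + int (nat (F + 1 - x)) * e"
  proof (cases "F < x")
    case False
    have "F < x + (F + 1 - x)" by simp
    also have "\<dots> \<le> x + (F + 1 - x) * e"
      by (intro add_left_mono le_mult_pos) (use e_props(2) False in auto)
    finally have "F < x + (F + 1 - x) * e" .
    then show ?thesis using False by simp
  qed simp
  then have ex: "\<exists>k. x + int k * e \<in> H" using above_F by blast
  define k where "k = (LEAST k. x + int k * e \<in> H)"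
  have k: "x + int k * e \<in> H" unfolding k_def by (rule LeastI_ex[OF ex])
  have "k \<noteq> 0" using k assms by (intro notI) simp
  then obtain k' where k': "k = Suc k'" using not0_implies_Suc by blast
  have "x + int k' * e \<notin> H" using not_less_Least[of k' "\<lambda>k. x + int k * e \<in> H"] k' unfolding k_def by simp
  moreover have "x + int k' * e = x + int (Suc k') * e - e" by (simp add: algebra_simps)
  ultimately have "x + int (Suc k') * e \<in> Apery" using k k' unfolding Apery_def by simp
  then show ?thesis by (rule that)
qed

lemma F_plus_e: "F + e \<in> Apery"
  unfolding Apery_def using above_F[of "F + e"] e_props(2) F_notin by simp

text \<open>For w in \<open>Apery\<close> the numbers F + e - w lie in K and generate it over the
  multiples of e. The two removed elements w give F + e and 0, which belong to H, so
  \<open>Apery'\<close> indexes generators of K modulo H.\<close>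

definition Apery' :: "int set" where "Apery' = Apery - {0, F + e}"

text \<open>F - z is outside H; adding multiples of e, the first number reached inside H is the
  element w of the Apery set.\<close>

lemma K_minus_H_decomp:
  assumes "z \<in> K - H"
  obtains w j where "w \<in> Apery'" "z = F + e - w + int j * e"
proof -
  have "F - z \<notin> H" using assms unfolding K_def by simp
  then obtain j where j: "F - z + int (Suc j) * e \<in> Apery" by (rule Apery_reach)
  define w where "w = F - z + int (Suc j) * e"
  have z: "z = F + e - w + int j * e" unfolding w_def by (simp add: algebra_simps)
  have "w \<noteq> 0"
  proof
    assume "w = 0"
    then have "z = (F + e) + int j * e" using z by simp
    then have "z \<in> H" using add_in multiple_e F_plus_e unfolding Apery_def by blast
    then show False using assms by blast
  qed
  moreover have "w \<noteq> F + e" using z assms multiple_e by auto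
  ultimately have "w \<in> Apery'" using j unfolding Apery'_def w_def by blast
  then show ?thesis using z by (rule that)
qed

lemma Apery'_K: "w \<in> Apery' \<Longrightarrow> F + e - w \<in> K"
  unfolding Apery'_def Apery_def K_def by simp

text \<open>The assumption combines the two kinds of generalized Gorenstein rings: either \<open>H\<close> is symmetric,
  or \<open>\<omega>/A\<close> attains the largest length possible for its number of generators. In the second case the
  sums \<open>F + e - w + h\<close> with \<open>w \<in> Apery'\<close> and \<open>h \<in> H - C\<close> enumerate \<open>K - H\<close> without repetition.\<close>

theorem semigroup_structure:
  assumes "K \<subseteq> H \<or> card (H - C) * card Apery' \<le> card (K - H)"
  defines "n \<equiv> card (H - C)"
  shows "H \<inter> {int n * e..} = (+) (int n * e) ` T"
    and "\<And>x. x \<in> H \<Longrightarrow> x < int n * e \<Longrightarrow> \<exists>j. x = int j * e"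
    and "\<And>z. z \<notin> T \<Longrightarrow> F - int n * e - z \<in> T"
proof -
  have "H \<inter> {int n * e..} = (+) (int n * e) ` T \<and> (\<forall>x. x \<in> H \<longrightarrow> x < int n * e \<longrightarrow> (\<exists>j. x = int j * e))
    \<and> (\<forall>z. z \<notin> T \<longrightarrow> F - int n * e - z \<in> T)"
  proof (cases "K \<subseteq> H")
    case True
    then have TH: "T = H" by (rule T_eq_H)
    have "C = H" using C_subset_H add_in unfolding C_def TH by blast
    then have n0: "n = 0" unfolding n_def by simp
    have "F - z \<in> H" if "z \<notin> H" for z using True that unfolding K_def by auto
    then show ?thesis unfolding n0 TH using nonneg by force
  next
    case False
    then have ineq: "card (H - C) * card Apery' \<le> card (K - H)" using assms(1) by blast
    define P0 where "P0 = Apery' \<times> (H - C)"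
    define f where "f = (\<lambda>(w, h). F + e - w + h)"
    have finP: "finite P0" unfolding P0_def Apery'_def using Apery_card(1) finite_H_minus_C by simp
    have sub: "K - H \<subseteq> f ` P0"
    proof
      fix z assume z: "z \<in> K - H"
      then obtain w j where w: "w \<in> Apery'" "z = F + e - w + int j * e" by (rule K_minus_H_decomp)
      \<comment> \<open>A multiplier in C would carry F + e - w, an element of T, into H. This is
        what limits the number of multipliers to the size of H - C.\<close>
      have "int j * e \<notin> C"
      proof
        assume "int j * e \<in> C"
        then have "int j * e + (F + e - w) \<in> H"
          unfolding C_def using Apery'_K[OF w(1)] K_subset_T by blast
        then show False using z w(2) by (simp add: algebra_simps)
      qed
      then have "(w, int j * e) \<in> P0" unfolding P0_def using w(1) multiple_e by blast
      moreover have "z = f (w, int j * e)" unfolding f_def using w(2) by simp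
      ultimately show "z \<in> f ` P0" by blast
    qed
    have "card (f ` P0) \<le> card (K - H)"
      using card_image_le[OF finP, of f] ineq unfolding P0_def card_cartesian_product by (simp add: mult.commute)
    then have img: "f ` P0 = K - H"
      using sub finP card_subset_eq[of "f ` P0" "K - H"] card_mono[of "f ` P0" "K - H"] by auto
    have P: "h \<in> C" if "w \<in> Apery'" "h \<in> H" "F + e - w + h \<in> H" for w h
    proof (rule ccontr)
      assume "h \<notin> C"
      then have "f (w, h) \<in> f ` P0" unfolding P0_def using that by blast
      then show False using img that(3) unfolding f_def by auto
    qed
    have GmH: "F + e \<in> H" using F_plus_e unfolding Apery_def by blast
    have ApH: "w \<in> H" "w - e \<notin> H" if "w \<in> Apery" for w using that unfolding Apery_def by auto
    have Ap'H: "w \<in> H" "w - e \<notin> H" "w \<in> Apery" if "w \<in> Apery'" for w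
      using that unfolding Apery'_def Apery_def by auto
    \<comment> \<open>Take h = w in \<open>P\<close>: the sum is F + e, which is in H. Thus outside
      C only multiples of e remain in H.\<close>
    have wC: "w \<in> C" if "w \<in> Apery" "w \<noteq> 0" for w
    proof (cases "w = F + e")
      case True
      then show ?thesis using C_high e_props(2) by simp
    next
      case False
      then have "w \<in> Apery'" using that unfolding Apery'_def by simp
      then show ?thesis using P[of w w] ApH[OF that(1)] GmH by simp
    qed
    have "P0 \<noteq> {}" using False img by blast
    then obtain w0 where w0: "w0 \<in> Apery'" and "H - C \<noteq> {}" unfolding P0_def by blast
    have mult: "\<exists>j. x = int j * e" if "x \<in> H - C" for x
    proof -
      have "x \<in> H" using that by blast
      then obtain w j where wj: "w \<in> Apery" "x = w + int j * e" by (rule Apery_decomp)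
      have "w = 0"
      proof (rule ccontr)
        assume "w \<noteq> 0"
        then have "w \<in> C" using wC wj(1) by blast
        then have "x \<in> C" using wj(2) C_add_T multiple_e H_subset_T by blast
        then show False using that by blast
      qed
      then show ?thesis using wj(2) by auto
    qed
    have exn: "\<exists>m. int m * e \<in> C"
    proof -
      have "F < int (nat (F + 1)) * e"
      proof -
        have "F < F + 1" by simp
        also have "\<dots> \<le> (F + 1) * e" by (rule le_mult_pos) (use e_props(2) F_ge in auto)
        finally have "F < (F + 1) * e" .
        then show ?thesis using F_ge by simp
      qed
      then show ?thesis using C_high by blast
    qed
    \<comment> \<open>The multiples of e below m e will turn out to be all of H - C, so m is
      n.\<close>
    define m where "m = (LEAST m. int m * e \<in> C)"
    have mC: "int m * e \<in> C" unfolding m_def by (rule LeastI_ex[OF exn])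
    have less_m: "int j * e \<notin> C" if "j < m" for j
      using not_less_Least[of j "\<lambda>m. int m * e \<in> C"] that unfolding m_def by simp
    have HC: "H - C = (\<lambda>j. int j * e) ` {..<m}"
    proof (intro equalityI subsetI)
      fix x assume x: "x \<in> H - C"
      then obtain j where j: "x = int j * e" using mult by blast
      have "j < m"
      proof (rule ccontr)
        assume "\<not> j < m"
        then have "x = int m * e + int (j - m) * e" using j by (simp add: of_nat_diff algebra_simps)
        moreover have "int (j - m) * e \<in> T" using multiple_e H_subset_T by blast
        ultimately have "x \<in> C" using C_add_T[OF mC] by simp
        then show False using x by blast
      qed
      then show "x \<in> (\<lambda>j. int j * e) ` {..<m}" using j by blast
    qed (use less_m multiple_e in auto)
    have "inj_on (\<lambda>j. int j * e) {..<m}" using e_props(2) by (intro inj_onI) simp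
    then have nm: "n = m" unfolding n_def HC by (simp add: card_image)
    have "m \<noteq> 0" using \<open>H - C \<noteq> {}\<close> HC by auto
    then obtain m' where m': "m = Suc m'" using not0_implies_Suc by blast
    have m'e: "int m * e = int m' * e + e" unfolding m' by (simp add: algebra_simps)
    \<comment> \<open>An involution of \<open>Apery'\<close>: m e \<in> C puts the reflected element
      into H, while (m - 1) e \<notin> C keeps it from staying there after subtraction of e. It
      shows w - m e = F + e - \<sigma> w, so that w - m e is in K and hence in T.\<close>
    define \<sigma> where "\<sigma> w = int m * e + (F + e - w)" for w
    have \<sigma>: "\<sigma> w \<in> Apery'" if w: "w \<in> Apery'" for w
    proof -
      have 1: "\<sigma> w \<in> H" unfolding \<sigma>_def using mC Apery'_K[OF w] K_subset_T unfolding C_def by blast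
      have 2: "\<sigma> w - e \<notin> H"
      proof
        assume "\<sigma> w - e \<in> H"
        then have "F + e - w + int m' * e \<in> H" unfolding \<sigma>_def m'e by (simp add: algebra_simps)
        then have "int m' * e \<in> C" using P[OF w multiple_e] by blast
        then show False using less_m[of m'] m' by simp
      qed
      have 3: "\<sigma> w \<noteq> 0"
      proof
        assume "\<sigma> w = 0"
        then have "w - e = int m' * e + (F + e)" unfolding \<sigma>_def m'e by simp
        moreover have "int m' * e + (F + e) \<in> H" by (rule add_in[OF multiple_e GmH])
        ultimately show False using Ap'H(2)[OF w] by metis
      qed
      have 4: "\<sigma> w \<noteq> F + e"
      proof
        assume "\<sigma> w = F + e"
        then have "w - e = int m' * e" unfolding \<sigma>_def m'e by simp
        then show False using Ap'H(2)[OF w] multiple_e[of m'] by metis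
      qed
      show ?thesis using 1 2 3 4 unfolding Apery'_def Apery_def by simp
    qed
    have wT: "w - int m * e \<in> T" if w: "w \<in> Apery'" for w
    proof -
      have "w - int m * e = F + e - \<sigma> w" unfolding \<sigma>_def by simp
      then show ?thesis using Apery'_K[OF \<sigma>[OF w]] K_subset_T by auto
    qed
    \<comment> \<open>The element F + e of the Apery set has no reflection in \<open>Apery'\<close>;
      its shift is instead the sum of the two members of K belonging to w0 and its
      reflection.\<close>
    have GT: "F + e - int m * e \<in> T"
    proof -
      have "F + e - int m * e = (F + e - w0) + (F + e - \<sigma> w0)" unfolding \<sigma>_def by simp
      moreover have "F + e - w0 \<in> T" "F + e - \<sigma> w0 \<in> T"
        using Apery'_K[OF w0] Apery'_K[OF \<sigma>[OF w0]] K_subset_T by blast+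
      ultimately show ?thesis using T_add by metis
    qed
    have wT': "w - int m * e \<in> T" if "w \<in> Apery" "w \<noteq> 0" for w
      using that wT GT unfolding Apery'_def by blast
    have HT: "H \<inter> {int m * e..} = (+) (int m * e) ` T"
    proof (intro equalityI subsetI)
      fix x assume x: "x \<in> H \<inter> {int m * e..}"
      then have "x \<in> H" by blast
      then obtain w j where wj: "w \<in> Apery" "x = w + int j * e" by (rule Apery_decomp)
      have "x - int m * e \<in> T"
      proof (cases "w = 0")
        case True
        then have "int m * e \<le> int j * e" using x wj(2) by simp
        then have "m \<le> j" using e_props(2) by simp
        then have "x - int m * e = int (j - m) * e" using wj(2) True by (simp add: of_nat_diff algebra_simps)
        then show ?thesis using multiple_e H_subset_T by auto
      next
        case False
        have "(w - int m * e) + int j * e \<in> T"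
          using T_add[OF wT'[OF wj(1) False]] multiple_e H_subset_T by blast
        then show ?thesis using wj(2) by (simp add: algebra_simps)
      qed
      then show "x \<in> (+) (int m * e) ` T" by (intro image_eqI[of _ _ "x - int m * e"]) auto
    next
      fix x assume "x \<in> (+) (int m * e) ` T"
      then obtain t where t: "t \<in> T" "x = int m * e + t" by blast
      then have "x \<in> H" using mC unfolding C_def by blast
      then show "x \<in> H \<inter> {int m * e..}" using t T_nonneg by simp
    qed
    have low: "\<exists>j. x = int j * e" if x: "x \<in> H" "x < int m * e" for x
    proof -
      have "x \<notin> C"
      proof
        assume xC: "x \<in> C"
        obtain w j where wj: "w \<in> Apery" "x = w + int j * e" using x(1) by (rule Apery_decomp)
        have "w = 0"
        proof (rule ccontr)
          assume "w \<noteq> 0"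
          then have "int m * e \<le> w" using T_nonneg[OF wT'[OF wj(1)]] by simp
          then show False using wj(2) x(2) e_props(2) by (smt (verit) of_nat_0_le_iff zero_le_mult_iff)
        qed
        then have "int j * e < int m * e" "int j * e \<in> C" using wj(2) x(2) xC by auto
        then show False using less_m[of j] e_props(2) by simp
      qed
      then show ?thesis using mult x(1) by blast
    qed
    \<comment> \<open>Climb from z in steps of e to the first u in T. Then m e + u is either m e
      itself or a nonzero element of the Apery set, and in both cases the reflection F + e - m e - u
      is already known to be in T; the remaining multiple of e is added back.\<close>
    have sym: "F - int m * e - z \<in> T" if z: "z \<notin> T" for z
    proof -
      have HT': "y \<in> T \<longleftrightarrow> int m * e + y \<in> H" if "0 \<le> y" for y
      proof -
        have "int m * e + y \<in> H \<inter> {int m * e..} \<longleftrightarrow> y \<in> T" unfolding HT by auto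
        then show ?thesis using that by simp
      qed
      have exk: "\<exists>k. z + int k * e \<in> T"
      proof -
        define a where "a = nat (F + 1 - z) + nat (- z)"
        have "int a \<le> int a * e" by (rule le_mult_pos) (use e_props(2) in auto)
        then have "F < z + int a * e" unfolding a_def by linarith
        then show ?thesis using above_F H_subset_T by blast
      qed
      define k where "k = (LEAST k. z + int k * e \<in> T)"
      have k: "z + int k * e \<in> T" unfolding k_def by (rule LeastI_ex[OF exk])
      have "k \<noteq> 0" using k z by (intro notI) simp
      then obtain k' where k': "k = Suc k'" using not0_implies_Suc by blast
      define u where "u = z + int k * e"
      have "z + int k' * e \<notin> T" using not_less_Least[of k' "\<lambda>k. z + int k * e \<in> T"] k' unfolding k_def by simp
      then have ue: "u - e \<notin> T" unfolding u_def k' by (simp add: algebra_simps)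
      have uT: "u \<in> T" unfolding u_def by (rule k)
      have target: "F - int m * e - z = (F + e - int m * e - u) + int k' * e"
        unfolding u_def k' by (simp add: algebra_simps)
      have "int m * e + u \<in> H" using HT'[OF T_nonneg[OF uT]] uT by blast
      then obtain w j where wj: "w \<in> Apery" "int m * e + u = w + int j * e" by (rule Apery_decomp)
      have "F + e - int m * e - u \<in> T"
      proof (cases "w = 0")
        case True
        have "\<not> m < j"
        proof
          assume "m < j"
          then have "u - e = int (j - m - 1) * e" using wj(2) True by (simp add: of_nat_diff algebra_simps)
          then show False using ue multiple_e H_subset_T by auto
        qed
        moreover have "\<not> j < m"
        proof
          assume "j < m"
          then have "int j * e < int m * e" using e_props(2) by simp
          then show False using wj(2) True T_nonneg[OF uT] by simp
        qed
        ultimately have "u = 0" using wj(2) True by (metis add.commute add_cancel_right_right add_0 linorder_neqE_nat)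
        then show ?thesis using GT by simp
      next
        case False
        note w' = wT'[OF wj(1) False]
        have "j = 0"
        proof (rule ccontr)
          assume "j \<noteq> 0"
          then have "u - e = (w - int m * e) + int (j - 1) * e" using wj(2) by (simp add: of_nat_diff algebra_simps)
          then show False using ue T_add[OF w'] multiple_e H_subset_T by auto
        qed
        then have "F + e - int m * e - u = F + e - w" using wj(2) by simp
        moreover have "F + e - w \<in> T"
        proof (cases "w = F + e")
          case True
          then show ?thesis using zero_T by simp
        next
          case ne: False
          then have "w \<in> Apery'" using wj(1) False unfolding Apery'_def by simp
          then show ?thesis using Apery'_K K_subset_T by blast
        qed
        ultimately show ?thesis by metis
      qed
      then show ?thesis unfolding target using T_add multiple_e H_subset_T by blast
    qed
    show ?thesis unfolding nm using HT low sym by blast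
  qed
  then show "H \<inter> {int n * e..} = (+) (int n * e) ` T"
    and "\<And>x. x \<in> H \<Longrightarrow> x < int n * e \<Longrightarrow> \<exists>j. x = int j * e"
    and "\<And>z. z \<notin> T \<Longrightarrow> F - int n * e - z \<in> T" by blast+
qed

text \<open>T is symmetric with Frobenius number F - n e, and translation by n e carries the Arf
  condition from H down to T, so \<open>symmetric_Arf_two\<close> applies. In the other direction a
  parity argument makes any T containing 2 Arf, and the part of H below n e causes no trouble
  because it consists of multiples of e.\<close>

theorem Arf_semigroup_iff:
  assumes "K \<subseteq> H \<or> card (H - C) * card Apery' \<le> card (K - H)"
  defines "n \<equiv> card (H - C)"
  shows "Arf_semigroup \<longleftrightarrow> 2 + int n * e \<in> H"
    and "Arf_semigroup \<Longrightarrow> x \<in> H \<Longrightarrow> \<nexists>j. x = int j * e \<Longrightarrow> 2 + x \<in> H"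
proof -
  note str = semigroup_structure[OF assms(1), folded n_def]
  have T_iff: "t \<in> T \<longleftrightarrow> int n * e + t \<in> H" if "0 \<le> t" for t
  proof -
    have "int n * e + t \<in> H \<inter> {int n * e..} \<longleftrightarrow> t \<in> T" unfolding str(1) by auto
    then show ?thesis using that by simp
  qed
  have eT: "int j * e \<in> T" for j using multiple_e H_subset_T by blast
  have two: "2 \<in> T" if arf: Arf_semigroup
  proof (rule symmetric_Arf_two[of T "F - int n * e"])
    show GT: "F - int n * e \<notin> T"
    proof
      assume a: "F - int n * e \<in> T"
      show False using T_iff[OF T_nonneg[OF a]] a F_notin by simp
    qed
    \<comment> \<open>Symmetry at -1 puts F - n e + 1 into T. Numbers above F - n e are therefore
      nonnegative, which \<open>T_iff\<close> presupposes.\<close>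
    have "- 1 \<notin> T" using T_nonneg[of "-1"] by auto
    then have "0 \<le> F - int n * e + 1" using str(3)[of "-1"] T_nonneg[of "F - int n * e + 1"] by simp
    then show "z \<in> T" if "F - int n * e < z" for z
      using that above_F[of "int n * e + z"] T_iff[of z] by simp
    show "x + y - z \<in> T" if h: "x \<in> T" "y \<in> T" "z \<in> T" "z \<le> x" "z \<le> y" for x y z
    proof -
      have "int n * e + x \<in> H" "int n * e + y \<in> H" "int n * e + z \<in> H"
        using T_iff T_nonneg h(1-3) by blast+
      then have "(int n * e + x) + (int n * e + y) - (int n * e + z) \<in> H"
        using h(4,5) by (intro arf[unfolded Arf_semigroup_def, rule_format]) auto
      then have "int n * e + (x + y - z) \<in> H" by (simp add: algebra_simps)
      then show ?thesis using T_iff[of "x + y - z"] T_nonneg[OF h(1)] h(5) by simp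
    qed
  qed (use zero_T T_add T_nonneg str(3) in auto)
  show "2 + x \<in> H" if arf: Arf_semigroup and x: "x \<in> H" "\<nexists>j. x = int j * e"
  proof -
    \<comment> \<open>Below n e there are only multiples of e, so x is n e plus an element of T, to
      which 2 may be added.\<close>
    have "int n * e \<le> x" using str(2)[OF x(1)] x(2) by force
    then have "x - int n * e \<in> T" using T_iff[of "x - int n * e"] x(1) by simp
    then have "2 + (x - int n * e) \<in> T" using two[OF arf] T_add by blast
    then show ?thesis using T_iff[of "2 + (x - int n * e)"] \<open>int n * e \<le> x\<close> by simp
  qed
  show "Arf_semigroup \<longleftrightarrow> 2 + int n * e \<in> H"
  proof
    assume Arf_semigroup
    then show "2 + int n * e \<in> H" using T_iff[of 2] two by (simp add: add.commute)
  next
    assume "2 + int n * e \<in> H"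
    then have 2: "2 \<in> T" using T_iff[of 2] by (simp add: add.commute)
    have even: "t + 2 * int k \<in> T" if "t \<in> T" for t k
    proof (induction k)
      case (Suc k)
      then show ?case using T_add[OF Suc 2] by (simp add: algebra_simps)
    qed (use that in simp)
    have even': "t' \<in> T" if tt: "t \<in> T" "t \<le> t'" "even (t' - t)" for t t'
    proof -
      obtain q where q: "t' - t = 2 * q" using tt(3) by (rule evenE)
      then have "t' = t + 2 * int (nat q)" using tt(2) by simp
      then show ?thesis using even[OF tt(1), of "nat q"] by simp
    qed
    \<comment> \<open>One of x - z, y - z and their sum is even. Accordingly x + y - z exceeds y, x
      or z by a nonnegative even number.\<close>
    have T_arf: "x + y - z \<in> T" if h: "x \<in> T" "y \<in> T" "z \<in> T" "z \<le> x" "z \<le> y" for x y z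
    proof -
      consider "even (x - z)" | "even (y - z)" | "odd (x - z)" "odd (y - z)" by blast
      then show ?thesis
      proof cases
        case 1
        then show ?thesis using even'[OF h(2), of "x + y - z"] h by simp
      next
        case 2
        then show ?thesis using even'[OF h(1), of "x + y - z"] h by simp
      next
        case 3
        then have "even ((x - z) + (y - z))" by simp
        then show ?thesis using even'[OF h(3), of "x + y - z"] h by (simp add: algebra_simps)
      qed
    qed
    show Arf_semigroup
      unfolding Arf_semigroup_def
    proof (intro ballI impI)
      fix x y z assume h: "x \<in> H" "y \<in> H" "z \<in> H" "z \<le> x" "z \<le> y"
      have inT: "x - int n * e \<in> T" if "x \<in> H" "int n * e \<le> x" for x
        using T_iff[of "x - int n * e"] that by simp
      show "x + y - z \<in> H"
      proof (cases "int n * e \<le> z")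
        case True
        have "(x - int n * e) + (y - int n * e) - (z - int n * e) \<in> T"
          by (rule T_arf) (use True h inT in auto)
        then have t: "x + y - z - int n * e \<in> T" by (simp add: algebra_simps)
        have "int n * e + (x + y - z - int n * e) \<in> H" using T_iff[OF T_nonneg[OF t]] t by blast
        then show ?thesis by (simp add: algebra_simps)
      next
        case False
        then obtain j where j: "z = int j * e" using str(2)[OF h(3)] by auto
        \<comment> \<open>If one of x and y is also below n e, its difference from z is a
          nonnegative multiple of e, to which the other summand is added inside H.\<close>
        have diff: "u - z \<in> H" if u: "u \<in> H" "z \<le> u" "u < int n * e" for u
        proof -
          obtain i where i: "u = int i * e" using str(2)[OF u(1,3)] by auto
          then have "int j * e \<le> int i * e" using u(2) j by simp
          then have "j \<le> i" using e_props(2) by simp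
          then have "u - z = int (i - j) * e" using i j by (simp add: of_nat_diff algebra_simps)
          then show ?thesis using multiple_e by simp
        qed
        consider "x < int n * e" | "y < int n * e" | "int n * e \<le> x" "int n * e \<le> y" by linarith
        then show ?thesis
        proof cases
          case 1
          then show ?thesis using add_in[OF diff[OF h(1,4)] h(2)] by (simp add: algebra_simps)
        next
          case 2
          then show ?thesis using add_in[OF diff[OF h(2,5)] h(1)] by (simp add: algebra_simps)
        next
          \<comment> \<open>Here z = j e is subtracted from a sum containing 2 n e; one n e remains
            for the translation and the surplus (n - j) e is an element of T.\<close>
          case 3
          have "int j * e < int n * e" using False j by simp
          then have "j < n" using e_props(2) by simp
          have t: "(x - int n * e) + (y - int n * e) + int (n - j) * e \<in> T"
            by (intro T_add inT eT) (use 3 h in auto)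
          have "int n * e + ((x - int n * e) + (y - int n * e) + int (n - j) * e) = x + y - z"
            using \<open>j < n\<close> j by (simp add: of_nat_diff algebra_simps)
          moreover have "int n * e + ((x - int n * e) + (y - int n * e) + int (n - j) * e) \<in> H"
            using T_iff[OF T_nonneg[OF t]] t by blast
          ultimately show ?thesis by metis
        qed
      qed
    qed
  qed
qed

lemma Arf_minimal_multiplicity:
  assumes Arf_semigroup "x \<in> H - {0}" "y \<in> H - {0}"
  shows "x + y - e \<in> H - {0}"
proof -
  have "e \<le> x" "e \<le> y" using assms(2,3) e_props(3) nonneg[of x] nonneg[of y] by auto
  then show ?thesis using assms e_props(1,2) unfolding Arf_semigroup_def by auto
qed

end

section \<open>The conductor\<close>

lemma submodule_carrier:
  assumes "module R M"
  shows "submodule (carrier M) R M"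
proof -
  interpret M: module R M by fact
  show ?thesis by (rule M.submoduleI') auto
qed

lemma submodule_generated_submodule:
  assumes "module R M" "Y \<subseteq> carrier M"
  shows "submodule (submodule_generated R M Y) R M"
proof -
  interpret M: module R M by fact
  show ?thesis
    unfolding submodule_generated_def
  proof (rule M.submoduleI')
    show "\<Inter> {N. submodule N R M \<and> Y \<subseteq> N} \<subseteq> carrier M"
      using submodule_carrier[OF assms(1)] assms(2) by blast
    show "\<zero>\<^bsub>M\<^esub> \<in> \<Inter> {N. submodule N R M \<and> Y \<subseteq> N}"
      using submodule_zero[OF assms(1)] by blast
    show "x \<oplus>\<^bsub>M\<^esub> y \<in> \<Inter> {N. submodule N R M \<and> Y \<subseteq> N}"
      if "x \<in> \<Inter> {N. submodule N R M \<and> Y \<subseteq> N}" "y \<in> \<Inter> {N. submodule N R M \<and> Y \<subseteq> N}" for x y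
      using that by (auto intro: M.submoduleE(5))
    show "r \<odot>\<^bsub>M\<^esub> x \<in> \<Inter> {N. submodule N R M \<and> Y \<subseteq> N}"
      if "r \<in> carrier R" "x \<in> \<Inter> {N. submodule N R M \<and> Y \<subseteq> N}" for r x
      using that by (auto intro: M.submoduleE(4))
  qed
qed

lemma submodule_generated_subset: "submodule N R M \<Longrightarrow> Y \<subseteq> N \<Longrightarrow> submodule_generated R M Y \<subseteq> N"
  unfolding submodule_generated_def by blast

lemma subset_submodule_generated: "Y \<subseteq> submodule_generated R M Y"
  unfolding submodule_generated_def by blast

lemma submodule_generated_image:
  assumes M: "module R M" and Q: "module R Q" and \<pi>: "\<pi> \<in> module_hom R M Q" and Y: "Y \<subseteq> carrier M"
  shows "\<pi> ` submodule_generated R M Y = submodule_generated R Q (\<pi> ` Y)"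
proof
  have Y': "\<pi> ` Y \<subseteq> carrier Q" using Y module_homD(1)[OF \<pi>] by auto
  have "submodule_generated R M Y \<subseteq> {x \<in> carrier M. \<pi> x \<in> submodule_generated R Q (\<pi> ` Y)}"
  proof (rule submodule_generated_subset)
    show "submodule {x \<in> carrier M. \<pi> x \<in> submodule_generated R Q (\<pi> ` Y)} R M"
      by (rule submodule_preimage[OF M Q \<pi> submodule_generated_submodule[OF Q Y']])
    show "Y \<subseteq> {x \<in> carrier M. \<pi> x \<in> submodule_generated R Q (\<pi> ` Y)}"
      using Y subset_submodule_generated[of "\<pi> ` Y"] by blast
  qed
  then show "\<pi> ` submodule_generated R M Y \<subseteq> submodule_generated R Q (\<pi> ` Y)" by blast
  show "submodule_generated R Q (\<pi> ` Y) \<subseteq> \<pi> ` submodule_generated R M Y"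
    by (rule submodule_generated_subset[OF submodule_image[OF M Q \<pi> submodule_generated_submodule[OF M Y]]])
      (intro image_mono subset_submodule_generated)
qed

lemma ideal_smult_image:
  assumes M: "module R M" and Q: "module R Q" and \<pi>: "\<pi> \<in> module_hom R M Q"
    and surj: "\<pi> ` carrier M = carrier Q" and J: "J \<subseteq> carrier R"
  shows "\<pi> ` ideal_smult R J M = ideal_smult R J Q"
proof -
  interpret M: module R M by fact
  have eq: "\<pi> ` {r \<odot>\<^bsub>M\<^esub> x | r x. r \<in> J \<and> x \<in> carrier M} = {r \<odot>\<^bsub>Q\<^esub> x | r x. r \<in> J \<and> x \<in> carrier Q}"
  proof (intro equalityI subsetI)
    fix y assume "y \<in> \<pi> ` {r \<odot>\<^bsub>M\<^esub> x | r x. r \<in> J \<and> x \<in> carrier M}"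
    then obtain r x where "r \<in> J" "x \<in> carrier M" "y = \<pi> (r \<odot>\<^bsub>M\<^esub> x)" by blast
    then show "y \<in> {r \<odot>\<^bsub>Q\<^esub> x | r x. r \<in> J \<and> x \<in> carrier Q}"
      using module_homD(1,3)[OF \<pi>] J by blast
  next
    fix y assume "y \<in> {r \<odot>\<^bsub>Q\<^esub> x | r x. r \<in> J \<and> x \<in> carrier Q}"
    then obtain r z where r: "r \<in> J" "z \<in> carrier Q" "y = r \<odot>\<^bsub>Q\<^esub> z" by blast
    then obtain x where x: "x \<in> carrier M" "z = \<pi> x" using surj by blast
    then have "y = \<pi> (r \<odot>\<^bsub>M\<^esub> x)" using r module_homD(3)[OF \<pi>] J by auto
    then show "y \<in> \<pi> ` {r \<odot>\<^bsub>M\<^esub> x | r x. r \<in> J \<and> x \<in> carrier M}" using r(1) x(1) by blast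
  qed
  have sub: "{r \<odot>\<^bsub>M\<^esub> x | r x. r \<in> J \<and> x \<in> carrier M} \<subseteq> carrier M" using J by auto
  show ?thesis
    unfolding ideal_smult_def submodule_generated_image[OF M Q \<pi> sub] eq ..
qed

lemma ideal_smult_submodule:
  assumes "module R M" "J \<subseteq> carrier R"
  shows "submodule (ideal_smult R J M) R M"
proof -
  interpret M: module R M by fact
  show ?thesis
    unfolding ideal_smult_def by (rule submodule_generated_submodule[OF assms(1)]) (use assms(2) in auto)
qed

lemma ideal_smult_mem: "r \<in> J \<Longrightarrow> x \<in> carrier M \<Longrightarrow> r \<odot>\<^bsub>M\<^esub> x \<in> ideal_smult R J M"
  unfolding ideal_smult_def by (rule subsetD[OF subset_submodule_generated]) blast

lemma ideal_smult_subset: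
  assumes "submodule N R M" "\<And>r x. r \<in> J \<Longrightarrow> x \<in> carrier M \<Longrightarrow> r \<odot>\<^bsub>M\<^esub> x \<in> N"
  shows "ideal_smult R J M \<subseteq> N"
  unfolding ideal_smult_def by (rule submodule_generated_subset[OF assms(1)]) (use assms(2) in blast)

lemma ideal_module_simps [simp]:
  "carrier (ideal_module R J) = J" "\<zero>\<^bsub>ideal_module R J\<^esub> = \<zero>\<^bsub>R\<^esub>"
  "x \<oplus>\<^bsub>ideal_module R J\<^esub> y = x \<oplus>\<^bsub>R\<^esub> y" "x \<odot>\<^bsub>ideal_module R J\<^esub> y = x \<otimes>\<^bsub>R\<^esub> y"
  by (auto simp: ideal_module_def self_module_def)

context numerical_semigroup begin

lemma omega_K: "(\<omega> :: 'k::field fls set) = series_on K"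
  unfolding K_def by simp

lemma zero_K: "0 \<in> K"
  using H_subset_K zero_in by blast

lemma module_fractional:
  fixes L :: "'k::field fls set"
  assumes "ksubspace L" "\<And>r x. r \<in> A \<Longrightarrow> x \<in> L \<Longrightarrow> r * x \<in> L"
  shows "module R (ideal_module R L)"
  by (rule module_ring_onI[OF cring_R, of _ L]) (use ksubspaceD[OF assms(1)] assms(2) minus_one_A in auto)

lemma A_omega: "r \<in> A \<Longrightarrow> w \<in> series_on K \<Longrightarrow> r * w \<in> series_on K"
  by (erule series_on_mult) (auto dest: K_add_H simp: add.commute)

lemma series_on_T_mult: "x \<in> series_on T \<Longrightarrow> y \<in> series_on T \<Longrightarrow> x * y \<in> series_on T"
  by (erule series_on_mult) (auto intro: T_add)

lemma tail_T: "series_on {F + 1..} \<subseteq> series_on T"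
  by (rule series_on_mono) (use H_subset_T above_F in auto)

text \<open>Since \<open>1/g\<close> and hence the unit \<open>g\<close> belong to the ring, it contains the monomials of \<open>\<omega>\<close>.\<close>

lemma series_on_T_subset:
  fixes B :: "'k::field fls set"
  assumes AB: "A \<subseteq> B" and add: "\<And>x y. x \<in> B \<Longrightarrow> y \<in> B \<Longrightarrow> x + y \<in> B"
    and mult: "\<And>x y. x \<in> B \<Longrightarrow> y \<in> B \<Longrightarrow> x * y \<in> B"
    and g: "g \<in> series_on K" "g $$ 0 \<noteq> 0" and frac: "\<And>w. w \<in> series_on K \<Longrightarrow> w / g \<in> B"
  shows "series_on T \<subseteq> B"
proof -
  have const: "fls_const c \<in> B" for c using AB const_A by blast
  have B: "ksubspace B" unfolding ksubspace_def using add mult const AB by auto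
  have tail: "series_on {F + 1..} \<subseteq> B" using tail_A AB by blast
  have one: "1 \<in> B" using AB one_A by blast
  have g0: "g \<noteq> 0" using g(2) by auto
  have g_nn: "g \<in> series_on {0..}" using g(1) series_on_mono[of K "{0..}"] K_nonneg by auto
  have sub0: "fls_subdegree g = 0"
  proof (rule antisym)
    show "fls_subdegree g \<le> 0" by (rule fls_subdegree_leI[OF g(2)])
    show "0 \<le> fls_subdegree g" using g_nn g0 unfolding series_on_atLeast_iff by simp
  qed
  have "1 \<in> series_on K" using const_in_series_on[OF zero_K, of 1] by simp
  then have "1 / g \<in> B" by (rule frac)
  then have inv: "inverse g \<in> B" by (simp add: field_simps)
  have "inverse (inverse g) \<in> B"
  proof (rule inverse_mem_ring[OF B mult tail one inv])
    show "inverse g \<in> series_on {0..}" using sub0 unfolding series_on_atLeast_iff by simp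
    have "inverse g $$ fls_subdegree (inverse g) \<noteq> 0"
      by (rule nth_fls_subdegree_nonzero) (simp add: g0)
    then show "inverse g $$ 0 \<noteq> 0" using sub0 by simp
  qed
  then have gB: "g \<in> B" by simp
  have wB: "w \<in> B" if w: "w \<in> series_on K" for w
  proof -
    have "w = w / g * g" using g0 by simp
    then show ?thesis using mult[OF frac[OF w] gB] by simp
  qed
  have mono: "fls_mono t \<in> B" if "t \<in> T" for t
    using that
  proof induction
    case zero_T
    show ?case using one by simp
  next
    case (add_T x y)
    have "fls_mono x \<in> B" by (rule wB) (simp add: add_T.hyps(1))
    then have "fls_mono x * fls_mono y \<in> B" using add_T.IH by (rule mult)
    then show ?case by (simp add: fls_mono_mult)
  qed
  show ?thesis
  proof
    fix f :: "'k fls" assume f: "f \<in> series_on T"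
    show "f \<in> B"
    proof (rule ksubspace_memI[OF B tail])
      show "fls_mono i \<in> B" if "f $$ i \<noteq> 0" for i by (rule mono[OF series_onD[OF f that]])
    qed
  qed
qed

text \<open>g has order 0 and belongs to the ring of series on T, so its inverse does too.\<close>

lemma frac_in_series_on_T:
  fixes g :: "'k::field fls"
  assumes g: "g \<in> series_on K" "g $$ 0 \<noteq> 0" and w: "w \<in> series_on K"
  shows "w / g \<in> series_on T"
proof -
  have KT: "(series_on K :: 'k fls set) \<subseteq> series_on T" by (rule series_on_mono[OF K_subset_T])
  have "inverse g \<in> series_on T"
  proof (rule inverse_mem_ring[OF ksubspace_series_on series_on_T_mult tail_T])
    show "1 \<in> (series_on T :: 'k fls set)"
      using const_in_series_on[OF zero_T, of 1] by simp
    show "g \<in> series_on {0..}" using g(1) series_on_mono[of K "{0..}"] K_nonneg by auto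
  qed (use g KT in auto)
  then have "w * inverse g \<in> series_on T" using w KT series_on_T_mult by blast
  then show ?thesis by (simp add: field_simps)
qed

text \<open>The result no longer mentions g: the ring S of the theorem depends on H alone, whatever
  canonical ideal and reduction are chosen.\<close>

lemma generate_ring_frac:
  fixes g :: "'k::field fls"
  assumes g: "g \<in> series_on K" "g $$ 0 \<noteq> 0"
  shows "generate_ring ring_of_type_algebra (A \<union> (\<lambda>w. w / g) ` series_on K) = series_on T"
proof
  let ?G = "ring_of_type_algebra :: 'k fls ring"
  let ?S = "generate_ring ?G (A \<union> (\<lambda>w. w / g) ` series_on K)"
  interpret G: ring ?G by (rule ring_from_type_algebra)
  have minus: "\<ominus>\<^bsub>?G\<^esub> x = - x" for x
  proof (rule G.minus_equality)
    show "- x \<oplus>\<^bsub>?G\<^esub> x = \<zero>\<^bsub>?G\<^esub>" by (simp add: ring_of_type_algebra_def)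
  qed (simp_all add: ring_of_type_algebra_def)
  have one_T: "1 \<in> (series_on T :: 'k fls set)"
    using const_in_series_on[OF zero_T, of 1] by simp
  show "?S \<subseteq> series_on T"
  proof
    fix x assume "x \<in> ?S"
    then show "x \<in> series_on T"
    proof induction
      case one
      then show ?case using one_T by (simp add: ring_of_type_algebra_def)
    next
      case (incl h)
      then show ?case using frac_in_series_on_T[OF g] series_on_mono[OF H_subset_T] by blast
    next
      case (a_inv h)
      then show ?case unfolding minus by (intro series_on_uminus)
    next
      case (eng_add x y)
      then show ?case using series_on_add[of x T y] by (simp add: ring_of_type_algebra_def)
    next
      case (eng_mult x y)
      then show ?case using series_on_T_mult[of x y] by (simp add: ring_of_type_algebra_def)
    qed
  qed
  show "series_on T \<subseteq> ?S"
  proof (rule series_on_T_subset[OF _ _ _ g])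
    show "A \<subseteq> ?S" by (auto intro: generate_ring.incl)
    show "x + y \<in> ?S" if "x \<in> ?S" "y \<in> ?S" for x y
      using generate_ring.eng_add[OF that] by (simp add: ring_of_type_algebra_def)
    show "x * y \<in> ?S" if "x \<in> ?S" "y \<in> ?S" for x y
      using generate_ring.eng_mult[OF that] by (simp add: ring_of_type_algebra_def)
    show "w / g \<in> ?S" if "w \<in> series_on K" for w
      using that by (auto intro: generate_ring.incl)
  qed
qed

lemma conductor_eq: "colon A A (series_on T) = (series_on C :: 'k::field fls set)"
proof (intro equalityI subsetI)
  fix z :: "'k fls" assume "z \<in> colon A A (series_on T)"
  then have z: "z * w \<in> A" if "w \<in> series_on T" for w using that unfolding colon_A by blast
  show "z \<in> series_on C"
  proof (rule series_onI)
    fix n assume n: "z $$ n \<noteq> 0"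
    have "n + t \<in> H" if t: "t \<in> T" for t
    proof -
      have "z * fls_mono t \<in> A" by (rule z) (simp add: t)
      moreover have "(z * fls_mono t) $$ (n + t) \<noteq> 0" using n by simp
      ultimately show ?thesis by (rule series_onD)
    qed
    then show "n \<in> C" unfolding C_def by blast
  qed
next
  fix z :: "'k fls" assume z: "z \<in> series_on C"
  have "z * w \<in> A" if "w \<in> series_on T" for w
    using z that by (rule series_on_mult) (auto simp: C_def)
  then show "z \<in> colon A A (series_on T)" unfolding colon_A by blast
qed

lemma ideal_C: "ideal (series_on C) (R :: 'k::field fls ring)"
proof (rule ideal_ring_onI[OF cring_R])
  show "(series_on C :: 'k fls set) \<subseteq> A" by (rule series_on_mono[OF C_subset_H])
  show "r * x \<in> series_on C" if "r \<in> A" "x \<in> series_on C" for r x :: "'k fls"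
    using that by (rule series_on_mult) (metis C_add_T H_subset_T add.commute subsetD)
qed (auto intro: series_on_add)

lemma tail_C: "series_on {F + 1..} \<subseteq> series_on C"
  by (rule series_on_mono) (use C_high in auto)

lemma length_conductor:
  "module_length R (quotient_module (self_module R) (series_on C :: 'k::field fls set)) = enat (card (H - C))"
  using module_length_quotient_ring[OF ideal_C tail_C] unfolding vals_series_on .

text \<open>Taking orders, K is a translate of H. Both have least element 0, so the translation is
  trivial.\<close>

lemma omega_principal:
  fixes f :: "'k::field fls"
  assumes "series_on K = (*) f ` A"
  shows "K \<subseteq> H"
proof -
  have f: "f \<noteq> 0"
  proof
    assume "f = 0"
    then have "(series_on K :: 'k fls set) \<subseteq> {0}" using assms by auto
    moreover have "fls_mono 0 \<in> (series_on K :: 'k fls set)" by (simp only: fls_mono_in_series_on zero_K)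
    ultimately show False by auto
  qed
  have K: "K = (+) (fls_subdegree f) ` H"
    using vals_mult_image[OF f, of A] vals_series_on[of K, where 'a = 'k] vals_series_on[of H, where 'a = 'k]
    unfolding assms by simp
  have "fls_subdegree f + 0 \<in> K" unfolding K using zero_in by blast
  then have "0 \<le> fls_subdegree f" using K_nonneg by simp
  moreover obtain h where "h \<in> H" "0 = fls_subdegree f + h" using zero_K unfolding K by blast
  ultimately have "fls_subdegree f = 0" using nonneg by force
  then show ?thesis unfolding K by auto
qed

text \<open>If \<open>A\<close> is its own canonical module, the isomorphism to \<omega> is
  multiplication by the image of 1, so \<omega> is principal.\<close>

lemma gorenstein_symmetric:
  assumes "gorenstein_ring (R :: 'k::field fls ring)"
  shows "K \<subseteq> H"
proof -
  obtain \<Psi> :: "'k fls \<Rightarrow> 'k fls" where sm: "\<forall>r\<in>A. \<forall>x\<in>A. \<Psi> (r * x) = r * \<Psi> x"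
    and bij: "bij_betw \<Psi> A (series_on K)"
    using canonical_module_iso[OF assms[unfolded gorenstein_ring_def]] unfolding omega_K by auto
  have "\<Psi> x = \<Psi> 1 * x" if "x \<in> A" for x using sm[rule_format, OF that one_A] by simp
  then have "\<Psi> ` A = (*) (\<Psi> 1) ` A" by (intro image_cong refl)
  then have "series_on K = (*) (\<Psi> 1) ` A" using bij unfolding bij_betw_def by simp
  then show ?thesis by (rule omega_principal)
qed

end

section \<open>Ulrich cokernels\<close>

text \<open>The exact sequence 0 \<rightarrow> A \<rightarrow> K \<rightarrow> C \<rightarrow> 0 of
  the definition, carried over to \<omega>: g is the image of 1, \<pi> the projection onto the
  cokernel Q. The assumption \<open>reduced_inj\<close> is injectivity of the reduced map, stated
  for representatives.\<close>

locale ulrich_presentation = numerical_semigroup H F for H F +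
  fixes q :: "'k::field fls set" and Q :: "('k fls, 'c, 'n) module_scheme" and \<pi> :: "'k fls \<Rightarrow> 'c" and g :: "'k fls"
  assumes primary: "max_primary R q" and Q: "module R Q" and ulrich: "ulrich_module R q Q"
    and g: "g \<in> series_on K" "g \<noteq> 0"
    and \<pi>: "\<pi> \<in> module_hom R (ideal_module R (series_on K)) Q"
    and surj: "\<pi> ` series_on K = carrier Q"
    and ker: "x \<in> series_on K \<Longrightarrow> \<pi> x = \<zero>\<^bsub>Q\<^esub> \<longleftrightarrow> x \<in> (*) g ` A"
    and reduced_inj: "x \<in> A \<Longrightarrow> g * x \<in> ideal_smult R q (ideal_module R (series_on K)) \<Longrightarrow> x \<in> q"
begin

abbreviation om :: "('k fls, 'k fls) module" where "om \<equiv> ideal_module R (series_on K)"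
abbreviation gA :: "'k fls set" where "gA \<equiv> (*) g ` A"

sublocale Q: module R Q by (rule Q)

lemma q_ideal: "ideal q R" and q_mm: "q \<subseteq> \<mm>"
  using primary unfolding max_primary_def max_ideal_R by auto

lemma q_A: "q \<subseteq> A"
  by (rule ideal_ring_onD(1)[OF q_ideal])

lemma q_nonzero: "\<exists>r\<in>q. r \<noteq> 0"
proof -
  obtain n where "fls_mono (F + 2) [^]\<^bsub>R\<^esub> (n::nat) \<in> q"
    using primary mm_nonzero[where 'a = 'k] unfolding max_primary_def max_ideal_R by blast
  then have "fls_mono (F + 2) ^ n \<in> q" by simp
  then show ?thesis unfolding fls_mono_power using fls_mono_nonzero by blast
qed

lemma om_module: "module R om"
  by (rule module_fractional[OF ksubspace_series_on A_omega])

lemma \<pi>_closed: "x \<in> series_on K \<Longrightarrow> \<pi> x \<in> carrier Q"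
  using module_homD(1)[OF \<pi>] by simp

lemma \<pi>_add: "x \<in> series_on K \<Longrightarrow> y \<in> series_on K \<Longrightarrow> \<pi> (x + y) = \<pi> x \<oplus>\<^bsub>Q\<^esub> \<pi> y"
  using module_homD(2)[OF \<pi>] by simp

lemma \<pi>_smult: "r \<in> A \<Longrightarrow> x \<in> series_on K \<Longrightarrow> \<pi> (r * x) = r \<odot>\<^bsub>Q\<^esub> \<pi> x"
  using module_homD(3)[OF \<pi>] by simp

lemma gA_K: "gA \<subseteq> series_on K"
proof
  fix x assume "x \<in> gA"
  then obtain y where "y \<in> A" "x = y * g" by (auto simp: mult.commute)
  then show "x \<in> series_on K" using A_omega g(1) by blast
qed

lemma gA_ksubspace: "ksubspace gA"
  unfolding ksubspace_def
proof (intro conjI ballI allI)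
  show "0 \<in> gA" by (rule image_eqI[of _ _ 0]) auto
  fix x assume "x \<in> gA"
  then obtain a where a: "a \<in> A" "x = g * a" by blast
  show "x + y \<in> gA" if "y \<in> gA" for y
  proof -
    obtain b where b: "b \<in> A" "y = g * b" using \<open>y \<in> gA\<close> by blast
    have "x + y = g * (a + b)" using a b by (simp add: algebra_simps)
    then show ?thesis using series_on_add[OF a(1) b(1)] by blast
  qed
  show "fls_const c * x \<in> gA" for c
  proof -
    have "fls_const c * x = g * (fls_const c * a)" using a by (simp add: algebra_simps)
    then show ?thesis using series_on_const_mult[OF a(1)] by blast
  qed
qed

lemma gA_smult: "r \<in> A \<Longrightarrow> x \<in> gA \<Longrightarrow> r * x \<in> gA"
proof -
  assume r: "r \<in> A" and "x \<in> gA"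
  then obtain a where a: "a \<in> A" "x = g * a" by blast
  have "r * x = g * (r * a)" using a by (simp add: algebra_simps)
  then show ?thesis using mult_A[OF r a(1)] by blast
qed

lemma gA_tail: "series_on {fls_subdegree g + F + 1..} \<subseteq> gA"
proof
  fix f :: "'k fls" assume f: "f \<in> series_on {fls_subdegree g + F + 1..}"
  have "inverse g \<in> series_on {- fls_subdegree g..}" unfolding series_on_atLeast_iff by simp
  then have "inverse g * f \<in> series_on {F + 1..}" using f by (rule series_on_mult) auto
  then have "inverse g * f \<in> A" using tail_A by blast
  moreover have "f = g * (inverse g * f)" using g(2) by simp
  ultimately show "f \<in> gA" by (rule rev_image_eqI)
qed

lemma K_bound: "(series_on K :: 'k fls set) \<subseteq> series_on {0..}"
  by (rule series_on_mono) (use K_nonneg in auto)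

text \<open>Pulled back along \<pi>, a submodule of Q becomes a set of series above gA, where
  lengths are counted by missing values.\<close>

lemma quotient_length:
  assumes P: "submodule P R Q"
  shows "module_length R (quotient_module Q P) = enat (card (K - vals {x \<in> series_on K. \<pi> x \<in> P}))"
proof -
  interpret QP: submodule_quotient R Q P by (intro submodule_quotient.intro submodule_quotient_axioms.intro Q P)
  define \<kappa> where "\<kappa> x = P +>\<^bsub>Q\<^esub> \<pi> x" for x
  have hom: "\<kappa> \<in> module_hom R om (quotient_module Q P)"
    unfolding module_hom_def \<kappa>_def using \<pi>_closed \<pi>_add \<pi>_smult by auto
  have onto: "\<kappa> ` carrier om = carrier (quotient_module Q P)"
    unfolding QP.quotient_simps ideal_module_simps surj[symmetric] \<kappa>_def by auto
  have kernel: "{x \<in> carrier om. \<kappa> x = \<zero>\<^bsub>quotient_module Q P\<^esub>} = {x \<in> series_on K. \<pi> x \<in> P}"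
    unfolding QP.quotient_simps ideal_module_simps \<kappa>_def using QP.coset_eq_N_iff \<pi>_closed by auto
  have sub: "submodule {x \<in> series_on K. \<pi> x \<in> P} R om"
    using submodule_preimage[OF om_module Q \<pi> P] by simp
  have "gA \<subseteq> {x \<in> series_on K. \<pi> x \<in> P}"
  proof
    fix x assume x: "x \<in> gA"
    then have "x \<in> series_on K" using gA_K by blast
    moreover from this have "\<pi> x = \<zero>\<^bsub>Q\<^esub>" using ker x by blast
    ultimately show "x \<in> {x \<in> series_on K. \<pi> x \<in> P}" using submodule_zero[OF Q P] by simp
  qed
  then have tail: "series_on {fls_subdegree g + F + 1..} \<subseteq> {x \<in> series_on K. \<pi> x \<in> P}"
    using gA_tail by blast
  have "module_length R (quotient_module Q P) = length_above R om {x \<in> series_on K. \<pi> x \<in> P}"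
    using module_length_surjection[OF om_module QP.quotient_is_module hom onto] unfolding kernel .
  also have "\<dots> = enat (card (vals (carrier om) - vals {x \<in> series_on K. \<pi> x \<in> P}))"
    by (rule length_above_fls[OF om_module _ _ _ sub tail, of 0]) (use K_bound in auto)
  finally show ?thesis by (simp add: vals_series_on)
qed

lemma preimage_zero: "{x \<in> series_on K. \<pi> x \<in> {\<zero>\<^bsub>Q\<^esub>}} = gA"
  using ker gA_K by auto

lemma zero_submodule: "submodule {\<zero>\<^bsub>Q\<^esub>} R Q"
  by (rule Q.submoduleI') auto

lemma mono_kills:
  assumes "r \<in> A" "r \<in> series_on {fls_subdegree g + F + 1..}" "x \<in> carrier Q"
  shows "r \<odot>\<^bsub>Q\<^esub> x = \<zero>\<^bsub>Q\<^esub>"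
proof -
  obtain w where w: "w \<in> series_on K" "x = \<pi> w" using assms(3) surj by blast
  have "r * w \<in> series_on {fls_subdegree g + F + 1..}"
    by (rule series_on_mult[OF assms(2) subsetD[OF K_bound w(1)]]) auto
  then have "r * w \<in> gA" using gA_tail by blast
  then have "\<pi> (r * w) = \<zero>\<^bsub>Q\<^esub>" using ker gA_K by blast
  then show ?thesis using \<pi>_smult[OF assms(1) w(1)] w(2) by simp
qed

text \<open>Q has finite length, so its dimension is 0 and its multiplicity is the length of Q
  modulo a high power of q, that is, of Q itself. The Ulrich condition equates this with the length
  of Q/qQ; equality of lengths leaves no room for qQ.\<close>

lemma q_annihilates: "ideal_smult R q Q = {\<zero>\<^bsub>Q\<^esub>}"
proof -
  define s where "s = fls_subdegree g + F + 1"
  have "fls_subdegree g \<in> K" by (rule subdegree_in_series_on[OF g])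
  then have s0: "F < s" "0 \<le> s" unfolding s_def using K_nonneg F_ge by force+
  have dim: "module_dim R Q = 0"
    unfolding module_dim_def
  proof (rule dim_above_nonzero)
    have "fls_mono s \<in> A" using above_F[OF s0(1)] by simp
    moreover have "fls_mono s \<in> series_on {s..}" by simp
    ultimately show "fls_mono s \<in> annihilator R Q"
      unfolding annihilator_def using mono_kills unfolding s_def by simp
  qed simp
  \<comment> \<open>Elements of q have order at least 1, so those of the n-th power have order at
    least n. From order s on they move \<omega> into gA.\<close>
  have power: "ideal_smult R (ideal_power R q n) Q = {\<zero>\<^bsub>Q\<^esub>}" if n: "nat s \<le> n" for n
  proof
    have pA: "ideal_power R q n \<subseteq> A"
      using ideal_ring_onD(1)[OF ideal_power_ideal[OF q_ideal]] .
    have "q \<subseteq> series_on {1..}"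
    proof (rule order_trans[OF q_mm series_on_mono])
      show "H - {0} \<subseteq> {1..}" using nonneg by force
    qed
    then have "ideal_power R q n \<subseteq> series_on {int n * 1..}" by (rule ideal_power_bound)
    also have "\<dots> \<subseteq> series_on {s..}" by (rule series_on_mono) (use n in auto)
    finally have p: "ideal_power R q n \<subseteq> series_on {s..}" .
    show "ideal_smult R (ideal_power R q n) Q \<subseteq> {\<zero>\<^bsub>Q\<^esub>}"
    proof (rule ideal_smult_subset[OF zero_submodule])
      fix r x assume r: "r \<in> ideal_power R q n" and x: "x \<in> carrier Q"
      have "r \<odot>\<^bsub>Q\<^esub> x = \<zero>\<^bsub>Q\<^esub>"
        by (rule mono_kills[OF subsetD[OF pA r] _ x]) (use subsetD[OF p r] in \<open>simp add: s_def\<close>)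
      then show "r \<odot>\<^bsub>Q\<^esub> x \<in> {\<zero>\<^bsub>Q\<^esub>}" by simp
    qed
    have "submodule (ideal_smult R (ideal_power R q n) Q) R Q"
      by (rule ideal_smult_submodule[OF Q]) (use pA in simp)
    then show "{\<zero>\<^bsub>Q\<^esub>} \<subseteq> ideal_smult R (ideal_power R q n) Q" using submodule_zero[OF Q] by blast
  qed
  define c where "c = card (K - vals gA)"
  \<comment> \<open>In dimension 0 both the factorial and the power of n in the definition are
    1.\<close>
  have "multiplicity_wrt R q Q = lim (\<lambda>n. real (the_enat (module_length R
      (quotient_module Q (ideal_smult R (ideal_power R q n) Q)))))"
    unfolding multiplicity_wrt_def dim by (simp add: zero_enat_def)
  also have "\<dots> = real c"
  proof (rule limI, rule tendsto_eventually)
    show "\<forall>\<^sub>F n in sequentially. real (the_enat (module_length R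
      (quotient_module Q (ideal_smult R (ideal_power R q n) Q)))) = real c"
      unfolding eventually_sequentially
    proof (intro exI allI impI)
      fix n assume "nat s \<le> n"
      then show "real (the_enat (module_length R
          (quotient_module Q (ideal_smult R (ideal_power R q n) Q)))) = real c"
        unfolding power[OF \<open>nat s \<le> n\<close>] quotient_length[OF zero_submodule] preimage_zero c_def by simp
    qed
  qed
  finally have mult: "multiplicity_wrt R q Q = real c" .
  define P where "P = {x \<in> series_on K. \<pi> x \<in> ideal_smult R q Q}"
  have qs: "submodule (ideal_smult R q Q) R Q" by (rule ideal_smult_submodule[OF Q]) (use q_A in simp)
  have "real c = real (the_enat (module_length R (quotient_module Q (ideal_smult R q Q))))"
    using ulrich mult unfolding ulrich_module_def by simp
  then have card_eq: "card (K - vals gA) = card (K - vals P)"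
    unfolding quotient_length[OF qs] c_def P_def by simp
  have gP: "gA \<subseteq> P" unfolding P_def preimage_zero[symmetric] using submodule_zero[OF Q qs] by auto
  have PK: "P \<subseteq> series_on K" unfolding P_def by blast
  have vP: "vals gA \<subseteq> vals P" "vals P \<subseteq> K"
    using vals_mono[OF gP] vals_mono[OF PK] unfolding vals_series_on by auto
  have fin: "finite (K - vals gA)" using finite_vals_diff[OF gA_tail K_bound] unfolding vals_series_on .
  have "K - vals P = K - vals gA"
    by (rule card_subset_eq[OF fin]) (use vP card_eq in auto)
  then have vals: "vals P \<subseteq> vals gA" using vP by blast
  have "submodule P R om" unfolding P_def using submodule_preimage[OF om_module Q \<pi> qs] by simp
  then have "0 \<in> P \<and> (\<forall>x\<in>P. \<forall>y\<in>P. x + y \<in> P) \<and> (\<forall>r\<in>A. \<forall>x\<in>P. r * x \<in> P)"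
    by (subst (asm) submodule_iff_set[OF om_module]) auto
  then have "ksubspace P" unfolding ksubspace_def using const_A by blast
  then have "P \<subseteq> gA" by (rule subset_if_vals_subset[OF gA_ksubspace _ gP gA_tail vals])
  show ?thesis
  proof
    show "{\<zero>\<^bsub>Q\<^esub>} \<subseteq> ideal_smult R q Q" using submodule_zero[OF Q qs] by blast
    show "ideal_smult R q Q \<subseteq> {\<zero>\<^bsub>Q\<^esub>}"
    proof
      fix y assume y: "y \<in> ideal_smult R q Q"
      then have "y \<in> carrier Q" using Q.submoduleE(1)[OF qs] by blast
      then obtain x where x: "x \<in> series_on K" "y = \<pi> x" using surj by blast
      then have "x \<in> P" using y unfolding P_def by blast
      then have "x \<in> gA" using \<open>P \<subseteq> gA\<close> by blast
      then show "y \<in> {\<zero>\<^bsub>Q\<^esub>}" using ker[OF x(1)] x(2) by simp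
    qed
  qed
qed

text \<open>Annihilation of Q by q places products r w in gA; \<open>reduced_inj\<close> then moves
  the cofactor from \<open>A\<close> into q. Together: q \<omega> is contained in g q.\<close>

lemma q_omega: "r \<in> q \<Longrightarrow> w \<in> series_on K \<Longrightarrow> \<exists>x\<in>q. r * w = g * x"
proof -
  assume r: "r \<in> q" and w: "w \<in> series_on K"
  have rA: "r \<in> A" using r q_A by blast
  have rw: "r * w \<in> ideal_smult R q om" using ideal_smult_mem[of r q w om R] r w by simp
  have "\<pi> (r * w) \<in> ideal_smult R q Q"
    unfolding \<pi>_smult[OF rA w] using r \<pi>_closed[OF w] by (rule ideal_smult_mem)
  then have "\<pi> (r * w) = \<zero>\<^bsub>Q\<^esub>" unfolding q_annihilates by simp
  then have "r * w \<in> gA" using ker[OF A_omega[OF rA w]] by blast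
  then obtain x where x: "x \<in> A" "r * w = g * x" by blast
  then show ?thesis using reduced_inj[of x] rw by auto
qed

text \<open>1 belongs to \<omega>, so an element of q of least order is g times an element of q. The
  latter cannot have smaller order, hence g has order at most 0.\<close>

lemma g_unit: "fls_subdegree g = 0"
proof (rule antisym)
  have "fls_subdegree g \<in> K" by (rule subdegree_in_series_on[OF g])
  then show "0 \<le> fls_subdegree g" by (rule K_nonneg)
  define d where "d = (LEAST n. \<exists>r\<in>q. r \<noteq> 0 \<and> n = nat (fls_subdegree r))"
  have "\<exists>n. \<exists>r\<in>q. r \<noteq> 0 \<and> n = nat (fls_subdegree r)" using q_nonzero by blast
  then have "\<exists>r\<in>q. r \<noteq> 0 \<and> d = nat (fls_subdegree r)" unfolding d_def by (rule LeastI_ex)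
  then obtain r where r: "r \<in> q" "r \<noteq> 0" "d = nat (fls_subdegree r)" by blast
  have min: "fls_subdegree r \<le> fls_subdegree x" if x: "x \<in> q" "x \<noteq> 0" for x
  proof -
    have "d \<le> nat (fls_subdegree x)" unfolding d_def by (rule Least_le) (use x in blast)
    moreover have "0 \<le> fls_subdegree x" using A_subdegree q_A x(1) by blast
    moreover have "0 \<le> fls_subdegree r" using A_subdegree q_A r(1) by blast
    ultimately show ?thesis using r(3) by linarith
  qed
  have "1 \<in> (series_on K :: 'k fls set)" using const_in_series_on[OF zero_K, of 1] by simp
  then obtain x where x: "x \<in> q" "r * 1 = g * x" using q_omega[OF r(1)] by blast
  then have "x \<noteq> 0" using r(2) by auto
  then have "fls_subdegree r = fls_subdegree g + fls_subdegree x" using x(2) g(2) by simp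
  then show "fls_subdegree g \<le> 0" using min[OF x(1) \<open>x \<noteq> 0\<close>] by simp
qed

lemma g_nth_0: "g $$ 0 \<noteq> 0"
  using nth_fls_subdegree_nonzero[OF g(2)] unfolding g_unit .

text \<open>The multiplier ring of q contains \<open>A\<close> and, by \<open>q_omega\<close>, all
  of \<omega>/g; hence it contains the series on T. So q is an ideal of that ring lying inside
  \<open>A\<close>, and such ideals lie in the conductor.\<close>

lemma q_subset_C: "q \<subseteq> series_on C"
proof
  fix r assume r: "r \<in> q"
  define B where "B = {z. \<forall>x\<in>q. z * x \<in> q}"
  note qD = ideal_ring_onD[OF q_ideal]
  have "series_on T \<subseteq> B"
  proof (rule series_on_T_subset[OF _ _ _ g(1) g_nth_0])
    show "A \<subseteq> B" unfolding B_def using qD(4) by blast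
    show "x + y \<in> B" if "x \<in> B" "y \<in> B" for x y
      using that qD(3) unfolding B_def by (simp add: distrib_right)
    show "x * y \<in> B" if "x \<in> B" "y \<in> B" for x y
      using that unfolding B_def by (simp add: mult.assoc)
    show "w / g \<in> B" if w: "w \<in> series_on K" for w
      unfolding B_def
    proof (intro CollectI ballI)
      fix x assume "x \<in> q"
      then obtain y where y: "y \<in> q" "x * w = g * y" using q_omega w by blast
      have "w / g * x = (x * w) / g" by simp
      also have "\<dots> = y" using y(2) g(2) by simp
      finally show "w / g * x \<in> q" using y(1) by simp
    qed
  qed
  then have mult: "fls_mono t * r \<in> A" if "t \<in> T" for t
  proof -
    have "fls_mono t \<in> B" by (rule subsetD[OF \<open>series_on T \<subseteq> B\<close>]) (simp add: that)
    then show ?thesis using r q_A unfolding B_def by blast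
  qed
  show "r \<in> series_on C"
  proof (rule series_onI)
    fix n assume n: "r $$ n \<noteq> 0"
    have "n + t \<in> H" if "t \<in> T" for t
    proof (rule series_onD[OF mult[OF that]])
      show "(fls_mono t * r) $$ (n + t) \<noteq> 0" using n by simp
    qed
    then show "n \<in> C" unfolding C_def by blast
  qed
qed

section \<open>Freeness of the cokernel, lifted to \<omega>\<close>

lemma singleton_coset: "x \<in> carrier Q \<Longrightarrow> {\<zero>\<^bsub>Q\<^esub>} +>\<^bsub>Q\<^esub> x = {x}"
  using a_r_coset_mem[where N = "{\<zero>\<^bsub>Q\<^esub>}" and M = Q and x = x] by auto

abbreviation D where "D \<equiv> reduction_module R q Q"

text \<open>Since qQ = 0, the cosets that make up Q/qQ are singletons and the reduction is Q itself
  in disguise.\<close>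

lemma D_carrier: "carrier D = (\<lambda>x. {\<pi> x}) ` series_on K"
proof -
  have "carrier D = (\<lambda>x. {\<zero>\<^bsub>Q\<^esub>} +>\<^bsub>Q\<^esub> x) ` carrier Q"
    unfolding reduction_module_def q_annihilates by (auto simp: A_RCOSETS_def')
  also have "\<dots> = (\<lambda>x. {x}) ` carrier Q" by (intro image_cong refl singleton_coset)
  finally show ?thesis unfolding surj[symmetric] by auto
qed

lemma D_zero: "\<zero>\<^bsub>D\<^esub> = {\<zero>\<^bsub>Q\<^esub>}"
  unfolding reduction_module_def q_annihilates by simp

lemma D_add: "x \<in> series_on K \<Longrightarrow> y \<in> series_on K \<Longrightarrow> {\<pi> x} \<oplus>\<^bsub>D\<^esub> {\<pi> y} = {\<pi> (x + y)}"
  unfolding reduction_module_def by (simp add: set_add_def' \<pi>_add)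

lemma D_smult:
  assumes a: "a \<in> A" and x: "x \<in> series_on K"
  shows "(q +>\<^bsub>R\<^esub> a) \<odot>\<^bsub>D\<^esub> {\<pi> x} = {\<pi> (a * x)}"
proof -
  have eq: "{\<zero>\<^bsub>Q\<^esub>} +>\<^bsub>Q\<^esub> (r \<odot>\<^bsub>Q\<^esub> \<pi> x) = {\<pi> (a * x)}" if r: "r \<in> q +>\<^bsub>R\<^esub> a" for r
  proof -
    obtain n where n: "n \<in> q" "r = n + a" using r unfolding a_r_coset_mem by auto
    have nA: "n \<in> A" using n(1) q_A by blast
    have "\<pi> (n * x) = \<zero>\<^bsub>Q\<^esub>"
    proof -
      obtain y where "y \<in> q" "n * x = g * y" using q_omega[OF n(1) x] by blast
      then have "n * x \<in> gA" using q_A by blast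
      then show ?thesis using ker[OF A_omega[OF nA x]] by simp
    qed
    then have "\<pi> (r * x) = \<pi> (a * x)"
      unfolding n(2) distrib_right \<pi>_add[OF A_omega[OF nA x] A_omega[OF a x]]
      using \<pi>_closed[OF A_omega[OF a x]] by simp
    moreover have "r \<in> A" using n nA a series_on_add by blast
    ultimately have "r \<odot>\<^bsub>Q\<^esub> \<pi> x = \<pi> (a * x)" using \<pi>_smult[OF _ x] by simp
    then show ?thesis using singleton_coset[OF \<pi>_closed[OF A_omega[OF a x]]] by simp
  qed
  have ne: "q +>\<^bsub>R\<^esub> a \<noteq> {}"
    using ideal_ring_onD(2)[OF q_ideal] a_r_coset_mem[where y = "0 + a" and N = q and M = R and x = a] by auto
  have "(q +>\<^bsub>R\<^esub> a) \<odot>\<^bsub>D\<^esub> {\<pi> x} = (\<Union>r\<in>q +>\<^bsub>R\<^esub> a. {\<zero>\<^bsub>Q\<^esub>} +>\<^bsub>Q\<^esub> (r \<odot>\<^bsub>Q\<^esub> \<pi> x))"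
    unfolding reduction_module_def q_annihilates by simp
  also have "\<dots> = (\<Union>r\<in>q +>\<^bsub>R\<^esub> a. {\<pi> (a * x)})" by (intro SUP_cong refl eq)
  also have "\<dots> = {\<pi> (a * x)}" using ne by simp
  finally show ?thesis .
qed

lemma coset_q: "q +>\<^bsub>R\<^esub> a = q \<Longrightarrow> a \<in> q"
  using ideal_ring_onD(2)[OF q_ideal] a_r_coset_mem[where y = "0 + a" and N = q and M = R and x = a] by auto

lemma quot_carrier: "carrier (R Quot q) = (\<lambda>a. q +>\<^bsub>R\<^esub> a) ` A" and quot_zero: "\<zero>\<^bsub>R Quot q\<^esub> = q"
  unfolding FactRing_def by (auto simp: A_RCOSETS_def')

lemma free_D: "free_module (R Quot q) D"
  using ulrich unfolding ulrich_module_def by blast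

lemma D_module: "module (R Quot q) D"
  using free_D unfolding free_module_def by blast

lemma omega_sum: "(\<And>b. b \<in> Z \<Longrightarrow> a b \<in> A \<and> \<beta> b \<in> series_on K) \<Longrightarrow> (\<Sum>b\<in>Z. a b * \<beta> b) \<in> series_on K"
  by (rule series_on_sum) (use A_omega in blast)

lemma D_finsum:
  assumes "finite Z" "\<And>b. b \<in> Z \<Longrightarrow> x b \<in> series_on K"
  shows "(\<Oplus>\<^bsub>D\<^esub>b\<in>Z. {\<pi> (x b)}) = {\<pi> (\<Sum>b\<in>Z. x b)}"
  using assms
proof (induction Z)
  interpret D: module "R Quot q" D by (rule D_module)
  case empty
  have "\<pi> 0 = \<zero>\<^bsub>Q\<^esub>" using module_hom_zero[OF om_module Q \<pi>] by simp
  then show ?case unfolding D.finsum_empty D_zero by simp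
next
  interpret D: module "R Quot q" D by (rule D_module)
  case (insert b Z)
  have "(\<Oplus>\<^bsub>D\<^esub>i\<in>insert b Z. {\<pi> (x i)}) = {\<pi> (x b)} \<oplus>\<^bsub>D\<^esub> (\<Oplus>\<^bsub>D\<^esub>i\<in>Z. {\<pi> (x i)})"
    by (rule D.finsum_insert[OF insert.hyps]) (use insert.prems in \<open>auto simp: D_carrier\<close>)
  also have "(\<Oplus>\<^bsub>D\<^esub>i\<in>Z. {\<pi> (x i)}) = {\<pi> (\<Sum>i\<in>Z. x i)}"
    by (rule insert.IH) (use insert.prems in blast)
  also have "{\<pi> (x b)} \<oplus>\<^bsub>D\<^esub> \<dots> = {\<pi> (x b + (\<Sum>i\<in>Z. x i))}"
    by (intro D_add series_on_sum insert.prems) auto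
  finally show ?case using insert.hyps by simp
qed

text \<open>Freeness of Q over A/q in terms of lifts: coefficients are taken in \<open>A\<close>
  instead of A/q, and vanishing in Q becomes membership in gA. The index set is the abstract basis
  itself, hence its type of sets.\<close>

definition omega_basis :: "'c set set \<Rightarrow> ('c set \<Rightarrow> 'k fls) \<Rightarrow> bool" where
  "omega_basis J \<beta> \<longleftrightarrow> (\<forall>b\<in>J. \<beta> b \<in> series_on K) \<and>
    (\<forall>Z a. finite Z \<longrightarrow> Z \<subseteq> J \<longrightarrow> (\<forall>b\<in>Z. a b \<in> A) \<longrightarrow> (\<Sum>b\<in>Z. a b * \<beta> b) \<in> gA \<longrightarrow> (\<forall>b\<in>Z. a b \<in> q)) \<and>
    (\<forall>w\<in>series_on K. \<exists>Z a. finite Z \<and> Z \<subseteq> J \<and> (\<forall>b\<in>Z. a b \<in> A) \<and> w - (\<Sum>b\<in>Z. a b * \<beta> b) \<in> gA)"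

text \<open>Unique representation is split into its two halves: existence gives generation, and
  uniqueness for the zero element gives independence.\<close>

theorem ex_omega_basis: "\<exists>J \<beta>. omega_basis J \<beta>"
proof -
  interpret D: module "R Quot q" D by (rule D_module)
  let ?E = "carrier (R Quot q)"
  define represents where "represents J x c \<longleftrightarrow> c \<in> J \<rightarrow>\<^sub>E ?E \<and> finite {b\<in>J. c b \<noteq> q} \<and>
        x = (\<Oplus>\<^bsub>D\<^esub>b\<in>{b\<in>J. c b \<noteq> q}. c b \<odot>\<^bsub>D\<^esub> b)" for J x c
  have "\<exists>J\<subseteq>carrier D. \<forall>x\<in>carrier D. \<exists>!c. represents J x c"
    using free_D unfolding free_module_def quot_zero represents_def by (rule conjunct2)
  then obtain J where J: "J \<subseteq> carrier D" and basis: "\<forall>x\<in>carrier D. \<exists>!c. represents J x c" by blast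
  have "\<forall>b\<in>J. \<exists>x. x \<in> series_on K \<and> b = {\<pi> x}" using J unfolding D_carrier by blast
  then obtain \<beta> where \<beta>: "\<And>b. b \<in> J \<Longrightarrow> \<beta> b \<in> series_on K" "\<And>b. b \<in> J \<Longrightarrow> b = {\<pi> (\<beta> b)}" by metis
  have q_quot: "q \<in> ?E" using D.R.zero_closed unfolding quot_zero .
  have fin_sum: "(\<Oplus>\<^bsub>D\<^esub>b\<in>Z. (q +>\<^bsub>R\<^esub> a b) \<odot>\<^bsub>D\<^esub> b) = {\<pi> (\<Sum>b\<in>Z. a b * \<beta> b)}"
    if Z: "finite Z" "Z \<subseteq> J" and a: "\<And>b. b \<in> Z \<Longrightarrow> a b \<in> A" for Z a
  proof -
    have "(\<Oplus>\<^bsub>D\<^esub>b\<in>Z. (q +>\<^bsub>R\<^esub> a b) \<odot>\<^bsub>D\<^esub> b) = (\<Oplus>\<^bsub>D\<^esub>b\<in>Z. {\<pi> (a b * \<beta> b)})"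
    proof (rule D.finsum_cong')
      show "(\<lambda>b. {\<pi> (a b * \<beta> b)}) \<in> Z \<rightarrow> carrier D"
        unfolding D_carrier using Z(2) a A_omega \<beta>(1) by blast
      fix b assume b: "b \<in> Z"
      then have "b \<in> J" using Z(2) by blast
      show "(q +>\<^bsub>R\<^esub> a b) \<odot>\<^bsub>D\<^esub> b = {\<pi> (a b * \<beta> b)}"
        using D_smult[OF a[OF b] \<beta>(1)[OF \<open>b \<in> J\<close>]] \<beta>(2)[OF \<open>b \<in> J\<close>] by metis
    qed simp
    also have "\<dots> = {\<pi> (\<Sum>b\<in>Z. a b * \<beta> b)}"
      by (rule D_finsum[OF Z(1)]) (use Z(2) a A_omega \<beta>(1) in blast)
    finally show ?thesis .
  qed
  have indep: "\<forall>b\<in>Z. a b \<in> q"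
    if Z: "finite Z" "Z \<subseteq> J" and a: "\<And>b. b \<in> Z \<Longrightarrow> a b \<in> A" and sum: "(\<Sum>b\<in>Z. a b * \<beta> b) \<in> gA" for Z a
  proof -
    \<comment> \<open>The classes of the given coefficients, extended by q, the zero of A/q. Where
      the class is zero, the coefficient is in q and its term lies in gA, so the support of c
      accounts for the whole relation.\<close>
    define c where "c = (\<lambda>b\<in>J. if b \<in> Z then q +>\<^bsub>R\<^esub> a b else q)"
    define c0 where "c0 = (\<lambda>b\<in>J. q)"
    let ?nz = "{b\<in>J. c b \<noteq> q}"
    have nz: "?nz \<subseteq> Z" unfolding c_def by auto
    then have fin: "finite ?nz" using Z(1) finite_subset by blast
    have c: "c \<in> J \<rightarrow>\<^sub>E ?E" unfolding c_def quot_carrier using a q_quot[unfolded quot_carrier] by auto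
    have s1: "(\<Sum>b\<in>Z - ?nz. a b * \<beta> b) \<in> gA"
    proof (rule ksubspace_sum[OF gA_ksubspace])
      fix b assume b: "b \<in> Z - ?nz"
      then have "b \<in> J" "c b = q" using Z(2) by auto
      then have "q +>\<^bsub>R\<^esub> a b = q" using b unfolding c_def by simp
      then have "a b \<in> q" by (rule coset_q)
      then show "a b * \<beta> b \<in> gA" using q_omega[OF _ \<beta>(1)[OF \<open>b \<in> J\<close>]] q_A by blast
    qed
    have "(\<Sum>b\<in>Z. a b * \<beta> b) = (\<Sum>b\<in>Z - ?nz. a b * \<beta> b) + (\<Sum>b\<in>?nz. a b * \<beta> b)"
      by (rule sum.subset_diff[OF nz Z(1)])
    then have "(\<Sum>b\<in>?nz. a b * \<beta> b) = (\<Sum>b\<in>Z. a b * \<beta> b) - (\<Sum>b\<in>Z - ?nz. a b * \<beta> b)"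
      by (simp only: add_diff_cancel_left')
    then have sum': "(\<Sum>b\<in>?nz. a b * \<beta> b) \<in> gA"
      using ksubspaceD(5)[OF gA_ksubspace sum s1] by (simp only:)
    have "(\<Oplus>\<^bsub>D\<^esub>b\<in>?nz. c b \<odot>\<^bsub>D\<^esub> b) = (\<Oplus>\<^bsub>D\<^esub>b\<in>?nz. (q +>\<^bsub>R\<^esub> a b) \<odot>\<^bsub>D\<^esub> b)"
    proof (rule D.finsum_cong')
      show "(\<lambda>b. (q +>\<^bsub>R\<^esub> a b) \<odot>\<^bsub>D\<^esub> b) \<in> ?nz \<rightarrow> carrier D"
      proof
        fix b assume b: "b \<in> ?nz"
        then have "q +>\<^bsub>R\<^esub> a b \<in> ?E" unfolding quot_carrier using a nz by blast
        then show "(q +>\<^bsub>R\<^esub> a b) \<odot>\<^bsub>D\<^esub> b \<in> carrier D" using J b by (intro D.smult_closed) auto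
      qed
      show "c b \<odot>\<^bsub>D\<^esub> b = (q +>\<^bsub>R\<^esub> a b) \<odot>\<^bsub>D\<^esub> b" if "b \<in> ?nz" for b
      proof -
        have "c b = q +>\<^bsub>R\<^esub> a b" using that nz unfolding c_def by auto
        then show ?thesis by simp
      qed
    qed simp
    also have "\<dots> = {\<pi> (\<Sum>b\<in>?nz. a b * \<beta> b)}" by (rule fin_sum[OF fin]) (use a nz in auto)
    also have "\<dots> = \<zero>\<^bsub>D\<^esub>"
      unfolding D_zero using ker[OF subsetD[OF gA_K sum']] sum' by simp
    finally have 1: "\<zero>\<^bsub>D\<^esub> = (\<Oplus>\<^bsub>D\<^esub>b\<in>?nz. c b \<odot>\<^bsub>D\<^esub> b)" by simp
    have empty: "{b\<in>J. c0 b \<noteq> q} = {}" unfolding c0_def by auto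
    have "represents J \<zero>\<^bsub>D\<^esub> c" unfolding represents_def using c fin 1 by blast
    moreover have "represents J \<zero>\<^bsub>D\<^esub> c0"
      unfolding represents_def empty using q_quot unfolding c0_def by auto
    \<comment> \<open>The relation and the zero family both represent the zero element.\<close>
    ultimately have "c = c0" using basis[rule_format, OF D.zero_closed] by (metis (no_types))
    show ?thesis
    proof
      fix b assume b: "b \<in> Z"
      then have bJ: "b \<in> J" using Z(2) by blast
      have "q +>\<^bsub>R\<^esub> a b = c b" unfolding c_def using b bJ by simp
      also have "\<dots> = q" unfolding \<open>c = c0\<close> c0_def using bJ by simp
      finally show "a b \<in> q" by (rule coset_q)
    qed
  qed
  have gen: "\<exists>Z a. finite Z \<and> Z \<subseteq> J \<and> (\<forall>b\<in>Z. a b \<in> A) \<and> w - (\<Sum>b\<in>Z. a b * \<beta> b) \<in> gA"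
    if w: "w \<in> series_on K" for w
  proof -
    have "{\<pi> w} \<in> carrier D" unfolding D_carrier using w by blast
    then obtain c where rc: "represents J {\<pi> w} c" using basis by (metis (no_types))
    then have c: "c \<in> J \<rightarrow>\<^sub>E ?E" and fin: "finite {b\<in>J. c b \<noteq> q}"
      and eq: "{\<pi> w} = (\<Oplus>\<^bsub>D\<^esub>b\<in>{b\<in>J. c b \<noteq> q}. c b \<odot>\<^bsub>D\<^esub> b)"
      unfolding represents_def by (rule conjunct1, rule conjunct1[OF conjunct2], rule conjunct2[OF conjunct2])
    define Z where "Z = {b\<in>J. c b \<noteq> q}"
    have ZJ: "Z \<subseteq> J" unfolding Z_def by blast
    have "\<forall>b\<in>J. \<exists>a. a \<in> A \<and> c b = q +>\<^bsub>R\<^esub> a" using c unfolding quot_carrier by (auto simp: PiE_def Pi_def)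
    then obtain a where a: "\<And>b. b \<in> J \<Longrightarrow> a b \<in> A" "\<And>b. b \<in> J \<Longrightarrow> c b = q +>\<^bsub>R\<^esub> a b" by metis
    have "{\<pi> w} = (\<Oplus>\<^bsub>D\<^esub>b\<in>Z. (q +>\<^bsub>R\<^esub> a b) \<odot>\<^bsub>D\<^esub> b)"
      unfolding eq Z_def[symmetric]
    proof (rule D.finsum_cong')
      show "(\<lambda>b. (q +>\<^bsub>R\<^esub> a b) \<odot>\<^bsub>D\<^esub> b) \<in> Z \<rightarrow> carrier D"
      proof
        fix b assume b: "b \<in> Z"
        then have "q +>\<^bsub>R\<^esub> a b \<in> ?E" unfolding quot_carrier using a ZJ by blast
        then show "(q +>\<^bsub>R\<^esub> a b) \<odot>\<^bsub>D\<^esub> b \<in> carrier D" using J ZJ b by (intro D.smult_closed) auto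
      qed
    qed (use a ZJ in auto)
    also have "\<dots> = {\<pi> (\<Sum>b\<in>Z. a b * \<beta> b)}"
      by (rule fin_sum[OF fin[folded Z_def] ZJ]) (use a(1) ZJ in auto)
    finally have eq': "\<pi> w = \<pi> (\<Sum>b\<in>Z. a b * \<beta> b)" by simp
    define v where "v = (\<Sum>b\<in>Z. a b * \<beta> b)"
    have v: "v \<in> series_on K" unfolding v_def by (rule omega_sum) (use a(1) ZJ \<beta>(1) in blast)
    have wv: "w - v \<in> series_on K" using series_on_diff[OF w v] .
    have "\<pi> (w - v) \<oplus>\<^bsub>Q\<^esub> \<pi> v = \<pi> w" using \<pi>_add[OF wv v] by simp
    then have "\<pi> (w - v) \<oplus>\<^bsub>Q\<^esub> \<pi> v = \<zero>\<^bsub>Q\<^esub> \<oplus>\<^bsub>Q\<^esub> \<pi> v" using eq' \<pi>_closed[OF v] unfolding v_def by simp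
    then have "\<pi> (w - v) = \<zero>\<^bsub>Q\<^esub>"
      using Q.M.add.right_cancel[OF \<pi>_closed[OF v] \<pi>_closed[OF wv] Q.M.zero_closed] by simp
    then have "w - v \<in> gA" using ker[OF wv] by simp
    then show ?thesis using fin[folded Z_def] ZJ a(1) unfolding v_def by blast
  qed
  have "omega_basis J \<beta>" unfolding omega_basis_def
  proof (intro conjI ballI allI impI)
    show "\<beta> b \<in> series_on K" if "b \<in> J" for b by (rule \<beta>(1)[OF that])
    show "a b \<in> q" if "finite Z" "Z \<subseteq> J" "\<forall>b\<in>Z. a b \<in> A" "(\<Sum>b\<in>Z. a b * \<beta> b) \<in> gA" "b \<in> Z" for Z a b
      using indep[OF that(1,2) bspec[OF that(3)] that(4)] that(5) by blast
    show "\<exists>Z a. finite Z \<and> Z \<subseteq> J \<and> (\<forall>b\<in>Z. a b \<in> A) \<and> w - (\<Sum>b\<in>Z. a b * \<beta> b) \<in> gA"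
      if "w \<in> series_on K" for w by (rule gen[OF that])
  qed
  then show ?thesis by blast
qed

text \<open>Two counts are combined. A basis of Q with coefficients from H - C gives independent
  elements of \<omega> modulo gA, so n times the rank is at most the size of K - H. And g together
  with the basis generates \<omega>, while minimal multiplicity puts at least one value for 0 and
  one for each w in \<open>Apery'\<close> outside \<mm>\<omega>; hence the rank is at least the size
  of \<open>Apery'\<close>.\<close>

theorem length_bound:
  assumes min: "\<And>x y. x \<in> H - {0} \<Longrightarrow> y \<in> H - {0} \<Longrightarrow> x + y - e \<in> H"
  shows "card (H - C) * card Apery' \<le> card (K - H)"
proof (cases "H - C = {}")
  case True
  show ?thesis unfolding True by simp
next
  case False
  obtain J \<beta> where basis: "omega_basis J \<beta>" using ex_omega_basis by blast
  have \<beta>: "\<beta> b \<in> series_on K" if "b \<in> J" for b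
    using basis that unfolding omega_basis_def by (elim conjE) (erule bspec)
  have indep: "\<forall>b\<in>Z. a b \<in> q"
    if "finite Z" "Z \<subseteq> J" "\<forall>b\<in>Z. a b \<in> A" "(\<Sum>b\<in>Z. a b * \<beta> b) \<in> gA" for Z a
    by (rule basis[unfolded omega_basis_def, THEN conjunct2, THEN conjunct1,
        THEN spec[of _ Z], THEN spec[of _ a], THEN mp, THEN mp, THEN mp, THEN mp, OF that])
  have gen: "\<exists>Z a. finite Z \<and> Z \<subseteq> J \<and> (\<forall>b\<in>Z. a b \<in> A) \<and> w - (\<Sum>b\<in>Z. a b * \<beta> b) \<in> gA"
    if "w \<in> series_on K" for w
    by (rule basis[unfolded omega_basis_def, THEN conjunct2, THEN conjunct2, THEN bspec, OF that])
  have vals_gA: "vals gA = H" using vals_mult_image[OF g(2), of A] unfolding g_unit vals_series_on by simp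
  have bound: "card (H - C) * card Z \<le> card (K - H)" if Z: "finite Z" "Z \<subseteq> J" for Z
  proof -
    \<comment> \<open>In a relation between these products, the coefficient of each basis element is
      a polynomial supported on H - C. Freeness puts it into q, hence into the series on C, and so
      it is zero.\<close>
    define x where "x = (\<lambda>(h, b). fls_mono h * \<beta> b)"
    have "card ((H - C) \<times> Z) \<le> card (vals (series_on K :: 'k fls set) - vals gA)"
    proof (rule card_independent_le[OF gA_ksubspace ksubspace_series_on gA_K gA_tail K_bound])
      show "finite ((H - C) \<times> Z)" using finite_H_minus_C Z(1) by blast
      show "x i \<in> series_on K" if i: "i \<in> (H - C) \<times> Z" for i
      proof -
        obtain h b where "i = (h, b)" "h \<in> H" "b \<in> Z" using i by blast
        moreover have "fls_mono h * \<beta> b \<in> series_on K" using A_omega[OF _ \<beta>] calculation Z(2) by auto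
        ultimately show ?thesis unfolding x_def by simp
      qed
      fix c assume sum: "(\<Sum>i\<in>(H - C) \<times> Z. fls_const (c i) * x i) \<in> gA"
      define a where "a b = (\<Sum>h\<in>H - C. fls_const (c (h, b)) * fls_mono h)" for b
      have a_nth: "a b $$ h = c (h, b)" if "h \<in> H - C" for h b
      proof -
        have "a b $$ h = (\<Sum>i\<in>H - C. if i = h then c (i, b) else 0)"
          unfolding a_def fls_nth_sum by (intro sum.cong refl) auto
        also have "\<dots> = c (h, b)" using that finite_H_minus_C by simp
        finally show ?thesis .
      qed
      have aA: "a b \<in> A" for b
        unfolding a_def by (intro series_on_sum series_on_const_mult) auto
      have "(\<Sum>i\<in>(H - C) \<times> Z. fls_const (c i) * x i) = (\<Sum>h\<in>H - C. \<Sum>b\<in>Z. fls_const (c (h, b)) * x (h, b))"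
        using sum.cartesian_product[of "\<lambda>h b. fls_const (c (h, b)) * x (h, b)" Z "H - C"] by simp
      also have "\<dots> = (\<Sum>b\<in>Z. \<Sum>h\<in>H - C. fls_const (c (h, b)) * x (h, b))" by (rule sum.swap)
      also have "\<dots> = (\<Sum>b\<in>Z. a b * \<beta> b)"
        unfolding a_def x_def sum_distrib_right by (simp add: mult.assoc)
      finally have "(\<Sum>b\<in>Z. a b * \<beta> b) \<in> gA" using sum by simp
      then have aq: "\<forall>b\<in>Z. a b \<in> q" by (intro indep[OF Z] ballI aA)
      show "\<forall>i\<in>(H - C) \<times> Z. c i = 0"
      proof
        fix i assume "i \<in> (H - C) \<times> Z"
        then obtain h b where i: "i = (h, b)" "h \<in> H - C" "b \<in> Z" by blast
        have "a b \<in> series_on C" using aq i(3) q_subset_C by blast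
        then have "a b $$ h = 0" by (rule series_on_zero) (use i(2) in blast)
        then show "c i = 0" using a_nth[OF i(2)] i(1) by simp
      qed
    qed
    then show ?thesis unfolding vals_gA vals_series_on card_cartesian_product .
  qed
  \<comment> \<open>The bound holds for every finite part of the basis, and since H - C is nonempty
    it bounds the size of the part.\<close>
  have finJ: "finite J"
  proof (rule ccontr)
    assume "infinite J"
    then obtain Z where Z: "Z \<subseteq> J" "finite Z" "card Z = Suc (card (K - H))"
      by (meson infinite_arbitrarily_large)
    have "1 * card Z \<le> card (H - C) * card Z"
      by (rule mult_le_mono1) (use False finite_H_minus_C in \<open>simp add: Suc_le_eq card_gt_0_iff\<close>)
    then show False using bound[OF Z(2,1)] Z(3) by simp
  qed
  \<comment> \<open>The values of \<mm>\<omega>.\<close>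
  define E where "E = sumset (H - {0}) K"
  \<comment> \<open>\<open>None\<close> is the index of g, the generator of the image of
    \<open>A\<close>.\<close>
  define I where "I = insert None (Some ` J)"
  define x where "x i = (case i of None \<Rightarrow> g | Some b \<Rightarrow> \<beta> b)" for i
  let ?U = "span_mod (series_on E) x I"
  have finI: "finite I" unfolding I_def using finJ by simp
  have U: "ksubspace ?U" by (rule ksubspace_span_mod[OF ksubspace_series_on finI])
  have EU: "series_on E \<subseteq> ?U" by (rule subset_span_mod)
  have xU: "x i \<in> ?U" if i: "i \<in> I" for i
  proof -
    have "(\<Sum>j\<in>I. fls_const (if j = i then 1 else 0) * x j) = (\<Sum>j\<in>I. if j = i then x j else 0)"
      by (intro sum.cong refl) auto
    also have "\<dots> = x i" using i finI by simp
    finally have "x i = 0 + (\<Sum>j\<in>I. fls_const (if j = i then 1 else 0) * x j)" by simp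
    then show ?thesis unfolding span_mod_def
      by (intro CollectI exI[of _ 0] exI[of _ "\<lambda>j. if j = i then 1 else 0"] conjI) auto
  qed
  have xK: "x i \<in> series_on K" if "i \<in> I" for i
    using that g(1) \<beta> unfolding I_def x_def by auto
  have axU: "r * x i \<in> ?U" if r: "r \<in> A" and i: "i \<in> I" for r i
  proof -
    have "r - fls_const (r $$ 0) \<in> \<mm>"
      unfolding mm_iff using series_on_diff[OF r const_A] by simp
    then have "(r - fls_const (r $$ 0)) * x i \<in> series_on E"
      by (rule series_on_mult[OF _ xK[OF i]]) (simp add: E_def sumsetI)
    then have 1: "(r - fls_const (r $$ 0)) * x i \<in> ?U" using EU by blast
    have 2: "fls_const (r $$ 0) * x i \<in> ?U" by (rule ksubspaceD(3)[OF U xU[OF i]])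
    have "r * x i = (r - fls_const (r $$ 0)) * x i + fls_const (r $$ 0) * x i" by (simp add: algebra_simps)
    then show ?thesis using ksubspaceD(2)[OF U 1 2] by simp
  qed
  have KU: "series_on K \<subseteq> ?U"
  proof
    fix w :: "'k fls" assume w: "w \<in> series_on K"
    obtain Z a where Z: "finite Z" "Z \<subseteq> J" "\<forall>b\<in>Z. a b \<in> A" "w - (\<Sum>b\<in>Z. a b * \<beta> b) \<in> gA"
      using gen[OF w] by (elim exE conjE) (rule that; assumption)
    then obtain r where r: "r \<in> A" "w - (\<Sum>b\<in>Z. a b * \<beta> b) = g * r" by (elim imageE)
    have 1: "r * x None \<in> ?U" by (rule axU[OF r(1)]) (simp add: I_def)
    have 2: "(\<Sum>b\<in>Z. a b * x (Some b)) \<in> ?U"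
      by (rule ksubspace_sum[OF U], rule axU) (use Z(2,3) in \<open>auto simp: I_def\<close>)
    have "w = r * x None + (\<Sum>b\<in>Z. a b * x (Some b))"
      using r(2) unfolding x_def by (simp add: algebra_simps)
    then show "w \<in> ?U" using ksubspaceD(2)[OF U 1 2] by simp
  qed
  have card: "finite (vals ?U - E)" "card (vals ?U - E) \<le> card I"
    using card_vals_span_mod[OF ksubspace_series_on finI, of E x] unfolding vals_series_on by auto
  have E_pos: "e \<le> z" if z: "z \<in> E" for z
  proof -
    obtain h k where "h \<in> H - {0}" "k \<in> K" "z = h + k" using z unfolding E_def by (rule sumsetE)
    then show ?thesis using e_props(3)[of h] nonneg[of h] K_nonneg[of k] by auto
  qed
  have "insert 0 ((\<lambda>w. F + e - w) ` Apery') \<subseteq> vals ?U - E"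
  proof -
    have KE: "K \<subseteq> vals ?U" using vals_mono[OF KU] unfolding vals_series_on .
    have "F + e - w \<notin> E" if w: "w \<in> Apery'" for w
    proof
      assume "F + e - w \<in> E"
      then obtain h k where hk: "h \<in> H - {0}" "k \<in> K" "F + e - w = h + k" unfolding E_def by (rule sumsetE)
      have "w \<in> H - {0}" using w unfolding Apery'_def Apery_def by blast
      \<comment> \<open>Minimal multiplicity enters here: it makes F - k an element of H,
        contradicting k \<in> K. So the generators F + e - w of K stay outside
        \<mm>\<omega>.\<close>
      then have "w + h - e \<in> H" using min hk(1) by blast
      moreover have "F - k = w + h - e" using hk(3) by simp
      ultimately show False using hk(2) unfolding K_def by simp
    qed
    moreover have "0 \<notin> E" using E_pos[of 0] e_props(2) by auto
    ultimately show ?thesis using KE zero_K Apery'_K by blast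
  qed
  then have "card (insert 0 ((\<lambda>w. F + e - w) ` Apery')) \<le> card I"
    using card card_mono by (meson order_trans)
  moreover have "card (insert 0 ((\<lambda>w. F + e - w) ` Apery')) = Suc (card Apery')"
  proof -
    have fin: "finite ((\<lambda>w. F + e - w) ` Apery')" unfolding Apery'_def using Apery_card(1) by simp
    have "0 \<notin> (\<lambda>w. F + e - w) ` Apery'" unfolding Apery'_def by auto
    moreover have "card ((\<lambda>w. F + e - w) ` Apery') = card Apery'" by (rule card_image) (simp add: inj_on_def)
    ultimately show ?thesis using fin by simp
  qed
  moreover have "card I = Suc (card J)"
  proof -
    have "card (Some ` J) = card J" by (rule card_image) simp
    then show ?thesis unfolding I_def using finJ by simp
  qed
  ultimately have "card Apery' \<le> card J" by simp
  then have "card (H - C) * card Apery' \<le> card (H - C) * card J" by simp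
  also have "\<dots> \<le> card (K - H)" by (rule bound[OF finJ order_refl])
  finally show ?thesis .
qed

end

section \<open>Generalized Gorenstein semigroup rings\<close>

context numerical_semigroup begin

lemma reduced_map_zero:
  assumes K': "module R K'" and q: "q \<subseteq> carrier R" and Y: "Y \<noteq> {}" "\<And>y. y \<in> Y \<Longrightarrow> \<phi> y \<in> ideal_smult R q K'"
  shows "reduced_map R q K' \<phi> Y = ideal_smult R q K'"
proof -
  have sub: "submodule (ideal_smult R q K') R K'" by (rule ideal_smult_submodule[OF K' q])
  interpret S: submodule_quotient R K' "ideal_smult R q K'"
    by (intro submodule_quotient.intro submodule_quotient_axioms.intro K' sub)
  have "ideal_smult R q K' +>\<^bsub>K'\<^esub> \<phi> y = ideal_smult R q K'" if "y \<in> Y" for y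
    using S.coset_eq_N_iff S.NE(1) Y(2)[OF that] by blast
  then have "reduced_map R q K' \<phi> Y = (\<Union>y\<in>Y. ideal_smult R q K')"
    unfolding reduced_map_def by (rule SUP_cong[OF refl])
  then show ?thesis using Y(1) by simp
qed

text \<open>In the Gorenstein case H is symmetric. Otherwise the abstract sequence is moved to
  \<omega> along the isomorphism of \<open>canonical_module_iso\<close>, with the image of 1 as g,
  and becomes an \<open>ulrich_presentation\<close>.\<close>

theorem generalized_gorenstein_bound:
  assumes gg: "generalized_gorenstein (R :: 'k::field fls ring)"
    and min: "\<And>x y. x \<in> H - {0} \<Longrightarrow> y \<in> H - {0} \<Longrightarrow> x + y - e \<in> H"
  shows "K \<subseteq> H \<or> card (H - C) * card Apery' \<le> card (K - H)"
proof (cases "gorenstein_ring (R :: 'k fls ring)")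
  case True
  then show ?thesis using gorenstein_symmetric by blast
next
  case False
  obtain q and K' C' :: "('k fls, (nat \<Rightarrow> 'k fls) set) module" and \<phi> \<psi>
    where q: "max_primary R q" and can: "canonical_module R K'" and C': "module R C'"
      and exact: "short_exact R (self_module R) \<phi> K' \<psi> C'" and ulrich: "ulrich_module R q C'"
      and inj: "inj_on (reduced_map R q K' \<phi>) (carrier (R Quot q))"
    using gg False unfolding generalized_gorenstein_def by blast
  have K': "module R K'" using can unfolding canonical_module_def finitely_generated_module_def by blast
  interpret K': module R K' by fact
  have q_ideal: "ideal q R" using q unfolding max_primary_def by blast
  note qA = ideal_ring_onD(1)[OF q_ideal]
  have \<phi>: "\<phi> \<in> module_hom R (self_module R) K'" and \<psi>: "\<psi> \<in> module_hom R K' C'"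
    and \<phi>_inj: "inj_on \<phi> A" and img: "\<phi> ` A = {x \<in> carrier K'. \<psi> x = \<zero>\<^bsub>C'\<^esub>}"
    and onto: "\<psi> ` carrier K' = carrier C'"
    using exact unfolding short_exact_def by simp_all
  obtain \<Psi> :: "(nat \<Rightarrow> 'k fls) set \<Rightarrow> 'k fls"
    where add: "\<forall>x\<in>carrier K'. \<forall>y\<in>carrier K'. \<Psi> (x \<oplus>\<^bsub>K'\<^esub> y) = \<Psi> x + \<Psi> y"
      and sm: "\<forall>r\<in>A. \<forall>x\<in>carrier K'. \<Psi> (r \<odot>\<^bsub>K'\<^esub> x) = r * \<Psi> x"
      and bij: "bij_betw \<Psi> (carrier K') (series_on K)"
    using canonical_module_iso[OF can] unfolding omega_K by blast
  define \<Theta> where "\<Theta> = inv_into (carrier K') \<Psi>"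
  have \<Theta>: "\<Theta> w \<in> carrier K'" "\<Psi> (\<Theta> w) = w" if "w \<in> series_on K" for w
    unfolding \<Theta>_def using bij that by (auto simp: bij_betw_def inv_into_into f_inv_into_f)
  have \<Psi>_closed: "\<Psi> x \<in> series_on K" and \<Theta>\<Psi>: "\<Theta> (\<Psi> x) = x" if "x \<in> carrier K'" for x
    unfolding \<Theta>_def using bij that by (auto simp: bij_betw_def)
  let ?om = "ideal_module R (series_on K)"
  have om: "module R ?om" by (rule module_fractional[OF ksubspace_series_on A_omega])
  have \<Theta>_add: "\<Theta> (x + y) = \<Theta> x \<oplus>\<^bsub>K'\<^esub> \<Theta> y" if x: "x \<in> series_on K" and y: "y \<in> series_on K" for x y
    using add[rule_format, OF \<Theta>(1)[OF x] \<Theta>(1)[OF y]] \<Theta>\<Psi>[OF K'.M.a_closed[OF \<Theta>(1)[OF x] \<Theta>(1)[OF y]]]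
    unfolding \<Theta>(2)[OF x] \<Theta>(2)[OF y] by simp
  have \<Theta>_sm: "\<Theta> (r * x) = r \<odot>\<^bsub>K'\<^esub> \<Theta> x" if r: "r \<in> A" and x: "x \<in> series_on K" for r x
  proof -
    have "\<Psi> (r \<odot>\<^bsub>K'\<^esub> \<Theta> x) = r * x" using sm[rule_format, OF r \<Theta>(1)[OF x]] \<Theta>(2)[OF x] by simp
    moreover have "r \<odot>\<^bsub>K'\<^esub> \<Theta> x \<in> carrier K'" using K'.smult_closed \<Theta>(1)[OF x] r by simp
    ultimately show ?thesis using \<Theta>\<Psi> by metis
  qed
  have \<Psi>_hom: "\<Psi> \<in> module_hom R K' ?om"
    unfolding module_hom_def using \<Psi>_closed add sm by auto
  have \<phi>1: "\<phi> 1 \<in> carrier K'" using module_homD(1)[OF \<phi>, of 1] by simp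
  have \<phi>_eq: "\<phi> x = x \<odot>\<^bsub>K'\<^esub> \<phi> 1" if "x \<in> A" for x
    using module_homD(3)[OF \<phi>, of x 1] that by simp
  define g where "g = \<Psi> (\<phi> 1)"
  have g: "g \<in> series_on K" unfolding g_def by (rule \<Psi>_closed[OF \<phi>1])
  have \<Psi>\<phi>: "\<Psi> (\<phi> x) = g * x" if "x \<in> A" for x
    unfolding g_def \<phi>_eq[OF that] using sm[rule_format, OF that \<phi>1] by (simp add: mult.commute)
  have \<phi>_closed: "\<phi> x \<in> carrier K'" if "x \<in> A" for x using module_homD(1)[OF \<phi>] that by simp
  interpret U: ulrich_presentation H F q C' "\<lambda>x. \<psi> (\<Theta> x)" g
  proof (intro ulrich_presentation.intro ulrich_presentation_axioms.intro)
    show "numerical_semigroup H F" by (rule numerical_semigroup_axioms)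
    show "max_primary R q" "module R C'" "ulrich_module R q C'" "g \<in> series_on K" by fact+
    show "g \<noteq> 0"
    proof
      assume "g = 0"
      then have "\<Psi> (\<phi> 1) = \<Psi> (\<phi> 0)" using \<Psi>\<phi>[of 0] unfolding g_def by simp
      then have "\<Theta> (\<Psi> (\<phi> 1)) = \<Theta> (\<Psi> (\<phi> 0))" by (rule arg_cong)
      then have "\<phi> 1 = \<phi> 0"
        unfolding \<Theta>\<Psi>[OF \<phi>_closed[OF one_A]] \<Theta>\<Psi>[OF \<phi>_closed[OF zero_in_series_on]] .
      then have "1 = (0 :: 'k fls)" by (rule inj_onD[OF \<phi>_inj _ one_A zero_in_series_on])
      then show False by simp
    qed
    show "(\<lambda>x. \<psi> (\<Theta> x)) \<in> module_hom R ?om C'"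
      unfolding module_hom_def using \<Theta>(1) \<Theta>_add \<Theta>_sm module_homD[OF \<psi>] by auto
    have "\<Theta> ` series_on K = carrier K'"
      using bij_betw_inv_into[OF bij] unfolding \<Theta>_def bij_betw_def by blast
    then show "(\<lambda>x. \<psi> (\<Theta> x)) ` series_on K = carrier C'" using onto by (simp only: image_image[symmetric])
    show "\<psi> (\<Theta> x) = \<zero>\<^bsub>C'\<^esub> \<longleftrightarrow> x \<in> (*) g ` A" if x: "x \<in> series_on K" for x
    proof
      assume "\<psi> (\<Theta> x) = \<zero>\<^bsub>C'\<^esub>"
      then have "\<Theta> x \<in> \<phi> ` A" unfolding img using \<Theta>(1)[OF x] by simp
      then obtain y where y: "y \<in> A" "\<Theta> x = \<phi> y" by blast
      then have "x = g * y" using \<Theta>(2)[OF x] \<Psi>\<phi>[OF y(1)] by simp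
      then show "x \<in> (*) g ` A" using y(1) by blast
    next
      assume "x \<in> (*) g ` A"
      then obtain y where y: "y \<in> A" "x = g * y" by blast
      then have "\<Theta> x = \<phi> y" using \<Psi>\<phi>[OF y(1)] \<Theta>\<Psi>[OF \<phi>_closed[OF y(1)]] by simp
      then have "\<Theta> x \<in> \<phi> ` A" using y(1) by blast
      then show "\<psi> (\<Theta> x) = \<zero>\<^bsub>C'\<^esub>" unfolding img by simp
    qed
    \<comment> \<open>If the image of x lies in q times the module, the coset of x and the zero
      coset have the same image under the reduced map, so injectivity identifies them.\<close>
    show "x \<in> q" if x: "x \<in> A" "g * x \<in> ideal_smult R q ?om" for x
    proof -
      let ?Q = "ideal_smult R q K'"
      have sub: "submodule ?Q R K'" by (rule ideal_smult_submodule[OF K']) (use qA in simp)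
      note QK = K'.submoduleE(1)[OF sub]
      have "\<Psi> ` ?Q = ideal_smult R q ?om"
        by (rule ideal_smult_image[OF K' om \<Psi>_hom]) (use bij qA in \<open>auto simp: bij_betw_def\<close>)
      then obtain y where y: "y \<in> ?Q" "g * x = \<Psi> y" using x(2) by blast
      have "\<Psi> (\<phi> x) = \<Psi> y" using \<Psi>\<phi>[OF x(1)] y(2) by simp
      then have "\<Theta> (\<Psi> (\<phi> x)) = \<Theta> (\<Psi> y)" by (rule arg_cong)
      then have "\<phi> x = y" unfolding \<Theta>\<Psi>[OF \<phi>_closed[OF x(1)]] \<Theta>\<Psi>[OF subsetD[OF QK y(1)]] .
      then have \<phi>x: "\<phi> x \<in> ?Q" using y(1) by simp
      have \<phi>q: "\<phi> n \<in> ?Q" if "n \<in> q" for n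
        using \<phi>_eq[OF subsetD[OF qA that]] ideal_smult_mem[OF that \<phi>1, of R] by simp
      have coset: "z \<in> q +>\<^bsub>R\<^esub> x \<longleftrightarrow> (\<exists>n\<in>q. z = n + x)" for z by (simp add: a_r_coset_mem)
      have q0: "q +>\<^bsub>R\<^esub> 0 = q" by (auto simp: a_r_coset_mem)
      have x_mem: "x \<in> q +>\<^bsub>R\<^esub> x" unfolding coset using ideal_ring_onD(2)[OF q_ideal] by force
      have "reduced_map R q K' \<phi> (q +>\<^bsub>R\<^esub> x) = ?Q"
      proof (rule reduced_map_zero[OF K'])
        show "\<phi> z \<in> ?Q" if z: "z \<in> q +>\<^bsub>R\<^esub> x" for z
        proof -
          obtain n where n: "n \<in> q" "z = n + x" using z[unfolded coset] by blast
          have "\<phi> z = \<phi> n \<oplus>\<^bsub>K'\<^esub> \<phi> x" using module_homD(2)[OF \<phi>, of n x] n qA x(1) by auto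
          then show ?thesis using K'.submoduleE(5)[OF sub \<phi>q[OF n(1)] \<phi>x] by simp
        qed
      qed (use qA x_mem in auto)
      moreover have "reduced_map R q K' \<phi> q = ?Q"
        by (rule reduced_map_zero[OF K']) (use qA \<phi>q ideal_ring_onD(2)[OF q_ideal] in auto)
      ultimately have eq: "reduced_map R q K' \<phi> (q +>\<^bsub>R\<^esub> x) = reduced_map R q K' \<phi> q" by simp
      have mem: "q +>\<^bsub>R\<^esub> y \<in> carrier (R Quot q)" if "y \<in> A" for y
        unfolding FactRing_def using that by (auto simp: A_RCOSETS_def')
      have "q \<in> carrier (R Quot q)" using mem[of 0] unfolding q0 by simp
      with eq have "q +>\<^bsub>R\<^esub> x = q" by (rule inj_onD[OF inj _ mem[OF x(1)]])
      then show "x \<in> q" using x_mem by simp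
    qed
  qed
  show ?thesis using U.length_bound[OF min] by blast
qed

text \<open>The isomorphism \<Psi> from I to \<omega> is multiplication by a fixed fraction, so I/b
  is \<omega> divided by \<Psi> b. It remains to see that \<Psi> b has order 0. The preimage z of 1
  has least order in I, and the reduction property forces b to have that order too.\<close>

lemma canonical_fractional_ideal:
  fixes I :: "'k::field fls set"
  assumes can: "canonical_ideal A I" and red: "principal_reduction A I b"
  shows "\<exists>g. g \<in> series_on K \<and> g $$ 0 \<noteq> 0 \<and> {x / b | x. x \<in> I} = (\<lambda>w. w / g) ` series_on K"
proof -
  have I: "ideal I R" and cm: "canonical_module R (ideal_module R I)"
    using can unfolding canonical_ideal_def by auto
  note ID = ideal_ring_onD[OF I]
  obtain \<Psi> :: "'k fls \<Rightarrow> 'k fls" where sm: "\<forall>r\<in>A. \<forall>x\<in>I. \<Psi> (r * x) = r * \<Psi> x"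
    and bij: "bij_betw \<Psi> I (series_on K)"
    using canonical_module_iso[OF cm] unfolding omega_K by auto
  have b: "b \<in> I" using red unfolding principal_reduction_def by blast
  obtain n where n: "ideal_power R I (Suc n) = (*) b ` ideal_power R I n"
    using red unfolding principal_reduction_def by blast
  \<comment> \<open>Linearity applied to the product of x and y in both orders: the ratio of \<Psi>
    x to x is the same for all nonzero x in I.\<close>
  have comm: "y * \<Psi> x = x * \<Psi> y" if x: "x \<in> I" and y: "y \<in> I" for x y
    using sm[rule_format, OF subsetD[OF ID(1) y] x] sm[rule_format, OF subsetD[OF ID(1) x] y]
    by (simp add: mult.commute)
  have one: "1 \<in> (series_on K :: 'k fls set)" using const_in_series_on[OF zero_K, of 1] by simp
  obtain z where z: "z \<in> I" "\<Psi> z = 1" using bij one unfolding bij_betw_def by (metis imageE)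
  have "\<Psi> 0 = 0" using sm[rule_format, of 0 0] ID(2) by simp
  then have z0: "z \<noteq> 0" using z(2) by auto
  have zb: "z * \<Psi> b = b" using comm[OF b z(1)] z(2) by simp
  \<comment> \<open>The power of z equals b times an element of the n-th power of I, whose order is
    at least n times that of z. Comparing orders bounds the order of b by that of z.\<close>
  have zpow: "z ^ Suc n \<in> (*) b ` ideal_power R I n" using power_in_ideal_power[OF z(1), of "Suc n"] unfolding n .
  have b0: "b \<noteq> 0"
  proof
    assume "b = 0"
    then have "z ^ Suc n = 0" using zpow by auto
    then show False using z0 by simp
  qed
  have gK: "\<Psi> b \<in> series_on K" using bij b unfolding bij_betw_def by blast
  have g0: "\<Psi> b \<noteq> 0" using zb b0 by auto
  have min: "fls_subdegree z \<le> fls_subdegree x" if x: "x \<in> I" "x \<noteq> 0" for x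
  proof -
    have eq: "x = z * \<Psi> x" using comm[OF x(1) z(1)] z(2) by simp
    have "\<Psi> x \<noteq> 0" using eq x(2) by auto
    moreover have "\<Psi> x \<in> series_on K" using bij x(1) unfolding bij_betw_def by blast
    ultimately have "0 \<le> fls_subdegree (\<Psi> x)" using subdegree_in_series_on K_nonneg by blast
    moreover have "fls_subdegree x = fls_subdegree z + fls_subdegree (\<Psi> x)"
      using eq z0 \<open>\<Psi> x \<noteq> 0\<close> by (metis fls_subdegree_mult)
    ultimately show ?thesis by simp
  qed
  have "I \<subseteq> series_on {fls_subdegree z..}"
  proof
    fix x assume "x \<in> I"
    then show "x \<in> series_on {fls_subdegree z..}" unfolding series_on_atLeast_iff using min by blast
  qed
  then have Ipow: "ideal_power R I n \<subseteq> series_on {int n * fls_subdegree z..}" by (rule ideal_power_bound)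
  obtain y where y: "y \<in> ideal_power R I n" "z ^ Suc n = b * y" using zpow by blast
  have y0: "y \<noteq> 0" using y(2) z0 by auto
  have "int n * fls_subdegree z \<le> fls_subdegree y"
    using Ipow y(1) y0 by (auto simp: series_on_atLeast_iff)
  moreover have "int (Suc n) * fls_subdegree z = fls_subdegree b + fls_subdegree y"
    using arg_cong[OF y(2), of fls_subdegree] b0 y0 by (simp only: fls_subdegree_pow fls_subdegree_mult not_False_eq_True)
  ultimately have "fls_subdegree b \<le> fls_subdegree z" by (simp add: algebra_simps)
  moreover have "fls_subdegree b = fls_subdegree z + fls_subdegree (\<Psi> b)"
    using zb z0 g0 by (metis fls_subdegree_mult)
  moreover have "0 \<le> fls_subdegree (\<Psi> b)" using subdegree_in_series_on[OF gK g0] K_nonneg by blast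
  ultimately have "fls_subdegree (\<Psi> b) = 0" by simp
  then have "\<Psi> b $$ 0 \<noteq> 0" using nth_fls_subdegree_nonzero[OF g0] by simp
  moreover have "{x / b | x. x \<in> I} = (\<lambda>w. w / \<Psi> b) ` series_on K"
  proof -
    have "x / b = \<Psi> x / \<Psi> b" if "x \<in> I" for x
      using comm[OF that b] b0 g0 by (simp add: field_simps)
    then have "(\<lambda>x. x / b) ` I = (\<lambda>x. \<Psi> x / \<Psi> b) ` I" by (rule image_cong[OF refl])
    moreover have "{x / b | x. x \<in> I} = (\<lambda>x. x / b) ` I" by auto
    ultimately have "{x / b | x. x \<in> I} = (\<lambda>x. \<Psi> x / \<Psi> b) ` I" by simp
    also have "\<dots> = (\<lambda>w. w / \<Psi> b) ` \<Psi> ` I" by (simp add: image_image)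
    finally show ?thesis using bij unfolding bij_betw_def by simp
  qed
  ultimately show ?thesis using gK by blast
qed

lemma length_canonical_conductor:
  fixes I :: "'k::field fls set"
  assumes "canonical_ideal A I" "principal_reduction A I b"
  shows "module_length R (quotient_module (self_module R)
    (colon A A (generate_ring ring_of_type_algebra (A \<union> {x / b | x. x \<in> I})))) = enat (card (H - C))"
proof -
  obtain g where g: "g \<in> series_on K" "g $$ 0 \<noteq> 0" and eq: "{x / b | x. x \<in> I} = (\<lambda>w. w / g) ` series_on K"
    using canonical_fractional_ideal[OF assms] by blast
  show ?thesis unfolding eq generate_ring_frac[OF g] conductor_eq by (rule length_conductor)
qed

text \<open>Minimal multiplicity is available on both sides: it is assumed on the right and follows
  from the Arf condition at z = e on the left. It supplies the cardinality bound on which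
  \<open>Arf_semigroup_iff\<close> depends.\<close>

theorem arf_ring_criterion:
  assumes gg: "generalized_gorenstein (R :: 'k::field fls ring)"
  defines "n \<equiv> card (H - C)"
  shows "arf_ring (A :: 'k fls set) \<longleftrightarrow> minimal_multiplicity (R :: 'k fls ring) \<and> 2 + int n * e \<in> H"
    and "arf_ring (A :: 'k fls set) \<Longrightarrow> x \<in> H \<Longrightarrow> \<nexists>j. x = int j * e \<Longrightarrow> 2 + x \<in> H"
proof -
  have bound: "K \<subseteq> H \<or> card (H - C) * card Apery' \<le> card (K - H)"
    if "minimal_multiplicity (R :: 'k fls ring)"
    using generalized_gorenstein_bound[OF gg] that unfolding minimal_multiplicity_iff by blast
  have min: "minimal_multiplicity (R :: 'k fls ring)" if Arf_semigroup
    unfolding minimal_multiplicity_iff using Arf_minimal_multiplicity[OF that] by blast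
  show "arf_ring (A :: 'k fls set) \<longleftrightarrow> minimal_multiplicity (R :: 'k fls ring) \<and> 2 + int n * e \<in> H"
    unfolding arf_ring_iff n_def using Arf_semigroup_iff(1) bound min by blast
  show "2 + x \<in> H" if "arf_ring (A :: 'k fls set)" "x \<in> H" "\<nexists>j. x = int j * e"
    using Arf_semigroup_iff(2)[OF bound[OF min]] that unfolding arf_ring_iff by blast
qed

end

section \<open>From the generators to the value semigroup\<close>

text \<open>Positivity of the generators makes the set of multi-indices of each weight finite. It is
  nonempty exactly when the weight is in the semigroup, and then a single multi-index can carry the
  whole coefficient.\<close>

lemma semigroup_ring_eq:
  assumes pos: "\<And>i. i \<in> {1..l} \<Longrightarrow> 0 < a i"
  shows "(semigroup_ring a l :: 'k::field fls set) = series_on (int ` semigroup_generated a {1..l})"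
proof -
  define E where "E n = {e \<in> {1..l} \<rightarrow>\<^sub>E UNIV. (\<Sum>i=1..l. e i * a i) = n}" for n :: nat
  have fin: "finite (E n)" for n
  proof (rule finite_subset)
    show "E n \<subseteq> {1..l} \<rightarrow>\<^sub>E {..n}"
    proof
      fix e assume e: "e \<in> E n"
      have "e i \<le> n" if i: "i \<in> {1..l}" for i
      proof -
        have "e i * 1 \<le> e i * a i" using pos[OF i] by (intro mult_left_mono) auto
        also have "\<dots> \<le> (\<Sum>i=1..l. e i * a i)" by (rule member_le_sum[OF i]) auto
        finally show ?thesis using e unfolding E_def by simp
      qed
      then show "e \<in> {1..l} \<rightarrow>\<^sub>E {..n}" using e unfolding E_def by (auto simp: PiE_def Pi_def)
    qed
  qed (intro finite_PiE finite_atLeastAtMost finite_atMost)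
  have E_ne: "n \<in> semigroup_generated a {1..l} \<longleftrightarrow> E n \<noteq> {}" for n
  proof
    assume "n \<in> semigroup_generated a {1..l}"
    then obtain c where c: "n = (\<Sum>i\<in>{1..l}. c i * a i)" unfolding semigroup_generated_def by blast
    then have "restrict c {1..l} \<in> E n" unfolding E_def by auto
    then show "E n \<noteq> {}" by blast
  next
    assume "E n \<noteq> {}"
    then show "n \<in> semigroup_generated a {1..l}" unfolding E_def semigroup_generated_def by blast
  qed
  show ?thesis
  proof (intro equalityI subsetI)
    fix f :: "'k fls" assume "f \<in> semigroup_ring a l"
    then obtain p :: "'k fps" and c where p: "f = fps_to_fls p" "\<And>n. fps_nth p n = (\<Sum>e\<in>E n. c e)"
      unfolding semigroup_ring_def E_def by blast
    show "f \<in> series_on (int ` semigroup_generated a {1..l})"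
    proof (rule series_onI)
      fix m assume m: "f $$ m \<noteq> 0"
      then have m0: "0 \<le> m" and "fps_nth p (nat m) \<noteq> 0" unfolding p(1) by (auto split: if_splits)
      then have "E (nat m) \<noteq> {}" unfolding p(2) by auto
      then have "nat m \<in> semigroup_generated a {1..l}" unfolding E_ne .
      then show "m \<in> int ` semigroup_generated a {1..l}" using m0 by (metis image_eqI int_nat_eq)
    qed
  next
    fix f :: "'k fls" assume f: "f \<in> series_on (int ` semigroup_generated a {1..l})"
    define p where "p = Abs_fps (\<lambda>n. f $$ int n)"
    have fp: "f = fps_to_fls p"
    proof (rule fls_eqI)
      fix m show "f $$ m = fps_to_fls p $$ m"
      proof (cases "m < 0")
        case True
        then have "m \<notin> int ` semigroup_generated a {1..l}" by auto
        then show ?thesis using series_on_zero[OF f] True by simp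
      qed (simp add: p_def)
    qed
    \<comment> \<open>All of the coefficient at n is put on one chosen multi-index of weight n;
      multi-indices of different weights do not interfere.\<close>
    define c where "c e = (let n = (\<Sum>i=1..l. e i * a i) in if e = (SOME e. e \<in> E n) then f $$ int n else 0)"
      for e :: "nat \<Rightarrow> nat"
    have "fps_nth p n = (\<Sum>e\<in>E n. c e)" for n
    proof (cases "E n = {}")
      case True
      then have "int n \<notin> int ` semigroup_generated a {1..l}" using E_ne[of n] by auto
      then show ?thesis unfolding True p_def using series_on_zero[OF f] by simp
    next
      case False
      have "(\<Sum>e\<in>E n. c e) = (\<Sum>e\<in>E n. if e = (SOME e. e \<in> E n) then f $$ int n else 0)"
      proof (rule sum.cong[OF refl])
        fix e assume "e \<in> E n"
        then have "(\<Sum>i=1..l. e i * a i) = n" unfolding E_def by blast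
        then show "c e = (if e = (SOME e. e \<in> E n) then f $$ int n else 0)" unfolding c_def by (simp only: Let_def)
      qed
      also have "\<dots> = f $$ int n" using False fin[of n] by (simp add: some_in_eq)
      finally show ?thesis unfolding p_def by simp
    qed
    then show "f \<in> semigroup_ring a l" unfolding semigroup_ring_def fp E_def by blast
  qed
qed

lemma semigroup_generated_add:
  "x \<in> semigroup_generated a J \<Longrightarrow> y \<in> semigroup_generated a J \<Longrightarrow> x + y \<in> semigroup_generated a J"
proof -
  assume "x \<in> semigroup_generated a J" "y \<in> semigroup_generated a J"
  then obtain c d where "x = (\<Sum>i\<in>J. c i * a i)" "y = (\<Sum>i\<in>J. d i * a i)"
    unfolding semigroup_generated_def by blast
  then have "x + y = (\<Sum>i\<in>J. (c i + d i) * a i)" by (simp add: algebra_simps sum.distrib)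
  then show ?thesis unfolding semigroup_generated_def by (intro CollectI exI[of _ "\<lambda>i. c i + d i"] conjI TrueI)
qed

lemma semigroup_generated_zero: "0 \<in> semigroup_generated a J"
  unfolding semigroup_generated_def by (intro CollectI exI[of _ "\<lambda>_. 0"]) simp

lemma semigroup_generated_multiple:
  assumes "finite J" "i \<in> J"
  shows "k * a i \<in> semigroup_generated a J"
proof -
  have "(\<Sum>j\<in>J. (if j = i then k else 0) * a j) = (\<Sum>j\<in>J. if j = i then k * a j else 0)"
    by (intro sum.cong) auto
  also have "\<dots> = k * a i" using assms by simp
  finally show ?thesis unfolding semigroup_generated_def
    by (intro CollectI exI[of _ "\<lambda>j. if j = i then k else 0"] conjI TrueI) (rule sym)
qed

text \<open>The differences of elements form the group of multiples of their least positive member,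
  which divides all generators; so two elements differ by 1, and their combinations are cofinite.\<close>

lemma numerical_semigroup_cofinite:
  fixes T :: "int set"
  assumes T: "0 \<in> T" "\<And>x y. x \<in> T \<Longrightarrow> y \<in> T \<Longrightarrow> x + y \<in> T" "\<And>x. x \<in> T \<Longrightarrow> 0 \<le> x"
    and gcd: "\<And>d. (\<And>x. x \<in> T \<Longrightarrow> d dvd x) \<Longrightarrow> d dvd 1"
  shows "\<exists>F. numerical_semigroup T F"
proof -
  have mult: "int k * x \<in> T" if "x \<in> T" for x k
  proof (induction k)
    case (Suc k)
    then show ?case using T(2)[OF that Suc] by (simp add: algebra_simps)
  qed (use T(1) in simp)
  have pos: "\<exists>x\<in>T. 0 < x"
  proof (rule ccontr)
    assume "\<not> ?thesis"
    then have "0 dvd x" if "x \<in> T" for x using T(3)[OF that] that by auto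
    then have "(0 :: int) dvd 1" by (rule gcd)
    then show False by simp
  qed
  define P where "P d \<longleftrightarrow> 0 < d \<and> (\<exists>x\<in>T. \<exists>y\<in>T. int d = x - y)" for d
  obtain x0 where "x0 \<in> T" "0 < x0" using pos by blast
  then have "P (nat x0)" unfolding P_def using T(1) by force
  define d where "d = (LEAST d. P d)"
  have Pd: "P d" unfolding d_def using \<open>P (nat x0)\<close> by (rule LeastI)
  then obtain x y where xy: "x \<in> T" "y \<in> T" "int d = x - y" and d0: "0 < d" unfolding P_def by blast
  have "int d dvd z" if z: "z \<in> T" for z
  proof (rule ccontr)
    assume nd: "\<not> int d dvd z"
    define r where "r = z mod int d"
    have "r \<noteq> 0" using nd unfolding r_def dvd_eq_mod_eq_0 .
    moreover have "0 \<le> r" "r < int d" unfolding r_def using d0 by simp_all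
    ultimately have r: "0 < r" "r < int d" by simp_all
    have "0 \<le> z div int d" using T(3)[OF z] d0 by (simp add: pos_imp_zdiv_nonneg_iff)
    then obtain k where k: "z div int d = int k" by (rule nonneg_int_cases)
    \<comment> \<open>The remainder of z modulo d is again a difference of two elements of T,
      smaller than d. By minimality of d it cannot be positive.\<close>
    have "r = z - int k * (x - y)"
      unfolding r_def k[symmetric] xy(3)[symmetric] by (simp add: minus_div_mult_eq_mod)
    then have "int (nat r) = (z + int k * y) - int k * x" using r(1) by (simp add: algebra_simps)
    moreover have "z + int k * y \<in> T" by (rule T(2)[OF z mult[OF xy(2)]])
    moreover have "int k * x \<in> T" by (rule mult[OF xy(1)])
    ultimately have "P (nat r)" unfolding P_def using r(1) by auto
    then have "d \<le> nat r" unfolding d_def by (rule Least_le)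
    then show False using r by linarith
  qed
  then have "int d dvd 1" by (rule gcd)
  then have d1: "x = y + 1" using xy(3) by simp
  have y0: "0 \<le> y" using T(3) xy(2) by blast
  \<comment> \<open>Division by y gives n = k y + r with r < y \<le> k, and hence n = (k - r) y + r
    (y + 1), a combination of two elements of T.\<close>
  have cof: "n \<in> T" if n: "y * y \<le> n" for n
  proof (cases "y = 0")
    case True
    have "int (nat n) * x \<in> T" by (rule mult[OF xy(1)])
    then show ?thesis using n True d1 by simp
  next
    case False
    then have "0 < y" using y0 by simp
    define k r where "k = n div y" and "r = n mod y"
    have r: "0 \<le> r" "r < y" unfolding r_def using \<open>0 < y\<close> by simp_all
    have "y * y div y \<le> n div y" using n \<open>0 < y\<close> by (intro zdiv_mono1) auto
    then have "y \<le> k" unfolding k_def using False by simp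
    then have "int (nat (k - r)) * y + int (nat r) * x \<in> T" by (intro T(2) mult xy(1,2))
    moreover have "int (nat (k - r)) * y + int (nat r) * x = n"
    proof -
      have "n = k * y + r" unfolding k_def r_def by simp
      then show ?thesis using r \<open>y \<le> k\<close> d1 by (simp add: algebra_simps)
    qed
    ultimately show ?thesis by simp
  qed
  \<comment> \<open>The entry -1 makes the maximum exist when T has no gaps, with the expected
    Frobenius number.\<close>
  define G where "G = insert (-1) {z. 0 \<le> z \<and> z \<notin> T}"
  have "{z. 0 \<le> z \<and> z \<notin> T} \<subseteq> {0..y * y}"
  proof
    fix z assume z: "z \<in> {z. 0 \<le> z \<and> z \<notin> T}"
    then have "\<not> y * y \<le> z" using cof[of z] by auto
    then show "z \<in> {0..y * y}" using z by simp
  qed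
  then have "finite {z. 0 \<le> z \<and> z \<notin> T}" by (rule finite_subset) simp
  then have finG: "finite G" unfolding G_def by simp
  have "numerical_semigroup T (Max G)"
  proof
    have "Max G \<in> G" by (rule Max_in[OF finG]) (simp add: G_def)
    moreover have "x \<notin> T" if "x \<in> G" for x using that T(3)[of "-1"] unfolding G_def by auto
    ultimately show "Max G \<notin> T" by blast
    fix n assume n: "Max G < n"
    have "-1 \<le> Max G" by (rule Max_ge[OF finG]) (simp add: G_def)
    then have "0 \<le> n" using n by simp
    show "n \<in> T"
    proof (rule ccontr)
      assume "n \<notin> T"
      then have "n \<in> G" unfolding G_def using \<open>0 \<le> n\<close> by simp
      then show False using Max_ge[OF finG \<open>n \<in> G\<close>] n by simp
    qed
  qed (use T in auto)
  then show ?thesis by blast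
qed

unbundle no fps_syntax

theorem corollary1p3:
  fixes l :: nat and a :: "nat \<Rightarrow> nat" and A I K S \<cc> :: "'k::field fls set"
    and b :: "'k fls" and H :: "nat set"
  assumes "l > 0"
    and "0 < a 1"
    and "\<forall>i\<in>{1..<l}. a i < a (Suc i)"
    and "Gcd (a ` {1..l}) = 1"
    and minimal_generators: "\<forall>i\<in>{1..l}. a i \<notin> semigroup_generated a ({1..l} - {i})"
    and "A = semigroup_ring a l"
    and "H = semigroup_generated a {1..l}"
    and "canonical_ideal A I"
    and "max_primary (ring_on A) (PIdl\<^bsub>ring_on A\<^esub> b)"
    and "principal_reduction A I b"
    and "K = {x / b | x. x \<in> I}"
    and "S = generate_ring ring_of_type_algebra (A \<union> K)"
    and "\<cc> = colon A A S"
    and "generalized_gorenstein (ring_on A)"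
  shows "arf_ring A \<longleftrightarrow>
    (minimal_multiplicity (ring_on A) \<and>
     2 + the_enat (module_length (ring_on A)
           (quotient_module (self_module (ring_on A)) \<cc>)) * a 1 \<in> H \<and>
     (\<forall>i\<in>{2..l}. 2 + a i \<in> H))"
proof -
  have ge: "a 1 \<le> a i" if "i \<in> {1..l}" for i
    using that
  proof (induction i)
    case (Suc i)
    show ?case
    proof (cases "i = 0")
      case False
      then have "a 1 \<le> a i" "a i < a (Suc i)" using Suc assms(3) by auto
      then show ?thesis by simp
    qed simp
  qed simp
  have gen: "a i \<in> H" if "i \<in> {1..l}" for i
    using semigroup_generated_multiple[of "{1..l}" i 1 a] that assms(7) by simp
  have "\<exists>F. numerical_semigroup (int ` H) F"
  proof (rule numerical_semigroup_cofinite)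
    show "0 \<in> int ` H" unfolding assms(7) using semigroup_generated_zero by force
    show "x + y \<in> int ` H" if "x \<in> int ` H" "y \<in> int ` H" for x y
      using that semigroup_generated_add unfolding assms(7) by (auto simp flip: of_nat_add)
    show "d dvd 1" if d: "\<And>x. x \<in> int ` H \<Longrightarrow> d dvd x" for d
    proof -
      have "nat \<bar>d\<bar> dvd a i" if "i \<in> {1..l}" for i
        using d[OF imageI[OF gen[OF that]]] by (simp add: nat_abs_dvd_iff)
      then have "nat \<bar>d\<bar> dvd Gcd (a ` {1..l})" by (intro Gcd_greatest) auto
      then show ?thesis unfolding assms(4) by (simp add: nat_abs_dvd_iff)
    qed
  qed auto
  then obtain F where "numerical_semigroup (int ` H) F" by blast
  then interpret N: numerical_semigroup "int ` H" F .
  have A: "A = series_on (int ` H)"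
    unfolding assms(6,7) by (rule semigroup_ring_eq) (use ge assms(2) in force)
  \<comment> \<open>A positive combination of generators is at least as large as one of its nonzero
    terms, hence at least the smallest generator.\<close>
  have e: "N.e = int (a 1)"
  proof (rule antisym)
    show "N.e \<le> int (a 1)" by (rule N.e_props(3)) (use gen[of 1] assms(1,2) in auto)
    obtain c where c: "N.e = int (\<Sum>i=1..l. c i * a i)"
      using N.e_props(1) unfolding assms(7) semigroup_generated_def by blast
    then have "(\<Sum>i=1..l. c i * a i) \<noteq> 0" using N.e_props(2) by linarith
    then obtain i where i: "i \<in> {1..l}" "c i * a i \<noteq> 0" by (meson sum.neutral)
    have "a 1 \<le> a i" by (rule ge[OF i(1)])
    also have "\<dots> \<le> c i * a i" using i(2) by simp
    also have "\<dots> \<le> (\<Sum>i=1..l. c i * a i)" by (rule member_le_sum[OF i(1)]) auto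
    finally show "int (a 1) \<le> N.e" unfolding c by (rule of_nat_mono)
  qed
  have len: "the_enat (module_length (ring_on A) (quotient_module (self_module (ring_on A)) \<cc>)) = card (int ` H - N.C)"
    unfolding assms(11-13) A N.length_canonical_conductor[OF assms(8,10)[unfolded A]] by simp
  have two: "2 + n * a 1 \<in> H \<longleftrightarrow> 2 + int n * N.e \<in> int ` H" for n
  proof -
    have "2 + int n * N.e = int (2 + n * a 1)" unfolding e by simp
    then show ?thesis by (simp only: inj_image_mem_iff[OF inj_of_nat])
  qed
  note gg = assms(14)[unfolded A]
  have "2 + a i \<in> H" if arf: "arf_ring A" and i: "i \<in> {2..l}" for i
  proof -
    \<comment> \<open>A generator that is a multiple of the first one would be generated by the
      others, against minimality of the generating system. The criterion for elements that are not
      multiples of e therefore applies.\<close>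
    have "\<nexists>j. int (a i) = int j * N.e"
    proof
      assume "\<exists>j. int (a i) = int j * N.e"
      then obtain j where "a i = j * a 1" unfolding e by (metis of_nat_eq_iff of_nat_mult)
      then have "a i \<in> semigroup_generated a ({1..l} - {i})"
        using semigroup_generated_multiple[of "{1..l} - {i}" 1 j a] i by auto
      then show False using minimal_generators i by auto
    qed
    then have "2 + int (a i) \<in> int ` H"
      using N.arf_ring_criterion(2)[OF gg arf[unfolded A]] gen i by auto
    moreover have "2 + int (a i) = int (2 + a i)" by simp
    ultimately show ?thesis by (simp only: inj_image_mem_iff[OF inj_of_nat])
  qed
  then show ?thesis
    unfolding len two using N.arf_ring_criterion(1)[OF gg] unfolding A by blast
qed

end
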